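(* Let $1<p<\infty$, let $Z=(Z,d,\mu)$ be a $p$-PI space, let $\Omega\subset Z$ be a measurable set satisfying the measure-density condition, and let $\mathbb V$ be a Banach space. Then $\Omega$ is a $\mathbb V$-valued $W^{1,p}$-extension set if and only if $W^{1,p}(\Omega;\mathbb V)=M^{1,p}(\Omega;\mathbb V)$ as sets.
   Context: Metric measure space: a triple $(Z,d,\mu)$ with $(Z,d)$ a separable metric space and $\mu$ a Borel regular outer measure with $0<\mu(B)<\infty$ for all open balls $B$. $\mu$ is doubling if there is $c_\mu>0$ with $\mu(2B)\le c_\mu\mu(B)$ for every open ball $B$. $L^p(Z;\mathbb V)$: a map $u:Z\to\mathbb V$ is measurable if preimages of open sets are $\mu$-measurable and $u(Z\setminus N)$ is separable for some $\mu$-null set $N$; $L^p(Z;\mathbb V)$ is the space of a.e.-equivalence classes of measurable $u$ with $|u|\in L^p(Z)$. Newton–Sobolev functions: a path is a continuous $\gamma:[a,b]\to Z$. For Borel $\rho:Z\to[0,\infty]$, $\int_\gamma\rho\,ds$ is the usual integral with respect to the length measure of $\gamma$ if $\gamma$ is rectifiable, and $\infty$ otherwise. A family of paths $\Gamma$ is $p$-negligible if there is an $L^p$-integrable Borel $\rho:Z\to[0,\infty]$ with $\int_\gamma\rho\,ds=\infty$ for all $\gamma\in\Gamma$. A Borel $\rho:Z\to[0,\infty]$ is a $p$-weak upper gradient of $u:Z\to\mathbb V$ if $|u(\gamma(a))-u(\gamma(b))|\le\int_\gamma\rho\,ds$ for all paths $\gamma:[a,b]\to Z$ outside a $p$-negligible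 family. $W^{1,p}(Z;\mathbb V)$ is the set of $u\in L^p(Z;\mathbb V)$ having a representative $\widetilde u$ that admits an $L^p$-integrable $p$-weak upper gradient, with norm $\|u\|_{L^p(Z;\mathbb V)}+\inf_\rho\|\rho\|_{L^p(Z)}$, infimum over $L^p$-integrable $p$-weak upper gradients of $\widetilde u$. Hajłasz–Sobolev space: a measurable $g:Z\to[0,\infty]$ is a Hajłasz upper gradient of $u:Z\to\mathbb V$ if there is a $\mu$-null set $N$ with $|u(x)-u(y)|\le d(x,y)(g(x)+g(y))$ for all $x,y\in Z\setminus N$. $M^{1,p}(Z;\mathbb V)$ is the set of $u\in L^p(Z;\mathbb V)$ having a Hajłasz upper gradient in $L^p(Z)$. For measurable $\Omega\subset Z$ these spaces are defined using the restricted distance and measure. $p$-PI space: a complete metric measure space with $\mu$ doubling and supporting a weak $(1,p)$-Poincaré inequality: there are $C>0$, $\lambda\ge1$ such that $\frac1{\mu(B)}\int_B|u-u_B|\,d\mu\le C\operatorname{diam}(B)\big(\frac1{\mu(\lambda B)}\int_{\lambda B}\rho^p\,d\mu\big)^{1/p}$ for every ball $B$, every integrable $u:\lambda B\to\mathbb R$ and every $L^p$-integrable $p$-weak upper gradient $\rho:\lambda B\to[0,\infty]$ of $u$, where $u_B$ is the average of $u$ over $B$. Measure-density condition: there is $c_\Omega>0$ with $\mu(B(x,r)\cap\Omega)\ge c_\Omega\,\mu(B(x,r))$ for every $x\in\Omega$, $r\in(0,1]$. $\Omega$ is a $\mathbb V$-valued $W^{1,p}$-extension set if there are $C>0$ and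 a (not necessarily linear) map $E:W^{1,p}(\Omega;\mathbb V)\to W^{1,p}(Z;\mathbb V)$ with $E(u)|_\Omega=u$ a.e. and $\|E(u)\|_{W^{1,p}(Z;\mathbb V)}\le C\|u\|_{W^{1,p}(\Omega;\mathbb V)}$ for all $u$. *)

theory Defs
  imports "HOL-Analysis.Analysis"
begin

text \<open>
  The ambient set \<open>Z\<close> is the universe of a type of sort
  \<open>{metric_space, second_countable_topology}\<close>; for metric spaces, second countability is separability.
  The outer measure is a function \<open>\<mu>\<close> on all subsets, and \<open>caratheodory_measure \<mu>\<close> is its
  restriction to the \<open>\<mu>\<close>-measurable sets.
\<close>

definition borel_regular_outer_measure :: "('z::topological_space set \<Rightarrow> ennreal) \<Rightarrow> bool" where
  "borel_regular_outer_measure \<mu> \<longleftrightarrow>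
     outer_measure_space (Pow UNIV) \<mu> \<and>
     sets borel \<subseteq> lambda_system UNIV (Pow UNIV) \<mu> \<and>
     (\<forall>A. \<exists>B\<in>sets borel. A \<subseteq> B \<and> \<mu> B = \<mu> A)"

definition caratheodory_measure :: "('z set \<Rightarrow> ennreal) \<Rightarrow> 'z measure" where
  "caratheodory_measure \<mu> = measure_of UNIV (lambda_system UNIV (Pow UNIV) \<mu>) \<mu>"

definition metric_measure_space ::
    "('z::{metric_space, second_countable_topology} set \<Rightarrow> ennreal) \<Rightarrow> bool" where
  "metric_measure_space \<mu> \<longleftrightarrow>
     borel_regular_outer_measure \<mu> \<and> (\<forall>x. \<forall>r>0. 0 < \<mu> (ball x r) \<and> \<mu> (ball x r) < \<infinity>)"

definition doubling :: "('z::metric_space set \<Rightarrow> ennreal) \<Rightarrow> bool" where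
  "doubling \<mu> \<longleftrightarrow> (\<exists>c>0. \<forall>x. \<forall>r>0. \<mu> (ball x (2 * r)) \<le> ennreal c * \<mu> (ball x r))"

lemma
  assumes "outer_measure_space (Pow UNIV) \<mu>"
  shows space_caratheodory_measure: "space (caratheodory_measure \<mu>) = UNIV"
    and sets_caratheodory_measure: "sets (caratheodory_measure \<mu>) = lambda_system UNIV (Pow UNIV) \<mu>"
    and emeasure_caratheodory_measure:
      "A \<in> lambda_system UNIV (Pow UNIV) \<mu> \<Longrightarrow> emeasure (caratheodory_measure \<mu>) A = \<mu> A"
proof -
  have ms: "measure_space UNIV (lambda_system UNIV (Pow UNIV) \<mu>) \<mu>"
    using sigma_algebra.caratheodory_lemma[OF sigma_algebra_Pow assms] .
  show "space (caratheodory_measure \<mu>) = UNIV"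
    by (simp add: caratheodory_measure_def space_measure_of_conv)
  show sets: "sets (caratheodory_measure \<mu>) = lambda_system UNIV (Pow UNIV) \<mu>"
    unfolding caratheodory_measure_def
    using ms by (intro sigma_algebra.sets_measure_of_eq) (auto simp: measure_space_def)
  show "A \<in> lambda_system UNIV (Pow UNIV) \<mu> \<Longrightarrow> emeasure (caratheodory_measure \<mu>) A = \<mu> A"
    using ms sets by (intro emeasure_measure_of[OF caratheodory_measure_def])
      (auto simp: measure_space_def)
qed

text \<open>
  From here on, \<open>N\<close> is the measure of a metric measure space with underlying set \<open>space N\<close>: it is
  \<open>caratheodory_measure \<mu>\<close> for \<open>Z\<close> itself and \<open>restrict_space (caratheodory_measure \<mu>) S\<close> for a
  measurable \<open>S\<close> with the restricted distance and measure. Maps on \<open>space N\<close> are represented by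
  functions on the whole type, whose values off \<open>space N\<close> are irrelevant.
\<close>

definition ennreal_powr :: "ennreal \<Rightarrow> real \<Rightarrow> ennreal" where
  "ennreal_powr x p = (if x = \<infinity> then \<infinity> else ennreal (enn2real x powr p))"

definition Lp_integrable :: "'z measure \<Rightarrow> real \<Rightarrow> ('z \<Rightarrow> ennreal) \<Rightarrow> bool" where
  "Lp_integrable N p f \<longleftrightarrow> f \<in> borel_measurable N \<and> (\<integral>\<^sup>+x. ennreal_powr (f x) p \<partial>N) < \<infinity>"

definition Lp_norm :: "'z measure \<Rightarrow> real \<Rightarrow> ('z \<Rightarrow> ennreal) \<Rightarrow> real" where
  "Lp_norm N p f = enn2real (\<integral>\<^sup>+x. ennreal_powr (f x) p \<partial>N) powr (1 / p)"

definition ess_separable_measurable :: "'z measure \<Rightarrow> ('z \<Rightarrow> 'v::real_normed_vector) \<Rightarrow> bool" where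
  "ess_separable_measurable N u \<longleftrightarrow>
     u \<in> borel_measurable N \<and>
     (\<exists>A\<in>null_sets N. separable_space (top_of_set (u ` (space N - A))))"

definition ae_rel :: "'z measure \<Rightarrow> (('z \<Rightarrow> 'v::real_normed_vector) \<times> ('z \<Rightarrow> 'v)) set" where
  "ae_rel N = {(u, v). ess_separable_measurable N u \<and> ess_separable_measurable N v \<and>
                       (AE x in N. u x = v x)}"

text \<open>Elements of the function spaces are a.e.-equivalence classes.\<close>

definition Lp_space :: "'z measure \<Rightarrow> real \<Rightarrow> ('z \<Rightarrow> 'v::real_normed_vector) set set" where
  "Lp_space N p =
     {u. ess_separable_measurable N u \<and> Lp_integrable N p (\<lambda>x. ennreal (norm (u x)))} // ae_rel N"

definition Lp_class_norm :: "'z measure \<Rightarrow> real \<Rightarrow> ('z \<Rightarrow> 'v::real_normed_vector) set \<Rightarrow> real" where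
  "Lp_class_norm N p U = the_elem ((\<lambda>u. Lp_norm N p (\<lambda>x. ennreal (norm (u x)))) ` U)"

text \<open>A path is a triple \<open>(a, b, \<gamma>)\<close>; the values of \<open>\<gamma>\<close> off \<open>{a..b}\<close> are irrelevant.\<close>

definition paths_in :: "'z::metric_space set \<Rightarrow> (real \<times> real \<times> (real \<Rightarrow> 'z)) set" where
  "paths_in S = {(a, b, \<gamma>). a \<le> b \<and> continuous_on {a..b} \<gamma> \<and> \<gamma> ` {a..b} \<subseteq> S}"

definition curve_length :: "real \<Rightarrow> real \<Rightarrow> (real \<Rightarrow> 'z::metric_space) \<Rightarrow> ennreal" where
  "curve_length a b \<gamma> =
     (SUP ts \<in> {ts. sorted ts \<and> set ts \<subseteq> {a..b}}.
        \<Sum>i<length ts - 1. ennreal (dist (\<gamma> (ts ! i)) (\<gamma> (ts ! Suc i))))"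

text \<open>
  The length measure of a rectifiable path is the Stieltjes measure of \<open>t \<mapsto>\<close> length of
  \<open>\<gamma>\<close> on \<open>[a, t]\<close>, extended by constants to the left of \<open>a\<close> and to the right of \<open>b\<close>. (The length
  over an empty interval is \<open>0\<close>.)
\<close>

definition length_measure :: "real \<Rightarrow> real \<Rightarrow> (real \<Rightarrow> 'z::metric_space) \<Rightarrow> real measure" where
  "length_measure a b \<gamma> = interval_measure (\<lambda>t. enn2real (curve_length a (min t b) \<gamma>))"

definition curve_integral :: "('z::metric_space \<Rightarrow> ennreal) \<Rightarrow> real \<times> real \<times> (real \<Rightarrow> 'z) \<Rightarrow> ennreal" where
  "curve_integral \<rho> = (\<lambda>(a, b, \<gamma>).
     if curve_length a b \<gamma> < \<infinity>
     then (\<integral>\<^sup>+t. \<rho> (\<gamma> t) * indicator {a..b} t \<partial>length_measure a b \<gamma>)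
     else \<infinity>)"

definition p_negligible ::
    "'z::metric_space measure \<Rightarrow> real \<Rightarrow> (real \<times> real \<times> (real \<Rightarrow> 'z)) set \<Rightarrow> bool" where
  "p_negligible N p \<Gamma> \<longleftrightarrow>
     \<Gamma> \<subseteq> paths_in (space N) \<and>
     (\<exists>\<rho>. \<rho> \<in> borel_measurable (restrict_space borel (space N)) \<and> Lp_integrable N p \<rho> \<and>
          (\<forall>c\<in>\<Gamma>. curve_integral \<rho> c = \<infinity>))"

definition weak_upper_gradient ::
    "'z::metric_space measure \<Rightarrow> real \<Rightarrow> ('z \<Rightarrow> 'v::real_normed_vector) \<Rightarrow> ('z \<Rightarrow> ennreal) \<Rightarrow> bool" where
  "weak_upper_gradient N p u \<rho> \<longleftrightarrow>
     \<rho> \<in> borel_measurable (restrict_space borel (space N)) \<and>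
     (\<exists>\<Gamma>. p_negligible N p \<Gamma> \<and>
        (\<forall>(a, b, \<gamma>) \<in> paths_in (space N) - \<Gamma>.
           ennreal (norm (u (\<gamma> a) - u (\<gamma> b))) \<le> curve_integral \<rho> (a, b, \<gamma>)))"

definition W1p :: "'z::metric_space measure \<Rightarrow> real \<Rightarrow> ('z \<Rightarrow> 'v::real_normed_vector) set set" where
  "W1p N p = {U \<in> Lp_space N p. \<exists>u\<in>U. \<exists>\<rho>. weak_upper_gradient N p u \<rho> \<and> Lp_integrable N p \<rho>}"

text \<open>
  Two representatives with \<open>L\<^sup>p\<close>-integrable \<open>p\<close>-weak upper gradients have the same
  \<open>p\<close>-weak upper gradients, so the infimum over all representatives below is the infimum for any
  one admissible representative.
\<close>

definition W1p_norm ::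
    "'z::metric_space measure \<Rightarrow> real \<Rightarrow> ('z \<Rightarrow> 'v::real_normed_vector) set \<Rightarrow> real" where
  "W1p_norm N p U = Lp_class_norm N p U +
     Inf {Lp_norm N p \<rho> | \<rho> u. u \<in> U \<and> weak_upper_gradient N p u \<rho> \<and> Lp_integrable N p \<rho>}"

definition hajlasz_upper_gradient ::
    "'z::metric_space measure \<Rightarrow> ('z \<Rightarrow> 'v::real_normed_vector) \<Rightarrow> ('z \<Rightarrow> ennreal) \<Rightarrow> bool" where
  "hajlasz_upper_gradient N u g \<longleftrightarrow>
     g \<in> borel_measurable N \<and>
     (\<exists>A\<in>null_sets N. \<forall>x\<in>space N - A. \<forall>y\<in>space N - A.
        ennreal (norm (u x - u y)) \<le> ennreal (dist x y) * (g x + g y))"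

definition M1p :: "'z::metric_space measure \<Rightarrow> real \<Rightarrow> ('z \<Rightarrow> 'v::real_normed_vector) set set" where
  "M1p N p = {U \<in> Lp_space N p. \<exists>u\<in>U. \<exists>g. hajlasz_upper_gradient N u g \<and> Lp_integrable N p g}"

definition average :: "'z measure \<Rightarrow> 'z set \<Rightarrow> ('z \<Rightarrow> real) \<Rightarrow> real" where
  "average M B f = (LINT x:B|M. f x) / measure M B"

definition weak_poincare :: "real \<Rightarrow> 'z::metric_space measure \<Rightarrow> bool" where
  "weak_poincare p M \<longleftrightarrow>
     (\<exists>C>0. \<exists>\<kappa>\<ge>1. \<forall>x. \<forall>r>0. \<forall>u::'z \<Rightarrow> real. \<forall>\<rho>.
        let B = ball x r; B' = ball x (\<kappa> * r); N' = restrict_space M B' in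
        integrable N' u \<longrightarrow> weak_upper_gradient N' p u \<rho> \<longrightarrow> Lp_integrable N' p \<rho> \<longrightarrow>
        average M B (\<lambda>y. \<bar>u y - average M B u\<bar>) \<le>
          C * diameter B *
          (enn2real (\<integral>\<^sup>+y. ennreal_powr (\<rho> y) p \<partial>N') / measure M B') powr (1 / p))"

definition PI_space ::
    "real \<Rightarrow> ('z::{metric_space, second_countable_topology} set \<Rightarrow> ennreal) \<Rightarrow> bool" where
  "PI_space p \<mu> \<longleftrightarrow>
     metric_measure_space \<mu> \<and> complete (UNIV :: 'z set) \<and> doubling \<mu> \<and>
     weak_poincare p (caratheodory_measure \<mu>)"

definition measure_density :: "('z::metric_space set \<Rightarrow> ennreal) \<Rightarrow> 'z set \<Rightarrow> bool" where
  "measure_density \<mu> \<Omega> \<longleftrightarrow>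
     (\<exists>c>0. \<forall>x\<in>\<Omega>. \<forall>r\<in>{0<..1}. \<mu> (ball x r \<inter> \<Omega>) \<ge> ennreal c * \<mu> (ball x r))"

definition W1p_extension_set ::
    "'v::real_normed_vector itself \<Rightarrow> real \<Rightarrow> 'z::metric_space measure \<Rightarrow> 'z set \<Rightarrow> bool" where
  "W1p_extension_set _ p M \<Omega> \<longleftrightarrow>
     (\<exists>C>0. \<exists>E :: ('z \<Rightarrow> 'v) set \<Rightarrow> ('z \<Rightarrow> 'v) set.
        \<forall>U \<in> W1p (restrict_space M \<Omega>) p.
          E U \<in> W1p M p \<and>
          (\<forall>f\<in>E U. \<forall>u\<in>U. AE x in restrict_space M \<Omega>. f x = u x) \<and>
          W1p_norm M p (E U) \<le> C * W1p_norm (restrict_space M \<Omega>) p U)"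

end

theory Submission
 imports Defs "HOL-Probability.Distribution_Functions"
begin

text \<open>
 A function with Hajlasz gradient \<open>g\<close> has a representative with \<open>p\<close>-weak upper gradient \<open>4 g\<close>: cut
 a path into pieces of equal length and pick in each piece a point where \<open>g\<close> is at most its average.

 On a PI space the converse holds. Call a ball of radius \<open>r\<close> bad at level \<open>l\<close> if one of the functions
 \<open>norm (u x - d)\<close>, \<open>d\<close> in a countable dense set, deviates by more than \<open>l r\<close> from every constant on a
 fixed fraction of the ball. Off the union of the (enlarged) bad balls all these functions are
 Lipschitz with a constant comparable to \<open>l\<close>. The Poincare inequality, applied to an average of \<open>k\<close>
 Lipschitz truncations, and a covering argument give a recursion for the measures of these unions at
 the levels \<open>2\<^sup>i\<close>, in which the other levels carry the small factor \<open>k powr (1 - p)\<close>. Hence the measures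
 are summable with weights \<open>2 powr (i p)\<close>, which produces an \<open>L\<^sup>p\<close>-integrable Hajlasz gradient. So
 restricting an extension to \<open>\<Omega>\<close> shows that \<open>W1p\<close> and \<open>M1p\<close> agree on \<open>\<Omega>\<close>.

 If conversely they agree, the inclusion is bounded by Zabreiko's lemma, and functions with a Hajlasz
 gradient extend by a Whitney partition of unity: the coefficient of a piece is the value of \<open>u\<close> at a
 nearby point of \<open>\<Omega>\<close> where \<open>norm u + g\<close> is at most its average, so that everything is controlled by the
 maximal function of \<open>norm u + g\<close>.
\<close>

text \<open>Used once, the (1,p)-Poincare inequality gives only a weak-type bound:
  \<open>2 powr (i * p)\<close> times the measure of the bad set at level \<open>2^i\<close> is
  bounded in i, but these numbers need not have a finite sum, and the gradient would only be in weak
  L^p. Averaging truncations takes the place of the self-improvement of the Poincare exponent. A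
  truncation at level \<open>2^j l\<close> has a gradient of that size on the bad set of its level.
  An average of k of them carries the factor 1/k, and the p-th power of the sum costs no further
  power of k, because the sizes grow geometrically. So each level contributes with k^(-p) and all k
  levels together with k^(1-p), which can be absorbed; the weak bound supplies the finiteness and
  the boundary terms that absorption needs.

  The bad sets are shared by all functions \<open>norm (u x - d)\<close>, so that one gradient and
  one null set serve for every d and are inherited by u.

  No Poincare inequality is available on \<Omega> itself, so equality of the spaces there comes
  without any comparison of norms. This is why an abstract boundedness lemma is needed before
  extending.\<close>

abbreviation pint :: "'z measure \<Rightarrow> real \<Rightarrow> ('z \<Rightarrow> ennreal) \<Rightarrow> ennreal" where
 "pint N p f \<equiv> \<integral>\<^sup>+x. ennreal_powr (f x) p \<partial>N"

abbreviation enorm :: "('z \<Rightarrow> 'v::real_normed_vector) \<Rightarrow> 'z \<Rightarrow> ennreal" where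
 "enorm u \<equiv> \<lambda>x. ennreal (norm (u x))"

abbreviation borel_on :: "'z::topological_space set \<Rightarrow> ('z \<Rightarrow> 'a::topological_space) set" where
 "borel_on S \<equiv> borel_measurable (restrict_space borel S)"

abbreviation dyad :: "int \<Rightarrow> real" where
 "dyad i \<equiv> 2 powr real_of_int i"

section \<open>Rectifiable paths\<close>

text \<open>The sum under the supremum in \<open>curve_length\<close>, named separately so that
  estimates can be proved by induction on the list of vertices.\<close>

definition polygon_length :: "(real \<Rightarrow> 'z::metric_space) \<Rightarrow> real list \<Rightarrow> ennreal" where
 "polygon_length \<gamma> ts = (\<Sum>i<length ts - 1. ennreal (dist (\<gamma> (ts ! i)) (\<gamma> (ts ! Suc i))))"

lemma polygon_length_simps [simp]:
 "polygon_length \<gamma> [] = 0"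
 "polygon_length \<gamma> [x] = 0"
 "polygon_length \<gamma> (x # y # ts) = ennreal (dist (\<gamma> x) (\<gamma> y)) + polygon_length \<gamma> (y # ts)"
 by (simp_all add: polygon_length_def sum.lessThan_Suc_shift del: sum.lessThan_Suc)

lemma curve_length_alt:
 "curve_length a b \<gamma> = (SUP ts \<in> {ts. sorted ts \<and> set ts \<subseteq> {a..b}}. polygon_length \<gamma> ts)"
 by (simp add: curve_length_def polygon_length_def)

lemma polygon_length_le_curve_length:
 "sorted ts \<Longrightarrow> set ts \<subseteq> {a..b} \<Longrightarrow> polygon_length \<gamma> ts \<le> curve_length a b \<gamma>"
 unfolding curve_length_alt by (intro SUP_upper) auto

lemma polygon_length_Cons_ge: "polygon_length \<gamma> ts \<le> polygon_length \<gamma> (x # ts)"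
 by (cases ts) auto

lemma polygon_length_append_ge:
 "polygon_length \<gamma> xs + polygon_length \<gamma> ys \<le> polygon_length \<gamma> (xs @ ys)"
proof (induction xs rule: induct_list012)
 case (2 x)
 then show ?case by (simp add: polygon_length_Cons_ge)
next
 case (3 x y zs)
 then show ?case by (simp add: add.assoc add_left_mono)
qed simp

text \<open>Triangle inequality across the junction of the two lists; \<open>c\<close> need not fit
  into their order.\<close>

lemma polygon_length_insert:
 "polygon_length \<gamma> (xs @ ys) \<le> polygon_length \<gamma> (xs @ [c]) + polygon_length \<gamma> (c # ys)"
proof (induction xs rule: induct_list012)
 case 1
 then show ?case by (simp add: polygon_length_Cons_ge)
next
 case (2 x)
 show ?case
 proof (cases ys)
  case (Cons y zs)
  have "ennreal (dist (\<gamma> x) (\<gamma> y)) \<le> ennreal (dist (\<gamma> x) (\<gamma> c)) + ennreal (dist (\<gamma> c) (\<gamma> y))"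
   by (simp add: dist_triangle flip: ennreal_plus)
  then show ?thesis
   using Cons by (simp add: add.assoc[symmetric] add_right_mono)
 qed simp
next
 case (3 x y zs)
 then show ?case by (simp add: add.assoc add_left_mono)
qed

lemma polygon_length_const_snoc:
 "set xs \<subseteq> {t} \<Longrightarrow> polygon_length \<gamma> (xs @ [s]) \<le> ennreal (dist (\<gamma> t) (\<gamma> s))"
 by (induction xs rule: induct_list012) auto

lemma polygon_length_Cons_const:
 "set ys \<subseteq> {t} \<Longrightarrow> polygon_length \<gamma> (s # ys) \<le> ennreal (dist (\<gamma> s) (\<gamma> t))"
proof -
 have const: "set ys \<subseteq> {t} \<Longrightarrow> polygon_length \<gamma> (t # ys) = 0" for ys
  by (induction ys) auto
 show "set ys \<subseteq> {t} \<Longrightarrow> polygon_length \<gamma> (s # ys) \<le> ennreal (dist (\<gamma> s) (\<gamma> t))"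
  using const by (cases ys) auto
qed

lemma curve_length_mono:
 "a' \<le> a \<Longrightarrow> b \<le> b' \<Longrightarrow> curve_length a b \<gamma> \<le> curve_length a' b' \<gamma>"
 unfolding curve_length_alt by (intro SUP_subset_mono) auto

lemma curve_length_empty: "b < a \<Longrightarrow> curve_length a b \<gamma> = 0"
 by (simp add: curve_length_alt)

lemma dist_le_curve_length:
 "s \<le> t \<Longrightarrow> ennreal (dist (\<gamma> s) (\<gamma> t)) \<le> curve_length s t \<gamma>"
 using polygon_length_le_curve_length[of "[s, t]" s t \<gamma>] by simp

text \<open>A downward closed \<open>P\<close> cuts a sorted list into an initial and a final
  segment, and the two filters return exactly these. Both \<open>x \<le> c\<close> and
  \<open>x < c\<close> will be used: they decide on which side vertices equal to the cutting point
  are counted.\<close>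

lemma polygon_length_split:
 assumes "sorted ts" "\<And>x y. x \<le> y \<Longrightarrow> P y \<Longrightarrow> P x"
 shows "polygon_length \<gamma> ts \<le>
  polygon_length \<gamma> (filter P ts @ [c]) + polygon_length \<gamma> (c # filter (\<lambda>x. \<not> P x) ts)"
proof -
 have "ts = filter P ts @ filter (\<lambda>x. \<not> P x) ts"
  using assms(1)
 proof (induction ts)
  case (Cons a ts)
  show ?case
  proof (cases "P a")
   case False
   then have "filter P ts = []" "filter (\<lambda>x. \<not> P x) ts = ts"
    using Cons.prems assms(2) by (auto simp: filter_empty_conv filter_id_conv)
   then show ?thesis using False by simp
  qed (use Cons in auto)
 qed simp
 then show ?thesis
  using polygon_length_insert[of \<gamma> "filter P ts" "filter (\<lambda>x. \<not> P x) ts" c] by simp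
qed

lemma curve_length_add:
 assumes "a \<le> c" "c \<le> b"
 shows "curve_length a b \<gamma> = curve_length a c \<gamma> + curve_length c b \<gamma>"
proof (rule antisym)
 show "curve_length a b \<gamma> \<le> curve_length a c \<gamma> + curve_length c b \<gamma>"
  unfolding curve_length_alt[of a b]
 proof (intro SUP_least, clarsimp)
  fix ts :: "real list" assume ts: "sorted ts" "set ts \<subseteq> {a..b}"
  have "polygon_length \<gamma> (filter (\<lambda>x. x \<le> c) ts @ [c]) \<le> curve_length a c \<gamma>"
   using ts assms by (intro polygon_length_le_curve_length) (auto simp: sorted_append sorted_filter[of id, simplified])
  moreover have "polygon_length \<gamma> (c # filter (\<lambda>x. \<not> x \<le> c) ts) \<le> curve_length c b \<gamma>"
   using ts assms by (intro polygon_length_le_curve_length) (auto simp: sorted_filter[of id, simplified])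
  ultimately show "polygon_length \<gamma> ts \<le> curve_length a c \<gamma> + curve_length c b \<gamma>"
   by (intro order_trans[OF polygon_length_split[OF ts(1), of "\<lambda>x. x \<le> c" _ c] add_mono]) auto
 qed
 have "polygon_length \<gamma> xs + polygon_length \<gamma> ys \<le> curve_length a b \<gamma>"
  if "sorted xs" "set xs \<subseteq> {a..c}" "sorted ys" "set ys \<subseteq> {c..b}" for xs ys
 proof -
  have "polygon_length \<gamma> (xs @ ys) \<le> curve_length a b \<gamma>"
   using that assms by (intro polygon_length_le_curve_length) (force simp: sorted_append)+
  then show ?thesis using polygon_length_append_ge order_trans by blast
 qed
 then have "polygon_length \<gamma> xs + curve_length c b \<gamma> \<le> curve_length a b \<gamma>"
  if "sorted xs" "set xs \<subseteq> {a..c}" for xs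
  unfolding curve_length_alt[of c b] using that
  by (subst ennreal_SUP_add_right) (auto intro!: SUP_least exI[of _ "[]"])
 then show "curve_length a c \<gamma> + curve_length c b \<gamma> \<le> curve_length a b \<gamma>"
  unfolding curve_length_alt[of a c]
  by (subst ennreal_SUP_add_left[symmetric]) (auto intro!: SUP_least exI[of _ "[]"])
qed

lemma curve_length_refl [simp]: "curve_length a a \<gamma> = 0"
proof -
 have "polygon_length \<gamma> ts = 0" if "set ts \<subseteq> {a}" for ts
  using that by (induction ts rule: induct_list012) auto
 then show ?thesis unfolding curve_length_alt by (auto intro!: SUP_eqI)
qed

text \<open>Take a polygon in \<open>[t, b]\<close> whose length is within e/2 of the supremum. If s
  comes before its first vertex beyond t, then up to s the polygon is the single chord from
  \<open>\<gamma> t\<close> to \<open>\<gamma> s\<close>, which is at most e/2 by continuity.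
  Additivity of length leaves at most e for \<open>[t, s]\<close>.\<close>

lemma curve_length_right_small:
 assumes fin: "curve_length a b \<gamma> < \<infinity>" and cont: "continuous_on {a..b} \<gamma>"
  and t: "a \<le> t" "t < b" and e: "e > 0"
 shows "\<exists>d>0. \<forall>s\<in>{a..b}. t \<le> s \<and> s < t + d \<longrightarrow> curve_length t s \<gamma> \<le> ennreal e"
proof -
 have finb: "curve_length t b \<gamma> < \<infinity>"
  using curve_length_mono[of a t b b \<gamma>] t fin by (auto intro: le_less_trans)
 then obtain ts where ts: "sorted ts" "set ts \<subseteq> {t..b}"
  and le: "curve_length t b \<gamma> \<le> polygon_length \<gamma> ts + ennreal (e/2)"
 proof -
  have "\<exists>ts\<in>{ts. sorted ts \<and> set ts \<subseteq> {t..b}}. (SUP ts \<in> {ts. sorted ts \<and> set ts \<subseteq> {t..b}}. polygon_length \<gamma> ts) < polygon_length \<gamma> ts + ennreal (e/2)"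
  proof (rule SUP_approx_ennreal[OF _ _ refl])
   show "{ts. sorted ts \<and> set ts \<subseteq> {t..b}} \<noteq> {}" by (auto intro!: exI[of _ "[]"])
   show "(SUP ts \<in> {ts. sorted ts \<and> set ts \<subseteq> {t..b}}. polygon_length \<gamma> ts) \<noteq> \<infinity>"
    using finb unfolding curve_length_alt by (rule less_imp_neq)
  qed (use e in simp)
  then show ?thesis using that unfolding curve_length_alt by (auto simp: less_imp_le)
 qed
 obtain d1 where d1: "d1 > 0" "\<forall>s\<in>{a..b}. dist s t < d1 \<longrightarrow> dist (\<gamma> s) (\<gamma> t) < e/2"
  using cont t e unfolding continuous_on_iff by (metis atLeastAtMost_iff half_gt_zero less_imp_le)
 \<comment> \<open>No vertex lies strictly between t and t + d; \<open>d1\<close> keeps the chord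
   short and the set under the minimum nonempty.\<close>
 define d where "d = Min (insert d1 ((\<lambda>x. x - t) ` {x\<in>set ts. x > t}))"
 have d: "d > 0" "d \<le> d1" "\<And>x. x \<in> set ts \<Longrightarrow> x > t \<Longrightarrow> d \<le> x - t"
  using d1 by (auto simp: d_def)
 have "curve_length t s \<gamma> \<le> ennreal e" if s: "s \<in> {a..b}" "t \<le> s" "s < t + d" for s
 proof -
  have "polygon_length \<gamma> (filter (\<lambda>x. x \<le> s) ts @ [s]) \<le> ennreal (dist (\<gamma> t) (\<gamma> s))"
   using ts d(3) s by (intro polygon_length_const_snoc) force
  also have "\<dots> \<le> ennreal (e/2)"
   using d1(2) s d(2) by (intro ennreal_leI) (auto simp: dist_real_def dist_commute less_imp_le)
  finally have 1: "polygon_length \<gamma> (filter (\<lambda>x. x \<le> s) ts @ [s]) \<le> ennreal (e/2)" .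
  have 2: "polygon_length \<gamma> (s # filter (\<lambda>x. \<not> x \<le> s) ts) \<le> curve_length s b \<gamma>"
   using ts s by (intro polygon_length_le_curve_length) (auto simp: sorted_filter[of id, simplified])
  have "curve_length t s \<gamma> + curve_length s b \<gamma> = curve_length t b \<gamma>"
   using s by (subst curve_length_add[of t s b]) auto
  also have "\<dots> \<le> polygon_length \<gamma> ts + ennreal (e/2)" by fact
  also have "\<dots> \<le> (ennreal (e/2) + curve_length s b \<gamma>) + ennreal (e/2)"
   by (intro add_right_mono order_trans[OF polygon_length_split[OF ts(1), of "\<lambda>x. x \<le> s"] add_mono[OF 1 2]]) auto
  also have "\<dots> = ennreal e + curve_length s b \<gamma>"
  proof -
   have "ennreal (e/2) + ennreal (e/2) = ennreal e" using e by (simp flip: ennreal_plus)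
   then show ?thesis by (metis add.assoc add.commute)
  qed
  finally have "curve_length t s \<gamma> + curve_length s b \<gamma> \<le> ennreal e + curve_length s b \<gamma>" .
  moreover have "curve_length s b \<gamma> < \<infinity>"
   using curve_length_mono[of a s b b \<gamma>] s fin by (auto intro: le_less_trans)
  ultimately show ?thesis by (simp add: ennreal_add_left_cancel_le add.commute[of _ "curve_length s b \<gamma>"] less_top[symmetric])
 qed
 then show ?thesis using d by blast
qed

text \<open>Mirror image of the preceding argument. The cut is now \<open>x < s\<close>, so that the
  vertices from s on are all equal to t.\<close>

lemma curve_length_left_small:
 assumes fin: "curve_length a b \<gamma> < \<infinity>" and cont: "continuous_on {a..b} \<gamma>"
  and t: "a < t" "t \<le> b" and e: "e > 0"
 shows "\<exists>d>0. \<forall>s\<in>{a..b}. s \<le> t \<and> t - d < s \<longrightarrow> curve_length s t \<gamma> \<le> ennreal e"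
proof -
 have finb: "curve_length a t \<gamma> < \<infinity>"
  using curve_length_mono[of a a t b \<gamma>] t fin by (auto intro: le_less_trans)
 then obtain ts where ts: "sorted ts" "set ts \<subseteq> {a..t}"
  and le: "curve_length a t \<gamma> \<le> polygon_length \<gamma> ts + ennreal (e/2)"
 proof -
  have "\<exists>ts\<in>{ts. sorted ts \<and> set ts \<subseteq> {a..t}}. (SUP ts \<in> {ts. sorted ts \<and> set ts \<subseteq> {a..t}}. polygon_length \<gamma> ts) < polygon_length \<gamma> ts + ennreal (e/2)"
  proof (rule SUP_approx_ennreal[OF _ _ refl])
   show "{ts. sorted ts \<and> set ts \<subseteq> {a..t}} \<noteq> {}" by (auto intro!: exI[of _ "[]"])
   show "(SUP ts \<in> {ts. sorted ts \<and> set ts \<subseteq> {a..t}}. polygon_length \<gamma> ts) \<noteq> \<infinity>"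
    using finb unfolding curve_length_alt by (rule less_imp_neq)
  qed (use e in simp)
  then show ?thesis using that unfolding curve_length_alt by (auto simp: less_imp_le)
 qed
 obtain d1 where d1: "d1 > 0" "\<forall>s\<in>{a..b}. dist s t < d1 \<longrightarrow> dist (\<gamma> s) (\<gamma> t) < e/2"
  using cont t e unfolding continuous_on_iff by (metis atLeastAtMost_iff half_gt_zero less_imp_le)
 define d where "d = Min (insert d1 ((\<lambda>x. t - x) ` {x\<in>set ts. x < t}))"
 have d: "d > 0" "d \<le> d1" "\<And>x. x \<in> set ts \<Longrightarrow> x < t \<Longrightarrow> d \<le> t - x"
  using d1 by (auto simp: d_def)
 have "curve_length s t \<gamma> \<le> ennreal e" if s: "s \<in> {a..b}" "s \<le> t" "t - d < s" for s
 proof -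
  have "polygon_length \<gamma> (s # filter (\<lambda>x. \<not> x < s) ts) \<le> ennreal (dist (\<gamma> s) (\<gamma> t))"
   using ts d(3) s by (intro polygon_length_Cons_const) force
  also have "\<dots> \<le> ennreal (e/2)"
   using d1(2) s d(2) by (intro ennreal_leI) (auto simp: dist_real_def dist_commute less_imp_le)
  finally have 1: "polygon_length \<gamma> (s # filter (\<lambda>x. \<not> x < s) ts) \<le> ennreal (e/2)" .
  have 2: "polygon_length \<gamma> (filter (\<lambda>x. x < s) ts @ [s]) \<le> curve_length a s \<gamma>"
   using ts s by (intro polygon_length_le_curve_length) (auto simp: sorted_append sorted_filter[of id, simplified])
  have "curve_length a s \<gamma> + curve_length s t \<gamma> = curve_length a t \<gamma>"
   using s by (subst curve_length_add[of a s t]) auto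
  also have "\<dots> \<le> polygon_length \<gamma> ts + ennreal (e/2)" by fact
  also have "\<dots> \<le> (curve_length a s \<gamma> + ennreal (e/2)) + ennreal (e/2)"
   by (intro add_right_mono order_trans[OF polygon_length_split[OF ts(1), of "\<lambda>x. x < s"] add_mono[OF 2 1]]) auto
  also have "\<dots> = curve_length a s \<gamma> + ennreal e"
  proof -
   have "ennreal (e/2) + ennreal (e/2) = ennreal e" using e by (simp flip: ennreal_plus)
   then show ?thesis by (metis add.assoc)
  qed
  finally have "curve_length a s \<gamma> + curve_length s t \<gamma> \<le> curve_length a s \<gamma> + ennreal e" .
  moreover have "curve_length a s \<gamma> < \<infinity>"
   using curve_length_mono[of a a s b \<gamma>] s fin by (auto intro: le_less_trans)
  ultimately show ?thesis by (simp add: ennreal_add_left_cancel_le less_top[symmetric])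
 qed
 then show ?thesis using d by blast
qed

lemma continuous_on_curve_length:
 assumes fin: "curve_length a b \<gamma> < \<infinity>" and cont: "continuous_on {a..b} \<gamma>"
 shows "continuous_on {a..b} (\<lambda>t. enn2real (curve_length a t \<gamma>))"
proof -
 have finite: "curve_length s t \<gamma> < \<infinity>" if "a \<le> s" "t \<le> b" for s t
  using curve_length_mono[of a s t b \<gamma>] that fin by (auto intro: le_less_trans)
 have diff: "\<bar>enn2real (curve_length a t \<gamma>) - enn2real (curve_length a s \<gamma>)\<bar> \<le> e"
  if "a \<le> s" "s \<le> t" "t \<le> b" "curve_length s t \<gamma> \<le> ennreal e" "0 < e" for s t e
 proof -
  have "enn2real (curve_length a t \<gamma>) = enn2real (curve_length a s \<gamma>) + enn2real (curve_length s t \<gamma>)"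
   using that finite[of a s] finite[of s t]
   by (subst curve_length_add[of a s t]) (auto simp: enn2real_plus)
  moreover have "enn2real (curve_length s t \<gamma>) \<le> e"
   using that by (intro enn2real_leI) auto
  ultimately show ?thesis by simp
 qed
 show ?thesis
  unfolding continuous_on_iff dist_real_def
 proof (intro ballI allI impI)
  fix t e :: real assume t: "t \<in> {a..b}" and e: "e > 0"
  have "\<exists>d>0. \<forall>s\<in>{a..b}. t \<le> s \<and> s < t + d \<longrightarrow> curve_length t s \<gamma> \<le> ennreal (e/2)"
  proof (cases "t < b")
   case False
   then show ?thesis using t by (intro exI[of _ 1]) auto
  qed (use t e in \<open>intro curve_length_right_small[OF fin cont]; auto\<close>)
  then obtain d1 where d1: "d1 > 0" "\<forall>s\<in>{a..b}. t \<le> s \<and> s < t + d1 \<longrightarrow> curve_length t s \<gamma> \<le> ennreal (e/2)"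
   by blast
  have "\<exists>d>0. \<forall>s\<in>{a..b}. s \<le> t \<and> t - d < s \<longrightarrow> curve_length s t \<gamma> \<le> ennreal (e/2)"
  proof (cases "a < t")
   case False
   then show ?thesis using t by (intro exI[of _ 1]) auto
  qed (use t e in \<open>intro curve_length_left_small[OF fin cont]; auto\<close>)
  then obtain d2 where d2: "d2 > 0" "\<forall>s\<in>{a..b}. s \<le> t \<and> t - d2 < s \<longrightarrow> curve_length s t \<gamma> \<le> ennreal (e/2)"
   by blast
  show "\<exists>d>0. \<forall>s\<in>{a..b}. \<bar>s - t\<bar> < d \<longrightarrow> \<bar>enn2real (curve_length a s \<gamma>) - enn2real (curve_length a t \<gamma>)\<bar> < e"
  proof (intro exI[of _ "min d1 d2"] conjI ballI impI)
   fix s assume s: "s \<in> {a..b}" "\<bar>s - t\<bar> < min d1 d2"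
   have "\<bar>enn2real (curve_length a s \<gamma>) - enn2real (curve_length a t \<gamma>)\<bar> \<le> e/2"
   proof (cases "t \<le> s")
    case True
    then show ?thesis using d1 s t e by (intro diff) auto
   next
    case False
    then show ?thesis using d2 s t e by (subst abs_minus_commute, intro diff) auto
   qed
   then show "\<bar>enn2real (curve_length a s \<gamma>) - enn2real (curve_length a t \<gamma>)\<bar> < e"
    using e by simp
  qed (use d1 d2 in auto)
 qed
qed

section \<open>The length measure of a rectifiable path\<close>

locale rectifiable_path =
 fixes a b :: real and \<gamma> :: "real \<Rightarrow> 'z::metric_space"
 assumes ab: "a \<le> b" and rectifiable: "curve_length a b \<gamma> < \<infinity>"
  and continuous: "continuous_on {a..b} \<gamma>"
begin

lemma curve_length_finite: "a \<le> s \<Longrightarrow> t \<le> b \<Longrightarrow> curve_length s t \<gamma> < \<infinity>"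
 using curve_length_mono[of a s t b \<gamma>] rectifiable by (auto intro: le_less_trans)

text \<open>The distribution function behind \<open>length_measure\<close>. Its continuity on the
  whole line makes the length measure free of atoms, so that half-open and closed intervals are
  interchangeable.\<close>

definition len :: "real \<Rightarrow> real" where
 "len t = enn2real (curve_length a (min t b) \<gamma>)"

lemma len_mono: "s \<le> t \<Longrightarrow> len s \<le> len t"
 unfolding len_def using curve_length_finite[of a "min t b"]
 by (intro enn2real_mono curve_length_mono) (auto simp: less_top)

lemma len_le: "len t \<le> enn2real (curve_length a b \<gamma>)"
 unfolding len_def using rectifiable
 by (intro enn2real_mono curve_length_mono) (auto simp: less_top)

lemma len_left: "t \<le> a \<Longrightarrow> len t = 0"
 by (cases "t = a") (auto simp: len_def curve_length_empty min_def)

lemma len_diff: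
 assumes "a \<le> s" "s \<le> t" "t \<le> b"
 shows "ennreal (len t - len s) = curve_length s t \<gamma>"
proof -
 have "curve_length a t \<gamma> = curve_length a s \<gamma> + curve_length s t \<gamma>"
  using assms by (intro curve_length_add) auto
 then show ?thesis
  using assms curve_length_finite[of a s] curve_length_finite[of s t]
  by (auto simp: len_def min_def enn2real_plus)
qed

lemma continuous_len: "continuous_on S len"
proof -
 have "continuous_on UNIV (\<lambda>t. enn2real (curve_length a (max a (min t b)) \<gamma>))"
  using ab by (intro continuous_on_compose2[OF continuous_on_curve_length[OF rectifiable continuous]]
   continuous_intros) auto
 also have "(\<lambda>t. enn2real (curve_length a (max a (min t b)) \<gamma>)) = len"
  using ab by (auto simp: fun_eq_iff len_def min_def max_def curve_length_empty)
 finally show ?thesis by (rule continuous_on_subset) simp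
qed

definition lm :: "real measure" where "lm = length_measure a b \<gamma>"

lemma lm_alt: "lm = interval_measure len"
 unfolding lm_def length_measure_def len_def ..

lemma sets_lm [simp, measurable_cong]: "sets lm = sets borel"
 by (simp add: lm_alt)

lemma space_lm [simp]: "space lm = UNIV"
 by (simp add: lm_alt)

lemma emeasure_lm_Ioc: "s \<le> t \<Longrightarrow> emeasure lm {s<..t} = ennreal (len t - len s)"
 unfolding lm_alt using continuous_len[of UNIV]
 by (intro emeasure_interval_measure_Ioc len_mono)
  (auto simp: continuous_on_eq_continuous_within continuous_at_imp_continuous_at_within)

lemma emeasure_lm_Ioc_le: "emeasure lm {s<..t} \<le> curve_length a b \<gamma>"
proof (cases "s \<le> t")
 case True
 have "ennreal (len t - len s) \<le> ennreal (enn2real (curve_length a b \<gamma>))"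
  using len_le[of t] enn2real_nonneg[of "curve_length a (min s b) \<gamma>"] unfolding len_def by (intro ennreal_leI) linarith
 also have "\<dots> = curve_length a b \<gamma>" using rectifiable by simp
 finally show ?thesis using True by (simp add: emeasure_lm_Ioc)
qed simp

lemma finite_measure_lm: "finite_measure lm"
proof
 have "emeasure lm (\<Union>n::nat. {- real n<..real n}) = (SUP n::nat. emeasure lm {- real n<..real n})"
  by (intro SUP_emeasure_incseq[symmetric]) (auto simp: incseq_def)
 also have "\<dots> \<le> curve_length a b \<gamma>"
  by (intro SUP_least emeasure_lm_Ioc_le)
 also have "(\<Union>n::nat. {- real n<..real n}) = (UNIV :: real set)"
 proof (intro equalityI subsetI UN_I)
  fix x :: real
  show "x \<in> {- real (Suc (nat \<lceil>\<bar>x\<bar>\<rceil>))<..real (Suc (nat \<lceil>\<bar>x\<bar>\<rceil>))}" by simp linarith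
 qed auto
 finally show "emeasure lm (space lm) \<noteq> \<infinity>"
  using rectifiable by (auto simp: top_unique)
qed

lemma emeasure_lm_singleton: "emeasure lm {t} = 0"
proof -
 have "emeasure lm {t..t} = ennreal (len t - len t)"
  unfolding lm_alt using continuous_len[of UNIV]
  by (intro emeasure_interval_measure_Icc len_mono) auto
 then show ?thesis by simp
qed

lemma dist_le_lm:
 "a \<le> s \<Longrightarrow> s \<le> t \<Longrightarrow> t \<le> b \<Longrightarrow> ennreal (dist (\<gamma> s) (\<gamma> t)) \<le> emeasure lm {s<..t}"
 by (simp add: emeasure_lm_Ioc len_diff dist_le_curve_length)

lemma subpath:
 assumes "a \<le> s" "s \<le> t" "t \<le> b"
 shows "rectifiable_path s t \<gamma>"
 using assms curve_length_finite[of s t] continuous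
 by unfold_locales (auto intro: continuous_on_subset)

end

text \<open>The distribution function of the subpath is \<open>len\<close> frozen outside
  \<open>[s, t]\<close> and shifted by a constant, so both measures agree on the half-open
  intervals, which generate the Borel sets. Integrals along all subpaths become integrals against
  the one measure \<open>lm\<close>.\<close>

lemma (in rectifiable_path) length_measure_subpath:
 assumes "a \<le> s" "s \<le> t" "t \<le> b"
 shows "length_measure s t \<gamma> = density lm (indicator {s<..t})"
proof -
 interpret sub: rectifiable_path s t \<gamma> by (rule subpath) fact+
 have len_sub: "sub.len x = len (max s (min x t)) - len s" for x
 proof -
  define m where "m = max s (min x t)"
  have "sub.len x = sub.len m"
   using assms by (cases "x \<le> t") (auto simp: m_def sub.len_left sub.len_def max_def min_def curve_length_empty)
  also have "\<dots> = len m - len s"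
  proof -
   have m: "s \<le> m" "m \<le> t" using assms by (auto simp: m_def)
   have "ennreal (sub.len m - sub.len s) = ennreal (len m - len s)"
    using m assms by (simp add: sub.len_diff len_diff)
   then show ?thesis using len_mono[OF m(1)] sub.len_left[of s] by (simp add: sub.len_def)
  qed
  finally show ?thesis by (simp add: m_def)
 qed
 have "sub.lm = density lm (indicator {s<..t})"
 proof (rule measure_eqI_generator_eq[where \<Omega>=UNIV and E="range (\<lambda>(c::real, d). {c<..d})" and A="\<lambda>n::nat. {- real n<..real n}"])
  show "Int_stable (range (\<lambda>(c::real, d). {c<..d}))"
   unfolding Int_stable_def by (clarsimp simp: image_iff) blast
  fix X :: "real set" assume "X \<in> range (\<lambda>(c, d). {c<..d})"
  then obtain c d where X: "X = {c<..d}" by auto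
  show "emeasure sub.lm X = emeasure (density lm (indicator {s<..t})) X"
  proof (cases "c \<le> d")
   case True
   have eq: "{s<..t} \<inter> {c<..d} = {max s (min c t)<..max s (min d t)}"
    using assms by (auto simp: min_def max_def)
   show ?thesis
    using True assms
    by (simp add: X sub.emeasure_lm_Ioc emeasure_restricted emeasure_lm_Ioc len_sub eq del: Int_greaterThanAtMost)
  qed (simp add: X)
 next
  show "sets sub.lm = sigma_sets UNIV (range (\<lambda>(c::real, d). {c<..d}))"
   by (simp add: borel_sigma_sets_Ioc)
  show "sets (density lm (indicator {s<..t})) = sigma_sets UNIV (range (\<lambda>(c::real, d). {c<..d}))"
   by (simp add: borel_sigma_sets_Ioc)
  show "(\<Union>n::nat. {- real n<..real n}) = UNIV"
  proof (intro equalityI subsetI UN_I)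
   fix x :: real
   show "x \<in> {- real (Suc (nat \<lceil>\<bar>x\<bar>\<rceil>))<..real (Suc (nat \<lceil>\<bar>x\<bar>\<rceil>))}" by simp linarith
  qed auto
  show "emeasure sub.lm {- real n<..real n} \<noteq> \<infinity>" for n :: nat
   using finite_measure.emeasure_finite[OF sub.finite_measure_lm] by simp
 qed auto
 then show ?thesis by (simp add: sub.lm_def)
qed

text \<open>\<rho> is Borel only on \<open>S\<close> and \<gamma> continuous only on
  \<open>[a, b]\<close>, so the composition becomes a Borel function on the line only after a
  cut-off by an indicator.\<close>

lemma (in rectifiable_path) measurable_along:
 assumes \<rho>: "\<rho> \<in> borel_on S" and sub: "\<gamma> ` {a..b} \<subseteq> S"
  and st: "a \<le> s" "t \<le> b"
 shows "(\<lambda>\<tau>. \<rho> (\<gamma> \<tau>) * indicator {s..t} \<tau> :: ennreal) \<in> borel_measurable borel"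
  "(\<lambda>\<tau>. \<rho> (\<gamma> \<tau>) * indicator {s<..t} \<tau> :: ennreal) \<in> borel_measurable borel"
proof -
 have m: "\<gamma> \<in> measurable (restrict_space borel X) (restrict_space borel S)" if "X \<subseteq> {a..b}" for X
  using that sub continuous
  by (intro measurable_restrict_space2 borel_measurable_continuous_on_restrict)
   (auto intro: continuous_on_subset simp: space_restrict_space)
 have "(\<lambda>\<tau>. \<rho> (\<gamma> \<tau>)) \<in> borel_on X" if "X \<subseteq> {a..b}" for X
  using measurable_comp[OF m[OF that] \<rho>] by (simp add: comp_def)
 then have "(\<lambda>\<tau>. \<rho> (\<gamma> \<tau>) * indicator X \<tau>) \<in> borel_measurable borel" if "X \<subseteq> {a..b}" "X \<in> sets borel" for X
  using that borel_measurable_restrict_space_iff_ennreal[of X borel "\<lambda>\<tau>. \<rho> (\<gamma> \<tau>)"] by simp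
 moreover have "{s..t} \<subseteq> {a..b}" "{s<..t} \<subseteq> {a..b}"
  using st by force+
 ultimately show "(\<lambda>\<tau>. \<rho> (\<gamma> \<tau>) * indicator {s..t} \<tau>) \<in> borel_measurable borel"
  "(\<lambda>\<tau>. \<rho> (\<gamma> \<tau>) * indicator {s<..t} \<tau>) \<in> borel_measurable borel"
  by auto
qed

lemma (in rectifiable_path) curve_integral_subpath:
 assumes \<rho>: "\<rho> \<in> borel_on S" and sub: "\<gamma> ` {a..b} \<subseteq> S"
  and st: "a \<le> s" "s \<le> t" "t \<le> b"
 shows "curve_integral \<rho> (s, t, \<gamma>) = (\<integral>\<^sup>+\<tau>. \<rho> (\<gamma> \<tau>) * indicator {s<..t} \<tau> \<partial>lm)"
proof -
 have [measurable]: "(\<lambda>\<tau>. \<rho> (\<gamma> \<tau>) * indicator {s..t} \<tau>) \<in> borel_measurable borel"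
  using measurable_along[OF \<rho> sub, of s t] st by auto
 have "curve_integral \<rho> (s, t, \<gamma>) = (\<integral>\<^sup>+\<tau>. \<rho> (\<gamma> \<tau>) * indicator {s..t} \<tau> \<partial>density lm (indicator {s<..t}))"
  using curve_length_finite[of s t] st by (simp add: curve_integral_def length_measure_subpath)
 also have "\<dots> = (\<integral>\<^sup>+\<tau>. indicator {s<..t} \<tau> * (\<rho> (\<gamma> \<tau>) * indicator {s..t} \<tau>) \<partial>lm)"
  by (intro nn_integral_density) auto
 also have "\<dots> = (\<integral>\<^sup>+\<tau>. \<rho> (\<gamma> \<tau>) * indicator {s<..t} \<tau> \<partial>lm)"
  by (intro nn_integral_cong) (auto split: split_indicator)
 finally show ?thesis .
qed

text \<open>If \<delta> G exceeded the integral of G over \<open>I\<close> at every admissible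
  point, integration over \<open>I\<close>, which has measure \<delta>, would be contradictory. It
  selects sample points on paths and, later, the points whose values become the Whitney
  coefficients.\<close>

lemma exists_le_average:
 fixes G :: "'a \<Rightarrow> ennreal"
 assumes [measurable]: "G \<in> borel_measurable M" "I \<in> sets M"
  and I: "emeasure M I = ennreal \<delta>" "\<delta> > 0" and P: "AE x in M. x \<in> I \<longrightarrow> P x"
 shows "\<exists>x\<in>I. P x \<and> ennreal \<delta> * G x \<le> emeasure (density M G) I"
proof (rule ccontr)
 let ?J = "emeasure (density M G) I"
 assume "\<not> ?thesis"
 then have gt: "?J < ennreal \<delta> * G x" if "x \<in> I" "P x" for x
  using that by (auto simp: not_le)
 have J: "?J = (\<integral>\<^sup>+x. G x * indicator I x \<partial>M)"
  by (simp add: emeasure_density)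
 have pos: "\<not> (AE x in M. x \<notin> I)"
  using I by (auto simp: AE_iff_null_sets[symmetric] null_sets_def)
 \<comment> \<open>Serves finiteness: at one admissible point the integral is strictly below some
   value, hence below \<infinity>, and integrals may be subtracted.\<close>
 have "\<exists>x\<in>I. P x"
 proof (rule ccontr)
  assume "\<not> (\<exists>x\<in>I. P x)"
  then have "AE x in M. x \<notin> I" using P by (auto elim: eventually_mono)
  then show False using pos by blast
 qed
 then have Jfin: "?J < \<infinity>" using gt by (auto intro: less_le_trans simp: less_top[symmetric] top_unique)
 have "(\<integral>\<^sup>+x. ?J * indicator I x \<partial>M) = ennreal \<delta> * ?J"
  using nn_integral_cmult_indicator[OF assms(2), of ?J] I(1) by (metis mult.commute)
 moreover have "(\<integral>\<^sup>+x. ennreal \<delta> * (G x * indicator I x) \<partial>M) = ennreal \<delta> * ?J"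
  by (simp add: nn_integral_cmult J)
 moreover have "(\<integral>\<^sup>+x. ennreal \<delta> * (G x * indicator I x) - ?J * indicator I x \<partial>M) =
   (\<integral>\<^sup>+x. ennreal \<delta> * (G x * indicator I x) \<partial>M) - (\<integral>\<^sup>+x. ?J * indicator I x \<partial>M)"
 proof (rule nn_integral_diff)
  show "(\<integral>\<^sup>+x. ?J * indicator I x \<partial>M) \<noteq> \<infinity>"
   using Jfin I by (simp add: nn_integral_cmult ennreal_mult_eq_top_iff)
  show "AE x in M. ?J * indicator I x \<le> ennreal \<delta> * (G x * indicator I x)"
   using P by eventually_elim (auto split: split_indicator dest: gt intro: less_imp_le)
 qed auto
 ultimately have "(\<integral>\<^sup>+x. ennreal \<delta> * (G x * indicator I x) - ?J * indicator I x \<partial>M) = 0"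
  using Jfin by (simp add: ennreal_mult_eq_top_iff diff_eq_0_iff_ennreal ennreal_mult_less_top less_top[symmetric])
 then have "AE x in M. ennreal \<delta> * (G x * indicator I x) - ?J * indicator I x = 0"
  by (subst (asm) nn_integral_0_iff_AE) auto
 then have "AE x in M. x \<notin> I"
  using P
 proof eventually_elim
  case (elim x)
  show ?case
  proof
   assume "x \<in> I"
   then have "?J < ennreal \<delta> * G x" "ennreal \<delta> * G x - ?J = 0" using elim gt by auto
   then show False by (metis diff_eq_0_iff_ennreal not_less)
  qed
 qed
 then show False using pos by blast
qed

context rectifiable_path
begin

lemma exists_len_eq:
 assumes "a \<le> s" "s \<le> t" "t \<le> b" "len s \<le> l" "l \<le> len t"
 obtains \<tau> where "s \<le> \<tau>" "\<tau> \<le> t" "len \<tau> = l"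
 using IVT'[of len s l t] assms continuous_len by blast

text \<open>A maximal-function-free form of the fact that functions with an integrable
 Hajlasz gradient on an interval are absolutely continuous: the interval is cut into pieces of
 equal length, in each of which the gradient is at most its average at a suitable point.\<close>

lemma hajlasz_along_path:
 fixes h :: "real \<Rightarrow> 'v::real_normed_vector" and G :: "real \<Rightarrow> ennreal"
 assumes [measurable]: "G \<in> borel_measurable borel"
  and P: "AE \<tau> in lm. \<tau> \<in> {a..b} \<longrightarrow> P \<tau>"
  and h: "\<And>s t. s \<in> {a..b} \<Longrightarrow> t \<in> {a..b} \<Longrightarrow> P s \<Longrightarrow> P t \<Longrightarrow>
   ennreal (norm (h s - h t)) \<le> ennreal (dist (\<gamma> s) (\<gamma> t)) * (G s + G t)"
  and st: "a \<le> s" "s \<le> t" "t \<le> b" "P s" "P t" and fin: "G s < \<infinity>" "G t < \<infinity>"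
 shows "ennreal (norm (h s - h t)) \<le> 4 * emeasure (density lm G) {s<..t}"
proof -
 let ?D = "emeasure (density lm G)"
 define l where "l = len t - len s"
 have l0: "l \<ge> 0" using st by (simp add: l_def len_mono)
 \<comment> \<open>The first term is the price of starting and ending at the prescribed times s and
   t, where G is not below an average. It vanishes as the number n of pieces grows, because
   \<open>G s\<close> and \<open>G t\<close> are finite.\<close>
 have main: "ennreal (norm (h s - h t)) \<le> ennreal (l / real n) * (G s + G t) + 4 * ?D {s<..t}"
  if n: "n > 0" for n :: nat
 proof (cases "l = 0")
  case True
  then have "ennreal (dist (\<gamma> s) (\<gamma> t)) = 0"
   using dist_le_lm[of s t] st by (simp add: emeasure_lm_Ioc l_def)
  then have "dist (\<gamma> s) (\<gamma> t) = 0" by (simp add: ennreal_eq_0_iff)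
  then have "ennreal (norm (h s - h t)) \<le> 0" using h[of s t] st by auto
  then show ?thesis by simp
 next
  case False
  define \<delta> where "\<delta> = l / real n"
  have \<delta>: "\<delta> > 0" using False l0 n by (simp add: \<delta>_def)
  have "\<exists>\<tau>. s \<le> \<tau> \<and> \<tau> \<le> t \<and> len \<tau> = len s + real i * \<delta>" if "i \<le> n" for i
  proof -
   have "real i * \<delta> \<le> l"
    using that n l0 by (simp add: \<delta>_def divide_simps mult_left_mono mult.commute[of _ l])
   then show ?thesis
    using exists_len_eq[of s t "len s + real i * \<delta>"] st \<delta> by (metis add_increasing2 diff_add_cancel add.commute add_left_mono l_def less_imp_le mult_nonneg_nonneg of_nat_0_le_iff order_refl)
  qed
  then obtain \<tau> where \<tau>: "\<And>i. i \<le> n \<Longrightarrow> s \<le> \<tau> i \<and> \<tau> i \<le> t \<and> len (\<tau> i) = len s + real i * \<delta>"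
   by metis
  have \<tau>_less: "\<tau> i < \<tau> (Suc i)" if "i < n" for i
  proof (rule ccontr)
   assume "\<not> \<tau> i < \<tau> (Suc i)"
   then have "len (\<tau> (Suc i)) \<le> len (\<tau> i)" by (simp add: len_mono)
   then show False using \<tau>[of i] \<tau>[of "Suc i"] that \<delta> by (simp add: algebra_simps)
  qed
  have "\<exists>x\<in>{\<tau> i<..\<tau> (Suc i)}. P x \<and> ennreal \<delta> * G x \<le> ?D {\<tau> i<..\<tau> (Suc i)}" if i: "i < n" for i
  proof (rule exists_le_average)
   show "emeasure lm {\<tau> i<..\<tau> (Suc i)} = ennreal \<delta>"
    using i \<tau>[of i] \<tau>[of "Suc i"] \<tau>_less[OF i] by (simp add: emeasure_lm_Ioc algebra_simps)
   show "AE x in lm. x \<in> {\<tau> i<..\<tau> (Suc i)} \<longrightarrow> P x"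
    using P i \<tau>[of i] \<tau>[of "Suc i"] st by (auto elim!: eventually_mono)
  qed (use \<delta> in auto)
  then obtain x where x: "\<And>i. i < n \<Longrightarrow> x i \<in> {\<tau> i<..\<tau> (Suc i)} \<and> P (x i) \<and> ennreal \<delta> * G (x i) \<le> ?D {\<tau> i<..\<tau> (Suc i)}"
   by metis
  have x_ab: "a \<le> x i" "x i \<le> b" "s \<le> x i" "x i \<le> t" if "i < n" for i
   using x[OF that] \<tau>[of i] \<tau>[of "Suc i"] that st by auto
  have step: "ennreal (norm (h u - h v)) \<le> ennreal c * G u + ennreal c * G v"
   if "u \<in> {a..b}" "v \<in> {a..b}" "P u" "P v" "u \<le> v" "len v - len u \<le> c" for u v c
  proof -
   have "ennreal (dist (\<gamma> u) (\<gamma> v)) \<le> emeasure lm {u<..v}" using that by (intro dist_le_lm) auto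
   also have "\<dots> \<le> ennreal c" using that by (simp add: emeasure_lm_Ioc ennreal_leI)
   finally have "ennreal (dist (\<gamma> u) (\<gamma> v)) * (G u + G v) \<le> ennreal c * (G u + G v)"
    by (rule mult_right_mono) simp
   then show ?thesis using h[of u v] that by (simp add: distrib_left order_trans)
  qed
  have len_x: "len s + real i * \<delta> \<le> len (x i)" "len (x i) \<le> len s + real (Suc i) * \<delta>" if "i < n" for i
   using \<tau>[of i] \<tau>[of "Suc i"] x[OF that] that len_mono[of "\<tau> i" "x i"] len_mono[of "x i" "\<tau> (Suc i)"] by auto
  \<comment> \<open>The term \<open>2 * ?D\<close> on the left prepays one half of the next step.
    Consecutive sample points are at most 2 \<delta> apart in length, so a step costs twice the
    integral over each of its two pieces, and a piece takes part in two steps; hence the factor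
    4.\<close>
  have ind: "ennreal (norm (h s - h (x k))) + 2 * ?D {\<tau> k<..\<tau> (Suc k)} \<le>
    ennreal \<delta> * G s + 4 * ?D {\<tau> 0<..\<tau> (Suc k)}" if "k < n" for k
   using that
  proof (induction k)
   case 0
   have "ennreal (norm (h s - h (x 0))) \<le> ennreal \<delta> * G s + ennreal \<delta> * G (x 0)"
    using x[of 0] x_ab[of 0] st len_x[of 0] 0 by (intro step) auto
   also have "\<dots> \<le> ennreal \<delta> * G s + ?D {\<tau> 0<..\<tau> (Suc 0)}"
    using x[of 0] 0 by (intro add_left_mono) auto
   finally have "ennreal (norm (h s - h (x 0))) + 2 * ?D {\<tau> 0<..\<tau> (Suc 0)} \<le>
     ennreal \<delta> * G s + (?D {\<tau> 0<..\<tau> (Suc 0)} + 2 * ?D {\<tau> 0<..\<tau> (Suc 0)})"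
    by (simp add: add_right_mono add.assoc[symmetric])
   also have "?D {\<tau> 0<..\<tau> (Suc 0)} + 2 * ?D {\<tau> 0<..\<tau> (Suc 0)} = 3 * ?D {\<tau> 0<..\<tau> (Suc 0)}"
    by (metis (no_types, lifting) ab_semigroup_add_class.add.commute distrib_right mult_1 numeral_Bit1 numeral_One one_add_one)
   also have "\<dots> \<le> 4 * ?D {\<tau> 0<..\<tau> (Suc 0)}" by (intro mult_right_mono) auto
   finally show ?case by (simp add: add_left_mono)
  next
   case (Suc k)
   let ?J = "?D {\<tau> k<..\<tau> (Suc k)}" and ?J' = "?D {\<tau> (Suc k)<..\<tau> (Suc (Suc k))}"
   have "ennreal (norm (h (x k) - h (x (Suc k)))) \<le> ennreal (2 * \<delta>) * G (x k) + ennreal (2 * \<delta>) * G (x (Suc k))"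
   proof (rule step)
    show "x k \<le> x (Suc k)" using x[of k] x[of "Suc k"] Suc.prems by auto
    have "len (x (Suc k)) - len (x k) \<le> (real (Suc (Suc k)) - real k) * \<delta>"
     using len_x[of k] len_x[of "Suc k"] Suc.prems by (simp add: algebra_simps)
    then show "len (x (Suc k)) - len (x k) \<le> 2 * \<delta>" by simp
   qed (use x[of k] x[of "Suc k"] x_ab[of k] x_ab[of "Suc k"] Suc.prems in auto)
   also have "\<dots> = 2 * (ennreal \<delta> * G (x k)) + 2 * (ennreal \<delta> * G (x (Suc k)))"
    using \<delta> by (simp add: ennreal_mult mult.assoc)
   also have "\<dots> \<le> 2 * ?J + 2 * ?J'"
    using x[of k] x[of "Suc k"] Suc.prems by (intro add_mono mult_left_mono) auto
   finally have s: "ennreal (norm (h (x k) - h (x (Suc k)))) \<le> 2 * ?J + 2 * ?J'" .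
   have "ennreal (norm (h s - h (x (Suc k)))) \<le> ennreal (norm (h s - h (x k))) + ennreal (norm (h (x k) - h (x (Suc k))))"
    by (simp add: norm_diff_triangle_ineq flip: ennreal_plus) (metis norm_triangle_ineq diff_add_cancel add_diff_eq)
   also have "\<dots> \<le> ennreal (norm (h s - h (x k))) + (2 * ?J + 2 * ?J')" using s by (rule add_left_mono)
   finally have "ennreal (norm (h s - h (x (Suc k)))) + 2 * ?J' \<le> (ennreal (norm (h s - h (x k))) + 2 * ?J) + (2 * ?J' + 2 * ?J')"
    by (simp add: add_right_mono add.assoc[symmetric])
   also have "\<dots> \<le> (ennreal \<delta> * G s + 4 * ?D {\<tau> 0<..\<tau> (Suc k)}) + (2 * ?J' + 2 * ?J')"
    using Suc by (intro add_right_mono Suc.IH) auto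
   also have "2 * ?J' + 2 * ?J' = 4 * ?J'"
    by (simp add: distrib_right[symmetric])
   also have "ennreal \<delta> * G s + 4 * ?D {\<tau> 0<..\<tau> (Suc k)} + 4 * ?J' = ennreal \<delta> * G s + 4 * (?D {\<tau> 0<..\<tau> (Suc k)} + ?J')"
    by (simp add: distrib_left add.assoc)
   also have "?D {\<tau> 0<..\<tau> (Suc k)} + ?J' = ?D ({\<tau> 0<..\<tau> (Suc k)} \<union> {\<tau> (Suc k)<..\<tau> (Suc (Suc k))})"
    by (intro plus_emeasure) auto
   also have "{\<tau> 0<..\<tau> (Suc k)} \<union> {\<tau> (Suc k)<..\<tau> (Suc (Suc k))} = {\<tau> 0<..\<tau> (Suc (Suc k))}"
   proof (rule ivl_disj_un_two(6))
    have "len (\<tau> 0) < len (\<tau> (Suc k))" using \<tau>[of 0] \<tau>[of "Suc k"] Suc.prems \<delta> by auto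
    then show "\<tau> 0 \<le> \<tau> (Suc k)" using len_mono[of "\<tau> (Suc k)" "\<tau> 0"] by linarith
   qed (use \<tau>_less[of "Suc k"] Suc.prems in auto)
   finally show ?case .
  qed
  define m where "m = n - 1"
  have m: "m < n" "Suc m = n" using n by (auto simp: m_def)
  have "ennreal (norm (h s - h t)) \<le> ennreal (norm (h s - h (x m))) + ennreal (norm (h (x m) - h t))"
   by (simp flip: ennreal_plus) (metis norm_triangle_ineq diff_add_cancel add_diff_eq)
  also have "ennreal (norm (h (x m) - h t)) \<le> ennreal \<delta> * G (x m) + ennreal \<delta> * G t"
  proof (rule step)
   have "real (Suc m) * \<delta> = l" using m n by (simp add: \<delta>_def)
   then have "len s + real m * \<delta> + \<delta> = len t" by (simp add: l_def algebra_simps)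
   then show "len t - len (x m) \<le> \<delta>" using len_x[of m] m by linarith
  qed (use x[of m] x_ab[of m] m st in auto)
  also have "\<dots> \<le> 2 * ?D {\<tau> m<..\<tau> (Suc m)} + ennreal \<delta> * G t"
   using x[of m] m by (intro add_right_mono) (metis add_increasing2 mult_2 zero_le)
  also have "ennreal (norm (h s - h (x m))) + (2 * ?D {\<tau> m<..\<tau> (Suc m)} + ennreal \<delta> * G t) \<le>
    (ennreal \<delta> * G s + 4 * ?D {\<tau> 0<..\<tau> (Suc m)}) + ennreal \<delta> * G t"
   using ind[OF m(1)] by (simp add: add.assoc[symmetric] add_right_mono)
  also have "\<dots> \<le> (ennreal \<delta> * G s + 4 * ?D {s<..t}) + ennreal \<delta> * G t"
   using \<tau>[of 0] \<tau>[of "Suc m"] m by (intro add_right_mono add_left_mono mult_left_mono emeasure_mono) auto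
  also have "\<dots> = ennreal \<delta> * (G s + G t) + 4 * ?D {s<..t}"
   by (simp add: distrib_left ac_simps)
  finally show ?thesis by (simp add: \<delta>_def add_left_mono)
 qed
 have "(\<lambda>n. ennreal (l / real n) * (G s + G t) + 4 * ?D {s<..t}) \<longlonglongrightarrow> ennreal 0 * (G s + G t) + 4 * ?D {s<..t}"
  using fin by (intro tendsto_add tendsto_const tendsto_mult_ennreal tendsto_ennrealI lim_const_over_n) auto
 then have "ennreal (norm (h s - h t)) \<le> ennreal 0 * (G s + G t) + 4 * ?D {s<..t}"
  using main by (intro LIMSEQ_le_const[where X="\<lambda>n. ennreal (l / real n) * (G s + G t) + 4 * ?D {s<..t}"]) (auto intro!: exI[of _ 1])
 then show ?thesis by simp
qed

lemma emeasure_lm_Ioo: "emeasure lm ({s<..t} - {t}) = emeasure lm {s<..t}"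
 using emeasure_lm_singleton[of t] by (intro emeasure_Diff_null_set) (auto simp: null_sets_def)

text \<open>Both functions are controlled by their own gradient; on the set where they agree, either gradient
 may be used. Only finitely many gaps of \<open>K\<close> matter for each partition.\<close>

lemma glue_along_path:
 fixes \<phi> \<psi> :: "real \<Rightarrow> real" and G :: "real \<Rightarrow> ennreal"
 assumes [measurable]: "G \<in> borel_measurable borel"
  and K: "closed K" "K \<subseteq> {a..b}" "\<And>t. t \<in> K \<Longrightarrow> \<phi> t = \<psi> t"
  and \<phi>: "\<And>s t. a \<le> s \<Longrightarrow> s \<le> t \<Longrightarrow> t \<le> b \<Longrightarrow> ennreal \<bar>\<phi> s - \<phi> t\<bar> \<le> L * emeasure lm {s<..t}"
  and \<psi>: "\<And>s t. a \<le> s \<Longrightarrow> s \<le> t \<Longrightarrow> t \<le> b \<Longrightarrow> ennreal \<bar>\<psi> s - \<psi> t\<bar> \<le> emeasure (density lm G) {s<..t}"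
  and fin: "emeasure (density lm G) {a<..b} < \<infinity>"
 shows "ennreal \<bar>\<phi> a - \<phi> b\<bar> \<le> L * emeasure lm ({a<..b} - K) + emeasure (density lm G) ({a<..b} \<inter> K)"
proof (cases "K = {}")
 case True
 then show ?thesis using \<phi>[of a b] ab by simp
next
 case False
 let ?D = "emeasure (density lm G)"
 have [measurable]: "K \<in> sets borel" using K(1) by auto
 \<comment> \<open>Closed neighbourhoods of \<open>K\<close>. A stretch between two points of
   \<open>K\<close> inside an interval of length r lies in \<open>nb r\<close>, and these sets
   shrink to \<open>K\<close> as the partition is refined.\<close>
 define nb where "nb r = {t. infdist t K \<le> r}" for r :: real
 have nb_closed: "closed (nb r)" for r
  unfolding nb_def by (intro closed_Collect_le continuous_intros)
 then have [measurable]: "nb r \<in> sets borel" for r by auto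
 have piece: "ennreal \<bar>\<phi> s - \<phi> t\<bar> \<le> L * emeasure lm ({s<..t} - K) + ?D ({s<..t} \<inter> nb (t - s))"
  if st: "a \<le> s" "s \<le> t" "t \<le> b" for s t
 proof (cases "{s..t} \<inter> K = {}")
  case True
  then have "{s<..t} - K = {s<..t}" using greaterThanAtMost_subseteq_atLeastAtMost_iff[of s t s t] by blast
  then show ?thesis using \<phi>[OF st] by (simp add: add_increasing2)
 next
  case False
  \<comment> \<open>\<alpha> and \<beta> will be the first and the last time in \<open>K\<close>.
    Between them \<psi> is used, which agrees with \<phi> at both; before \<alpha> and after \<beta>
    there is no point of \<open>K\<close> and \<phi> is used. The point \<alpha> itself can be
    removed from the first interval, since points have length measure 0.\<close>
  define C where "C = {s..t} \<inter> K"
  have C: "compact C" "C \<noteq> {}" using False K(1) by (auto simp: C_def compact_Int_closed)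
  obtain \<alpha> where \<alpha>: "\<alpha> \<in> C" "\<And>x. x \<in> C \<Longrightarrow> \<alpha> \<le> x" using compact_attains_inf[OF C] by blast
  obtain \<beta> where \<beta>: "\<beta> \<in> C" "\<And>x. x \<in> C \<Longrightarrow> x \<le> \<beta>" using compact_attains_sup[OF C] by blast
  have ord: "s \<le> \<alpha>" "\<alpha> \<le> \<beta>" "\<beta> \<le> t" using \<alpha> \<beta> by (auto simp: C_def)
  have "ennreal \<bar>\<phi> s - \<phi> \<alpha>\<bar> \<le> L * emeasure lm ({s<..\<alpha>} - {\<alpha>})"
   using \<phi>[of s \<alpha>] st ord by (simp add: emeasure_lm_Ioo)
  moreover have "ennreal \<bar>\<phi> \<beta> - \<phi> t\<bar> \<le> L * emeasure lm {\<beta><..t}"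
   using \<phi>[of \<beta> t] st ord by simp
  moreover have "ennreal \<bar>\<phi> \<alpha> - \<phi> \<beta>\<bar> \<le> ?D {\<alpha><..\<beta>}"
   using \<psi>[of \<alpha> \<beta>] st ord \<alpha>(1) \<beta>(1) K(3) by (simp add: C_def)
  moreover have "ennreal \<bar>\<phi> s - \<phi> t\<bar> \<le> ennreal \<bar>\<phi> s - \<phi> \<alpha>\<bar> + (ennreal \<bar>\<phi> \<alpha> - \<phi> \<beta>\<bar> + ennreal \<bar>\<phi> \<beta> - \<phi> t\<bar>)"
   by (auto simp flip: ennreal_plus)
  ultimately have "ennreal \<bar>\<phi> s - \<phi> t\<bar> \<le>
    L * emeasure lm ({s<..\<alpha>} - {\<alpha>}) + (?D {\<alpha><..\<beta>} + L * emeasure lm {\<beta><..t})"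
   by (meson add_mono order_trans)
  also have "\<dots> = L * (emeasure lm ({s<..\<alpha>} - {\<alpha>}) + emeasure lm {\<beta><..t}) + ?D {\<alpha><..\<beta>}"
   by (simp add: distrib_left ac_simps)
  also have "emeasure lm ({s<..\<alpha>} - {\<alpha>}) + emeasure lm {\<beta><..t} = emeasure lm (({s<..\<alpha>} - {\<alpha>}) \<union> {\<beta><..t})"
   using ord by (intro plus_emeasure) auto
  also have "\<dots> \<le> emeasure lm ({s<..t} - K)"
  proof (rule emeasure_mono)
   show "({s<..\<alpha>} - {\<alpha>}) \<union> {\<beta><..t} \<subseteq> {s<..t} - K"
   proof
    fix x assume x: "x \<in> ({s<..\<alpha>} - {\<alpha>}) \<union> {\<beta><..t}"
    then have "x \<in> {s<..t}" using ord by auto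
    moreover have "x \<notin> C" using x \<alpha>(2)[of x] \<beta>(2)[of x] by force
    ultimately show "x \<in> {s<..t} - K" by (auto simp: C_def)
   qed
  qed auto
  also have "?D {\<alpha><..\<beta>} \<le> ?D ({s<..t} \<inter> nb (t - s))"
  proof (rule emeasure_mono)
   show "{\<alpha><..\<beta>} \<subseteq> {s<..t} \<inter> nb (t - s)"
   proof
    fix x assume x: "x \<in> {\<alpha><..\<beta>}"
    have "infdist x K \<le> dist x \<alpha>" using \<alpha>(1) by (intro infdist_le) (auto simp: C_def)
    then show "x \<in> {s<..t} \<inter> nb (t - s)"
     using x ord by (auto simp: nb_def dist_real_def)
   qed
  qed auto
  finally show ?thesis by (simp add: add_mono mult_left_mono)
 qed
 define d where "d n = (b - a) / real (Suc n)" for n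
 have d0: "d n \<ge> 0" for n using ab by (simp add: d_def)
 have main: "ennreal \<bar>\<phi> a - \<phi> b\<bar> \<le> L * emeasure lm ({a<..b} - K) + ?D ({a<..b} \<inter> nb (d n))" for n
 proof -
  have "ennreal \<bar>\<phi> a - \<phi> (a + real k * d n)\<bar> \<le>
    L * emeasure lm ({a<..a + real k * d n} - K) + ?D ({a<..a + real k * d n} \<inter> nb (d n))" if "k \<le> Suc n" for k
   using that
  proof (induction k)
   case (Suc k)
   let ?s = "a + real k * d n" and ?t = "a + real (Suc k) * d n"
   have s: "a \<le> ?s" "?s \<le> ?t" using d0[of n] by (auto simp: algebra_simps)
   have "real (Suc k) * d n \<le> real (Suc n) * d n" using Suc.prems d0 by (intro mult_right_mono) auto
   then have t: "?t \<le> b" by (simp add: d_def)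
   have diff: "?t - ?s = d n" by (simp add: algebra_simps)
   have "ennreal \<bar>\<phi> a - \<phi> ?t\<bar> \<le> ennreal \<bar>\<phi> a - \<phi> ?s\<bar> + ennreal \<bar>\<phi> ?s - \<phi> ?t\<bar>"
    by (auto simp flip: ennreal_plus)
   also have "\<dots> \<le> (L * emeasure lm ({a<..?s} - K) + ?D ({a<..?s} \<inter> nb (d n))) +
     (L * emeasure lm ({?s<..?t} - K) + ?D ({?s<..?t} \<inter> nb (d n)))"
    using Suc piece[OF s t] unfolding diff by (intro add_mono) auto
   also have "\<dots> = L * (emeasure lm ({a<..?s} - K) + emeasure lm ({?s<..?t} - K)) +
     (?D ({a<..?s} \<inter> nb (d n)) + ?D ({?s<..?t} \<inter> nb (d n)))"
    by (simp add: distrib_left ac_simps)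
   also have "emeasure lm ({a<..?s} - K) + emeasure lm ({?s<..?t} - K) = emeasure lm (({a<..?s} - K) \<union> ({?s<..?t} - K))"
    by (intro plus_emeasure) auto
   also have "({a<..?s} - K) \<union> ({?s<..?t} - K) = {a<..?t} - K"
    using s by auto
   also have "?D ({a<..?s} \<inter> nb (d n)) + ?D ({?s<..?t} \<inter> nb (d n)) = ?D (({a<..?s} \<inter> nb (d n)) \<union> ({?s<..?t} \<inter> nb (d n)))"
    by (intro plus_emeasure) auto
   also have "({a<..?s} \<inter> nb (d n)) \<union> ({?s<..?t} \<inter> nb (d n)) = {a<..?t} \<inter> nb (d n)"
    using s by auto
   finally show ?case .
  qed simp
  from this[of "Suc n"] show ?thesis by (simp add: d_def)
 qed
 have "(\<lambda>n. ?D ({a<..b} \<inter> nb (d n))) \<longlonglongrightarrow> ?D (\<Inter>n. {a<..b} \<inter> nb (d n))"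
 proof (rule Lim_emeasure_decseq)
  have "d n \<le> d m" if "m \<le> n" for m n
   using that ab by (auto simp: d_def intro!: divide_left_mono)
  then show "decseq (\<lambda>n. {a<..b} \<inter> nb (d n))"
   by (fastforce simp: decseq_def nb_def)
  show "?D ({a<..b} \<inter> nb (d i)) \<noteq> \<infinity>" for i
   using fin emeasure_mono[of "{a<..b} \<inter> nb (d i)" "{a<..b}" "density lm G"] by (auto simp: top_unique)
 qed auto
 also have "(\<Inter>n. {a<..b} \<inter> nb (d n)) = {a<..b} \<inter> K"
 proof -
  have "x \<in> K" if x: "\<And>n. infdist x K \<le> d n" for x
  proof -
   have "d \<longlonglongrightarrow> 0" unfolding d_def by (intro LIMSEQ_Suc[OF lim_const_over_n])
   then have "infdist x K \<le> 0" using x by (intro LIMSEQ_le_const) auto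
   then show ?thesis
    using K(1) \<open>K \<noteq> {}\<close> infdist_nonneg[of x K] in_closed_iff_infdist_zero by force
  qed
  then show ?thesis using d0 by (auto simp: nb_def)
 qed
 finally have "(\<lambda>n. L * emeasure lm ({a<..b} - K) + ?D ({a<..b} \<inter> nb (d n))) \<longlonglongrightarrow>
   L * emeasure lm ({a<..b} - K) + ?D ({a<..b} \<inter> K)"
  by (intro tendsto_add tendsto_const)
 then show ?thesis using main by (intro LIMSEQ_le_const) auto
qed

end

section \<open>Hajlasz gradients yield weak upper gradients\<close>

lemma measurable_ennreal_powr [measurable]:
 "f \<in> borel_measurable M \<Longrightarrow> (\<lambda>x. ennreal_powr (f x) p) \<in> borel_measurable M"
proof -
 assume [measurable]: "f \<in> borel_measurable M"
 have "{x \<in> space M. f x = \<infinity>} \<in> sets M" by measurable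
 then show ?thesis unfolding ennreal_powr_def by (intro measurable_If) auto
qed

lemma tendsto_0_le_ennreal:
 fixes f g :: "nat \<Rightarrow> ennreal"
 assumes "\<And>n. f n \<le> g n" "g \<longlonglongrightarrow> 0" shows "f \<longlonglongrightarrow> 0"
 using assms by (intro tendsto_sandwich[of "\<lambda>_. 0" f sequentially g 0]) auto

lemma ennreal_powr_ennreal: "r \<ge> 0 \<Longrightarrow> ennreal_powr (ennreal r) p = ennreal (r powr p)"
 by (simp add: ennreal_powr_def)

lemma ennreal_powr_infinity [simp]: "ennreal_powr \<infinity> p = \<infinity>" "ennreal_powr top p = top"
 by (simp_all add: ennreal_powr_def)

lemma ennreal_powr_0 [simp]: "ennreal_powr 0 p = 0"
 by (simp add: ennreal_powr_def)

lemma ennreal_powr_1 [simp]: "ennreal_powr 1 p = 1"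
 by (simp add: ennreal_powr_def)

lemma ennreal_powr_mono: "0 \<le> p \<Longrightarrow> x \<le> y \<Longrightarrow> ennreal_powr x p \<le> ennreal_powr y p"
 by (cases x; cases y) (auto simp: ennreal_powr_ennreal powr_mono2 top_unique)

lemma ennreal_powr_mult:
 assumes "0 < p" shows "ennreal_powr (x * y) p = ennreal_powr x p * ennreal_powr y p"
proof (cases "x = \<infinity> \<or> y = \<infinity>")
 case True
 then show ?thesis
  by (cases x; cases y) (auto simp: ennreal_powr_def ennreal_top_mult ennreal_mult_top ennreal_mult_eq_top_iff)
next
 case False
 then show ?thesis
  by (cases x; cases y) (auto simp: ennreal_powr_ennreal ennreal_mult[symmetric] powr_mult)
qed

lemma ennreal_powr_powr: "ennreal_powr (ennreal_powr x p) q = ennreal_powr x (p * q)"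
 by (cases x) (auto simp: ennreal_powr_ennreal powr_powr)

lemma ennreal_powr_one_exponent [simp]: "ennreal_powr x 1 = x"
 by (cases x) (auto simp: ennreal_powr_ennreal)

lemma ennreal_powr_eq_0_iff [simp]: "ennreal_powr x p = 0 \<longleftrightarrow> x = 0"
 by (cases x) (auto simp: ennreal_powr_ennreal)

lemma ennreal_powr_less_top_iff [simp]: "ennreal_powr x p < top \<longleftrightarrow> x < top"
 by (cases x) (auto simp: ennreal_powr_ennreal)

lemma ennreal_powr_add:
 assumes "0 \<le> p"
 shows "ennreal_powr (x + y) p \<le> ennreal (2 powr p) * (ennreal_powr x p + ennreal_powr y p)"
proof -
 have "ennreal_powr (x + y) p \<le> ennreal_powr (2 * max x y) p"
  unfolding mult_2 using assms by (intro ennreal_powr_mono add_mono max.cobounded1 max.cobounded2)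
 also have "\<dots> \<le> ennreal (2 powr p) * ennreal_powr (max x y) p"
  by (cases "max x y") (auto simp: ennreal_powr_ennreal ennreal_mult[symmetric] powr_mult
    simp flip: ennreal_numeral)
 also have "ennreal_powr (max x y) p \<le> ennreal_powr x p + ennreal_powr y p"
  by (cases "x \<le> y") (auto simp: max_def)
 finally show ?thesis by (simp add: mult_left_mono)
qed

text \<open>The power 1/p is a monotone inverse, so an upper bound of the powers pulls back to an
  upper bound of the \<open>f i\<close>.\<close>

lemma ennreal_powr_SUP:
 assumes "0 < p"
 shows "ennreal_powr (SUP i\<in>I. f i) p = (SUP i\<in>I. ennreal_powr (f i) p)"
proof (rule antisym)
 have "f i \<le> ennreal_powr (SUP i\<in>I. ennreal_powr (f i) p) (1 / p)" if "i \<in> I" for i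
 proof -
  have "f i = ennreal_powr (ennreal_powr (f i) p) (1 / p)" using assms by (simp add: ennreal_powr_powr)
  also have "\<dots> \<le> ennreal_powr (SUP i\<in>I. ennreal_powr (f i) p) (1 / p)"
   using assms that by (intro ennreal_powr_mono SUP_upper) auto
  finally show ?thesis .
 qed
 then have "(SUP i\<in>I. f i) \<le> ennreal_powr (SUP i\<in>I. ennreal_powr (f i) p) (1 / p)"
  by (rule SUP_least)
 then have "ennreal_powr (SUP i\<in>I. f i) p \<le> ennreal_powr (ennreal_powr (SUP i\<in>I. ennreal_powr (f i) p) (1 / p)) p"
  using assms by (intro ennreal_powr_mono) auto
 then show "ennreal_powr (SUP i\<in>I. f i) p \<le> (SUP i\<in>I. ennreal_powr (f i) p)"
  using assms by (simp add: ennreal_powr_powr)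
qed (use assms in \<open>auto intro!: SUP_least ennreal_powr_mono SUP_upper\<close>)

lemma Lp_integrable_AE_finite:
 assumes "Lp_integrable N p f" shows "AE x in N. f x < \<infinity>"
proof -
 have [measurable]: "f \<in> borel_measurable N" using assms by (simp add: Lp_integrable_def)
 have "AE x in N. ennreal_powr (f x) p \<noteq> \<infinity>"
  using assms by (intro nn_integral_noteq_infinite) (auto simp: Lp_integrable_def)
 then show ?thesis by eventually_elim (auto simp: less_top[symmetric])
qed

lemma Lp_integrable_cmult:
 assumes "Lp_integrable N p f" "0 < p" "c < \<infinity>"
 shows "Lp_integrable N p (\<lambda>x. c * f x)"
proof -
 have [measurable]: "f \<in> borel_measurable N" using assms by (simp add: Lp_integrable_def)
 have "(\<integral>\<^sup>+x. ennreal_powr (c * f x) p \<partial>N) = ennreal_powr c p * (pint N p f)"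
  using assms(2) by (simp add: ennreal_powr_mult nn_integral_cmult)
 also have "\<dots> < \<infinity>" using assms by (simp add: Lp_integrable_def ennreal_mult_less_top)
 finally show ?thesis by (simp add: Lp_integrable_def)
qed

lemma Lp_integrable_cong_AE:
 assumes "Lp_integrable N p f" "g \<in> borel_measurable N" "AE x in N. g x = f x"
 shows "Lp_integrable N p g" "(pint N p g) = pint N p f"
proof -
 show "(pint N p g) = pint N p f"
  using assms(3) by (intro nn_integral_cong_AE) auto
 then show "Lp_integrable N p g" using assms by (simp add: Lp_integrable_def)
qed

text \<open>On the right \<open>C\<close> may lie outside \<open>S\<close>, which is what limits and
  unions of ranges provide. To move it into \<open>S\<close>, pick for each c in \<open>C\<close>
  and each n a point of \<open>S\<close> within 1/(n+1) of c, if there is one.\<close>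

lemma separable_top_of_set_iff:
 fixes S :: "'a::metric_space set"
 shows "separable_space (top_of_set S) \<longleftrightarrow> (\<exists>C. countable C \<and> S \<subseteq> closure C)"
proof
 assume "separable_space (top_of_set S)"
 then obtain C where "countable C" "C \<subseteq> S" "top_of_set S closure_of C = S"
  by (auto simp: separable_space_def)
 then show "\<exists>C. countable C \<and> S \<subseteq> closure C"
  by (intro exI[of _ C]) (auto simp: closure_of_subtopology Int_absorb1)
next
 assume "\<exists>C. countable C \<and> S \<subseteq> closure C"
 then obtain C where C: "countable C" "S \<subseteq> closure C" by blast
 define y where "y c n = (SOME x. x \<in> S \<and> dist c x < 1 / Suc n)" for c and n :: nat
 define I where "I = {(c, n). c \<in> C \<and> (\<exists>x. x \<in> S \<and> dist c x < 1 / Suc n)}"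
 have y: "y c n \<in> S" "dist c (y c n) < 1 / Suc n" if "(c, n) \<in> I" for c n
  using that someI_ex[of "\<lambda>x. x \<in> S \<and> dist c x < 1 / Suc n"] by (auto simp: I_def y_def)
 define D where "D = case_prod y ` I"
 have "I \<subseteq> C \<times> UNIV" by (auto simp: I_def)
 then have "countable D"
  unfolding D_def using C(1) by (meson countable_SIGMA countable_image countable_subset countableI_type)
 have D_S: "D \<subseteq> S"
  using y(1) by (auto simp: D_def)
 moreover have "S \<subseteq> closure D"
 proof
  fix x assume x: "x \<in> S"
  show "x \<in> closure D"
   unfolding closure_approachable
  proof (intro allI impI)
   fix e :: real assume "e > 0"
   then obtain n :: nat where n: "1 / Suc n < e / 2" using nat_approx_posE[of "e/2"] by auto
   obtain c where c: "c \<in> C" "dist c x < 1 / Suc n"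
    using C(2) x closure_approachable[of x C] by (metis divide_pos_pos of_nat_0_less_iff subsetD zero_less_Suc zero_less_one)
   have "(c, n) \<in> I" using c x by (auto simp: I_def)
   then have "dist c (y c n) < 1 / Suc n" "y c n \<in> D" using y by (auto simp: D_def)
   then show "\<exists>y\<in>D. dist y x < e"
    using c n dist_triangle[of "y c n" x c] by (intro bexI[of _ "y c n"]) (auto simp: dist_commute)
  qed
 qed
 ultimately show "separable_space (top_of_set S)"
  using \<open>countable D\<close> unfolding separable_space_def
  by (intro exI[of _ D]) (auto simp: closure_of_subtopology Int_absorb1)
qed

text \<open>Completeness permits changes on null sets. \<open>borel_majorant\<close> replaces a
  measurable gradient by a Borel one that is nowhere smaller and a.e. equal: Hajlasz gradients are
  only measurable, whereas weak upper gradients have to be Borel on the space.\<close>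

locale borel_compatible_measure = complete_measure N for N :: "'z::metric_space measure" +
 assumes borel_sets: "sets (restrict_space borel (space N)) \<subseteq> sets N"
  and borel_majorant: "f \<in> borel_measurable N \<Longrightarrow>
   \<exists>f'\<in>borel_on (space N).
    (\<forall>x\<in>space N. f x \<le> (f' x :: ennreal)) \<and> (AE x in N. f' x = f x)"
begin

lemma borel_measurableI: "f \<in> borel_on (space N) \<Longrightarrow> f \<in> borel_measurable N"
 using borel_sets by (auto simp: measurable_def space_restrict_space)

lemma measurable_AE_eq:
 fixes u v :: "'z \<Rightarrow> 'a::topological_space"
 assumes u: "u \<in> borel_measurable N" and eq: "AE x in N. v x = u x"
 shows "v \<in> borel_measurable N"
proof -
 obtain A where A: "A \<in> null_sets N" "{x\<in>space N. v x \<noteq> u x} \<subseteq> A"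
  using eq by (auto elim!: AE_E simp: null_sets_def)
 show ?thesis
 proof (rule measurableI)
  fix S :: "'a set" assume S: "S \<in> sets borel"
  have "v -` S \<inter> space N = ((u -` S \<inter> space N) - A) \<union> ((v -` S \<inter> space N) \<inter> A)"
   using A by auto
  moreover have "(v -` S \<inter> space N) \<inter> A \<in> sets N"
   using complete[of "(v -` S \<inter> space N) \<inter> A" A] A(1) by auto
  moreover have "(u -` S \<inter> space N) - A \<in> sets N"
   using measurable_sets[OF u S] A(1) by auto
  ultimately show "v -` S \<inter> space N \<in> sets N" by (metis sets.Un)
 qed simp
qed

lemma ess_separable_measurable_AE_eq:
 assumes u: "ess_separable_measurable N u" and eq: "AE x in N. v x = u x"
 shows "ess_separable_measurable N v"
proof -
 obtain A where A: "A \<in> null_sets N" "{x\<in>space N. v x \<noteq> u x} \<subseteq> A"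
  using eq by (auto elim!: AE_E simp: null_sets_def)
 obtain B C where B: "B \<in> null_sets N" and C: "countable C" "u ` (space N - B) \<subseteq> closure C"
  using u unfolding ess_separable_measurable_def separable_top_of_set_iff by blast
 have "v ` (space N - (A \<union> B)) \<subseteq> u ` (space N - B)"
  using A by (auto simp: image_iff)
 moreover have "A \<union> B \<in> null_sets N" using A B by auto
 ultimately show ?thesis
  using measurable_AE_eq[OF _ eq] u C unfolding ess_separable_measurable_def separable_top_of_set_iff
  by (meson order_trans)
qed

text \<open>On a path along which \<rho> has finite integral, almost every time is mapped into
  \<open>P\<close>, and between such times \<open>hajlasz_along_path\<close> bounds the oscillation
  of u. The end points may miss \<open>P\<close>, so u must be redefined there by a limit that
  depends on the point alone and not on the path. The relation \<open>R\<close> achieves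
  this.\<close>

lemma hajlasz_imp_weak_upper_gradient:
 fixes u :: "'z \<Rightarrow> 'v::banach"
 assumes p: "0 < p" and u: "ess_separable_measurable N u"
  and haj: "hajlasz_upper_gradient N u g" and int: "Lp_integrable N p g"
 shows "\<exists>v \<rho>. (AE x in N. v x = u x) \<and> ess_separable_measurable N v \<and> weak_upper_gradient N p v \<rho> \<and>
  Lp_integrable N p \<rho> \<and> pint N p \<rho> = (\<integral>\<^sup>+x. ennreal_powr (4 * g x) p \<partial>N)"
proof -
 have [measurable]: "g \<in> borel_measurable N" using haj by (simp add: hajlasz_upper_gradient_def)
 obtain A where A[measurable]: "A \<in> null_sets N"
  and gA: "\<And>x y. x \<in> space N - A \<Longrightarrow> y \<in> space N - A \<Longrightarrow>
   ennreal (norm (u x - u y)) \<le> ennreal (dist x y) * (g x + g y)"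
  using haj by (auto simp: hajlasz_upper_gradient_def)
 \<comment> \<open>The value \<infinity> on \<open>A\<close> puts the exceptional set of the Hajlasz
   inequality into the set where \<rho> is infinite; a path with finite integral spends no length
   there.\<close>
 have "(\<lambda>x. if x \<in> A then \<infinity> else g x) \<in> borel_measurable N"
  using A by (intro measurable_If_set) (auto simp: null_sets_def)
 from borel_majorant[OF this] obtain \<rho> where \<rho>: "\<rho> \<in> borel_on (space N)"
  and \<rho>_ge: "\<And>x. x \<in> space N \<Longrightarrow> (if x \<in> A then \<infinity> else g x) \<le> \<rho> x"
  and \<rho>_AE: "AE x in N. \<rho> x = (if x \<in> A then \<infinity> else g x)"
  by blast
 have [measurable]: "\<rho> \<in> borel_measurable N" by (rule borel_measurableI[OF \<rho>])
 have \<rho>_eq: "AE x in N. \<rho> x = g x"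
  using \<rho>_AE AE_not_in[OF A] by eventually_elim auto
 have \<rho>_int: "Lp_integrable N p \<rho>" by (rule Lp_integrable_cong_AE[OF int _ \<rho>_eq]) simp
 define P where "P x \<longleftrightarrow> x \<in> space N \<and> \<rho> x < \<infinity>" for x
 have P_AE: "AE x in N. P x"
  using Lp_integrable_AE_finite[OF \<rho>_int] AE_space by eventually_elim (simp add: P_def)
 have P_haj: "ennreal (norm (u x - u y)) \<le> ennreal (dist x y) * (\<rho> x + \<rho> y)" if "P x" "P y" for x y
 proof -
  have "x \<notin> A" "y \<notin> A" "g x \<le> \<rho> x" "g y \<le> \<rho> y"
   using that \<rho>_ge[of x] \<rho>_ge[of y] by (auto simp: P_def top_unique split: if_splits)
  then show ?thesis
   using gA[of x y] that by (meson DiffI P_def add_mono mult_left_mono order_trans zero_le)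
 qed
 text \<open>\<open>R x w\<close> says that \<open>w\<close> is the value of the representative at \<open>x\<close>; the weights \<open>(1/2)\<^sup>n\<close> make it unique.\<close>
 define R where "R x w \<longleftrightarrow> (\<exists>y. (\<forall>n. P (y n) \<and> dist (y n) x \<le> (1/2)^n) \<and>
   (\<lambda>n. ennreal ((1/2)^n) * \<rho> (y n)) \<longlonglongrightarrow> 0 \<and> (\<lambda>n. u (y n)) \<longlonglongrightarrow> w)" for x w
 have R_unique: "w = w'" if Rw: "R x w" and Rw': "R x w'" for x w w'
 proof -
  obtain y where y: "\<And>n. P (y n)" "\<And>n. dist (y n) x \<le> (1/2)^n"
   "(\<lambda>n. ennreal ((1/2)^n) * \<rho> (y n)) \<longlonglongrightarrow> 0" "(\<lambda>n. u (y n)) \<longlonglongrightarrow> w"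
   using Rw unfolding R_def by blast
  obtain z where z: "\<And>n. P (z n)" "\<And>n. dist (z n) x \<le> (1/2)^n"
   "(\<lambda>n. ennreal ((1/2)^n) * \<rho> (z n)) \<longlonglongrightarrow> 0" "(\<lambda>n. u (z n)) \<longlonglongrightarrow> w'"
   using Rw' unfolding R_def by blast
  have "ennreal (norm (u (y n) - u (z n))) \<le> 2 * (ennreal ((1/2)^n) * \<rho> (y n) + ennreal ((1/2)^n) * \<rho> (z n))" for n
  proof -
   have "dist (y n) (z n) \<le> 2 * (1/2)^n"
    using y(2)[of n] z(2)[of n] dist_triangle2[of "y n" "z n" x] by simp
   then have "ennreal (dist (y n) (z n)) * (\<rho> (y n) + \<rho> (z n)) \<le> ennreal (2 * (1/2)^n) * (\<rho> (y n) + \<rho> (z n))"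
    by (intro mult_right_mono ennreal_leI) auto
   also have "\<dots> = 2 * (ennreal ((1/2)^n) * \<rho> (y n) + ennreal ((1/2)^n) * \<rho> (z n))"
    by (simp add: ennreal_mult distrib_left mult.assoc)
   finally show ?thesis using P_haj[OF y(1)[of n] z(1)[of n]] by (rule order_trans[rotated])
  qed
  moreover have "(\<lambda>n. 2 * (ennreal ((1/2)^n) * \<rho> (y n) + ennreal ((1/2)^n) * \<rho> (z n))) \<longlonglongrightarrow> 2 * (0 + 0)"
   by (intro tendsto_mult_ennreal tendsto_add tendsto_const y z) auto
  ultimately have "(\<lambda>n. ennreal (norm (u (y n) - u (z n)))) \<longlonglongrightarrow> 0"
   by (intro tendsto_0_le_ennreal[where f="\<lambda>n. ennreal (norm (u (y n) - u (z n)))"]) simp_all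
  then have "(\<lambda>n. norm (u (y n) - u (z n))) \<longlonglongrightarrow> 0"
   using tendsto_ennreal_iff[of "\<lambda>n. norm (u (y n) - u (z n))" sequentially 0] by simp
  moreover have "(\<lambda>n. norm (u (y n) - u (z n))) \<longlonglongrightarrow> norm (w - w')"
   by (intro tendsto_intros y z)
  ultimately show ?thesis using LIMSEQ_unique by fastforce
 qed
 define v where "v x = (if \<exists>w. R x w then (SOME w. R x w) else u x)" for x
 have v_R: "v x = w" if "R x w" for x w
  using that R_unique[of x] someI[of "R x" w] by (auto simp: v_def)
 \<comment> \<open>The constant sequence at x is admissible in \<open>R\<close>, because
   \<open>\<rho> x\<close> is finite.\<close>
 have "v x = u x" if "P x" for x
 proof (rule v_R)
  have "(\<lambda>n. ennreal ((1/2)^n) * \<rho> x) \<longlonglongrightarrow> ennreal 0 * \<rho> x"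
   using that by (intro tendsto_mult_ennreal tendsto_ennrealI LIMSEQ_power_zero tendsto_const) (auto simp: P_def)
  then show "R x (u x)"
   unfolding R_def using that by (intro exI[of _ "\<lambda>_. x"]) auto
 qed
 then have v_eq: "AE x in N. v x = u x" using P_AE by (auto elim: eventually_mono)
 define \<Gamma> where "\<Gamma> = {c \<in> paths_in (space N). curve_integral \<rho> c = \<infinity>}"
 have \<Gamma>: "p_negligible N p \<Gamma>"
  unfolding p_negligible_def using \<rho> \<rho>_int by (auto simp: \<Gamma>_def)
 have "ennreal (norm (v (\<gamma> a) - v (\<gamma> b))) \<le> curve_integral (\<lambda>x. 4 * \<rho> x) (a, b, \<gamma>)"
  if c: "(a, b, \<gamma>) \<in> paths_in (space N) - \<Gamma>" for a b \<gamma>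
 proof (cases "\<gamma> a = \<gamma> b")
  case neq: False
  have pth: "a \<le> b" "continuous_on {a..b} \<gamma>" "\<gamma> ` {a..b} \<subseteq> space N" and fin: "curve_integral \<rho> (a, b, \<gamma>) < \<infinity>"
   using c by (auto simp: paths_in_def \<Gamma>_def less_top)
  then have "curve_length a b \<gamma> < \<infinity>"
   by (auto simp: curve_integral_def split: if_splits)
  then interpret rectifiable_path a b \<gamma> using pth by unfold_locales
  define G where "G \<tau> = \<rho> (\<gamma> \<tau>) * indicator {a..b} \<tau>" for \<tau>
  have G[measurable]: "G \<in> borel_measurable borel"
   unfolding G_def using measurable_along(1)[OF \<rho> pth(3)] by simp
  let ?D = "emeasure (density lm G)"
  have D: "?D {a<..b} = curve_integral \<rho> (a, b, \<gamma>)"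
  proof -
   have "?D {a<..b} = (\<integral>\<^sup>+\<tau>. G \<tau> * indicator {a<..b} \<tau> \<partial>lm)" by (simp add: emeasure_density)
   also have "\<dots> = (\<integral>\<^sup>+\<tau>. \<rho> (\<gamma> \<tau>) * indicator {a<..b} \<tau> \<partial>lm)"
    by (intro nn_integral_cong) (auto simp: G_def split: split_indicator)
   finally show ?thesis using curve_integral_subpath[OF \<rho> pth(3), of a b] pth by simp
  qed
  have P_path: "AE \<tau> in lm. \<tau> \<in> {a..b} \<longrightarrow> P (\<gamma> \<tau>)"
  proof -
   have "(\<integral>\<^sup>+\<tau>. G \<tau> * indicator {a<..b} \<tau> \<partial>lm) \<noteq> \<infinity>"
    using D fin by (simp add: emeasure_density)
   then have "AE \<tau> in lm. G \<tau> * indicator {a<..b} \<tau> \<noteq> \<infinity>"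
    by (intro nn_integral_noteq_infinite) auto
   moreover have "AE \<tau> in lm. \<tau> \<noteq> a"
    using emeasure_lm_singleton[of a] AE_not_in[of "{a}" lm] by (auto simp: null_sets_def)
   ultimately show ?thesis
    by eventually_elim (use pth(3) in \<open>auto simp: P_def G_def less_top[symmetric] split: split_indicator_asm\<close>)
  qed
  have haj_path0: "ennreal (norm (u (\<gamma> s) - u (\<gamma> t))) \<le> 4 * ?D {s<..t}"
   if "a \<le> s" "s \<le> t" "t \<le> b" "P (\<gamma> s)" "P (\<gamma> t)" for s t
  proof (rule hajlasz_along_path[where h="\<lambda>t. u (\<gamma> t)" and P="\<lambda>t. P (\<gamma> t)"])
   fix s t assume "s \<in> {a..b}" "t \<in> {a..b}" "P (\<gamma> s)" "P (\<gamma> t)"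
   then show "ennreal (norm (u (\<gamma> s) - u (\<gamma> t))) \<le> ennreal (dist (\<gamma> s) (\<gamma> t)) * (G s + G t)"
    using P_haj[of "\<gamma> s" "\<gamma> t"] by (simp add: G_def)
  qed (use that P_path in \<open>auto simp: G_def P_def\<close>)
  have haj_path: "ennreal (norm (u (\<gamma> s) - u (\<gamma> t))) \<le> 4 * ?D X"
   if st: "a \<le> s" "s \<le> b" "a \<le> t" "t \<le> b" "P (\<gamma> s)" "P (\<gamma> t)" and X: "X \<in> sets borel" "{s<..t} \<subseteq> X" "{t<..s} \<subseteq> X" for s t X
  proof (cases "s \<le> t")
   case True
   then have "ennreal (norm (u (\<gamma> s) - u (\<gamma> t))) \<le> 4 * ?D {s<..t}" using st by (intro haj_path0) auto
   also have "\<dots> \<le> 4 * ?D X" using X by (intro mult_left_mono emeasure_mono) auto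
   finally show ?thesis .
  next
   case False
   then have "ennreal (norm (u (\<gamma> t) - u (\<gamma> s))) \<le> 4 * ?D {t<..s}" using st by (intro haj_path0) auto
   also have "\<dots> \<le> 4 * ?D X" using X by (intro mult_left_mono emeasure_mono) auto
   finally show ?thesis by (simp add: norm_minus_commute)
  qed
  define l where "l = len b"
  have lena: "len a = 0" by (simp add: len_left)
  have l: "l > 0"
  proof -
   have "0 < ennreal (dist (\<gamma> a) (\<gamma> b))" using neq by simp
   also have "\<dots> \<le> ennreal (len b - len a)" using dist_le_lm[of a b] pth by (simp add: emeasure_lm_Ioc)
   finally show ?thesis by (simp add: l_def lena)
  qed
  \<comment> \<open>The bound by l keeps initial and final pieces of length
    \<open>\<delta> n\<close> inside the path; the bound by 1 gives the distance
    \<open>(1/2)^n\<close> demanded in \<open>R\<close>.\<close>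
  define \<delta> where "\<delta> n = min l 1 * (1/2)^n" for n :: nat
  have \<delta>: "0 < \<delta> n" "\<delta> n \<le> l" "\<delta> n \<le> (1/2)^n" "\<delta> (Suc n) < \<delta> n" for n
  proof -
   show "0 < \<delta> n" "\<delta> (Suc n) < \<delta> n" using l by (auto simp: \<delta>_def)
   have "min l 1 * (1/2)^n \<le> l * 1" using l by (intro mult_mono) (auto simp: power_le_one)
   then show "\<delta> n \<le> l" by (simp add: \<delta>_def)
   have "min l 1 * (1/2)^n \<le> 1 * (1/2)^n" by (intro mult_right_mono) auto
   then show "\<delta> n \<le> (1/2)^n" by (simp add: \<delta>_def)
  qed
  \<comment> \<open>\<open>J n\<close> is the piece of length \<open>\<delta> n\<close> at the end
    e. A point of \<open>J n\<close> where G is at most its average satisfies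
    \<open>\<delta> n * G \<le> ?D (J n)\<close>, which tends to 0: this is the weight condition in
    \<open>R\<close>. The values of u at these points are Cauchy, since their differences are at
    most \<open>4 * ?D (J n)\<close>; completeness of the target space provides the limit.\<close>
  have end_limit: "\<exists>s. (\<forall>n. s n \<in> J n \<and> P (\<gamma> (s n))) \<and> (\<lambda>n. u (\<gamma> (s n))) \<longlonglongrightarrow> v (\<gamma> e)"
   if J[measurable]: "\<And>n. J n \<in> sets borel" and J_sub: "\<And>n. J n \<subseteq> {a<..b}" and dec: "decseq J"
    and J_lm: "\<And>n. emeasure lm (J n) = ennreal (\<delta> n)"
    and conv: "\<And>n s t. s \<in> J n \<Longrightarrow> t \<in> J n \<Longrightarrow> {s<..t} \<subseteq> J n"
    and J_dist: "\<And>n s. s \<in> J n \<Longrightarrow> ennreal (dist (\<gamma> s) (\<gamma> e)) \<le> emeasure lm (J n)" for J :: "nat \<Rightarrow> real set" and e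
  proof -
   have "\<exists>s\<in>J n. P (\<gamma> s) \<and> ennreal (\<delta> n) * G s \<le> ?D (J n)" for n
    using J_sub[of n] \<delta>(1) J_lm P_path by (intro exists_le_average) (auto elim!: eventually_mono)
   then obtain s where s: "\<And>n. s n \<in> J n" "\<And>n. P (\<gamma> (s n))" "\<And>n. ennreal (\<delta> n) * G (s n) \<le> ?D (J n)"
    by metis
   have DJ: "(\<lambda>n. ?D (J n)) \<longlonglongrightarrow> 0"
   proof -
    have "(\<lambda>n. ?D (J n)) \<longlonglongrightarrow> ?D (\<Inter>n. J n)"
    proof (rule Lim_emeasure_decseq)
     show "?D (J n) \<noteq> \<infinity>" for n
      using emeasure_mono[OF J_sub[of n], of "density lm G"] D fin by (auto simp: top_unique)
    qed (use dec in auto)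
    moreover have "emeasure lm (\<Inter>n. J n) \<le> 0"
    proof (rule LIMSEQ_le_const)
     have "\<delta> \<longlonglongrightarrow> min l 1 * 0" unfolding \<delta>_def by (intro tendsto_mult tendsto_const LIMSEQ_power_zero) auto
     then show "(\<lambda>n. ennreal (\<delta> n)) \<longlonglongrightarrow> 0" using tendsto_ennrealI by fastforce
     show "\<exists>N. \<forall>n\<ge>N. emeasure lm (\<Inter>n. J n) \<le> ennreal (\<delta> n)"
      unfolding J_lm[symmetric] by (auto intro!: emeasure_mono)
    qed
    then have "(\<Inter>n. J n) \<in> null_sets (density lm G)"
     by (subst null_sets_density_iff) (auto simp: null_sets_def intro!: AE_I[of _ _ "\<Inter>n. J n"])
    ultimately show ?thesis by (simp add: null_sets_def)
   qed
   have tail: "ennreal (dist (u (\<gamma> (s n))) (u (\<gamma> (s m)))) \<le> 4 * ?D (J n)" if "n \<le> m" for n m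
   proof -
    have sub: "s m \<in> J n" using s(1)[of m] dec that by (auto simp: decseq_def)
    have ab': "a \<le> s n" "s n \<le> b" "a \<le> s m" "s m \<le> b" using s(1)[of n] s(1)[of m] J_sub by fastforce+
    show ?thesis unfolding dist_norm
     using ab' s(2) J conv[OF s(1)[of n] sub] conv[OF sub s(1)[of n]] by (intro haj_path) auto
   qed
   have "Cauchy (\<lambda>n. u (\<gamma> (s n)))"
    unfolding Cauchy_altdef2
   proof (intro allI impI)
    fix e :: real assume "e > 0"
    have "(\<lambda>n. 4 * ?D (J n)) \<longlonglongrightarrow> 4 * 0"
     by (intro tendsto_mult_ennreal tendsto_const DJ) auto
    then have "eventually (\<lambda>n. 4 * ?D (J n) < ennreal e) sequentially"
     by (rule order_tendstoD(2)) (simp add: \<open>e > 0\<close>)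
    then obtain n where n: "4 * ?D (J n) < ennreal e" by (auto dest: eventually_happens)
    have "dist (u (\<gamma> (s m))) (u (\<gamma> (s n))) < e" if "m \<ge> n" for m
     using le_less_trans[OF tail[OF that] n] \<open>e > 0\<close> by (simp add: dist_commute ennreal_less_iff)
    then show "\<exists>n. \<forall>m\<ge>n. dist (u (\<gamma> (s m))) (u (\<gamma> (s n))) < e" by blast
   qed
   then obtain w where w: "(\<lambda>n. u (\<gamma> (s n))) \<longlonglongrightarrow> w"
    using Cauchy_convergent by (auto simp: convergent_def)
   have "R (\<gamma> e) w"
    unfolding R_def
   proof (intro exI[of _ "\<lambda>n. \<gamma> (s n)"] conjI allI s w)
    fix n
    have "ennreal (dist (\<gamma> (s n)) (\<gamma> e)) \<le> ennreal ((1/2)^n)"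
     using J_dist[OF s(1)[of n]] J_lm[of n] \<delta>(3)[of n] by (metis ennreal_leI order_trans)
    then show "dist (\<gamma> (s n)) (\<gamma> e) \<le> (1/2)^n" by simp
   next
    have bound: "ennreal ((1/2)^n) * \<rho> (\<gamma> (s n)) \<le> ennreal (1 / min l 1) * ?D (J n)" for n
    proof -
     have sn: "s n \<in> {a..b}" using s(1)[of n] J_sub by force
     have "ennreal ((1/2)^n) = ennreal (1 / min l 1) * ennreal (\<delta> n)"
      using l by (simp add: \<delta>_def ennreal_mult[symmetric])
     then have "ennreal ((1/2)^n) * \<rho> (\<gamma> (s n)) = ennreal (1 / min l 1) * (ennreal (\<delta> n) * G (s n))"
      using sn by (simp add: G_def mult.assoc)
     also have "\<dots> \<le> ennreal (1 / min l 1) * ?D (J n)" using s(3) by (rule mult_left_mono) simp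
     finally show ?thesis .
    qed
    have "(\<lambda>n. ennreal (1 / min l 1) * ?D (J n)) \<longlonglongrightarrow> ennreal (1 / min l 1) * 0"
     by (intro tendsto_mult_ennreal tendsto_const DJ) auto
    then show "(\<lambda>n. ennreal ((1/2)^n) * \<rho> (\<gamma> (s n))) \<longlonglongrightarrow> 0"
     by (intro tendsto_0_le_ennreal[OF bound]) simp
   qed
   then have "v (\<gamma> e) = w" by (rule v_R)
   then show ?thesis using s w by blast
  qed
  have exists_len: "\<exists>\<tau>. a \<le> \<tau> \<and> \<tau> \<le> b \<and> len \<tau> = r" if "0 \<le> r" "r \<le> l" for r
  proof (rule exists_len_eq[of a b r])
   show "len a \<le> r" "r \<le> len b" using that by (simp_all add: lena l_def)
  qed (use pth in blast)+
  have "\<exists>\<tau>. a \<le> \<tau> \<and> \<tau> \<le> b \<and> len \<tau> = \<delta> n" for n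
   using \<delta>[of n] by (intro exists_len) auto
  then obtain \<tau> where \<tau>: "\<And>n. a \<le> \<tau> n" "\<And>n. \<tau> n \<le> b" "\<And>n. len (\<tau> n) = \<delta> n" by metis
  have "\<tau> (Suc n) \<le> \<tau> n" for n
   using len_mono[of "\<tau> n" "\<tau> (Suc n)"] \<tau>(3) \<delta>(4)[of n] by (metis le_cases not_le)
  then have dec1: "decseq (\<lambda>n. {a<..\<tau> n})"
   by (intro decseq_SucI subsetI) (metis greaterThanAtMost_iff order_trans)
  have "\<exists>s. (\<forall>n. s n \<in> {a<..\<tau> n} \<and> P (\<gamma> (s n))) \<and> (\<lambda>n. u (\<gamma> (s n))) \<longlonglongrightarrow> v (\<gamma> a)"
  proof (rule end_limit[where J="\<lambda>n. {a<..\<tau> n}"])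
   fix n s assume s: "s \<in> {a<..\<tau> n}"
   have "ennreal (dist (\<gamma> s) (\<gamma> a)) \<le> emeasure lm {a<..s}"
    using dist_le_lm[of a s] s \<tau>(2)[of n] by (simp add: dist_commute)
   also have "\<dots> \<le> emeasure lm {a<..\<tau> n}" using s by (intro emeasure_mono) auto
   finally show "ennreal (dist (\<gamma> s) (\<gamma> a)) \<le> emeasure lm {a<..\<tau> n}" .
  next
   show "{a<..\<tau> n} \<subseteq> {a<..b}" for n using \<tau>(2)[of n] by auto
   show "emeasure lm {a<..\<tau> n} = ennreal (\<delta> n)" for n using \<tau> by (simp add: emeasure_lm_Ioc lena)
   show "{s<..t} \<subseteq> {a<..\<tau> n}" if "s \<in> {a<..\<tau> n}" "t \<in> {a<..\<tau> n}" for n s t using that by auto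
  qed (use dec1 in auto)
  then obtain s where s: "\<And>n. s n \<in> {a<..\<tau> n}" "\<And>n. P (\<gamma> (s n))" "(\<lambda>n. u (\<gamma> (s n))) \<longlonglongrightarrow> v (\<gamma> a)"
   by blast
  have "\<exists>\<sigma>. a \<le> \<sigma> \<and> \<sigma> \<le> b \<and> len \<sigma> = l - \<delta> n" for n
   using \<delta>[of n] by (intro exists_len) auto
  then obtain \<sigma> where \<sigma>: "\<And>n. a \<le> \<sigma> n" "\<And>n. \<sigma> n \<le> b" "\<And>n. len (\<sigma> n) = l - \<delta> n" by metis
  have "\<sigma> n \<le> \<sigma> (Suc n)" for n
  proof (rule ccontr)
   assume "\<not> \<sigma> n \<le> \<sigma> (Suc n)"
   then have "len (\<sigma> (Suc n)) \<le> len (\<sigma> n)" by (intro len_mono) auto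
   then show False using \<sigma>(3)[of n] \<sigma>(3)[of "Suc n"] \<delta>(4)[of n] by simp
  qed
  then have dec2: "decseq (\<lambda>n. {\<sigma> n<..b})"
   by (intro decseq_SucI subsetI) (metis greaterThanAtMost_iff le_less_trans)
  have "\<exists>s. (\<forall>n. s n \<in> {\<sigma> n<..b} \<and> P (\<gamma> (s n))) \<and> (\<lambda>n. u (\<gamma> (s n))) \<longlonglongrightarrow> v (\<gamma> b)"
  proof (rule end_limit[where J="\<lambda>n. {\<sigma> n<..b}"])
   fix n s assume s: "s \<in> {\<sigma> n<..b}"
   have "ennreal (dist (\<gamma> s) (\<gamma> b)) \<le> emeasure lm {s<..b}"
    using dist_le_lm[of s b] s \<sigma>(1)[of n] by simp
   also have "\<dots> \<le> emeasure lm {\<sigma> n<..b}" using s by (intro emeasure_mono) auto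
   finally show "ennreal (dist (\<gamma> s) (\<gamma> b)) \<le> emeasure lm {\<sigma> n<..b}" .
  next
   show "{\<sigma> n<..b} \<subseteq> {a<..b}" for n using \<sigma>(1)[of n] by auto
   show "emeasure lm {\<sigma> n<..b} = ennreal (\<delta> n)" for n using \<sigma> by (simp add: emeasure_lm_Ioc l_def[symmetric])
   show "{s<..t} \<subseteq> {\<sigma> n<..b}" if "s \<in> {\<sigma> n<..b}" "t \<in> {\<sigma> n<..b}" for n s t using that by auto
  qed (use dec2 in auto)
  then obtain t where t: "\<And>n. t n \<in> {\<sigma> n<..b}" "\<And>n. P (\<gamma> (t n))" "(\<lambda>n. u (\<gamma> (t n))) \<longlonglongrightarrow> v (\<gamma> b)"
   by blast
  have "ennreal (norm (u (\<gamma> (s n)) - u (\<gamma> (t n)))) \<le> 4 * ?D {a<..b}" for n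
  proof -
   have st: "a \<le> s n" "s n \<le> b" "a \<le> t n" "t n \<le> b"
    using s(1)[of n] t(1)[of n] \<tau>(2)[of n] \<sigma>(1)[of n] by auto
   then show ?thesis using s(2) t(2) by (intro haj_path) auto
  qed
  moreover have "(\<lambda>n. ennreal (norm (u (\<gamma> (s n)) - u (\<gamma> (t n))))) \<longlonglongrightarrow> ennreal (norm (v (\<gamma> a) - v (\<gamma> b)))"
   by (intro tendsto_ennrealI tendsto_intros s t)
  ultimately have "ennreal (norm (v (\<gamma> a) - v (\<gamma> b))) \<le> 4 * ?D {a<..b}"
   by - (rule LIMSEQ_le_const2, assumption, blast)
  also have "\<dots> = (\<integral>\<^sup>+\<tau>. 4 * (\<rho> (\<gamma> \<tau>) * indicator {a<..b} \<tau>) \<partial>lm)"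
   using measurable_along(2)[OF \<rho> pth(3), of a b] curve_integral_subpath[OF \<rho> pth(3), of a b] pth D
   by (subst nn_integral_cmult) auto
  also have "\<dots> = curve_integral (\<lambda>x. 4 * \<rho> x) (a, b, \<gamma>)"
   using \<rho> pth by (subst curve_integral_subpath[OF _ pth(3)]) (auto simp: mult.assoc)
  finally show ?thesis .
 qed simp
 then have "weak_upper_gradient N p v (\<lambda>x. 4 * \<rho> x)"
  unfolding weak_upper_gradient_def using \<rho> \<Gamma> by (intro conjI exI[of _ \<Gamma>]) auto
 moreover have "Lp_integrable N p (\<lambda>x. 4 * \<rho> x)"
  using \<rho>_int p by (intro Lp_integrable_cmult) auto
 moreover have "(\<integral>\<^sup>+x. ennreal_powr (4 * \<rho> x) p \<partial>N) = (\<integral>\<^sup>+x. ennreal_powr (4 * g x) p \<partial>N)"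
  using \<rho>_eq by (intro nn_integral_cong_AE) auto
 ultimately show ?thesis
  using v_eq ess_separable_measurable_AE_eq[OF u v_eq] by blast
qed

end

section \<open>Zabreiko's lemma\<close>

text \<open>\<open>B t u\<close> stands for: the seminorm of u is at most t. A relation is used
  because the bounds come from infima that may be infinite or not attained. The last clause is
  countable subadditivity, with a.e. convergence of the partial sums in place of convergence in
  norm.\<close>

definition sigma_seminorm :: "'z measure \<Rightarrow> (real \<Rightarrow> ('z \<Rightarrow> 'v::real_normed_vector) \<Rightarrow> bool) \<Rightarrow> bool" where
 "sigma_seminorm N B \<longleftrightarrow>
   (\<forall>s t u. B s u \<longrightarrow> s \<le> t \<longrightarrow> B t u) \<and>
   (\<forall>t u c. B t u \<longrightarrow> c \<noteq> 0 \<longrightarrow> B (\<bar>c\<bar> * t) (\<lambda>x. c *\<^sub>R u x)) \<and>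
   (\<forall>t>0. B t (\<lambda>x. 0)) \<and>
   (\<forall>t u v. (\<forall>k. 0 < t k \<and> B (t k) (u k)) \<longrightarrow> summable t \<longrightarrow>
    (AE x in N. (\<lambda>n. \<Sum>k<n. u k x) \<longlonglongrightarrow> v x) \<longrightarrow> B (suminf t) v)"

lemma sigma_seminormD:
 assumes "sigma_seminorm N B"
 shows "B s u \<Longrightarrow> s \<le> t \<Longrightarrow> B t u"
  and "B t u \<Longrightarrow> c \<noteq> 0 \<Longrightarrow> B (\<bar>c\<bar> * t) (\<lambda>x. c *\<^sub>R u x)"
  and "0 < t \<Longrightarrow> B t (\<lambda>x. 0)"
  and "(\<And>k. 0 < T k) \<Longrightarrow> (\<And>k. B (T k) (U k)) \<Longrightarrow> summable T \<Longrightarrow>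
    (AE x in N. (\<lambda>n. \<Sum>k<n. U k x) \<longlonglongrightarrow> v x) \<Longrightarrow> B (suminf T) v"
proof -
 note * = assms[unfolded sigma_seminorm_def]
 show "B s u \<Longrightarrow> s \<le> t \<Longrightarrow> B t u"
  using *[THEN conjunct1, rule_format] .
 show "B t u \<Longrightarrow> c \<noteq> 0 \<Longrightarrow> B (\<bar>c\<bar> * t) (\<lambda>x. c *\<^sub>R u x)"
  using *[THEN conjunct2, THEN conjunct1, rule_format] .
 show "0 < t \<Longrightarrow> B t (\<lambda>x. 0)"
  using *[THEN conjunct2, THEN conjunct2, THEN conjunct1, rule_format] .
 show "(\<And>k. 0 < T k) \<Longrightarrow> (\<And>k. B (T k) (U k)) \<Longrightarrow> summable T \<Longrightarrow>
   (AE x in N. (\<lambda>n. \<Sum>k<n. U k x) \<longlonglongrightarrow> v x) \<Longrightarrow> B (suminf T) v"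
  using *[THEN conjunct2, THEN conjunct2, THEN conjunct2, rule_format, of T U v] by simp
qed

lemma sigma_seminorm_minus:
 assumes "sigma_seminorm N B" "B t u" shows "B t (\<lambda>x. - u x)"
 using sigma_seminormD(2)[OF assms(1), OF assms(2), where c="-1"] by simp

text \<open>Countable subadditivity wants a positive bound for every term, so the two functions are
  completed to a series by zero functions whose bounds add up to (r - s - t)/2. This is the origin
  of the strict inequality.\<close>

lemma sigma_seminorm_add:
 assumes B: "sigma_seminorm N B" and u: "B s u" "0 < s" and v: "B t v" "0 < t" and r: "s + t < r"
 shows "B r (\<lambda>x. u x + v x)"
proof -
 define T where "T k = (if k = 0 then s else if k = 1 then t else (r - s - t) * (1/2)^k)" for k :: nat
 define U where "U k = (if k = 0 then u else if k = 1 then v else (\<lambda>x. 0))" for k :: nat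
 have T_pos: "0 < T k" for k using u v r by (simp add: T_def)
 have T_le: "T sums (s + t + (r - s - t) / 2)"
 proof -
  have "(\<lambda>k. (r - s - t) / 4 * (1/2)^k) sums ((r - s - t) / 4 * (1 / (1 - 1/2)))"
   by (intro sums_mult geometric_sums) simp
  also have "(r - s - t) / 4 * (1 / (1 - 1/2)) = (r - s - t) / 2" by simp
  also have "(\<lambda>k. (r - s - t) / 4 * (1/2)^k) = (\<lambda>k. T (k + 2))"
   by (simp add: T_def power_add)
  finally have "T sums ((r - s - t) / 2 + (\<Sum>i<2. T i))" by (rule iffD1[OF sums_iff_shift])
  also have "(\<Sum>i<2. T i) = s + t" by (simp add: T_def numeral_2_eq_2)
  finally show ?thesis by (simp only: add.commute)
 qed
 have "B (suminf T) (\<lambda>x. u x + v x)"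
 proof (rule sigma_seminormD(4)[OF B, OF T_pos])
  show "B (T k) (U k)" for k
   using u v r sigma_seminormD(3)[OF B, of "T k"] T_pos[of k] by (auto simp: T_def U_def)
  show "summable T" using T_le by (rule sums_summable)
  have "(\<lambda>n. \<Sum>k<n. U k x) \<longlonglongrightarrow> u x + v x" for x
  proof (rule tendsto_eventually)
   have "(\<Sum>k<n. U k x) = u x + v x" if "n \<ge> 2" for n
   proof -
    have "(\<Sum>k<n. U k x) = (\<Sum>k\<in>{0,1::nat}. U k x)"
     using that by (intro sum.mono_neutral_right) (auto simp: U_def)
    then show ?thesis by (simp add: U_def)
   qed
   then show "eventually (\<lambda>n. (\<Sum>k<n. U k x) = u x + v x) sequentially"
    by (auto simp: eventually_sequentially)
  qed
  then show "AE x in N. (\<lambda>n. \<Sum>k<n. U k x) \<longlonglongrightarrow> u x + v x" by simp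
 qed
 then show ?thesis
  by (rule sigma_seminormD(1)[OF B]) (use T_le r in \<open>auto simp: sums_iff field_simps\<close>)
qed

lemma sigma_seminorm_diff:
 assumes B: "sigma_seminorm N B" and u: "B s u" "0 < s" and v: "B t v" "0 < t" and r: "s + t < r"
 shows "B r (\<lambda>x. u x - v x)"
 using sigma_seminorm_add[OF B, OF u sigma_seminorm_minus[OF B, OF v(1)] v(2) r] by simp

text \<open>Zabreiko's lemma. It replaces the closed graph theorem: completeness is needed only in the form
 that absolutely convergent series converge almost everywhere.\<close>

theorem sigma_seminorm_bounded:
 fixes A B :: "real \<Rightarrow> ('z \<Rightarrow> 'v::banach) \<Rightarrow> bool"
 assumes A: "sigma_seminorm N A" and B: "sigma_seminorm N B"
  and complete: "\<And>t u. (\<And>k. 0 < t k) \<Longrightarrow> (\<And>k. A (t k) (u k)) \<Longrightarrow> summable t \<Longrightarrow>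
   AE x in N. summable (\<lambda>k. norm (u k x))"
  and finite: "\<And>t u. 0 < t \<Longrightarrow> A t u \<Longrightarrow> \<exists>s>0. B s u"
 shows "\<exists>C>0. \<forall>t>0. \<forall>u. A t u \<longrightarrow> B (C * t) u"
proof -
 \<comment> \<open>\<open>Q s u\<close>: u lies in the closure, with respect to A, of the ball of
   radius s with respect to B.\<close>
 define Q where "Q s u \<longleftrightarrow> (\<forall>\<epsilon>>0. \<exists>m. B s m \<and> A \<epsilon> (\<lambda>x. u x - m x))" for s u
 have Q_scale: "Q (c * s) (\<lambda>x. c *\<^sub>R u x)" if "Q s u" "c > 0" for c s u
  unfolding Q_def
 proof (intro allI impI)
  fix \<epsilon> :: real assume "\<epsilon> > 0"
  then have "\<epsilon> / c > 0" using \<open>c > 0\<close> by simp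
  from \<open>Q s u\<close>[unfolded Q_def, rule_format, OF this] obtain m
   where m: "B s m" "A (\<epsilon> / c) (\<lambda>x. u x - m x)" by blast
  then show "\<exists>m. B (c * s) m \<and> A \<epsilon> (\<lambda>x. c *\<^sub>R u x - m x)"
   using sigma_seminormD(2)[OF B, OF m(1), of c] sigma_seminormD(2)[OF A, OF m(2), of c] \<open>c > 0\<close>
   by (intro exI[of _ "\<lambda>x. c *\<^sub>R m x"]) (auto simp: scaleR_diff_right)
 qed
 \<comment> \<open>The Baire category part, done by a gliding hump: if no C works, one builds a
   convergent series whose sum satisfies \<open>B\<close> with no bound at all.\<close>
 have "\<exists>C>0. \<forall>u. A 1 u \<longrightarrow> Q C u"
 proof (rule ccontr)
  assume "\<not> ?thesis"
  then have unb: "\<exists>u. A 1 u \<and> \<not> Q C u" if "C > 0" for C using that by blast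
  \<comment> \<open>If S + w were in the closure of the B-ball of radius n for all small w,
    subtracting S and scaling would put the whole unit A-ball into such a closure. The summand 1 in
    \<open>C\<close> is the slack of \<open>sigma_seminorm_diff\<close>.\<close>
  have hump: "\<exists>w. A \<eta> w \<and> \<not> Q n (\<lambda>x. S x + w x)"
   if S: "B s0 S" "0 < s0" and n: "0 < n" and \<eta>: "0 < \<eta>" for S s0 n \<eta>
  proof (rule ccontr)
   assume no: "\<not> ?thesis"
   define C where "C = (n + s0 + 1) / \<eta>"
   have C: "C > 0" using n S \<eta> by (simp add: C_def)
   obtain u where u: "A 1 u" "\<not> Q C u" using unb[OF C] by blast
   have "A \<eta> (\<lambda>x. \<eta> *\<^sub>R u x)" using sigma_seminormD(2)[OF A, OF u(1), of \<eta>] \<eta> by simp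
   then have q: "Q n (\<lambda>x. S x + \<eta> *\<^sub>R u x)" using no by blast
   have "Q (n + s0 + 1) (\<lambda>x. \<eta> *\<^sub>R u x)"
    unfolding Q_def
   proof (intro allI impI)
    fix \<epsilon> :: real assume "\<epsilon> > 0"
    then obtain m where m: "B n m" "A \<epsilon> (\<lambda>x. S x + \<eta> *\<^sub>R u x - m x)"
     using q unfolding Q_def by blast
    have "B (n + s0 + 1) (\<lambda>x. m x - S x)"
     using sigma_seminorm_diff[OF B, OF m(1) n S] by simp
    moreover have "(\<lambda>x. \<eta> *\<^sub>R u x - (m x - S x)) = (\<lambda>x. S x + \<eta> *\<^sub>R u x - m x)"
     by (simp add: algebra_simps)
    ultimately show "\<exists>m. B (n + s0 + 1) m \<and> A \<epsilon> (\<lambda>x. \<eta> *\<^sub>R u x - m x)"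
     using m(2) by (intro exI[of _ "\<lambda>x. m x - S x"]) simp
   qed
   from Q_scale[OF this, of "1 / \<eta>"] have "Q C u" using \<eta> by (simp add: C_def)
   then show False using u by blast
  qed
  \<comment> \<open>A state consists of a partial sum S and a radius \<eta> such that nothing within
    A-distance \<eta> of S lies in the B-ball of radius n. For n = 0 nothing is excluded, which
    allows the start with S = 0 and \<eta> = 1.\<close>
  define P where "P n = (\<lambda>(S, \<eta>). 0 < \<eta> \<and> (\<exists>t>0. A t S) \<and>
    (0 < n \<longrightarrow> (\<forall>m. A \<eta> (\<lambda>x. S x - m x) \<longrightarrow> \<not> B (real n) m)))" for n :: nat
  have dep: "\<exists>F. \<forall>n. (P n (F n) \<and> (n = 0 \<longrightarrow> F n = ((\<lambda>x. 0), 1))) \<and>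
    (case (F n, F (Suc n)) of ((S, \<eta>), (S', \<eta>')) \<Rightarrow> \<eta>' \<le> \<eta> / 2 \<and> A (\<eta> / 2) (\<lambda>x. S' x - S x))"
   proof (intro dependent_nat_choice[where
     Q="\<lambda>n F F'. case (F, F') of ((S, \<eta>), (S', \<eta>')) \<Rightarrow> \<eta>' \<le> \<eta> / 2 \<and> A (\<eta> / 2) (\<lambda>x. S' x - S x)"])
    show "\<exists>F. P 0 F \<and> ((0::nat) = 0 \<longrightarrow> F = ((\<lambda>x. 0), 1))"
     using sigma_seminormD(3)[OF A, of 1] by (intro exI[of _ "((\<lambda>x. 0), 1)"]) (auto simp: P_def intro!: exI[of _ 1])
   next
    fix F n assume F: "P n F \<and> (n = 0 \<longrightarrow> F = ((\<lambda>x. 0), 1))"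
    obtain S \<eta> where F_eq: "F = (S, \<eta>)" by (cases F)
    have \<eta>: "0 < \<eta>" using F by (simp add: F_eq P_def)
    obtain t where t: "0 < t" "A t S" using F by (auto simp: F_eq P_def)
    obtain s0 where s0: "0 < s0" "B s0 S" using finite[OF t] by blast
    obtain w where w: "A (\<eta> / 2) w" "\<not> Q (real (Suc n)) (\<lambda>x. S x + w x)"
     using hump[OF s0(2) s0(1), of "real (Suc n)" "\<eta> / 2"] \<eta> by auto
    obtain \<epsilon> where \<epsilon>: "\<epsilon> > 0" "\<And>m. B (real (Suc n)) m \<Longrightarrow> \<not> A \<epsilon> (\<lambda>x. S x + w x - m x)"
     using w(2) unfolding Q_def by blast
    define F' where "F' = ((\<lambda>x. S x + w x), min \<epsilon> (\<eta> / 2))"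
    have "A (t + \<eta>) (\<lambda>x. S x + w x)"
     using \<eta> t by (intro sigma_seminorm_add[OF A, OF t(2) t(1) w(1)]) auto
    then have "\<exists>t>0. A t (\<lambda>x. S x + w x)" using t \<eta> by (intro exI[of _ "t + \<eta>"]) auto
    moreover have "\<not> B (real (Suc n)) m" if "A (min \<epsilon> (\<eta> / 2)) (\<lambda>x. S x + w x - m x)" for m
     using sigma_seminormD(1)[OF A, OF that, of \<epsilon>] \<epsilon>(2)[of m] by auto
    ultimately have "P (Suc n) F'"
     using \<epsilon>(1) \<eta> by (auto simp: P_def F'_def)
    then show "\<exists>F'. (P (Suc n) F' \<and> (Suc n = 0 \<longrightarrow> F' = ((\<lambda>x. 0), 1))) \<and>
      (case (F, F') of ((S, \<eta>), (S', \<eta>')) \<Rightarrow> \<eta>' \<le> \<eta> / 2 \<and> A (\<eta> / 2) (\<lambda>x. S' x - S x))"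
     using w(1) by (intro exI[of _ F']) (auto simp: F'_def F_eq)
   qed
  obtain F where F: "\<forall>n. (P n (F n) \<and> (n = 0 \<longrightarrow> F n = ((\<lambda>x. 0), 1))) \<and>
    (case (F n, F (Suc n)) of ((S, \<eta>), (S', \<eta>')) \<Rightarrow> \<eta>' \<le> \<eta> / 2 \<and> A (\<eta> / 2) (\<lambda>x. S' x - S x))"
   by (rule exE[OF dep])
  have F0: "F 0 = ((\<lambda>x. 0), 1)"
   using F[rule_format, of 0, THEN conjunct1, THEN conjunct2] by simp
  have FP: "P n (F n)" for n
   using F[rule_format, of n, THEN conjunct1, THEN conjunct1] .
  have Fstep: "case (F n, F (Suc n)) of ((S, \<eta>), (S', \<eta>')) \<Rightarrow> \<eta>' \<le> \<eta> / 2 \<and> A (\<eta> / 2) (\<lambda>x. S' x - S x)" for n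
   using F[rule_format, of n, THEN conjunct2] .
  define S where "S n = fst (F n)" for n
  define \<eta> where "\<eta> n = snd (F n)" for n
  have S0: "S 0 = (\<lambda>x. 0)" using F0 by (simp add: S_def)
  have \<eta>_pos: "0 < \<eta> n" for n using FP[of n] by (auto simp: P_def \<eta>_def split: prod.splits)
  have bad: "\<not> B (real n) m" if "n > 0" "A (\<eta> n) (\<lambda>x. S n x - m x)" for n m
   using FP[of n] that by (auto simp: P_def \<eta>_def S_def split: prod.splits)
  have half: "\<eta> (Suc n) \<le> \<eta> n / 2" and step: "A (\<eta> n / 2) (\<lambda>x. S (Suc n) x - S n x)" for n
   using Fstep[of n] by (auto simp: \<eta>_def S_def split: prod.splits)
  have decay: "\<eta> (k + n) \<le> \<eta> n * (1/2)^k" for k n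
  proof (induction k)
   case (Suc k)
   then show ?case using half[of "k + n"] by simp
  qed simp
  have geo: "(\<lambda>k. \<eta> n * (1/2)^k / 2) sums \<eta> n" for n
   using sums_divide[OF sums_mult[OF geometric_sums[of "1/2::real"], of "\<eta> n"], of 2] by simp
  have tail_summable: "summable (\<lambda>k. \<eta> (k + n) / 2)" for n
  proof (rule summable_comparison_test'[OF sums_summable[OF geo[of n]], of 0])
   show "norm (\<eta> (k + n) / 2) \<le> \<eta> n * (1/2)^k / 2" for k
    using decay[of k n] \<eta>_pos[of "k + n"] by simp
  qed
  have tail: "(\<Sum>k. \<eta> (k + n) / 2) \<le> \<eta> n" for n
  proof -
   have "(\<Sum>k. \<eta> (k + n) / 2) \<le> (\<Sum>k. \<eta> n * (1/2)^k / 2)"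
   proof (rule suminf_le[OF _ tail_summable sums_summable[OF geo]])
    show "\<eta> (k + n) / 2 \<le> \<eta> n * (1/2)^k / 2" for k using decay[of k n] by simp
   qed
   then show ?thesis using geo[of n] by (simp add: sums_iff)
  qed
  define w where "w k = (\<lambda>x. S (Suc k) x - S k x)" for k
  define L where "L x = (\<Sum>k. w k x)" for x
  have "AE x in N. summable (\<lambda>k. norm (w k x))"
  proof (rule complete)
   show "0 < \<eta> k / 2" for k using \<eta>_pos by simp
   show "A (\<eta> k / 2) (w k)" for k using step by (simp add: w_def)
   show "summable (\<lambda>k. \<eta> k / 2)" using tail_summable[of 0] by simp
  qed
  then have L: "AE x in N. (\<lambda>n. \<Sum>k<n. w k x) \<longlonglongrightarrow> L x"
   unfolding L_def by eventually_elim (rule summable_LIMSEQ[OF summable_norm_cancel])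
  have partial: "(\<Sum>k<n. w k x) = S n x" for n x
   using sum_lessThan_telescope[of "\<lambda>k. S k x" n] S0 by (simp add: w_def)
  have tailsum: "(\<Sum>k<m. w (k + n) x) = S (m + n) x - S n x" for m n x
   using sum_lessThan_telescope[of "\<lambda>k. S (k + n) x" m] by (simp add: w_def)
  \<comment> \<open>The radii at least halve, so the tail of the series after \<open>S n\<close> is
    at most \<open>\<eta> n\<close>. The limit therefore stays in all the excluded neighbourhoods
    and is in no B-ball.\<close>
  have near: "A (\<eta> n) (\<lambda>x. S n x - L x)" for n
  proof -
   have "A (\<Sum>k. \<eta> (k + n) / 2) (\<lambda>x. L x - S n x)"
   proof (rule sigma_seminormD(4)[OF A, where U="\<lambda>k. w (k + n)"])
    show "AE x in N. (\<lambda>m. \<Sum>k<m. w (k + n) x) \<longlonglongrightarrow> L x - S n x"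
     using L
    proof eventually_elim
     case (elim x)
     then have "(\<lambda>m. S (m + n) x) \<longlonglongrightarrow> L x" unfolding partial by (rule LIMSEQ_ignore_initial_segment)
     then show ?case unfolding tailsum by (intro tendsto_diff tendsto_const)
    qed
    show "A (\<eta> (k + n) / 2) (w (k + n))" for k using step by (simp add: w_def)
   qed (use \<eta>_pos tail_summable in auto)
   then have "A (\<eta> n) (\<lambda>x. L x - S n x)" using tail by (rule sigma_seminormD(1)[OF A])
   from sigma_seminorm_minus[OF A, OF this] show ?thesis by simp
  qed
  have "A (\<eta> 0) L" using sigma_seminorm_minus[OF A, OF near[of 0]] by (simp add: S0)
  then obtain s where s: "0 < s" "B s L" using finite[OF \<eta>_pos] by blast
  obtain n :: nat where n: "s \<le> real n" using real_arch_simple by blast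
  have "B (real n) L" using s(2) n by (rule sigma_seminormD(1)[OF B])
  moreover have "n > 0" using n s by (cases n) auto
  ultimately show False using bad[OF _ near] by blast
 qed
 then obtain C where C: "C > 0" "\<And>u. A 1 u \<Longrightarrow> Q C u" by blast
 have Q_all: "Q (C * t) u" if "A t u" "0 < t" for t u
 proof -
  have "A 1 (\<lambda>x. (1 / t) *\<^sub>R u x)" using sigma_seminormD(2)[OF A, OF that(1), of "1/t"] that by simp
  from Q_scale[OF C(2)[OF this] that(2)] show ?thesis using that by (simp add: mult.commute)
 qed
 \<comment> \<open>Successive approximation as in the open mapping theorem: approximate u from the
   B-ball of radius C up to an error 1/2, then the error up to 1/4, and so on. The geometric series
   gives 2 C.\<close>
 have unit: "B (2 * C) u" if u: "A 1 u" for u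
 proof -
  have "\<exists>m. B (C * (1/2)^k) m \<and> A ((1/2)^Suc k) (\<lambda>x. r x - m x)" if "A ((1/2)^k) r" for k :: nat and r
   using Q_all[OF that] unfolding Q_def by auto
  then obtain M where M: "\<And>k r. A ((1/2)^k) r \<Longrightarrow> B (C * (1/2)^k) (M k r) \<and> A ((1/2)^Suc k) (\<lambda>x. r x - M k r x)"
   by metis
  define r where "r = rec_nat u (\<lambda>k r x. r x - M k r x)"
  have r_simps: "r 0 = u" "r (Suc k) = (\<lambda>x. r k x - M k (r k) x)" for k by (simp_all add: r_def)
  have r: "A ((1/2)^k) (r k)" for k
   by (induction k) (use u M in \<open>auto simp: r_simps\<close>)
  have "B (\<Sum>k. C * (1/2)^k) u"
  proof (rule sigma_seminormD(4)[OF B, where U="\<lambda>k. M k (r k)"])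
   have partial: "(\<Sum>k<n. M k (r k) x) = u x - r n x" for n x
    by (induction n) (auto simp: r_simps algebra_simps)
   have "AE x in N. summable (\<lambda>k. norm (r k x))"
   proof (rule complete)
    show "A ((1/2)^k) (r k)" for k by (rule r)
   qed (auto intro: summable_geometric)
   then show "AE x in N. (\<lambda>n. \<Sum>k<n. M k (r k) x) \<longlonglongrightarrow> u x"
   proof eventually_elim
    case (elim x)
    then have "(\<lambda>n. r n x) \<longlonglongrightarrow> 0"
     by (rule tendsto_norm_zero_cancel[OF summable_LIMSEQ_zero])
    then show ?case
     unfolding partial using tendsto_diff[OF tendsto_const[of "u x" sequentially], of "\<lambda>n. r n x" 0] by simp
   qed
   show "summable (\<lambda>k. C * (1/2)^k)" by (intro summable_mult summable_geometric) auto
  qed (use C M r in auto)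
  moreover have "(\<Sum>k. C * (1/2)^k) = 2 * C"
   using suminf_mult[OF summable_geometric[of "1/2::real"], of C] suminf_geometric[of "1/2::real"] by simp
  ultimately show ?thesis by simp
 qed
 have "B (2 * C * t) u" if "A t u" "0 < t" for t u
 proof -
  have "A 1 (\<lambda>x. (1 / t) *\<^sub>R u x)" using sigma_seminormD(2)[OF A, OF that(1), of "1/t"] that by simp
  from sigma_seminormD(2)[OF B, OF unit[OF this], of t] show ?thesis using that by (simp add: mult.commute)
 qed
 then show ?thesis using C(1) by (intro exI[of _ "2 * C"]) auto
qed

section \<open>Seminorms given by gradients\<close>

text \<open>The L^p norm is at most t, in the relational form of \<open>sigma_seminorm\<close> and
  for functions that may take the value \<infinity>.\<close>

definition Lp_bound :: "'z measure \<Rightarrow> real \<Rightarrow> real \<Rightarrow> ('z \<Rightarrow> ennreal) \<Rightarrow> bool" where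
 "Lp_bound N p t f \<longleftrightarrow> f \<in> borel_measurable N \<and> pint N p f \<le> ennreal (t powr p)"

lemma Lp_bound_measurable: "Lp_bound N p t f \<Longrightarrow> f \<in> borel_measurable N"
 by (simp add: Lp_bound_def)

lemma Lp_bound_imp_Lp_integrable: "Lp_bound N p t f \<Longrightarrow> Lp_integrable N p f"
 unfolding Lp_bound_def Lp_integrable_def using ennreal_less_top le_less_trans by fastforce

lemma Lp_bound_mono:
 assumes "Lp_bound N p s f" "0 \<le> s" "s \<le> t" "0 \<le> p" "g \<in> borel_measurable N" "AE x in N. g x \<le> f x"
 shows "Lp_bound N p t g"
proof -
 have "(pint N p g) \<le> pint N p f"
  using assms(6) by (intro nn_integral_mono_AE) (auto elim!: eventually_mono intro!: ennreal_powr_mono assms(4))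
 also have "\<dots> \<le> ennreal (s powr p)" using assms(1) by (simp add: Lp_bound_def)
 also have "\<dots> \<le> ennreal (t powr p)" using assms by (intro ennreal_leI powr_mono2) auto
 finally show ?thesis using assms(5) by (simp add: Lp_bound_def)
qed

lemma Lp_bound_cmult:
 assumes "Lp_bound N p t f" "0 < p" "0 \<le> c" "0 \<le> t"
 shows "Lp_bound N p (c * t) (\<lambda>x. ennreal c * f x)"
proof -
 have [measurable]: "f \<in> borel_measurable N" by (rule Lp_bound_measurable[OF assms(1)])
 have "(\<integral>\<^sup>+x. ennreal_powr (ennreal c * f x) p \<partial>N) = ennreal (c powr p) * (pint N p f)"
  using assms by (simp add: ennreal_powr_mult ennreal_powr_ennreal nn_integral_cmult)
 also have "\<dots> \<le> ennreal (c powr p) * ennreal (t powr p)"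
  using assms by (intro mult_left_mono) (auto simp: Lp_bound_def)
 also have "\<dots> = ennreal ((c * t) powr p)" using assms by (simp add: ennreal_mult[symmetric] powr_mult)
 finally show ?thesis by (simp add: Lp_bound_def)
qed

lemma Lp_integrable_imp_Lp_bound:
 assumes "Lp_integrable N p f" "0 < p" shows "\<exists>t>0. Lp_bound N p t f"
proof -
 define I where "I = enn2real (pint N p f)"
 have "(pint N p f) = ennreal I"
  using assms(1) by (simp add: I_def Lp_integrable_def)
 moreover have I: "1 + I > 0" by (simp add: I_def add_pos_nonneg)
 ultimately have "(pint N p f) = ennreal I" by simp
 also have "\<dots> \<le> ennreal (((1 + I) powr (1 / p)) powr p)"
  using assms(2) I by (intro ennreal_leI) (simp add: powr_powr)
 finally have "Lp_bound N p ((1 + I) powr (1 / p)) f"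
  using assms(1) by (simp add: Lp_bound_def Lp_integrable_def)
 moreover have "(1 + I) powr (1 / p) > 0" using I by simp
 ultimately show ?thesis by blast
qed

lemma Lp_integrable_scale:
 assumes "Lp_integrable N p f" "0 < p" "0 < t" shows "\<exists>c>0. Lp_bound N p t (\<lambda>x. ennreal c * f x)"
proof -
 obtain s where s: "s > 0" "Lp_bound N p s f" using Lp_integrable_imp_Lp_bound[OF assms(1,2)] by blast
 have "Lp_bound N p (t / s * s) (\<lambda>x. ennreal (t / s) * f x)"
  using s assms by (intro Lp_bound_cmult) auto
 then show ?thesis using s assms(3) by (intro exI[of _ "t / s"]) simp
qed

text \<open>Jensen's inequality with weights \<open>t k / T\<close>, T the total of the t k. If t k
  bounds the k-th summand in L^p, then (T / t k)^(p-1) (t k)^p = T^(p-1) t k, and summation over k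
  gives T^p: Minkowski's inequality, by convexity alone.\<close>

lemma powr_sum_le:
 fixes r t :: "'i \<Rightarrow> real"
 assumes S: "finite S" and p: "1 \<le> p" and t: "\<And>k. k \<in> S \<Longrightarrow> 0 < t k" and r: "\<And>k. k \<in> S \<Longrightarrow> 0 < r k"
 shows "(\<Sum>k\<in>S. r k) powr p \<le> (\<Sum>k\<in>S. (sum t S / t k) powr (p - 1) * r k powr p)"
proof (cases "S = {}")
 case False
 define T where "T = sum t S"
 have T: "T > 0" using S False t by (auto simp: T_def intro: sum_pos)
 have "(\<Sum>k\<in>S. (t k / T) *\<^sub>R (T / t k * r k)) powr p \<le> (\<Sum>k\<in>S. t k / T * (T / t k * r k) powr p)"
 proof (rule convex_on_sum[OF S False powr_convex[OF p]])
  show "(\<Sum>k\<in>S. t k / T) = 1" using T by (simp add: T_def sum_divide_distrib[symmetric])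
 qed (use T t r in \<open>auto simp: less_imp_le\<close>)
 also have "(\<Sum>k\<in>S. (t k / T) *\<^sub>R (T / t k * r k)) = (\<Sum>k\<in>S. r k)"
  using T t by (intro sum.cong) force+
 also have "(\<Sum>k\<in>S. t k / T * (T / t k * r k) powr p) = (\<Sum>k\<in>S. (T / t k) powr (p - 1) * r k powr p)"
 proof (rule sum.cong)
  fix k assume k: "k \<in> S"
  have "t k / T * (T / t k) powr p = (T / t k) powr (p - 1)"
   using T t[OF k] by (simp add: powr_diff)
  moreover have "(T / t k * r k) powr p = (T / t k) powr p * r k powr p"
   by (rule powr_mult)
  ultimately show "t k / T * (T / t k * r k) powr p = (T / t k) powr (p - 1) * r k powr p"
   by (simp only: mult.assoc[symmetric])
 qed simp
 finally show ?thesis by (simp add: T_def)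
qed simp

text \<open>An infinite summand makes the right-hand side infinite; zero summands are dropped,
  because the real version is for positive numbers.\<close>

lemma ennreal_powr_sum_le:
 fixes f :: "'i \<Rightarrow> ennreal"
 assumes S: "finite S" and p: "1 \<le> p" and t: "\<And>k. k \<in> S \<Longrightarrow> 0 < t k"
 shows "ennreal_powr (\<Sum>k\<in>S. f k) p \<le> (\<Sum>k\<in>S. ennreal ((sum t S / t k) powr (p - 1)) * ennreal_powr (f k) p)"
proof (cases "\<exists>k\<in>S. f k = \<infinity>")
 case True
 then obtain k where k: "k \<in> S" "f k = \<infinity>" by blast
 have "sum t S > 0" using S t k by (intro sum_pos) auto
 then have "ennreal ((sum t S / t k) powr (p - 1)) * ennreal_powr (f k) p = \<infinity>"
  using k t[of k] by (simp add: ennreal_mult_top)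
 moreover have "ennreal ((sum t S / t k) powr (p - 1)) * ennreal_powr (f k) p \<le>
   (\<Sum>k\<in>S. ennreal ((sum t S / t k) powr (p - 1)) * ennreal_powr (f k) p)"
  using S k by (intro member_le_sum) auto
 ultimately show ?thesis by (simp add: top_unique)
next
 case False
 define S' where "S' = {k\<in>S. f k \<noteq> 0}"
 define r where "r k = enn2real (f k)" for k
 have f: "f k = ennreal (r k)" if "k \<in> S" for k using False that by (auto simp: r_def less_top[symmetric])
 have r: "r k > 0" if "k \<in> S'" for k
  using that f[of k] by (auto simp: S'_def r_def enn2real_positive_iff less_top[symmetric] zero_less_iff_neq_zero False intro: ccontr)
 have S': "finite S'" "S' \<subseteq> S" using S by (auto simp: S'_def)
 have "(\<Sum>k\<in>S. f k) = (\<Sum>k\<in>S'. f k)" using S by (intro sum.mono_neutral_right) (auto simp: S'_def)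
 also have "\<dots> = ennreal (\<Sum>k\<in>S'. r k)"
 proof -
  have "(\<Sum>k\<in>S'. f k) = (\<Sum>k\<in>S'. ennreal (r k))" using S'(2) f by (intro sum.cong) auto
  then show ?thesis using r by (simp add: less_imp_le)
 qed
 finally have "ennreal_powr (\<Sum>k\<in>S. f k) p = ennreal ((\<Sum>k\<in>S'. r k) powr p)"
  using r by (simp add: ennreal_powr_ennreal sum_nonneg less_imp_le)
 also have "\<dots> \<le> ennreal (\<Sum>k\<in>S'. (sum t S' / t k) powr (p - 1) * r k powr p)"
  using S' r t p by (intro ennreal_leI powr_sum_le) auto
 also have "\<dots> \<le> ennreal (\<Sum>k\<in>S'. (sum t S / t k) powr (p - 1) * r k powr p)"
 proof (intro ennreal_leI sum_mono mult_right_mono powr_mono2 divide_right_mono)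
  show "sum t S' \<le> sum t S" using S S' t by (intro sum_mono2) (auto simp: less_imp_le)
  show "0 \<le> sum t S' / t k" if "k \<in> S'" for k
   using S' t that by (intro divide_nonneg_nonneg sum_nonneg) (auto simp: less_imp_le subset_iff)
 qed (use p S' t in \<open>auto simp: less_imp_le subset_iff\<close>)
 also have "\<dots> = (\<Sum>k\<in>S'. ennreal ((sum t S / t k) powr (p - 1)) * ennreal_powr (f k) p)"
 proof -
  have "ennreal (\<Sum>k\<in>S'. (sum t S / t k) powr (p - 1) * r k powr p) =
    (\<Sum>k\<in>S'. ennreal ((sum t S / t k) powr (p - 1) * r k powr p))"
   by (intro sum_ennreal[symmetric]) auto
  also have "\<dots> = (\<Sum>k\<in>S'. ennreal ((sum t S / t k) powr (p - 1)) * ennreal_powr (f k) p)"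
   using S'(2) r f by (intro sum.cong) (auto simp: ennreal_mult ennreal_powr_ennreal less_imp_le)
  finally show ?thesis .
 qed
 also have "\<dots> \<le> (\<Sum>k\<in>S. ennreal ((sum t S / t k) powr (p - 1)) * ennreal_powr (f k) p)"
  using S S' by (intro sum_mono2) auto
 finally show ?thesis .
qed

lemma Lp_bound_sum:
 assumes S: "finite S" and p: "1 \<le> p" and t: "\<And>k. k \<in> S \<Longrightarrow> 0 < t k"
  and f: "\<And>k. k \<in> S \<Longrightarrow> Lp_bound N p (t k) (f k)"
 shows "Lp_bound N p (sum t S) (\<lambda>x. \<Sum>k\<in>S. f k x)"
proof (cases "S = {}")
 case False
 have T: "sum t S > 0" using S t False by (intro sum_pos) auto
 have meas[measurable]: "f k \<in> borel_measurable N" if "k \<in> S" for k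
  using f[OF that] by (rule Lp_bound_measurable)
 have "(\<integral>\<^sup>+x. ennreal_powr (\<Sum>k\<in>S. f k x) p \<partial>N) \<le>
   (\<integral>\<^sup>+x. (\<Sum>k\<in>S. ennreal ((sum t S / t k) powr (p - 1)) * ennreal_powr (f k x) p) \<partial>N)"
  by (intro nn_integral_mono ennreal_powr_sum_le S p t)
 also have "\<dots> = (\<Sum>k\<in>S. ennreal ((sum t S / t k) powr (p - 1)) * (pint N p (f k)))"
  by (subst nn_integral_sum) (auto simp: nn_integral_cmult)
 also have "\<dots> \<le> (\<Sum>k\<in>S. ennreal ((sum t S / t k) powr (p - 1)) * ennreal (t k powr p))"
  using f by (intro sum_mono mult_left_mono) (auto simp: Lp_bound_def)
 also have "\<dots> = (\<Sum>k\<in>S. ennreal (sum t S powr (p - 1) * t k))"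
 proof (rule sum.cong)
  fix k assume k: "k \<in> S"
  have "t k powr p = t k powr (p - 1) * t k" using t[OF k] by (simp add: powr_diff)
  then show "ennreal ((sum t S / t k) powr (p - 1)) * ennreal (t k powr p) = ennreal (sum t S powr (p - 1) * t k)"
   using T t[OF k] by (simp add: ennreal_mult[symmetric] powr_divide)
 qed simp
 also have "\<dots> = ennreal (\<Sum>k\<in>S. sum t S powr (p - 1) * t k)"
  using t by (intro sum_ennreal) (auto simp: less_imp_le)
 also have "(\<Sum>k\<in>S. sum t S powr (p - 1) * t k) = sum t S powr p"
 proof -
  have "(\<Sum>k\<in>S. sum t S powr (p - 1) * t k) = sum t S powr (p - 1) * sum t S"
   by (rule sum_distrib_left[symmetric])
  then show ?thesis using T by (simp add: powr_diff)
 qed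
 finally show ?thesis by (simp add: Lp_bound_def)
qed (simp add: Lp_bound_def)

lemma Lp_bound_suminf:
 fixes f :: "nat \<Rightarrow> 'a \<Rightarrow> ennreal"
 assumes p: "1 \<le> p" and t: "\<And>k. 0 < t k" "summable t" and f: "\<And>k. Lp_bound N p (t k) (f k)"
 shows "Lp_bound N p (suminf t) (\<lambda>x. \<Sum>k. f k x)"
proof -
 have [measurable]: "f k \<in> borel_measurable N" for k
  using f[of k] by (rule Lp_bound_measurable)
 have "(\<integral>\<^sup>+x. ennreal_powr (\<Sum>k. f k x) p \<partial>N) = (\<integral>\<^sup>+x. (SUP n. ennreal_powr (\<Sum>k<n. f k x) p) \<partial>N)"
  using p by (simp add: suminf_eq_SUP ennreal_powr_SUP)
 also have "\<dots> = (SUP n. \<integral>\<^sup>+x. ennreal_powr (\<Sum>k<n. f k x) p \<partial>N)"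
 proof (rule nn_integral_monotone_convergence_SUP)
  show "incseq (\<lambda>n x. ennreal_powr (\<Sum>k<n. f k x) p)"
   using p by (auto simp: incseq_def le_fun_def intro!: ennreal_powr_mono sum_mono2)
 qed measurable
 also have "\<dots> \<le> ennreal (suminf t powr p)"
 proof (rule SUP_least)
  fix n
  have "(\<integral>\<^sup>+x. ennreal_powr (\<Sum>k<n. f k x) p \<partial>N) \<le> ennreal (sum t {..<n} powr p)"
   using Lp_bound_sum[of "{..<n}" p t N f] p t f by (simp add: Lp_bound_def)
  also have "\<dots> \<le> ennreal (suminf t powr p)"
   using p t by (intro ennreal_leI powr_mono2 sum_le_suminf sum_nonneg) (auto simp: less_imp_le)
  finally show "(\<integral>\<^sup>+x. ennreal_powr (\<Sum>k<n. f k x) p \<partial>N) \<le> ennreal (suminf t powr p)" .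
 qed
 finally show ?thesis by (simp add: Lp_bound_def)
qed

lemma Lp_integrable_add:
 assumes "Lp_integrable N p f" "Lp_integrable N p g" "0 < p"
 shows "Lp_integrable N p (\<lambda>x. f x + g x)"
proof -
 have [measurable]: "f \<in> borel_measurable N" "g \<in> borel_measurable N"
  using assms by (auto simp: Lp_integrable_def)
 have "(\<integral>\<^sup>+x. ennreal_powr (f x + g x) p \<partial>N) \<le>
   (\<integral>\<^sup>+x. ennreal (2 powr p) * (ennreal_powr (f x) p + ennreal_powr (g x) p) \<partial>N)"
  using assms by (intro nn_integral_mono ennreal_powr_add) auto
 also have "\<dots> < \<infinity>"
  using assms by (simp add: nn_integral_cmult nn_integral_add Lp_integrable_def ennreal_mult_less_top)
 finally show ?thesis by (simp add: Lp_integrable_def)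
qed

lemma curve_integral_mono:
 assumes "\<And>x. x \<in> \<gamma> ` {a..b} \<Longrightarrow> \<rho> x \<le> \<rho>' x"
 shows "curve_integral \<rho> (a, b, \<gamma>) \<le> curve_integral \<rho>' (a, b, \<gamma>)"
 unfolding curve_integral_def using assms
 by (auto intro!: nn_integral_mono split: split_indicator)

lemma curve_integral_finite_imp_rectifiable:
 assumes "(a, b, \<gamma>) \<in> paths_in S" "curve_integral \<rho> (a, b, \<gamma>) < \<infinity>"
 shows "rectifiable_path a b \<gamma>"
 using assms by unfold_locales (auto simp: paths_in_def curve_integral_def split: if_splits)

context rectifiable_path
begin

lemma curve_integral_eq:
 assumes "\<rho> \<in> borel_on S" "\<gamma> ` {a..b} \<subseteq> S"
 shows "curve_integral \<rho> (a, b, \<gamma>) = (\<integral>\<^sup>+\<tau>. \<rho> (\<gamma> \<tau>) * indicator {a<..b} \<tau> \<partial>lm)"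
 using curve_integral_subpath[OF assms, of a b] ab by simp

lemma curve_integral_subpath_le:
 assumes "\<rho> \<in> borel_on S" "\<gamma> ` {a..b} \<subseteq> S" "a \<le> s" "s \<le> t" "t \<le> b"
 shows "curve_integral \<rho> (s, t, \<gamma>) \<le> curve_integral \<rho> (a, b, \<gamma>)"
 unfolding curve_integral_subpath[OF assms] curve_integral_eq[OF assms(1,2)]
 using assms(3-5) by (intro nn_integral_mono) (auto split: split_indicator)

lemma curve_integral_cmult:
 assumes "\<rho> \<in> borel_on S" "\<gamma> ` {a..b} \<subseteq> S"
 shows "curve_integral (\<lambda>x. c * \<rho> x) (a, b, \<gamma>) = c * curve_integral \<rho> (a, b, \<gamma>)"
proof -
 have "curve_integral (\<lambda>x. c * \<rho> x) (a, b, \<gamma>) = (\<integral>\<^sup>+\<tau>. c * (\<rho> (\<gamma> \<tau>) * indicator {a<..b} \<tau>) \<partial>lm)"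
  using assms by (subst curve_integral_eq[OF _ assms(2)]) (auto simp: mult.assoc)
 also have "\<dots> = c * (\<integral>\<^sup>+\<tau>. \<rho> (\<gamma> \<tau>) * indicator {a<..b} \<tau> \<partial>lm)"
  using measurable_along(2)[OF assms, of a b] by (intro nn_integral_cmult) auto
 finally show ?thesis using curve_integral_eq[OF assms] by simp
qed

lemma curve_integral_suminf:
 assumes "\<And>k::nat. \<rho> k \<in> borel_on S" "\<gamma> ` {a..b} \<subseteq> S"
 shows "curve_integral (\<lambda>x. \<Sum>k. \<rho> k x) (a, b, \<gamma>) = (\<Sum>k. curve_integral (\<rho> k) (a, b, \<gamma>))"
proof -
 have "curve_integral (\<lambda>x. \<Sum>k. \<rho> k x) (a, b, \<gamma>) = (\<integral>\<^sup>+\<tau>. (\<Sum>k. \<rho> k (\<gamma> \<tau>) * indicator {a<..b} \<tau>) \<partial>lm)"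
  using assms by (subst curve_integral_eq[OF _ assms(2)]) auto
 also have "\<dots> = (\<Sum>k. \<integral>\<^sup>+\<tau>. \<rho> k (\<gamma> \<tau>) * indicator {a<..b} \<tau> \<partial>lm)"
  using measurable_along(2)[OF assms(1) assms(2), of a b] by (intro nn_integral_suminf) auto
 finally show ?thesis using curve_integral_eq[OF assms(1) assms(2)] by simp
qed

text \<open>Distinct end points force positive length. The point found is where convergence of a
  series starts before it is propagated along the path.\<close>

lemma exists_finite_on_path:
 assumes "\<rho> \<in> borel_on S" "\<gamma> ` {a..b} \<subseteq> S"
  and fin: "curve_integral \<rho> (a, b, \<gamma>) < \<infinity>" and neq: "\<gamma> a \<noteq> \<gamma> b"
 shows "\<exists>s\<in>{a..b}. \<rho> (\<gamma> s) < \<infinity>"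
proof (rule ccontr)
 assume no: "\<not> ?thesis"
 have "0 < ennreal (dist (\<gamma> a) (\<gamma> b))" using neq by simp
 also have "\<dots> \<le> emeasure lm {a<..b}" using dist_le_lm[of a b] ab by simp
 finally have "emeasure lm {a<..b} \<noteq> 0" by auto
 then have "\<infinity> = (\<integral>\<^sup>+\<tau>. \<infinity> * indicator {a<..b} \<tau> \<partial>lm)"
  by (subst nn_integral_cmult_indicator) (auto simp: ennreal_top_mult)
 also have "\<dots> \<le> (\<integral>\<^sup>+\<tau>. \<rho> (\<gamma> \<tau>) * indicator {a<..b} \<tau> \<partial>lm)"
  using no by (intro nn_integral_mono) (auto split: split_indicator simp: less_top[symmetric] top_unique)
 finally show False using fin curve_integral_eq[OF assms(1,2)] by simp
qed

end

lemma ennreal_LIMSEQ_le: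
 fixes f :: "nat \<Rightarrow> ennreal"
 assumes "f \<longlonglongrightarrow> l" "\<And>n. f n \<le> c" shows "l \<le> c"
 using assms by (intro LIMSEQ_le_const2[of f l c]) auto

lemma ess_separable_measurable_measurable: "ess_separable_measurable N u \<Longrightarrow> u \<in> borel_measurable N"
 by (simp add: ess_separable_measurable_def)

lemma measurable_ennreal_norm:
 assumes "ess_separable_measurable N u"
 shows "(enorm u) \<in> borel_measurable N"
 using ess_separable_measurable_measurable[OF assms] by measurable

lemma ess_separable_measurableE:
 assumes "ess_separable_measurable N u"
 obtains A C where "A \<in> null_sets N" "countable C" "u ` (space N - A) \<subseteq> closure C"
 using assms unfolding ess_separable_measurable_def separable_top_of_set_iff by blast

lemma ess_separable_measurableI:
 assumes "u \<in> borel_measurable N" "A \<in> null_sets N" "countable C" "u ` (space N - A) \<subseteq> closure C"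
 shows "ess_separable_measurable N u"
 using assms unfolding ess_separable_measurable_def separable_top_of_set_iff by blast

text \<open>The least index of a dense sequence within \<epsilon> of \<open>u x\<close> depends
  measurably on x. These countably valued functions replace simple functions for a target that need
  not be separable.\<close>

lemma ess_separable_measurable_approx:
 fixes u :: "'z \<Rightarrow> 'v::real_normed_vector"
 assumes u: "ess_separable_measurable N u" and \<epsilon>: "\<epsilon> > 0"
 shows "\<exists>(d :: nat \<Rightarrow> 'v) i. i \<in> measurable N (count_space UNIV) \<and> (AE x in N. norm (u x - d (i x)) < \<epsilon>)"
proof -
 obtain A C where A: "A \<in> null_sets N" and C: "countable C" "u ` (space N - A) \<subseteq> closure C"
  using ess_separable_measurableE[OF u] .
 have [measurable]: "u \<in> borel_measurable N" by (rule ess_separable_measurable_measurable[OF u])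
 show ?thesis
 proof (cases "C = {}")
  case True
  then have "AE x in N. False" using A C by (intro AE_I'[OF A]) auto
  then show ?thesis by (intro exI[of _ "\<lambda>_. 0"]) (auto elim: eventually_mono)
 next
  case False
  define d where "d = from_nat_into C"
  define i where "i x = (LEAST n. norm (u x - d n) < \<epsilon>)" for x
  have "(\<lambda>x. norm (u x - d n) < \<epsilon>) \<in> measurable N (count_space UNIV)" for n
  proof -
   have "{x \<in> space N. norm (u x - d n) < \<epsilon>} = u -` ball (d n) \<epsilon> \<inter> space N"
    by (auto simp: dist_norm norm_minus_commute)
   also have "\<dots> \<in> sets N" by measurable
   finally show ?thesis by (simp add: pred_def)
  qed
  then have "i \<in> measurable N (count_space UNIV)"
   unfolding i_def by (rule measurable_Least)
  moreover have "AE x in N. norm (u x - d (i x)) < \<epsilon>"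
  proof (rule AE_I'[OF A], safe)
   fix x assume x: "x \<in> space N" "\<not> norm (u x - d (i x)) < \<epsilon>"
   show "x \<in> A"
   proof (rule ccontr)
    assume "x \<notin> A"
    then have "u x \<in> closure C" using C x by auto
    then obtain c where c: "c \<in> C" "dist c (u x) < \<epsilon>" using \<epsilon> closure_approachable by blast
    obtain n where "c = d n" using from_nat_into_surj[OF C(1) c(1)] by (auto simp: d_def)
    then have "norm (u x - d n) < \<epsilon>" using c by (simp add: dist_norm norm_minus_commute)
    then have "norm (u x - d (i x)) < \<epsilon>" unfolding i_def by (rule LeastI)
    then show False using x by simp
   qed
  qed
  ultimately show ?thesis by blast
 qed
qed

lemma ess_separable_measurable_countable:
 fixes d :: "'i::countable \<Rightarrow> 'v::real_normed_vector"
 assumes "i \<in> measurable N (count_space UNIV)"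
 shows "ess_separable_measurable N (\<lambda>x. d (i x))"
proof (rule ess_separable_measurableI)
 show "(\<lambda>x. d (i x)) \<in> borel_measurable N"
  using assms by measurable
 show "(\<lambda>x. d (i x)) ` (space N - {}) \<subseteq> closure (range d)"
  using closure_subset by fastforce
qed auto

context borel_compatible_measure
begin

lemma ess_separable_measurable_lim:
 fixes s :: "nat \<Rightarrow> 'z \<Rightarrow> 'v::real_normed_vector"
 assumes s: "\<And>n. ess_separable_measurable N (s n)" and lim: "AE x in N. (\<lambda>n. s n x) \<longlonglongrightarrow> u x"
 shows "ess_separable_measurable N u"
proof -
 have "\<forall>n. \<exists>A C. A \<in> null_sets N \<and> countable C \<and> s n ` (space N - A) \<subseteq> closure C"
  using ess_separable_measurableE[OF s] by metis
 then obtain A C where A: "\<And>n. A n \<in> null_sets N" and C: "\<And>n. countable (C n)" "\<And>n. s n ` (space N - A n) \<subseteq> closure (C n)"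
  by metis
 obtain B where B: "B \<in> null_sets N" "{x\<in>space N. \<not> (\<lambda>n. s n x) \<longlonglongrightarrow> u x} \<subseteq> B"
  using lim by (auto elim!: AE_E simp: null_sets_def)
 define B' where "B' = B \<union> (\<Union>n. A n)"
 have B': "B' \<in> null_sets N" using B A by (auto simp: B'_def)
 define s' where "s' n x = (if x \<in> B' then 0 else s n x)" for n x
 define u' where "u' x = (if x \<in> B' then 0 else u x)" for x
 have "s' n \<in> borel_measurable N" for n
  unfolding s'_def using ess_separable_measurable_measurable[OF s] B'
  by (intro measurable_If_set) (auto simp: null_sets_def)
 then have "u' \<in> borel_measurable N"
  by (rule borel_measurable_LIMSEQ_metric) (use B in \<open>auto simp: s'_def u'_def B'_def\<close>)
 moreover have "AE x in N. u x = u' x"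
  using AE_not_in[OF B'] by eventually_elim (simp add: u'_def)
 ultimately have "u \<in> borel_measurable N" by (rule measurable_AE_eq)
 then show ?thesis
 proof (rule ess_separable_measurableI[OF _ B'])
  show "countable (\<Union>n. C n)" using C by auto
  show "u ` (space N - B') \<subseteq> closure (\<Union>n. C n)"
  proof safe
   fix x assume x: "x \<in> space N" "x \<notin> B'"
   have "(\<lambda>n. s n x) \<longlonglongrightarrow> u x" using x B by (auto simp: B'_def)
   moreover have "s n x \<in> closure (\<Union>n. C n)" for n
    using C(2)[of n] x closure_mono[of "C n" "\<Union>n. C n"] by (auto simp: B'_def)
   ultimately show "u x \<in> closure (\<Union>n. C n)"
    by - (rule closed_sequentially[OF closed_closure _ \<open>(\<lambda>n. s n x) \<longlonglongrightarrow> u x\<close>], blast)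
  qed
 qed
qed

text \<open>In a nonseparable space the Borel sets of the product may exceed the product of the
  Borel sigma-algebras, so even a sum is not measurable for general reasons. Countably valued
  approximations have a jointly measurable index, and f of them converges a.e. by
  continuity.\<close>

lemma ess_separable_measurable_compose2:
 fixes u v :: "'z \<Rightarrow> 'v::real_normed_vector" and f :: "'v \<Rightarrow> 'v \<Rightarrow> 'v"
 assumes u: "ess_separable_measurable N u" and v: "ess_separable_measurable N v"
  and f: "continuous_on UNIV (\<lambda>(x, y). f x y)"
 shows "ess_separable_measurable N (\<lambda>x. f (u x) (v x))"
proof -
 have "\<forall>n::nat. \<exists>(d :: nat \<Rightarrow> 'v) i. i \<in> measurable N (count_space UNIV) \<and> (AE x in N. norm (u x - d (i x)) < inverse (real (Suc n)))"
  by (intro allI ess_separable_measurable_approx[OF u]) simp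
 then obtain d :: "nat \<Rightarrow> nat \<Rightarrow> 'v" and i where i[measurable]: "\<And>n. i n \<in> measurable N (count_space UNIV)"
  and d: "\<And>n. AE x in N. norm (u x - d n (i n x)) < inverse (real (Suc n))" by metis
 have "\<forall>n::nat. \<exists>(d :: nat \<Rightarrow> 'v) i. i \<in> measurable N (count_space UNIV) \<and> (AE x in N. norm (v x - d (i x)) < inverse (real (Suc n)))"
  by (intro allI ess_separable_measurable_approx[OF v]) simp
 then obtain e :: "nat \<Rightarrow> nat \<Rightarrow> 'v" and j where j[measurable]: "\<And>n. j n \<in> measurable N (count_space UNIV)"
  and e: "\<And>n. AE x in N. norm (v x - e n (j n x)) < inverse (real (Suc n))" by metis
 have conv: "s \<longlonglongrightarrow> a" if "\<And>n. norm (a - s n) < inverse (real (Suc n))" for s and a :: 'v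
 proof -
  have "(\<lambda>n. s n - a) \<longlonglongrightarrow> 0"
   by (rule Lim_null_comparison[OF _ LIMSEQ_inverse_real_of_nat])
    (use that in \<open>auto simp: norm_minus_commute less_imp_le\<close>)
  then show ?thesis by (simp add: LIM_zero_iff)
 qed
 show ?thesis
 proof (rule ess_separable_measurable_lim)
  fix n
  have "(\<lambda>x. (i n x, j n x)) \<in> measurable N (count_space UNIV)"
  proof -
   have "(\<lambda>x. (i n x, j n x)) \<in> measurable N (count_space UNIV \<Otimes>\<^sub>M count_space UNIV)" by measurable
   then show ?thesis by (simp add: pair_measure_countable)
  qed
  from ess_separable_measurable_countable[OF this, of "\<lambda>(k, l). f (d n k) (e n l)"]
  show "ess_separable_measurable N (\<lambda>x. f (d n (i n x)) (e n (j n x)))" by simp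
 next
  have "AE x in N. \<forall>n. norm (u x - d n (i n x)) < inverse (real (Suc n))"
   using d by (simp add: AE_all_countable)
  moreover have "AE x in N. \<forall>n. norm (v x - e n (j n x)) < inverse (real (Suc n))"
   using e by (simp add: AE_all_countable)
  ultimately show "AE x in N. (\<lambda>n. f (d n (i n x)) (e n (j n x))) \<longlonglongrightarrow> f (u x) (v x)"
  proof eventually_elim
   case (elim x)
   have "(\<lambda>n. (d n (i n x), e n (j n x))) \<longlonglongrightarrow> (u x, v x)"
    using elim by (intro tendsto_Pair conv) auto
   moreover have "isCont (\<lambda>(x, y). f x y) (u x, v x)"
    using f by (simp add: continuous_on_eq_continuous_at)
   ultimately have "(\<lambda>n. (\<lambda>(x, y). f x y) (d n (i n x), e n (j n x))) \<longlonglongrightarrow> (\<lambda>(x, y). f x y) (u x, v x)"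
    by (rule isCont_tendsto_compose[rotated])
   then show ?case by simp
  qed
 qed
qed

lemma ess_separable_measurable_add:
 "ess_separable_measurable N u \<Longrightarrow> ess_separable_measurable N v \<Longrightarrow> ess_separable_measurable N (\<lambda>x. u x + v x)"
 by (rule ess_separable_measurable_compose2[where f="(+)"]) (auto simp: case_prod_beta intro!: continuous_intros)

lemma ess_separable_measurable_scaleR:
 "ess_separable_measurable N u \<Longrightarrow> ess_separable_measurable N (\<lambda>x. c *\<^sub>R u x)"
 by (rule ess_separable_measurable_compose2[where f="\<lambda>a b. c *\<^sub>R a"]) (auto simp: case_prod_beta intro!: continuous_intros)

lemma ess_separable_measurable_const: "ess_separable_measurable N (\<lambda>x. c)"
 using ess_separable_measurable_countable[of "\<lambda>_. ()" N "\<lambda>_. c"] by simp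

lemma ess_separable_measurable_sum:
 "(\<And>k. k \<in> S \<Longrightarrow> ess_separable_measurable N (u k)) \<Longrightarrow> finite S \<Longrightarrow> ess_separable_measurable N (\<lambda>x. \<Sum>k\<in>S. u k x)"
 by (induction S rule: infinite_finite_induct)
  (auto intro: ess_separable_measurable_add ess_separable_measurable_const)

end

text \<open>t bounds the function and the gradient separately, a maximum of two norms in place of
  the sum in \<open>W1p_norm\<close>; the two are comparable within a factor 2. The gradient belongs
  to a representative v, since a change of u on a null set may destroy it.\<close>

definition sobolev_bound ::
  "'z::metric_space measure \<Rightarrow> real \<Rightarrow> real \<Rightarrow> ('z \<Rightarrow> 'v::real_normed_vector) \<Rightarrow> bool" where
 "sobolev_bound N p t u \<longleftrightarrow> 0 \<le> t \<and> ess_separable_measurable N u \<and> Lp_bound N p t (enorm u) \<and>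
   (\<exists>v \<rho>. (AE x in N. v x = u x) \<and> weak_upper_gradient N p v \<rho> \<and> Lp_bound N p t \<rho>)"

text \<open>Records the size of the gradient; that of the function is already controlled by
  \<open>sobolev_bound\<close> wherever the two are compared.\<close>

definition hajlasz_bound ::
  "'z::metric_space measure \<Rightarrow> real \<Rightarrow> real \<Rightarrow> ('z \<Rightarrow> 'v::real_normed_vector) \<Rightarrow> bool" where
 "hajlasz_bound N p t u \<longleftrightarrow> 0 \<le> t \<and> ess_separable_measurable N u \<and>
   (\<exists>g. hajlasz_upper_gradient N u g \<and> Lp_bound N p t g)"

context borel_compatible_measure
begin

lemma Lp_bound_suminf_norm:
 fixes u :: "nat \<Rightarrow> 'z \<Rightarrow> 'v::real_normed_vector"
 assumes p: "1 \<le> p" and t: "\<And>k. 0 < t k" "summable t"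
  and u: "\<And>k. Lp_bound N p (t k) (\<lambda>x. ennreal (norm (u k x)))"
 shows "AE x in N. summable (\<lambda>k. norm (u k x))"
proof -
 have "Lp_bound N p (suminf t) (\<lambda>x. \<Sum>k. ennreal (norm (u k x)))"
  by (rule Lp_bound_suminf[OF p t u])
 from Lp_integrable_AE_finite[OF Lp_bound_imp_Lp_integrable[OF this]]
 show ?thesis
  by eventually_elim (auto intro: summable_suminf_not_top)
qed

lemma Lp_bound_norm_limit:
 fixes u :: "nat \<Rightarrow> 'z \<Rightarrow> 'v::real_normed_vector"
 assumes p: "1 \<le> p" and t: "\<And>k. 0 < t k" "summable t"
  and u: "\<And>k. Lp_bound N p (t k) (\<lambda>x. ennreal (norm (u k x)))"
  and lim: "AE x in N. (\<lambda>n. \<Sum>k<n. u k x) \<longlonglongrightarrow> v x"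
  and v: "ess_separable_measurable N v"
 shows "Lp_bound N p (suminf t) (enorm v)"
proof (rule Lp_bound_mono[OF Lp_bound_suminf[OF p t u]])
 show "AE x in N. ennreal (norm (v x)) \<le> (\<Sum>k. ennreal (norm (u k x)))"
  using lim
 proof eventually_elim
  case (elim x)
  have "ennreal (norm (\<Sum>k<n. u k x)) \<le> (\<Sum>k. ennreal (norm (u k x)))" for n
  proof -
   have "ennreal (norm (\<Sum>k<n. u k x)) \<le> ennreal (\<Sum>k<n. norm (u k x))"
    by (intro ennreal_leI norm_sum)
   also have "\<dots> = (\<Sum>k<n. ennreal (norm (u k x)))" by simp
   also have "\<dots> \<le> (\<Sum>k. ennreal (norm (u k x)))" by (rule sum_le_suminf) auto
   finally show ?thesis .
  qed
  moreover have "(\<lambda>n. ennreal (norm (\<Sum>k<n. u k x))) \<longlonglongrightarrow> ennreal (norm (v x))"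
   by (intro tendsto_ennrealI tendsto_norm elim)
  ultimately show ?case by - (rule ennreal_LIMSEQ_le, assumption, blast)
 qed
qed (use p t measurable_ennreal_norm[OF v] in \<open>auto intro: suminf_nonneg less_imp_le\<close>)

lemma sigma_seminorm_hajlasz:
 assumes p: "1 \<le> p"
 shows "sigma_seminorm N (hajlasz_bound N p :: real \<Rightarrow> ('z \<Rightarrow> 'v::banach) \<Rightarrow> bool)"
 unfolding sigma_seminorm_def
proof (intro conjI allI impI)
 show "hajlasz_bound N p t u" if "hajlasz_bound N p s u" "s \<le> t" for s t and u :: "'z \<Rightarrow> 'v"
 proof -
  obtain g where "0 \<le> s" "ess_separable_measurable N u" "hajlasz_upper_gradient N u g" "Lp_bound N p s g"
   using \<open>hajlasz_bound N p s u\<close> by (auto simp: hajlasz_bound_def)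
  moreover from this have "Lp_bound N p t g"
   using that p Lp_bound_measurable by (intro Lp_bound_mono[of N p s g t g]) auto
  ultimately show ?thesis using that by (auto simp: hajlasz_bound_def)
 qed
 show "hajlasz_bound N p (\<bar>c\<bar> * t) (\<lambda>x. c *\<^sub>R u x)" if u: "hajlasz_bound N p t u" for t c and u :: "'z \<Rightarrow> 'v"
 proof -
  obtain g A where t: "0 \<le> t" and g: "Lp_bound N p t g" "A \<in> null_sets N"
   "\<And>x y. x \<in> space N - A \<Longrightarrow> y \<in> space N - A \<Longrightarrow> ennreal (norm (u x - u y)) \<le> ennreal (dist x y) * (g x + g y)"
   using u by (auto simp: hajlasz_bound_def hajlasz_upper_gradient_def)
  have [measurable]: "g \<in> borel_measurable N" by (rule Lp_bound_measurable[OF g(1)])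
  have "hajlasz_upper_gradient N (\<lambda>x. c *\<^sub>R u x) (\<lambda>x. ennreal \<bar>c\<bar> * g x)"
   unfolding hajlasz_upper_gradient_def
  proof (intro conjI bexI[OF _ g(2)] ballI)
   fix x y assume xy: "x \<in> space N - A" "y \<in> space N - A"
   have "ennreal (norm (c *\<^sub>R u x - c *\<^sub>R u y)) = ennreal \<bar>c\<bar> * ennreal (norm (u x - u y))"
    by (simp add: scaleR_diff_right[symmetric] ennreal_mult)
   also have "\<dots> \<le> ennreal \<bar>c\<bar> * (ennreal (dist x y) * (g x + g y))"
    by (intro mult_left_mono g(3) xy) simp
   finally show "ennreal (norm (c *\<^sub>R u x - c *\<^sub>R u y)) \<le> ennreal (dist x y) * (ennreal \<bar>c\<bar> * g x + ennreal \<bar>c\<bar> * g y)"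
    by (simp add: distrib_left ac_simps)
  qed measurable
  moreover have "Lp_bound N p (\<bar>c\<bar> * t) (\<lambda>x. ennreal \<bar>c\<bar> * g x)"
   using p t by (intro Lp_bound_cmult[OF g(1)]) auto
  ultimately show ?thesis
   using u t by (auto simp: hajlasz_bound_def intro: ess_separable_measurable_scaleR)
 qed
 show "hajlasz_bound N p t (\<lambda>x. 0 :: 'v)" if "0 < t" for t
  unfolding hajlasz_bound_def hajlasz_upper_gradient_def
  using that by (auto intro!: exI[of _ "\<lambda>_. 0"] bexI[of _ "{}"] ess_separable_measurable_const simp: Lp_bound_def)
 show "hajlasz_bound N p (suminf t) v"
  if tu: "\<forall>k. 0 < t k \<and> hajlasz_bound N p (t k) (u k)" and sm: "summable t"
   and lim: "AE x in N. (\<lambda>n. \<Sum>k<n. u k x) \<longlonglongrightarrow> v x" for t and u :: "nat \<Rightarrow> 'z \<Rightarrow> 'v" and v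
 proof -
  have t: "0 < t k" for k using tu by blast
  have "\<forall>k. \<exists>g A. Lp_bound N p (t k) g \<and> A \<in> null_sets N \<and>
   (\<forall>x\<in>space N - A. \<forall>y\<in>space N - A. ennreal (norm (u k x - u k y)) \<le> ennreal (dist x y) * (g x + g y))"
   using tu unfolding hajlasz_bound_def hajlasz_upper_gradient_def by blast
  then obtain g A where g: "\<And>k. Lp_bound N p (t k) (g k)" and A: "\<And>k. A k \<in> null_sets N"
   and haj: "\<And>k x y. x \<in> space N - A k \<Longrightarrow> y \<in> space N - A k \<Longrightarrow>
    ennreal (norm (u k x - u k y)) \<le> ennreal (dist x y) * (g k x + g k y)"
   by metis
  have G: "Lp_bound N p (suminf t) (\<lambda>x. \<Sum>k. g k x)" by (rule Lp_bound_suminf[OF p t sm g])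
  obtain B where B: "B \<in> null_sets N" "{x\<in>space N. \<not> (\<lambda>n. \<Sum>k<n. u k x) \<longlonglongrightarrow> v x} \<subseteq> B"
   using lim by (auto elim!: AE_E simp: null_sets_def)
  have "B \<union> (\<Union>k. A k) \<in> null_sets N" using A B by auto
  moreover have "ennreal (norm (v x - v y)) \<le> ennreal (dist x y) * ((\<Sum>k. g k x) + (\<Sum>k. g k y))"
   if x: "x \<in> space N - (B \<union> (\<Union>k. A k))" and y: "y \<in> space N - (B \<union> (\<Union>k. A k))" for x y
  proof -
   have "(\<lambda>n. ennreal (norm ((\<Sum>k<n. u k x) - (\<Sum>k<n. u k y)))) \<longlonglongrightarrow> ennreal (norm (v x - v y))"
    using x y B by (intro tendsto_ennrealI tendsto_norm tendsto_diff) auto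
   moreover have "ennreal (norm ((\<Sum>k<n. u k x) - (\<Sum>k<n. u k y))) \<le> ennreal (dist x y) * ((\<Sum>k. g k x) + (\<Sum>k. g k y))" for n
   proof -
    have "norm ((\<Sum>k<n. u k x) - (\<Sum>k<n. u k y)) \<le> (\<Sum>k<n. norm (u k x - u k y))"
     by (simp add: sum_subtractf[symmetric] norm_sum)
    then have "ennreal (norm ((\<Sum>k<n. u k x) - (\<Sum>k<n. u k y))) \<le> (\<Sum>k<n. ennreal (norm (u k x - u k y)))"
     by (simp add: ennreal_leI)
    also have "\<dots> \<le> (\<Sum>k<n. ennreal (dist x y) * (g k x + g k y))"
     using x y by (intro sum_mono haj) auto
    also have "\<dots> = ennreal (dist x y) * ((\<Sum>k<n. g k x) + (\<Sum>k<n. g k y))"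
     by (simp add: sum_distrib_left[symmetric] sum.distrib)
    also have "\<dots> \<le> ennreal (dist x y) * ((\<Sum>k. g k x) + (\<Sum>k. g k y))"
     by (intro mult_left_mono add_mono sum_le_suminf) auto
    finally show ?thesis .
   qed
   ultimately show ?thesis by - (rule ennreal_LIMSEQ_le, assumption, blast)
  qed
  ultimately have "hajlasz_upper_gradient N v (\<lambda>x. \<Sum>k. g k x)"
   using Lp_bound_measurable[OF G] unfolding hajlasz_upper_gradient_def by blast
  moreover have "ess_separable_measurable N v"
  proof (rule ess_separable_measurable_lim[OF _ lim])
   show "ess_separable_measurable N (\<lambda>x. \<Sum>k<n. u k x)" for n
    using tu by (intro ess_separable_measurable_sum) (auto simp: hajlasz_bound_def)
  qed
  moreover have "0 \<le> suminf t" using t sm by (intro suminf_nonneg) (auto intro: less_imp_le)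
  ultimately show ?thesis
   using G unfolding hajlasz_bound_def by blast
 qed
qed

text \<open>Along a path on which all gradients are integrable, absolute convergence of the series of
 representatives at one point propagates to the end points.\<close>

lemma weak_upper_gradient_suminf:
 fixes v :: "nat \<Rightarrow> 'z \<Rightarrow> 'v::banach"
 assumes p: "1 \<le> p" and t: "\<And>k. 0 < t k" "summable t"
  and v: "\<And>k. Lp_bound N p (t k) (\<lambda>x. ennreal (norm (v k x)))"
  and wug: "\<And>k. weak_upper_gradient N p (v k) (\<rho> k)" and \<rho>: "\<And>k. Lp_bound N p (t k) (\<rho> k)"
 shows "weak_upper_gradient N p (\<lambda>x. \<Sum>k. v k x) (\<lambda>x. \<Sum>k. \<rho> k x)"
proof -
 have \<rho>_borel: "\<rho> k \<in> borel_on (space N)" for k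
  using wug[of k] by (simp add: weak_upper_gradient_def)
 have "\<forall>k. \<exists>\<Gamma> e. e \<in> borel_on (space N) \<and> Lp_integrable N p e \<and>
   (\<forall>c\<in>\<Gamma>. curve_integral e c = \<infinity>) \<and>
   (\<forall>(a, b, \<gamma>) \<in> paths_in (space N) - \<Gamma>. ennreal (norm (v k (\<gamma> a) - v k (\<gamma> b))) \<le> curve_integral (\<rho> k) (a, b, \<gamma>))"
  using wug unfolding weak_upper_gradient_def p_negligible_def by blast
 from choice[OF this] obtain \<Gamma> where "\<forall>k. \<exists>e. e \<in> borel_on (space N) \<and> Lp_integrable N p e \<and>
   (\<forall>c\<in>\<Gamma> k. curve_integral e c = \<infinity>) \<and>
   (\<forall>(a, b, \<gamma>) \<in> paths_in (space N) - \<Gamma> k. ennreal (norm (v k (\<gamma> a) - v k (\<gamma> b))) \<le> curve_integral (\<rho> k) (a, b, \<gamma>))" ..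
 from choice[OF this] obtain e where *: "\<forall>k. e k \<in> borel_on (space N) \<and> Lp_integrable N p (e k) \<and>
   (\<forall>c\<in>\<Gamma> k. curve_integral (e k) c = \<infinity>) \<and>
   (\<forall>(a, b, \<gamma>) \<in> paths_in (space N) - \<Gamma> k. ennreal (norm (v k (\<gamma> a) - v k (\<gamma> b))) \<le> curve_integral (\<rho> k) (a, b, \<gamma>))" ..
 have e: "e k \<in> borel_on (space N)" "Lp_integrable N p (e k)" for k
  using *[THEN spec, of k] by blast+
 have \<Gamma>: "curve_integral (e k) c = \<infinity>" if "c \<in> \<Gamma> k" for k c
  using *[THEN spec, of k] that by (elim conjE) blast
 have upper: "ennreal (norm (v k (\<gamma> a) - v k (\<gamma> b))) \<le> curve_integral (\<rho> k) (a, b, \<gamma>)"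
  if "(a, b, \<gamma>) \<in> paths_in (space N) - \<Gamma> k" for k a b \<gamma>
  using *[THEN spec, of k, THEN conjunct2, THEN conjunct2, THEN conjunct2, THEN bspec, OF that] by simp
 \<comment> \<open>Scaling makes the witnesses \<open>e k\<close> of the exceptional families
   summable in L^p, so that one finite integral excludes all families at once.\<close>
 have "\<forall>k. \<exists>c>0. Lp_bound N p ((1/2)^k) (\<lambda>x. ennreal c * e k x)"
  using p by (intro allI Lp_integrable_scale[OF e(2)]) auto
 then obtain c where c: "\<And>k. 0 < c k" "\<And>k. Lp_bound N p ((1/2)^k) (\<lambda>x. ennreal (c k) * e k x)"
  by metis
 have sum_v: "Lp_bound N p (suminf t) (\<lambda>x. \<Sum>k. ennreal (norm (v k x)))" by (rule Lp_bound_suminf[OF p t v])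
 have sum_\<rho>: "Lp_bound N p (suminf t) (\<lambda>x. \<Sum>k. \<rho> k x)" by (rule Lp_bound_suminf[OF p t \<rho>])
 have sum_e: "Lp_bound N p (suminf (\<lambda>k. (1/2)^k)) (\<lambda>x. \<Sum>k. ennreal (c k) * e k x)"
  by (rule Lp_bound_suminf[OF p _ _ c(2)]) (auto intro: summable_geometric)
 \<comment> \<open>Where this Borel majorant of the sum of the norms is finite, the series of
   representatives converges absolutely; its finite integral guarantees such a point on the
   path.\<close>
 obtain m where m: "m \<in> borel_on (space N)"
  "\<And>x. x \<in> space N \<Longrightarrow> (\<Sum>k. ennreal (norm (v k x))) \<le> m x" "AE x in N. m x = (\<Sum>k. ennreal (norm (v k x)))"
  using borel_majorant[OF Lp_bound_measurable[OF sum_v]] by blast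
 have m_int: "Lp_integrable N p m"
  by (rule Lp_integrable_cong_AE[OF Lp_bound_imp_Lp_integrable[OF sum_v] borel_measurableI[OF m(1)] m(3)])
 define \<rho>0 where "\<rho>0 x = m x + ((\<Sum>k. \<rho> k x) + (\<Sum>k. ennreal (c k) * e k x))" for x
 have \<rho>0: "\<rho>0 \<in> borel_on (space N)"
  unfolding \<rho>0_def using m(1) \<rho>_borel e(1) by (intro borel_measurable_add borel_measurable_suminf borel_measurable_times) auto
 have \<rho>0_int: "Lp_integrable N p \<rho>0"
  unfolding \<rho>0_def using p by (intro Lp_integrable_add m_int Lp_bound_imp_Lp_integrable[OF sum_\<rho>] Lp_bound_imp_Lp_integrable[OF sum_e]) auto
 define \<Gamma>0 where "\<Gamma>0 = {c \<in> paths_in (space N). curve_integral \<rho>0 c = \<infinity>}"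
 have "p_negligible N p \<Gamma>0"
  unfolding p_negligible_def using \<rho>0 \<rho>0_int by (auto simp: \<Gamma>0_def)
 moreover have "ennreal (norm ((\<Sum>k. v k (\<gamma> a)) - (\<Sum>k. v k (\<gamma> b)))) \<le> curve_integral (\<lambda>x. \<Sum>k. \<rho> k x) (a, b, \<gamma>)"
  if path: "(a, b, \<gamma>) \<in> paths_in (space N) - \<Gamma>0" for a b \<gamma>
 proof (cases "\<gamma> a = \<gamma> b")
  case neq: False
  have img: "\<gamma> ` {a..b} \<subseteq> space N" and le: "a \<le> b" using path by (auto simp: paths_in_def)
  have fin: "curve_integral \<rho>0 (a, b, \<gamma>) < \<infinity>" using path by (auto simp: \<Gamma>0_def less_top)
  interpret rectifiable_path a b \<gamma>
   by (rule curve_integral_finite_imp_rectifiable[OF _ fin]) (use path in auto)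
  have fin_le: "curve_integral \<sigma> (a, b, \<gamma>) < \<infinity>" if "\<And>x. \<sigma> x \<le> \<rho>0 x" for \<sigma>
   using curve_integral_mono[of \<gamma> a b \<sigma> \<rho>0] that fin by (meson le_less_trans)
  have fin_e: "curve_integral (e k) (a, b, \<gamma>) < \<infinity>" for k
  proof -
   have "ennreal (c k) * e k x \<le> (\<Sum>k. ennreal (c k) * e k x)" for x
    using sum_le_suminf[of "\<lambda>k. ennreal (c k) * e k x" "{k}"] by simp
   then have "curve_integral (\<lambda>x. ennreal (c k) * e k x) (a, b, \<gamma>) < \<infinity>"
    unfolding \<rho>0_def by (intro fin_le[unfolded \<rho>0_def] add_increasing) auto
   then have "ennreal (c k) * curve_integral (e k) (a, b, \<gamma>) < \<infinity>"
    using curve_integral_cmult[OF e(1) img] by simp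
   then show ?thesis using c(1)[of k] by (auto simp: ennreal_mult_less_top)
  qed
  \<comment> \<open>The families \<open>\<Gamma> k\<close> need not be closed under passing to
    subpaths, but finiteness of the integral of \<open>e k\<close> is inherited by subpaths.\<close>
  have sub: "ennreal (norm (v k (\<gamma> s) - v k (\<gamma> t))) \<le> curve_integral (\<rho> k) (a, b, \<gamma>)"
   if "a \<le> s" "s \<le> t" "t \<le> b" for k s t
  proof -
   have "curve_integral (e k) (s, t, \<gamma>) < \<infinity>"
    using curve_integral_subpath_le[OF e(1) img that] fin_e[of k] by (rule le_less_trans)
   then have "(s, t, \<gamma>) \<notin> \<Gamma> k" using \<Gamma> by force
   moreover have "(s, t, \<gamma>) \<in> paths_in (space N)"
    using that img continuous by (auto simp: paths_in_def intro: continuous_on_subset)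
   ultimately have "ennreal (norm (v k (\<gamma> s) - v k (\<gamma> t))) \<le> curve_integral (\<rho> k) (s, t, \<gamma>)"
    by (intro upper) simp
   also have "\<dots> \<le> curve_integral (\<rho> k) (a, b, \<gamma>)" by (rule curve_integral_subpath_le[OF \<rho>_borel img that])
   finally show ?thesis .
  qed
  have "curve_integral m (a, b, \<gamma>) < \<infinity>" by (rule fin_le) (simp add: \<rho>0_def)
  then obtain s where s: "s \<in> {a..b}" "m (\<gamma> s) < \<infinity>"
   using exists_finite_on_path[OF m(1) img _ neq] by blast
  have fin_s: "(\<Sum>k. ennreal (norm (v k (\<gamma> s)))) < \<infinity>"
  proof -
   have "\<gamma> s \<in> space N" using img s by blast
   from le_less_trans[OF m(2)[OF this] s(2)] show ?thesis .
  qed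
  have sum_int: "(\<Sum>k. curve_integral (\<rho> k) (a, b, \<gamma>)) = curve_integral (\<lambda>x. \<Sum>k. \<rho> k x) (a, b, \<gamma>)"
   by (rule curve_integral_suminf[OF \<rho>_borel img, symmetric])
  have fin_\<rho>: "curve_integral (\<lambda>x. \<Sum>k. \<rho> k x) (a, b, \<gamma>) < \<infinity>"
   unfolding \<rho>0_def by (rule fin_le[unfolded \<rho>0_def]) (intro add_increasing add_increasing2 order_refl zero_le)
  have ends: "summable (\<lambda>k. norm (v k (\<gamma> r)))" if r: "r \<in> {a..b}" for r
  proof (rule summable_suminf_not_top)
   have "ennreal (norm (v k (\<gamma> r))) \<le> ennreal (norm (v k (\<gamma> s))) + curve_integral (\<rho> k) (a, b, \<gamma>)" for k
   proof -
    have "ennreal (norm (v k (\<gamma> s) - v k (\<gamma> r))) \<le> curve_integral (\<rho> k) (a, b, \<gamma>)"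
     using sub[of s r k] sub[of r s k] s r by (cases "s \<le> r") (auto simp: norm_minus_commute)
    moreover have "ennreal (norm (v k (\<gamma> r))) \<le> ennreal (norm (v k (\<gamma> s))) + ennreal (norm (v k (\<gamma> s) - v k (\<gamma> r)))"
     using norm_triangle_sub[of "v k (\<gamma> r)" "v k (\<gamma> s)"]
     by (simp add: norm_minus_commute flip: ennreal_plus)
    ultimately show ?thesis by (meson add_left_mono order_trans)
   qed
   then have "(\<Sum>k. ennreal (norm (v k (\<gamma> r)))) \<le> (\<Sum>k. ennreal (norm (v k (\<gamma> s))) + curve_integral (\<rho> k) (a, b, \<gamma>))"
    by (intro suminf_le) auto
   also have "\<dots> = (\<Sum>k. ennreal (norm (v k (\<gamma> s)))) + (\<Sum>k. curve_integral (\<rho> k) (a, b, \<gamma>))"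
    by (intro suminf_add[symmetric]) auto
   also have "\<dots> < \<infinity>" using fin_s fin_\<rho> sum_int by (simp add: ennreal_add_less_top)
   finally show "(\<Sum>k. ennreal (norm (v k (\<gamma> r)))) \<noteq> top" by simp
  qed simp
  have sa: "(\<lambda>n. \<Sum>k<n. v k (\<gamma> a)) \<longlonglongrightarrow> (\<Sum>k. v k (\<gamma> a))" and sb: "(\<lambda>n. \<Sum>k<n. v k (\<gamma> b)) \<longlonglongrightarrow> (\<Sum>k. v k (\<gamma> b))"
   using le by (auto intro!: summable_LIMSEQ[OF summable_norm_cancel] ends)
  have "ennreal (norm ((\<Sum>k<n. v k (\<gamma> a)) - (\<Sum>k<n. v k (\<gamma> b)))) \<le> (\<Sum>k. curve_integral (\<rho> k) (a, b, \<gamma>))" for n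
  proof -
   have "norm ((\<Sum>k<n. v k (\<gamma> a)) - (\<Sum>k<n. v k (\<gamma> b))) \<le> (\<Sum>k<n. norm (v k (\<gamma> a) - v k (\<gamma> b)))"
    by (simp add: sum_subtractf[symmetric] norm_sum)
   then have "ennreal (norm ((\<Sum>k<n. v k (\<gamma> a)) - (\<Sum>k<n. v k (\<gamma> b)))) \<le> (\<Sum>k<n. ennreal (norm (v k (\<gamma> a) - v k (\<gamma> b))))"
    by (simp add: ennreal_leI)
   also have "\<dots> \<le> (\<Sum>k<n. curve_integral (\<rho> k) (a, b, \<gamma>))" using sub[of a b] le by (intro sum_mono) auto
   also have "\<dots> \<le> (\<Sum>k. curve_integral (\<rho> k) (a, b, \<gamma>))" by (rule sum_le_suminf) auto
   finally show ?thesis .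
  qed
  moreover have "(\<lambda>n. ennreal (norm ((\<Sum>k<n. v k (\<gamma> a)) - (\<Sum>k<n. v k (\<gamma> b))))) \<longlonglongrightarrow>
    ennreal (norm ((\<Sum>k. v k (\<gamma> a)) - (\<Sum>k. v k (\<gamma> b))))"
   by (intro tendsto_ennrealI tendsto_norm tendsto_diff sa sb)
  ultimately show ?thesis
   unfolding sum_int[symmetric] by - (rule ennreal_LIMSEQ_le, assumption, blast)
 qed simp
 moreover have "(\<lambda>x. \<Sum>k. \<rho> k x) \<in> borel_on (space N)"
  by (intro borel_measurable_suminf_order \<rho>_borel)
 ultimately show ?thesis
  unfolding weak_upper_gradient_def by (intro conjI exI[of _ \<Gamma>0]) auto
qed

lemma weak_upper_gradient_scaleR:
 assumes "weak_upper_gradient N p v \<rho>"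
 shows "weak_upper_gradient N p (\<lambda>x. c *\<^sub>R v x) (\<lambda>x. ennreal \<bar>c\<bar> * \<rho> x)"
proof -
 obtain \<Gamma> where \<rho>: "\<rho> \<in> borel_on (space N)" and \<Gamma>: "p_negligible N p \<Gamma>"
  and upper': "\<forall>(a, b, \<gamma>) \<in> paths_in (space N) - \<Gamma>. ennreal (norm (v (\<gamma> a) - v (\<gamma> b))) \<le> curve_integral \<rho> (a, b, \<gamma>)"
  using assms unfolding weak_upper_gradient_def by blast
 have upper: "ennreal (norm (v (\<gamma> a) - v (\<gamma> b))) \<le> curve_integral \<rho> (a, b, \<gamma>)"
  if "(a, b, \<gamma>) \<in> paths_in (space N) - \<Gamma>" for a b \<gamma>
  using bspec[OF upper' that] by simp
 have "ennreal (norm (c *\<^sub>R v (\<gamma> a) - c *\<^sub>R v (\<gamma> b))) \<le> curve_integral (\<lambda>x. ennreal \<bar>c\<bar> * \<rho> x) (a, b, \<gamma>)"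
  if path: "(a, b, \<gamma>) \<in> paths_in (space N) - \<Gamma>" for a b \<gamma>
 proof (cases "curve_integral (\<lambda>x. ennreal \<bar>c\<bar> * \<rho> x) (a, b, \<gamma>) < \<infinity>")
  case True
  have img: "\<gamma> ` {a..b} \<subseteq> space N" using path by (auto simp: paths_in_def)
  interpret rectifiable_path a b \<gamma>
   by (rule curve_integral_finite_imp_rectifiable[OF _ True]) (use path in auto)
  have "ennreal (norm (c *\<^sub>R v (\<gamma> a) - c *\<^sub>R v (\<gamma> b))) = ennreal \<bar>c\<bar> * ennreal (norm (v (\<gamma> a) - v (\<gamma> b)))"
   by (simp add: scaleR_diff_right[symmetric] ennreal_mult)
  also have "\<dots> \<le> ennreal \<bar>c\<bar> * curve_integral \<rho> (a, b, \<gamma>)" by (intro mult_left_mono upper path) simp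
  finally show ?thesis using curve_integral_cmult[OF \<rho> img] by simp
 qed (simp add: less_top[symmetric])
 then show ?thesis
  unfolding weak_upper_gradient_def using \<Gamma> \<rho> by (intro conjI exI[of _ \<Gamma>]) auto
qed

lemma sigma_seminorm_sobolev:
 assumes p: "1 \<le> p"
 shows "sigma_seminorm N (sobolev_bound N p :: real \<Rightarrow> ('z \<Rightarrow> 'v::banach) \<Rightarrow> bool)"
 unfolding sigma_seminorm_def
proof (intro conjI allI impI)
 show "sobolev_bound N p t u" if "sobolev_bound N p s u" "s \<le> t" for s t and u :: "'z \<Rightarrow> 'v"
 proof -
  obtain v \<rho> where *: "0 \<le> s" "ess_separable_measurable N u" "Lp_bound N p s (enorm u)"
   "AE x in N. v x = u x" "weak_upper_gradient N p v \<rho>" "Lp_bound N p s \<rho>"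
   using \<open>sobolev_bound N p s u\<close> by (auto simp: sobolev_bound_def)
  have "Lp_bound N p t f" if "Lp_bound N p s f" for f
   using that \<open>s \<le> t\<close> p *(1) Lp_bound_measurable by (intro Lp_bound_mono[of N p s f t f]) auto
  then show ?thesis using * that(2) unfolding sobolev_bound_def by (meson order_trans)
 qed
 show "sobolev_bound N p (\<bar>c\<bar> * t) (\<lambda>x. c *\<^sub>R u x)" if u: "sobolev_bound N p t u" for t c and u :: "'z \<Rightarrow> 'v"
 proof -
  obtain v \<rho> where *: "0 \<le> t" "ess_separable_measurable N u" "Lp_bound N p t (enorm u)"
   "AE x in N. v x = u x" "weak_upper_gradient N p v \<rho>" "Lp_bound N p t \<rho>"
   using u by (auto simp: sobolev_bound_def)
  have "Lp_bound N p (\<bar>c\<bar> * t) (\<lambda>x. ennreal (norm (c *\<^sub>R u x)))"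
   using Lp_bound_cmult[OF *(3), of "\<bar>c\<bar>"] p *(1) by (simp add: ennreal_mult)
  moreover have "AE x in N. c *\<^sub>R v x = c *\<^sub>R u x" using *(4) by eventually_elim simp
  moreover have "Lp_bound N p (\<bar>c\<bar> * t) (\<lambda>x. ennreal \<bar>c\<bar> * \<rho> x)"
   using p *(1) by (intro Lp_bound_cmult[OF *(6)]) auto
  ultimately show ?thesis
   unfolding sobolev_bound_def using *(1) ess_separable_measurable_scaleR[OF *(2)] weak_upper_gradient_scaleR[OF *(5), of c]
   by (metis abs_ge_zero mult_nonneg_nonneg)
 qed
 show "sobolev_bound N p t (\<lambda>x. 0 :: 'v)" if "0 < t" for t
 proof -
  have "weak_upper_gradient N p (\<lambda>x. 0 :: 'v) (\<lambda>x. 0)"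
   unfolding weak_upper_gradient_def p_negligible_def Lp_integrable_def
   by (auto intro!: exI[of _ "{}"] exI[of _ "\<lambda>_. 0"])
  then show ?thesis
   using that ess_separable_measurable_const unfolding sobolev_bound_def
   by (auto simp: Lp_bound_def intro!: exI[of _ "\<lambda>_. 0"])
 qed
 show "sobolev_bound N p (suminf t) w"
  if tu: "\<forall>k. 0 < t k \<and> sobolev_bound N p (t k) (u k)" and sm: "summable t"
   and lim: "AE x in N. (\<lambda>n. \<Sum>k<n. u k x) \<longlonglongrightarrow> w x" for t and u :: "nat \<Rightarrow> 'z \<Rightarrow> 'v" and w
 proof -
  have t: "0 < t k" for k using tu by blast
  have u: "ess_separable_measurable N (u k)" "Lp_bound N p (t k) (\<lambda>x. ennreal (norm (u k x)))" for k
   using tu by (auto simp: sobolev_bound_def)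
  have "\<forall>k. \<exists>v \<rho>. (AE x in N. v x = u k x) \<and> weak_upper_gradient N p v \<rho> \<and> Lp_bound N p (t k) \<rho>"
   using tu by (auto simp: sobolev_bound_def)
  then obtain v \<rho> where v: "\<And>k. AE x in N. v k x = u k x" and wug: "\<And>k. weak_upper_gradient N p (v k) (\<rho> k)"
   and \<rho>: "\<And>k. Lp_bound N p (t k) (\<rho> k)" by metis
  have v_bound: "Lp_bound N p (t k) (\<lambda>x. ennreal (norm (v k x)))" for k
  proof (rule Lp_bound_mono[OF u(2)[of k]])
   show "(\<lambda>x. ennreal (norm (v k x))) \<in> borel_measurable N"
    by (intro measurable_ennreal_norm ess_separable_measurable_AE_eq[OF u(1) v])
   show "AE x in N. ennreal (norm (v k x)) \<le> ennreal (norm (u k x))"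
    using v[of k] by eventually_elim simp
  qed (use t[of k] p in auto)
  have w: "ess_separable_measurable N w"
  proof (rule ess_separable_measurable_lim[OF _ lim])
   show "ess_separable_measurable N (\<lambda>x. \<Sum>k<n. u k x)" for n
    using u(1) by (intro ess_separable_measurable_sum) auto
  qed
  have "AE x in N. \<forall>k. v k x = u k x" using v by (simp add: AE_all_countable)
  then have "AE x in N. (\<Sum>k. v k x) = w x"
   using lim
  proof eventually_elim
   case (elim x)
   then have "(\<lambda>k. u k x) sums w x" by (simp add: sums_def)
   then show ?case using elim(1) by (simp add: sums_iff)
  qed
  moreover have "weak_upper_gradient N p (\<lambda>x. \<Sum>k. v k x) (\<lambda>x. \<Sum>k. \<rho> k x)"
   by (rule weak_upper_gradient_suminf[OF p t sm v_bound wug \<rho>])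
  moreover have "0 \<le> suminf t" using t sm by (intro suminf_nonneg) (auto intro: less_imp_le)
  moreover have "Lp_bound N p (suminf t) (\<lambda>x. \<Sum>k. \<rho> k x)"
   by (rule Lp_bound_suminf[OF p t sm \<rho>])
  moreover have "Lp_bound N p (suminf t) (enorm w)"
   by (rule Lp_bound_norm_limit[OF p t sm u(2) lim w])
  ultimately show ?thesis
   unfolding sobolev_bound_def using w
   by (intro conjI exI[of _ "\<lambda>x. \<Sum>k. v k x"] exI[of _ "\<lambda>x. \<Sum>k. \<rho> k x"])
 qed
qed

text \<open>Zabreiko's lemma for the inclusion; its completeness condition is met by the L^p part of
  \<open>sobolev_bound\<close>.\<close>

lemma sobolev_bound_imp_hajlasz_bound:
 assumes p: "1 \<le> p"
  and finite: "\<And>t u. 0 < t \<Longrightarrow> sobolev_bound N p t u \<Longrightarrow> \<exists>s>0. hajlasz_bound N p s (u :: 'z \<Rightarrow> 'v::banach)"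
 shows "\<exists>C>0. \<forall>t>0. \<forall>u :: 'z \<Rightarrow> 'v. sobolev_bound N p t u \<longrightarrow> hajlasz_bound N p (C * t) u"
 using p finite
 by (intro sigma_seminorm_bounded[where N=N] sigma_seminorm_sobolev sigma_seminorm_hajlasz Lp_bound_suminf_norm)
  (auto simp: sobolev_bound_def)

end

section \<open>Doubling measures\<close>

text \<open>Zorn's lemma for disjoint subfamilies G such that a ball of F meeting G meets a member
  of at least half its radius. A maximal G meets every ball of F: otherwise one could add a ball
  with more than half the supremum of the radii of the balls missed. If balls of radii r \<le> 2 s
  meet, the first lies within s + 2 r \<le> 5 s of the centre of the second.\<close>

lemma vitali_covering_metric:
 fixes F :: "('a::metric_space \<times> real) set"
 assumes F': "\<forall>B\<in>F. 0 < snd B \<and> snd B \<le> R"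
 shows "\<exists>G\<subseteq>F. (\<forall>B\<in>G. \<forall>B'\<in>G. B \<noteq> B' \<longrightarrow>
   ball (fst B) (snd B) \<inter> ball (fst B') (snd B') = {}) \<and>
  (\<forall>B\<in>F. \<exists>B'\<in>G. ball (fst B) (snd B) \<subseteq> ball (fst B') (5 * snd B'))"
proof -
 have F: "0 < r \<and> r \<le> R" if "(x, r) \<in> F" for x r using bspec[OF F' that] by simp
 define b :: "'a \<times> real \<Rightarrow> 'a set" where "b = (\<lambda>(x, r). ball x r)"
 define \<G> where "\<G> = {G. G \<subseteq> F \<and> (\<forall>B\<in>G. \<forall>B'\<in>G. B \<noteq> B' \<longrightarrow> b B \<inter> b B' = {}) \<and>
   (\<forall>B\<in>F. (\<exists>B'\<in>G. b B \<inter> b B' \<noteq> {}) \<longrightarrow> (\<exists>B'\<in>G. b B \<inter> b B' \<noteq> {} \<and> snd B \<le> 2 * snd B'))}"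
 have "\<exists>G\<in>\<G>. \<forall>X\<in>\<G>. G \<subseteq> X \<longrightarrow> X = G"
 proof (rule subset_Zorn')
  fix \<C> assume chain: "subset.chain \<G> \<C>"
  then have sub: "\<C> \<subseteq> \<G>" and lin: "\<And>X Y. X \<in> \<C> \<Longrightarrow> Y \<in> \<C> \<Longrightarrow> X \<subseteq> Y \<or> Y \<subseteq> X"
   by (auto simp: subset_chain_def)
  have "\<Union>\<C> \<subseteq> F" using sub by (auto simp: \<G>_def)
  moreover have "b B \<inter> b B' = {}" if "B \<in> \<Union>\<C>" "B' \<in> \<Union>\<C>" "B \<noteq> B'" for B B'
  proof -
   obtain X Y where X: "X \<in> \<C>" "B \<in> X" and Y: "Y \<in> \<C>" "B' \<in> Y" using \<open>B \<in> \<Union>\<C>\<close> \<open>B' \<in> \<Union>\<C>\<close> by auto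
   then obtain Z where "Z \<in> \<C>" "B \<in> Z" "B' \<in> Z" using lin[of X Y] by blast
   then have "Z \<in> \<G>" using sub by blast
   then show ?thesis using \<open>B \<in> Z\<close> \<open>B' \<in> Z\<close> \<open>B \<noteq> B'\<close> unfolding \<G>_def by blast
  qed
  moreover have "\<exists>B'\<in>\<Union>\<C>. b B \<inter> b B' \<noteq> {} \<and> snd B \<le> 2 * snd B'"
   if B: "B \<in> F" "\<exists>B'\<in>\<Union>\<C>. b B \<inter> b B' \<noteq> {}" for B
  proof -
   obtain X where X: "X \<in> \<C>" "\<exists>B'\<in>X. b B \<inter> b B' \<noteq> {}" using B(2) by blast
   have "X \<in> \<G>" using X(1) sub by blast
   then have "\<exists>B'\<in>X. b B \<inter> b B' \<noteq> {} \<and> snd B \<le> 2 * snd B'"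
    using X(2) B(1) unfolding \<G>_def by blast
   then show ?thesis using X(1) by blast
  qed
  ultimately show "\<Union>\<C> \<in> \<G>" unfolding \<G>_def by blast
 qed
 then obtain G where G: "G \<in> \<G>" and max: "\<And>X. X \<in> \<G> \<Longrightarrow> G \<subseteq> X \<Longrightarrow> X = G" by blast
 have GF: "G \<subseteq> F" and Gdisj: "\<And>B B'. B \<in> G \<Longrightarrow> B' \<in> G \<Longrightarrow> B \<noteq> B' \<Longrightarrow> b B \<inter> b B' = {}"
  and Gbig: "\<And>B. B \<in> F \<Longrightarrow> \<exists>B'\<in>G. b B \<inter> b B' \<noteq> {} \<Longrightarrow> \<exists>B'\<in>G. b B \<inter> b B' \<noteq> {} \<and> snd B \<le> 2 * snd B'"
  using G unfolding \<G>_def by blast+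
 have meets: "\<exists>B'\<in>G. b B \<inter> b B' \<noteq> {}" if "B \<in> F" for B
 proof (rule ccontr)
  assume none: "\<not> ?thesis"
  define H where "H = {B\<in>F. \<forall>B'\<in>G. b B \<inter> b B' = {}}"
  have "B \<in> H" using that none by (auto simp: H_def)
  have bdd: "bdd_above (snd ` H)" using F by (intro bdd_aboveI[of _ R]) (auto simp: H_def)
  define \<sigma> where "\<sigma> = Sup (snd ` H)"
  have le_\<sigma>: "snd B \<le> \<sigma>" if "B \<in> H" for B
   unfolding \<sigma>_def using bdd that by (intro cSup_upper) auto
  have "\<sigma> > 0" using le_\<sigma>[OF \<open>B \<in> H\<close>] F[of "fst B" "snd B"] \<open>B \<in> H\<close> by (auto simp: H_def)
  then have "\<sigma> / 2 < \<sigma>" by simp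
  then obtain B0 where B0: "B0 \<in> H" "\<sigma> / 2 < snd B0"
   unfolding \<sigma>_def using less_cSup_iff[OF _ bdd] \<open>B \<in> H\<close> by blast
  have "insert B0 G \<in> \<G>"
   unfolding \<G>_def
  proof (intro CollectI conjI ballI impI)
   show "insert B0 G \<subseteq> F" using GF B0 by (auto simp: H_def)
   show "b B \<inter> b B' = {}" if "B \<in> insert B0 G" "B' \<in> insert B0 G" "B \<noteq> B'" for B B'
    using that Gdisj[of B B'] B0(1) unfolding H_def by blast
   show "\<exists>B'\<in>insert B0 G. b B \<inter> b B' \<noteq> {} \<and> snd B \<le> 2 * snd B'"
    if B: "B \<in> F" "\<exists>B'\<in>insert B0 G. b B \<inter> b B' \<noteq> {}" for B
   proof (cases "\<exists>B'\<in>G. b B \<inter> b B' \<noteq> {}")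
    case True
    then show ?thesis using Gbig[OF B(1)] by blast
   next
    case False
    then have "B \<in> H" using B by (auto simp: H_def)
    moreover have "b B \<inter> b B0 \<noteq> {}" using False B by blast
    ultimately show ?thesis using le_\<sigma>[of B] B0(2) by (intro bexI[of _ B0]) auto
   qed
  qed
  then have "B0 \<in> G" using max by blast
  then have "b B0 = {}" using B0(1) by (auto simp: H_def)
  then show False using B0(1) F[of "fst B0" "snd B0"] by (auto simp: H_def b_def split: prod.splits)
 qed
  have cov: "\<exists>(y, s) \<in> G. ball x r \<subseteq> ball y (5 * s)" if xr: "(x, r) \<in> F" for x r
  proof -
   obtain B' where B': "B' \<in> G" "b (x, r) \<inter> b B' \<noteq> {}" "snd (x, r) \<le> 2 * snd B'"
    using Gbig[OF xr meets[OF xr]] by blast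
   obtain y s where "B' = (y, s)" by (cases B')
   with B' have ys: "(y, s) \<in> G" "ball x r \<inter> ball y s \<noteq> {}" "r \<le> 2 * s"
    by (simp_all add: b_def)
   then obtain z where z: "dist x z < r" "dist y z < s" by (auto simp: dist_commute)
   have "ball x r \<subseteq> ball y (5 * s)"
   proof
    fix w assume "w \<in> ball x r"
    then show "w \<in> ball y (5 * s)"
     using z ys(3) dist_triangle[of y w x] dist_triangle[of y x z] by (auto simp: dist_commute)
   qed
   then show ?thesis using ys(1) by blast
  qed
 show ?thesis
 proof (intro exI[of _ G] conjI ballI impI GF)
  show "ball (fst B) (snd B) \<inter> ball (fst B') (snd B') = {}" if "B \<in> G" "B' \<in> G" "B \<noteq> B'" for B B'
   using Gdisj[OF that] by (simp add: b_def case_prod_beta)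
  show "\<exists>B'\<in>G. ball (fst B) (snd B) \<subseteq> ball (fst B') (5 * snd B')" if "B \<in> F" for B
   using cov[of "fst B" "snd B"] that by (force simp: case_prod_beta)
 qed
qed

text \<open>Induction over the generated sigma-algebra. Inner and outer approximation are proved
  together because complements exchange them. An open set is exhausted by the points at distance at
  least 1/(n+1) from its complement, and for a countable union finitely many of the closed sets
  suffice, as the measure is finite.\<close>

lemma closed_open_approx:
 fixes \<eta> :: "'a::metric_space measure"
 assumes fin: "finite_measure \<eta>" and sets: "sets \<eta> = sets borel" and A: "A \<in> sets borel" and e: "e > 0"
 shows "\<exists>C V. closed C \<and> open V \<and> C \<subseteq> A \<and> A \<subseteq> V \<and> measure \<eta> (V - C) < e"
proof -
 interpret finite_measure \<eta> by fact
 have [measurable_cong, simp]: "sets \<eta> = sets borel" by fact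
 have "A \<in> sigma_sets UNIV {S. open S}" using A by (simp add: sets_borel)
 then show ?thesis using e
 proof (induction A arbitrary: e rule: sigma_sets.induct)
  case (Basic S)
  then have S: "open S" by simp
  show ?case
  proof (cases "S = UNIV")
   case True
   then show ?thesis using Basic by (intro exI[of _ UNIV]) auto
  next
   case False
   define C where "C n = {x. inverse (real (Suc n)) \<le> infdist x (- S)}" for n
   have C: "closed (C n)" for n
    unfolding C_def by (intro closed_Collect_le continuous_intros)
   then have [measurable]: "C n \<in> sets borel" for n by auto
   have [measurable]: "S \<in> sets borel" using S by auto
   have "closed (- S)" "- S \<noteq> {}" using S False by auto
   from in_closed_iff_infdist_zero[OF this] have inS: "x \<in> S \<longleftrightarrow> infdist x (- S) > 0" for x
    using infdist_nonneg[of x "- S"] by (metis ComplD ComplI less_irrefl less_le)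
   have "(\<lambda>n. measure \<eta> (S - C n)) \<longlonglongrightarrow> measure \<eta> (\<Inter>n. S - C n)"
   proof (rule finite_Lim_measure_decseq)
    show "decseq (\<lambda>n. S - C n)"
    proof (intro decseq_SucI subsetI)
     fix n x assume x: "x \<in> S - C (Suc n)"
     have "inverse (real (Suc (Suc n))) \<le> inverse (real (Suc n))" by (intro le_imp_inverse_le) auto
     then show "x \<in> S - C n"
      using x by (auto simp: C_def not_le simp del: of_nat_Suc elim: less_le_trans)
    qed
   qed auto
   also have "(\<Inter>n. S - C n) = {}"
   proof -
    have False if x: "x \<in> S" "\<And>n. x \<notin> C n" for x
    proof -
     obtain n where "inverse (real (Suc n)) < infdist x (- S)"
      using reals_Archimedean[of "infdist x (- S)"] inS x(1) by blast
     then show False using x(2)[of n] by (simp add: C_def)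
    qed
    then show ?thesis by blast
   qed
   finally have "(\<lambda>n. measure \<eta> (S - C n)) \<longlonglongrightarrow> 0" by simp
   then have "eventually (\<lambda>n. measure \<eta> (S - C n) < e) sequentially"
    using Basic.prems by (rule order_tendstoD)
   then obtain n where n: "measure \<eta> (S - C n) < e" by (auto dest: eventually_happens)
   have "C n \<subseteq> S"
   proof
    fix x assume "x \<in> C n"
    then have "inverse (real (Suc n)) \<le> infdist x (- S)" by (simp add: C_def del: of_nat_Suc)
    moreover have "0 < inverse (real (Suc n))" by simp
    ultimately show "x \<in> S" unfolding inS by (rule less_le_trans[rotated])
   qed
   then show ?thesis using n C S by blast
  qed
 next
  case Empty
  then show ?case by (intro exI[of _ "{}"]) auto
 next
  case (Compl A)
  obtain C V where CV: "closed C" "open V" "C \<subseteq> A" "A \<subseteq> V" "measure \<eta> (V - C) < e"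
   using Compl.IH[OF Compl.prems] by (elim exE conjE)
  have "- C - (- V) = V - C" by auto
  then have "measure \<eta> (- C - (- V)) < e" using CV(5) by (simp only:)
  moreover have "closed (- V)" "open (- C)" using CV by auto
  moreover have "- V \<subseteq> UNIV - A" "UNIV - A \<subseteq> - C" using CV by auto
  ultimately show ?case by blast
 next
  case (Union A)
  have "\<forall>i. \<exists>C V. closed C \<and> open V \<and> C \<subseteq> A i \<and> A i \<subseteq> V \<and> measure \<eta> (V - C) < e / 4 * (1/2)^i"
   using Union.prems by (intro allI Union.IH) auto
  from choice[OF this] obtain C where "\<forall>i. \<exists>V. closed (C i) \<and> open V \<and> C i \<subseteq> A i \<and> A i \<subseteq> V \<and> measure \<eta> (V - C i) < e / 4 * (1/2)^i" ..
  from choice[OF this] obtain V where V: "\<forall>i. closed (C i) \<and> open (V i) \<and> C i \<subseteq> A i \<and> A i \<subseteq> V i \<and> measure \<eta> (V i - C i) < e / 4 * (1/2)^i" ..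
  have CV: "closed (C i)" "open (V i)" "C i \<subseteq> A i" "A i \<subseteq> V i" "measure \<eta> (V i - C i) < e / 4 * (1/2)^i" for i
   using V[THEN spec, of i] by auto
  have [measurable]: "C i \<in> sets borel" "V i \<in> sets borel" for i using CV(1,2)[of i] by auto
  have geo: "(\<lambda>i. e / 4 * (1/2)^i) sums (e / 2)"
   using sums_mult[OF geometric_sums[of "1/2::real"], of "e/4"] by simp
  have "measure \<eta> (\<Union>i. V i - C i) \<le> (\<Sum>i. measure \<eta> (V i - C i))"
  proof (rule finite_measure_subadditive_countably)
   show "summable (\<lambda>i. measure \<eta> (V i - C i))"
    by (rule summable_comparison_test'[OF sums_summable[OF geo], of 0]) (use CV(5) in \<open>auto intro: less_imp_le\<close>)
  qed auto
  also have "\<dots> \<le> (\<Sum>i. e / 4 * (1/2)^i)"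
  proof (rule suminf_le)
   show "summable (\<lambda>i. measure \<eta> (V i - C i))"
    by (rule summable_comparison_test'[OF sums_summable[OF geo], of 0]) (use CV(5) in \<open>auto intro: less_imp_le\<close>)
  qed (use CV(5) geo in \<open>auto intro: less_imp_le sums_summable\<close>)
  also have "\<dots> = e / 2" using geo by (simp add: sums_iff)
  finally have "measure \<eta> (\<Union>i. V i - C i) \<le> e / 2" .
  moreover have "measure \<eta> ((\<Union>i. V i) - (\<Union>i. C i)) \<le> measure \<eta> (\<Union>i. V i - C i)"
   by (rule finite_measure_mono) auto
  ultimately have small: "measure \<eta> ((\<Union>i. V i) - (\<Union>i. C i)) \<le> e / 2" by linarith
  define D where "D n = (\<Union>i. V i) - (\<Union>i<n. C i)" for n
  have "(\<lambda>n. measure \<eta> (D n)) \<longlonglongrightarrow> measure \<eta> (\<Inter>n. D n)"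
  proof (rule finite_Lim_measure_decseq)
   have "D n \<in> sets borel" for n unfolding D_def by measurable
   then show "range D \<subseteq> sets \<eta>" by auto
   show "decseq D" by (intro decseq_SucI) (auto simp: D_def lessThan_Suc)
  qed
  also have "(\<Inter>n. D n) = (\<Union>i. V i) - (\<Union>i. C i)" by (auto simp: D_def)
  finally have "eventually (\<lambda>n. measure \<eta> (D n) < e) sequentially"
   by (rule order_tendstoD) (use small Union.prems in auto)
  then obtain n where "measure \<eta> ((\<Union>i. V i) - (\<Union>i<n. C i)) < e"
   by (auto dest: eventually_happens simp: D_def)
  moreover have "closed (\<Union>i<n. C i)" "open (\<Union>i. V i)" using CV(1,2) by auto
  moreover have "(\<Union>i<n. C i) \<subseteq> (\<Union>i. A i)" "(\<Union>i. A i) \<subseteq> (\<Union>i. V i)" using CV(3,4) by blast+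
  ultimately show ?case by blast
 qed
qed

lemma emeasure_UN_le_count_space:
 assumes I: "countable I" and X[measurable]: "\<And>i. i \<in> I \<Longrightarrow> X i \<in> sets M"
 shows "emeasure M (\<Union>i\<in>I. X i) \<le> (\<integral>\<^sup>+i. emeasure M (X i) \<partial>count_space I)"
proof -
 have [measurable]: "(\<Union>i\<in>I. X i) \<in> sets M" using I X by (intro sets.countable_UN') auto
 have "emeasure M (\<Union>i\<in>I. X i) = (\<integral>\<^sup>+x. indicator (\<Union>i\<in>I. X i) x \<partial>M)" by simp
 also have "\<dots> \<le> (\<integral>\<^sup>+x. \<integral>\<^sup>+i. indicator (X i) x \<partial>count_space I \<partial>M)"
 proof (rule nn_integral_mono)
  fix x
  show "indicator (\<Union>i\<in>I. X i) x \<le> (\<integral>\<^sup>+i. indicator (X i) x \<partial>count_space I :: ennreal)"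
  proof (cases "x \<in> (\<Union>i\<in>I. X i)")
   case True
   then obtain j where j: "j \<in> I" "x \<in> X j" by blast
   have "1 = (\<integral>\<^sup>+i. indicator {j} i \<partial>count_space I :: ennreal)" using j by simp
   also have "\<dots> \<le> (\<integral>\<^sup>+i. indicator (X i) x \<partial>count_space I)"
    using j by (intro nn_integral_mono) (auto split: split_indicator)
   finally show ?thesis using True by simp
  qed simp
 qed
 also have "\<dots> = (\<integral>\<^sup>+i. \<integral>\<^sup>+x. indicator (X i) x \<partial>M \<partial>count_space I)"
  using I X by (intro nn_integral_count_space_nn_integral) auto
 also have "\<dots> = (\<integral>\<^sup>+i. emeasure M (X i) \<partial>count_space I)"
  using X by (intro nn_integral_cong) auto
 finally show ?thesis .
qed

text \<open>\<open>borel_cover\<close> is Borel regularity. \<open>1 \<le> cd\<close> is a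
  normalization that keeps all powers of \<open>cd\<close> at least 1.\<close>

locale doubling_measure = complete_measure M
 for M :: "'z::{metric_space, second_countable_topology} measure" +
 fixes cd :: real
 assumes space_M [simp]: "space M = UNIV"
  and borel_sets_M: "sets borel \<subseteq> sets M"
  and ball_pos: "0 < r \<Longrightarrow> 0 < emeasure M (ball x r)"
  and ball_finite: "emeasure M (ball x r) < \<infinity>"
  and cd: "1 \<le> cd"
  and doubling: "0 < r \<Longrightarrow> emeasure M (ball x (2 * r)) \<le> ennreal cd * emeasure M (ball x r)"
  and borel_cover: "A \<in> sets M \<Longrightarrow> \<exists>B\<in>sets borel. A \<subseteq> B \<and> emeasure M B = emeasure M A"
begin

lemma borel_in_M: "A \<in> sets borel \<Longrightarrow> A \<in> sets M"
 using borel_sets_M by blast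

lemma open_in_M: "open A \<Longrightarrow> A \<in> sets M"
 by (intro borel_in_M) auto

lemma ball_in_M [measurable]: "ball x r \<in> sets M"
 by (intro open_in_M) auto

definition \<mu> :: "'z \<Rightarrow> real \<Rightarrow> real" where "\<mu> x r = measure M (ball x r)"

lemma emeasure_ball: "emeasure M (ball x r) = ennreal (\<mu> x r)"
 unfolding \<mu>_def using ball_finite by (intro emeasure_eq_ennreal_measure) (simp add: less_top)

lemma \<mu>_pos: "0 < r \<Longrightarrow> 0 < \<mu> x r"
 using ball_pos[of r x] by (simp add: emeasure_ball)

lemma \<mu>_nonneg: "0 \<le> \<mu> x r"
 by (simp add: \<mu>_def)

lemma \<mu>_mono: "ball x r \<subseteq> ball y s \<Longrightarrow> \<mu> x r \<le> \<mu> y s"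
 using emeasure_mono[of "ball x r" "ball y s" M] by (simp add: emeasure_ball \<mu>_nonneg)

lemma \<mu>_double: "0 < r \<Longrightarrow> \<mu> x (2 * r) \<le> cd * \<mu> x r"
 using doubling[of r x] cd by (simp add: emeasure_ball ennreal_mult[symmetric] \<mu>_nonneg)

lemma \<mu>_power: "0 < r \<Longrightarrow> \<mu> x (2 ^ n * r) \<le> cd ^ n * \<mu> x r"
proof (induction n)
 case (Suc n)
 have "\<mu> x (2 ^ Suc n * r) \<le> cd * \<mu> x (2 ^ n * r)"
  using \<mu>_double[of "2 ^ n * r" x] Suc.prems by (simp add: mult.assoc)
 also have "\<dots> \<le> cd * (cd ^ n * \<mu> x r)" using Suc cd by (intro mult_left_mono) auto
 finally show ?case by simp
qed simp

lemma \<mu>_comparable: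
 assumes "0 < r" "dist x y + s \<le> 2 ^ n * r"
 shows "\<mu> y s \<le> cd ^ n * \<mu> x r"
proof -
 have "ball y s \<subseteq> ball x (2 ^ n * r)"
 proof
  fix z assume "z \<in> ball y s"
  then show "z \<in> ball x (2 ^ n * r)" using assms dist_triangle[of x z y] by auto
 qed
 then show ?thesis using \<mu>_mono \<mu>_power[OF assms(1), of x n] order_trans by blast
qed

text \<open>The common source of the weak-type estimates. Vitali's lemma for the balls of radius
  \<kappa> r yields disjoint balls whose 5-fold dilations cover the union; doubling compares a ball
  of radius 5 \<kappa> r with that of radius r, hence with \<nu> of a disjoint ball. The right-hand
  side keeps \<nu> of the union itself and not its total mass, which is essential for the recursion
  between bad sets.\<close>

lemma covering_estimate:
 fixes \<nu> :: "'z measure"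
 assumes sets: "sets \<nu> = sets M" and \<kappa>: "1 \<le> \<kappa>" "5 * \<kappa> \<le> 2 ^ n"
  and B: "\<And>x r. (x, r) \<in> \<B> \<Longrightarrow> 0 < r \<and> emeasure M (ball x r) \<le> emeasure \<nu> (ball x (\<kappa> * r))"
 shows "emeasure M (\<Union>(x, r)\<in>\<B>. ball x (\<kappa> * r)) \<le> ennreal (cd ^ n) * emeasure \<nu> (\<Union>(x, r)\<in>\<B>. ball x (\<kappa> * r))"
proof -
 define U where "U = (\<Union>(x, r)\<in>\<B>. ball x (\<kappa> * r))"
 \<comment> \<open>Vitali's lemma needs bounded radii; the bound R is removed at the end by a
   monotone limit.\<close>
 define V where "V R = (\<Union>(x, r)\<in>{(x, r)\<in>\<B>. r \<le> real R}. ball x (\<kappa> * r))" for R :: nat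
 have V_open: "open (V R)" and U_open: "open U" for R by (auto simp: V_def U_def)
 have main: "emeasure M (V R) \<le> ennreal (cd ^ n) * emeasure \<nu> U" for R
 proof -
  define F where "F = (\<lambda>(x, r). (x, \<kappa> * r)) ` {(x, r)\<in>\<B>. r \<le> real R}"
  have F: "0 < s \<and> s \<le> \<kappa> * real R" if "(x, s) \<in> F" for x s
   using that B \<kappa> by (auto simp: F_def intro!: mult_left_mono)
  have "\<forall>B\<in>F. 0 < snd B \<and> snd B \<le> \<kappa> * real R" using F by auto
  from vitali_covering_metric[OF this] obtain G where G: "G \<subseteq> F"
   and disj: "\<forall>B\<in>G. \<forall>B'\<in>G. B \<noteq> B' \<longrightarrow> ball (fst B) (snd B) \<inter> ball (fst B') (snd B') = {}"
   and cov': "\<forall>B\<in>F. \<exists>B'\<in>G. ball (fst B) (snd B) \<subseteq> ball (fst B') (5 * snd B')"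
   by (elim exE conjE)
  have disj_pairs: "(case B of (x, r) \<Rightarrow> ball x r) \<inter> (case B' of (x, r) \<Rightarrow> ball x r) = {}"
   if "B \<in> G" "B' \<in> G" "B \<noteq> B'" for B B'
   using disj that by (simp add: case_prod_beta)
  have cov: "\<exists>y s. (y, s) \<in> G \<and> ball x r \<subseteq> ball y (5 * s)" if "(x, r) \<in> F" for x r
  proof -
   from bspec[OF cov' that] obtain B' where "B' \<in> G" "ball (fst (x, r)) (snd (x, r)) \<subseteq> ball (fst B') (5 * snd B')"
    by (elim bexE)
   then show ?thesis by (intro exI[of _ "fst B'"] exI[of _ "snd B'"]) simp
  qed
  have disj': "disjoint_family_on (\<lambda>(x, r). ball x r) G"
   unfolding disjoint_family_on_def using disj_pairs by blast
  have nonempty: "ball x r \<noteq> {}" if "(x, r) \<in> G" for x r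
   using F[of x r] that G by auto
  have inj: "inj_on (\<lambda>(x, r). ball x r) G"
  proof (rule inj_onI, rule ccontr)
   fix B B' assume *: "B \<in> G" "B' \<in> G" "(case B of (x, r) \<Rightarrow> ball x r) = (case B' of (x, r) \<Rightarrow> ball x r)" "B \<noteq> B'"
   then have "(case B of (x, r) \<Rightarrow> ball x r) = {}" using disj_pairs[of B B'] by simp
   then show False using nonempty[of "fst B" "snd B"] *(1) by (simp add: case_prod_beta)
  qed
  have "countable ((\<lambda>(x, r). ball x r) ` G)"
  proof (rule countable_disjoint_open_subsets)
   show "pairwise disjnt ((\<lambda>(x, r). ball x r) ` G)"
    unfolding pairwise_def disjnt_def
   proof (intro ballI impI, elim imageE)
    fix X Y B B' assume "X \<noteq> Y" "X = (case B of (x, r) \<Rightarrow> ball x r)" "B \<in> G" "Y = (case B' of (x, r) \<Rightarrow> ball x r)" "B' \<in> G"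
    then show "X \<inter> Y = {}" using disj_pairs[of B B'] by metis
   qed
  qed auto
  then have cG: "countable G" using inj by (rule countable_image_inj_on)
  have "V R \<subseteq> (\<Union>(y, s)\<in>G. ball y (5 * s))"
  proof
   fix z assume "z \<in> V R"
   then obtain x r where "(x, r) \<in> \<B>" "r \<le> real R" and z: "z \<in> ball x (\<kappa> * r)" by (auto simp: V_def)
   then have "(x, \<kappa> * r) \<in> F" unfolding F_def by (intro image_eqI[of _ _ "(x, r)"]) auto
   then obtain y s where "(y, s) \<in> G" "ball x (\<kappa> * r) \<subseteq> ball y (5 * s)" using cov by blast
   then show "z \<in> (\<Union>(y, s)\<in>G. ball y (5 * s))" using z by blast
  qed
  then have "emeasure M (V R) \<le> emeasure M (\<Union>B\<in>G. case B of (y, s) \<Rightarrow> ball y (5 * s))"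
   by (intro emeasure_mono open_in_M) auto
  also have "\<dots> \<le> (\<integral>\<^sup>+B. emeasure M (case B of (y, s) \<Rightarrow> ball y (5 * s)) \<partial>count_space G)"
   using cG by (intro emeasure_UN_le_count_space) auto
  also have "\<dots> \<le> (\<integral>\<^sup>+B. ennreal (cd ^ n) * emeasure \<nu> (case B of (y, s) \<Rightarrow> ball y s) \<partial>count_space G)"
  proof (intro nn_integral_mono, clarsimp)
   fix y s assume ys: "(y, s) \<in> G"
   then obtain r where r: "(y, r) \<in> \<B>" "s = \<kappa> * r" using G by (auto simp: F_def)
   have "emeasure M (ball y (5 * s)) \<le> ennreal (cd ^ n * \<mu> y r)"
    unfolding emeasure_ball r(2) using B[OF r(1)] \<kappa>
    by (intro ennreal_leI \<mu>_comparable) (auto simp: mult.assoc[symmetric] intro: mult_right_mono)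
   also have "\<dots> = ennreal (cd ^ n) * emeasure M (ball y r)" using cd by (simp add: emeasure_ball ennreal_mult \<mu>_nonneg)
   also have "\<dots> \<le> ennreal (cd ^ n) * emeasure \<nu> (ball y s)"
    unfolding r(2) using B[OF r(1)] by (intro mult_left_mono) auto
   finally show "emeasure M (ball y (5 * s)) \<le> ennreal (cd ^ n) * emeasure \<nu> (ball y s)" .
  qed
  also have "\<dots> = ennreal (cd ^ n) * (\<integral>\<^sup>+B. emeasure \<nu> (case B of (y, s) \<Rightarrow> ball y s) \<partial>count_space G)"
   by (intro nn_integral_cmult) auto
  also have "(\<integral>\<^sup>+B. emeasure \<nu> (case B of (y, s) \<Rightarrow> ball y s) \<partial>count_space G) = emeasure \<nu> (\<Union>B\<in>G. case B of (y, s) \<Rightarrow> ball y s)"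
   using cG disj' by (intro emeasure_UN_countable[symmetric]) (auto simp: sets)
  also have "\<dots> \<le> emeasure \<nu> U"
  proof (rule emeasure_mono)
   show "(\<Union>B\<in>G. case B of (y, s) \<Rightarrow> ball y s) \<subseteq> U"
   proof (intro UN_least)
    fix B assume "B \<in> G"
    then obtain x r where "(x, r) \<in> \<B>" "B = (x, \<kappa> * r)" using G by (auto simp: F_def)
    then show "(case B of (y, s) \<Rightarrow> ball y s) \<subseteq> U" by (auto simp: U_def)
   qed
  qed (use U_open in \<open>auto simp: sets open_in_M\<close>)
  finally show ?thesis by (simp add: mult_left_mono)
 qed
 have "emeasure M U = (SUP R. emeasure M (V R))"
 proof -
  have "U = (\<Union>R. V R)"
  proof (intro equalityI subsetI)
   fix z assume "z \<in> U"
   then obtain x r where xr: "(x, r) \<in> \<B>" "z \<in> ball x (\<kappa> * r)" by (auto simp: U_def)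
   obtain R :: nat where "r \<le> real R" using real_arch_simple by blast
   with xr have "z \<in> V R" by (auto simp: V_def)
   then show "z \<in> (\<Union>R. V R)" by blast
  next
   fix z assume "z \<in> (\<Union>R. V R)"
   then obtain x r where "(x, r) \<in> \<B>" "z \<in> ball x (\<kappa> * r)" by (auto simp: V_def)
   then show "z \<in> U" unfolding U_def by (intro UN_I[of "(x, r)"]) auto
  qed
  moreover have "incseq V"
  proof (intro incseq_SucI subsetI)
   fix R z assume "z \<in> V R"
   then obtain x r where xr: "(x, r) \<in> \<B>" "r \<le> real R" "z \<in> ball x (\<kappa> * r)" by (auto simp: V_def)
   then have "r \<le> real (Suc R)" by simp
   with xr show "z \<in> V (Suc R)" unfolding V_def by blast
  qed
  ultimately show ?thesis using V_open by (simp add: SUP_emeasure_incseq open_in_M image_subset_iff)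
 qed
 also have "\<dots> \<le> ennreal (cd ^ n) * emeasure \<nu> U" by (intro SUP_least main)
 finally show ?thesis by (simp add: U_def)
qed

end

context doubling_measure
begin

lemma null_sets_approx:
 assumes "\<And>\<epsilon>::real. \<epsilon> > 0 \<Longrightarrow> \<exists>U\<in>sets M. A \<subseteq> U \<and> emeasure M U \<le> ennreal \<epsilon>"
 shows "A \<in> null_sets M"
proof -
 have "\<forall>n::nat. \<exists>U\<in>sets M. A \<subseteq> U \<and> emeasure M U \<le> ennreal (inverse (real (Suc n)))"
  by (intro allI assms) simp
 then obtain U where U: "\<And>n. U n \<in> sets M" "\<And>n. A \<subseteq> U n" "\<And>n. emeasure M (U n) \<le> ennreal (inverse (real (Suc n)))"
  by metis
 have [measurable]: "(\<Inter>n. U n) \<in> sets M" using U(1) by auto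
 have "emeasure M (\<Inter>n. U n) \<le> ennreal (inverse (real (Suc n)))" for n
  using emeasure_mono[of "\<Inter>n. U n" "U n" M] U(1,3)[of n] by (meson INT_lower UNIV_I order_trans)
 moreover have "(\<lambda>n. ennreal (inverse (real (Suc n)))) \<longlonglongrightarrow> ennreal 0"
  by (intro tendsto_ennrealI LIMSEQ_inverse_real_of_nat)
 ultimately have "emeasure M (\<Inter>n. U n) \<le> ennreal 0"
  by (intro LIMSEQ_le_const[of "\<lambda>n. ennreal (inverse (real (Suc n)))"]) auto
 then have "(\<Inter>n. U n) \<in> null_sets M" by (auto simp: null_sets_def)
 moreover have "A \<subseteq> (\<Inter>n. U n)" using U(2) by blast
 ultimately show ?thesis using complete2 by blast
qed

lemma finite_measure_ball_M: "emeasure M (A \<inter> ball x r) < \<infinity>"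
proof (cases "A \<inter> ball x r \<in> sets M")
 case True
 then show ?thesis using emeasure_mono[of "A \<inter> ball x r" "ball x r" M] ball_finite le_less_trans by (metis Int_lower2 ball_in_M)
qed (simp add: emeasure_notin_sets)

text \<open>Cover the rest of the ball by a Borel set of the same measure. What it leaves is a Borel
  subset of A of full measure, to which regularity of finite Borel measures applies.\<close>

lemma measurable_closed_approx:
 assumes A[measurable]: "A \<in> sets M" and sub: "A \<subseteq> ball x0 R" and \<epsilon>: "\<epsilon> > 0"
 shows "\<exists>C. closed C \<and> C \<subseteq> A \<and> emeasure M (A - C) \<le> ennreal \<epsilon>"
proof -
 define B where "B = ball x0 R"
 have "B - A \<in> sets M" unfolding B_def by (intro sets.Diff ball_in_M A)
 from borel_cover[OF this] obtain H where H: "H \<in> sets borel" "B - A \<subseteq> H" "emeasure M H = emeasure M (B - A)"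
  by (elim bexE conjE)
 have [measurable]: "H \<in> sets M" "B \<in> sets M" using borel_in_M[OF H(1)] by (auto simp: B_def)
 define D where "D = B - H"
 have D: "D \<in> sets borel" "D \<subseteq> A" using H sub by (auto simp: D_def B_def)
 have [measurable]: "D \<in> sets M" using D by (intro borel_in_M)
 have "emeasure M (A - D) \<le> emeasure M (H - (B - A))"
  using sub H(2) by (intro emeasure_mono) (auto simp: D_def B_def)
 also have "\<dots> = emeasure M H - emeasure M (B - A)"
  using H finite_measure_ball_M[of "- A" x0 R] by (intro emeasure_Diff) (auto simp: B_def Diff_eq Int_commute)
 also have "\<dots> = 0" using H(3) finite_measure_ball_M[of "- A" x0 R] by (simp add: B_def Diff_eq Int_commute)
 finally have AD: "emeasure M (A - D) = 0" by simp
 define \<eta> where "\<eta> = distr (density M (indicator B)) borel (\<lambda>x. x)"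
 have meas: "(\<lambda>x. x) \<in> measurable (density M (indicator B)) borel"
  using borel_sets_M by (auto simp: measurable_def)
 have em: "emeasure \<eta> X = emeasure M (B \<inter> X)" if "X \<in> sets borel" for X
  using that meas borel_in_M[OF that] by (simp add: \<eta>_def emeasure_distr emeasure_restricted)
 have "finite_measure \<eta>"
 proof
  show "emeasure \<eta> (space \<eta>) \<noteq> \<infinity>"
   using em[of UNIV] ball_finite[of x0 R] by (simp add: \<eta>_def B_def)
 qed
 then obtain C V where CV: "closed C" "open V" "C \<subseteq> D" "D \<subseteq> V" "measure \<eta> (V - C) < \<epsilon>"
  using closed_open_approx[of \<eta> D \<epsilon>] D(1) \<epsilon> by (auto simp: \<eta>_def)
 have "emeasure M (D - C) \<le> emeasure M (B \<inter> (V - C))"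
 proof (rule emeasure_mono)
  show "D - C \<subseteq> B \<inter> (V - C)" using CV(4) by (auto simp: D_def)
  have "V - C \<in> sets M" using CV(1,2) by (intro borel_in_M) auto
  then show "B \<inter> (V - C) \<in> sets M" using \<open>B \<in> sets M\<close> by (rule sets.Int[rotated])
 qed
 also have "\<dots> = emeasure \<eta> (V - C)" using CV by (intro em[symmetric]) auto
 also have "\<dots> = ennreal (measure \<eta> (V - C))"
  by (rule finite_measure.emeasure_eq_measure) fact
 also have "\<dots> \<le> ennreal \<epsilon>" using CV(5) by (intro ennreal_leI) simp
 finally have DC: "emeasure M (D - C) \<le> ennreal \<epsilon>" .
 have [measurable]: "C \<in> sets M" using CV(1) by (intro borel_in_M) auto
 have "emeasure M (A - C) \<le> emeasure M (A - D) + emeasure M (D - C)"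
  by (intro order_trans[OF emeasure_mono emeasure_subadditive]) auto
 then have "emeasure M (A - C) \<le> ennreal \<epsilon>" using AD DC by simp
 then show ?thesis using CV D(2) by blast
qed

text \<open>In a large ball, approximate the complement of E from inside by a closed C. Small balls
  about a point of E avoid C, so if the complement of E is heavy in them, the small remainder is.
  The covering estimate then bounds the measure of the set of such points.\<close>

lemma density_point:
 assumes E[measurable]: "E \<in> sets M" and \<delta>: "\<delta> > 0"
 shows "AE x in M. x \<in> E \<longrightarrow> (\<exists>r0>0. \<forall>r. 0 < r \<and> r < r0 \<longrightarrow> measure M (ball x r - E) \<le> \<delta> * \<mu> x r)"
proof -
 define bad where "bad = {x\<in>E. \<forall>r0>0. \<exists>r. 0 < r \<and> r < r0 \<and> \<delta> * \<mu> x r < measure M (ball x r - E)}"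
 fix x0 :: 'z
 have "bad \<inter> ball x0 (real R) \<in> null_sets M" for R :: nat
 proof (rule null_sets_approx)
  fix \<epsilon> :: real assume \<epsilon>: "\<epsilon> > 0"
  define B where "B = ball x0 (real R)"
  have [measurable]: "B \<in> sets M" by (simp add: B_def)
  \<comment> \<open>\<open>cd ^ 3\<close> is the constant of \<open>covering_estimate\<close> for
    \<kappa> = 1, as 5 \<le> 2^3; the factor \<delta> cancels the 1/\<delta> in
    \<open>\<nu>\<close>.\<close>
  define \<epsilon>' where "\<epsilon>' = \<epsilon> * \<delta> / cd ^ 3"
  have \<epsilon>': "\<epsilon>' > 0" using \<epsilon> \<delta> cd by (simp add: \<epsilon>'_def)
  obtain C where C: "closed C" "C \<subseteq> B - E" "emeasure M ((B - E) - C) \<le> ennreal \<epsilon>'"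
   using measurable_closed_approx[of "B - E" x0 "real R" \<epsilon>'] \<epsilon>' by (auto simp: B_def)
  have [measurable]: "C \<in> sets M" using C(1) by (intro borel_in_M) auto
  define \<nu> where "\<nu> = scale_measure (ennreal (1 / \<delta>)) (density M (indicator (B - E - C)))"
  have \<nu>: "emeasure \<nu> X = ennreal (1 / \<delta>) * emeasure M ((B - E - C) \<inter> X)" if "X \<in> sets M" for X
   using that by (simp add: \<nu>_def emeasure_restricted)
  define \<B> where "\<B> = {(x, r). 0 < r \<and> emeasure M (ball x r) \<le> emeasure \<nu> (ball x (1 * r))}"
  define U where "U = (\<Union>(x, r)\<in>\<B>. ball x (1 * r))"
  have "emeasure M U \<le> ennreal (cd ^ 3) * emeasure \<nu> U"
   unfolding U_def by (rule covering_estimate) (auto simp: \<nu>_def \<B>_def)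
  also have "emeasure \<nu> U \<le> ennreal (1 / \<delta>) * ennreal \<epsilon>'"
  proof -
   have "open U" by (auto simp: U_def)
   then have "U \<in> sets M" by (rule open_in_M)
   moreover have "emeasure M ((B - E - C) \<inter> U) \<le> emeasure M (B - E - C)" by (intro emeasure_mono) auto
   ultimately show ?thesis using C(3) by (simp add: \<nu> mult_left_mono order_trans)
  qed
  also have "ennreal (cd ^ 3) * (ennreal (1 / \<delta>) * ennreal \<epsilon>') = ennreal \<epsilon>"
   using cd \<delta> \<epsilon> by (simp add: ennreal_mult[symmetric] \<epsilon>'_def)
  finally have "emeasure M U \<le> ennreal \<epsilon>" by (simp add: mult_left_mono)
  moreover have "bad \<inter> B \<subseteq> U"
  proof
   fix x assume x: "x \<in> bad \<inter> B"
   then have "open (B - C)" "x \<in> B - C" using C by (auto simp: bad_def B_def)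
   then obtain r0 where r0: "r0 > 0" "ball x r0 \<subseteq> B - C" using open_contains_ball by blast
   obtain r where r: "0 < r" "r < r0" "\<delta> * \<mu> x r < measure M (ball x r - E)"
    using x r0(1) by (auto simp: bad_def)
   have "ball x r \<subseteq> ball x r0" using r(2) by (simp add: subset_ball)
   then have eq: "(B - E - C) \<inter> ball x r = ball x r - E" using r0(2) by blast
   have "emeasure M (ball x r) = ennreal (1 / \<delta>) * ennreal (\<delta> * \<mu> x r)"
    using \<delta> by (simp add: emeasure_ball ennreal_mult[symmetric] \<mu>_nonneg)
   also have "\<dots> \<le> ennreal (1 / \<delta>) * emeasure M (ball x r - E)"
   proof -
    have "emeasure M (ball x r - E) = ennreal (measure M (ball x r - E))"
     using finite_measure_ball_M[of "- E" x r] by (intro emeasure_eq_ennreal_measure) (simp add: Diff_eq Int_commute less_top)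
    then show ?thesis using r(3) by (intro mult_left_mono) (simp_all add: ennreal_leI)
   qed
   also have "\<dots> = emeasure \<nu> (ball x (1 * r))" by (simp add: \<nu> eq)
   finally have "(x, r) \<in> \<B>" using r by (simp add: \<B>_def)
   then show "x \<in> U" using r(1) by (auto simp: U_def intro!: bexI[of _ "(x, r)"])
  qed
  moreover have "U \<in> sets M" by (intro open_in_M) (auto simp: U_def)
  ultimately show "\<exists>U\<in>sets M. bad \<inter> ball x0 (real R) \<subseteq> U \<and> emeasure M U \<le> ennreal \<epsilon>"
   unfolding B_def by blast
 qed
 then have "(\<Union>R::nat. bad \<inter> ball x0 (real R)) \<in> null_sets M" by (intro null_sets_UN) auto
 moreover have "bad \<subseteq> (\<Union>R::nat. bad \<inter> ball x0 (real R))"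
  using reals_Archimedean2 by auto
 ultimately have "bad \<in> null_sets M" using complete2 by blast
 then show ?thesis
  by (rule AE_I') (auto simp: bad_def not_le)
qed

text \<open>A substitute for Lebesgue points that asks for no integrability and is phrased by the
  same deviation sets as the bad balls.\<close>

definition approx_continuous :: "('z \<Rightarrow> real) \<Rightarrow> 'z \<Rightarrow> bool" where
 "approx_continuous f x \<longleftrightarrow> (\<forall>\<epsilon>>0. \<forall>\<delta>>0. \<exists>r0>0. \<forall>r. 0 < r \<and> r < r0 \<longrightarrow>
   measure M {z \<in> ball x r. \<epsilon> < \<bar>f z - f x\<bar>} \<le> \<delta> * \<mu> x r)"

text \<open>It suffices that x is a density point of every set \<open>{q1 < f < q2}\<close> with
  rational bounds that contains it; these are countably many conditions.\<close>

lemma AE_approx_continuous: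
 assumes f[measurable]: "f \<in> borel_measurable M"
 shows "AE x in M. approx_continuous f x"
proof -
 define E where "E q = {z. fst q < f z \<and> f z < snd q}" for q :: "real \<times> real"
 have E[measurable]: "E q \<in> sets M" for q
 proof -
  have "E q = {z \<in> space M. fst q < f z \<and> f z < snd q}" by (simp add: E_def)
  also have "\<dots> \<in> sets M" by measurable
  finally show ?thesis .
 qed
 have "AE x in M. \<forall>q\<in>\<rat> \<times> \<rat>. \<forall>n::nat. x \<in> E q \<longrightarrow>
   (\<exists>r0>0. \<forall>r. 0 < r \<and> r < r0 \<longrightarrow> measure M (ball x r - E q) \<le> inverse (real (Suc n)) * \<mu> x r)"
 proof (subst AE_ball_countable)
  show "countable (\<rat> \<times> \<rat> :: (real \<times> real) set)" by (intro countable_SIGMA countable_rat)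
  show "\<forall>q\<in>\<rat> \<times> \<rat>. AE x in M. \<forall>n::nat. x \<in> E q \<longrightarrow>
   (\<exists>r0>0. \<forall>r. 0 < r \<and> r < r0 \<longrightarrow> measure M (ball x r - E q) \<le> inverse (real (Suc n)) * \<mu> x r)"
   unfolding AE_all_countable by (intro ballI allI density_point E) simp
 qed
 then show ?thesis
 proof eventually_elim
  case (elim x)
  show ?case
   unfolding approx_continuous_def
  proof (intro allI impI)
   fix \<epsilon> \<delta> :: real assume "\<epsilon> > 0" "\<delta> > 0"
   obtain q1 where q1: "q1 \<in> \<rat>" "f x - \<epsilon> < q1" "q1 < f x" using Rats_dense_in_real[of "f x - \<epsilon>" "f x"] \<open>\<epsilon> > 0\<close> by auto
   obtain q2 where q2: "q2 \<in> \<rat>" "f x < q2" "q2 < f x + \<epsilon>" using Rats_dense_in_real[of "f x" "f x + \<epsilon>"] \<open>\<epsilon> > 0\<close> by auto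
   obtain n where n: "inverse (real (Suc n)) < \<delta>" using reals_Archimedean \<open>\<delta> > 0\<close> by blast
   have q: "(q1, q2) \<in> \<rat> \<times> \<rat>" using q1 q2 by simp
   have "x \<in> E (q1, q2)" using q1 q2 by (simp add: E_def)
   from elim[THEN bspec, OF q, THEN spec, of n, THEN mp, OF this] obtain r0 where r0: "r0 > 0"
    "\<And>r. 0 < r \<and> r < r0 \<Longrightarrow> measure M (ball x r - E (q1, q2)) \<le> inverse (real (Suc n)) * \<mu> x r"
    by blast
   show "\<exists>r0>0. \<forall>r. 0 < r \<and> r < r0 \<longrightarrow> measure M {z \<in> ball x r. \<epsilon> < \<bar>f z - f x\<bar>} \<le> \<delta> * \<mu> x r"
   proof (intro exI[of _ r0] conjI allI impI r0(1))
    fix r assume r: "0 < r \<and> r < r0"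
    have "measure M {z \<in> ball x r. \<epsilon> < \<bar>f z - f x\<bar>} \<le> measure M (ball x r - E (q1, q2))"
    proof (rule measure_mono_fmeasurable)
     show "{z \<in> ball x r. \<epsilon> < \<bar>f z - f x\<bar>} \<subseteq> ball x r - E (q1, q2)" using q1 q2 by (auto simp: E_def)
     have "{z \<in> ball x r. \<epsilon> < \<bar>f z - f x\<bar>} = ball x r \<inter> {z \<in> space M. \<epsilon> < \<bar>f z - f x\<bar>}" by auto
     also have "\<dots> \<in> sets M" by measurable
     finally show "{z \<in> ball x r. \<epsilon> < \<bar>f z - f x\<bar>} \<in> sets M" .
     show "ball x r - E (q1, q2) \<in> fmeasurable M"
      using finite_measure_ball_M[of "- E (q1, q2)" x r] by (intro fmeasurableI) (auto simp: Diff_eq Int_commute)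
    qed
    also have "\<dots> \<le> inverse (real (Suc n)) * \<mu> x r" using r0(2)[OF r] .
    also have "\<dots> \<le> \<delta> * \<mu> x r" using n by (intro mult_right_mono) (auto simp: \<mu>_nonneg)
    finally show "measure M {z \<in> ball x r. \<epsilon> < \<bar>f z - f x\<bar>} \<le> \<delta> * \<mu> x r" .
   qed
  qed
 qed
qed

end

text \<open>An l^p sum over the levels in place of the supremum of the 2^i with x in
  \<open>V i\<close>: the integral of the p-th power is then exactly a weighted sum of measures,
  without monotonicity of \<open>V\<close>. \<open>int_decode\<close> enumerates the
  integers.\<close>

definition dyadic_fun :: "real \<Rightarrow> (int \<Rightarrow> 'z set) \<Rightarrow> 'z \<Rightarrow> ennreal" where
 "dyadic_fun p V x = ennreal_powr
   (\<Sum>n. ennreal (2 powr (real_of_int (int_decode n) * p)) * indicator (V (int_decode n)) x) (1 / p)"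

lemma dyadic_fun_measurable [measurable]:
 assumes [measurable]: "\<And>i. V i \<in> sets M" shows "dyadic_fun p V \<in> borel_measurable M"
 unfolding dyadic_fun_def by measurable

lemma dyadic_fun_ge:
 assumes x: "x \<in> V i" and p: "0 < p" shows "ennreal (dyad i) \<le> dyadic_fun p V x"
proof -
 define h where "h n = ennreal (2 powr (real_of_int (int_decode n) * p)) * indicator (V (int_decode n)) x" for n
 have "ennreal (2 powr (real_of_int i * p)) = h (int_encode i)" using x by (simp add: h_def)
 also have "\<dots> \<le> suminf h" using sum_le_suminf[of h "{int_encode i}"] by simp
 finally have "ennreal_powr (ennreal (2 powr (real_of_int i * p))) (1 / p) \<le> dyadic_fun p V x"
  unfolding dyadic_fun_def h_def[symmetric] using p by (intro ennreal_powr_mono) auto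
 then show ?thesis using p by (simp add: ennreal_powr_ennreal powr_powr)
qed

lemma nn_integral_dyadic_fun:
 assumes [measurable]: "\<And>i. V i \<in> sets M" and p: "0 < p"
 shows "(pint M p (dyadic_fun p V)) =
  (\<Sum>n. ennreal (2 powr (real_of_int (int_decode n) * p)) * emeasure M (V (int_decode n)))"
proof -
 have "(pint M p (dyadic_fun p V)) =
   (\<integral>\<^sup>+x. (\<Sum>n. ennreal (2 powr (real_of_int (int_decode n) * p)) * indicator (V (int_decode n)) x) \<partial>M)"
  unfolding dyadic_fun_def using p by (simp add: ennreal_powr_powr)
 also have "\<dots> = (\<Sum>n. \<integral>\<^sup>+x. ennreal (2 powr (real_of_int (int_decode n) * p)) * indicator (V (int_decode n)) x \<partial>M)"
  by (intro nn_integral_suminf) measurable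
 finally show ?thesis by (simp add: nn_integral_cmult_indicator)
qed

lemma suminf_int_le:
 fixes w :: "int \<Rightarrow> ennreal"
 assumes "\<And>m::nat. (\<Sum>i\<in>{- int m..int m}. w i) \<le> K"
 shows "(\<Sum>n. w (int_decode n)) \<le> K"
 unfolding suminf_eq_SUP
proof (rule SUP_least)
 fix k
 have inj: "inj_on int_decode {..<k}" by (metis inj_int_decode inj_on_subset subset_UNIV)
 define m where "m = nat (Max (insert 0 ((\<lambda>n. \<bar>int_decode n\<bar>) ` {..<k})))"
 have m: "\<bar>int_decode n\<bar> \<le> int m" if "n < k" for n
  using that by (auto simp: m_def intro!: Max_ge)
 have "(\<Sum>n<k. w (int_decode n)) = sum w (int_decode ` {..<k})"
  using inj by (simp add: sum.reindex)
 also have "\<dots> \<le> sum w {- int m..int m}"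
 proof (rule sum_mono2)
  show "int_decode ` {..<k} \<subseteq> {- int m..int m}"
  proof (intro subsetI, elim imageE)
   fix i n assume "i = int_decode n" "n \<in> {..<k}"
   then show "i \<in> {- int m..int m}" using m[of n] by auto
  qed
 qed auto
 also have "\<dots> \<le> K" by (rule assms)
 finally show "(\<Sum>n<k. w (int_decode n)) \<le> K" .
qed

lemma sum_powr_int_le:
 fixes s :: real
 assumes s: "0 < s" and S: "finite S" "\<And>i. i \<in> S \<Longrightarrow> i \<le> L"
 shows "(\<Sum>i\<in>S. 2 powr (real_of_int i * s)) \<le> 2 powr (real_of_int L * s) / (1 - 2 powr (- s))"
proof -
 define q where "q = 2 powr (- s)"
 have q: "0 < q" "q < 1" using s by (auto simp: q_def powr_less_one)
 have inj: "inj_on (\<lambda>i. nat (L - i)) S" 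
 proof (rule inj_onI)
  fix x y assume "x \<in> S" "y \<in> S" "nat (L - x) = nat (L - y)"
  then show "x = y" using S(2)[of x] S(2)[of y] by (simp add: eq_nat_nat_iff)
 qed
 have "(\<Sum>i\<in>S. 2 powr (real_of_int i * s)) = (\<Sum>i\<in>S. 2 powr (real_of_int L * s) * q ^ nat (L - i))"
 proof (rule sum.cong)
  fix i assume "i \<in> S"
  then have "i \<le> L" by (rule S(2))
  then have "q ^ nat (L - i) = 2 powr (- s * real_of_int (L - i))"
   by (simp add: q_def powr_realpow[symmetric] powr_powr)
  then show "2 powr (real_of_int i * s) = 2 powr (real_of_int L * s) * q ^ nat (L - i)"
   by (simp add: powr_add[symmetric] algebra_simps)
 qed simp
 also have "\<dots> = 2 powr (real_of_int L * s) * (\<Sum>n\<in>(\<lambda>i. nat (L - i)) ` S. q ^ n)"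
  using inj by (simp add: sum_distrib_left sum.reindex)
 also have "\<dots> \<le> 2 powr (real_of_int L * s) * (\<Sum>n. q ^ n)"
  using q S(1) by (intro mult_left_mono sum_le_suminf summable_geometric) auto
 also have "(\<Sum>n. q ^ n) = 1 / (1 - q)" using q by (intro suminf_geometric) auto
 finally show ?thesis by (simp add: q_def)
qed

text \<open>A geometric sum is dominated by its largest term, and for real a the levels that
  contribute satisfy 2^i < 2 a; this is where \<open>2 powr s\<close> comes from.\<close>

lemma dyadic_layer_sum:
 fixes a :: ennreal
 assumes s: "0 < s"
 shows "(\<Sum>n. ennreal (2 powr (real_of_int (int_decode n) * s)) *
   indicator {i. ennreal (2 powr (real_of_int i - 1)) < a} (int_decode n)) \<le>
  ennreal (2 powr s / (1 - 2 powr (- s))) * ennreal_powr a s"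
proof (rule suminf_int_le[where w="\<lambda>i. ennreal (2 powr (real_of_int i * s)) *
   indicator {i. ennreal (2 powr (real_of_int i - 1)) < a} i"])
 fix m :: nat
 have q: "2 powr (- s) < 1" using s by (simp add: powr_less_one)
 consider "a = 0" | "a = \<infinity>" | r where "a = ennreal r" "0 < r"
  by (cases a) (auto simp: le_less)
 then show "(\<Sum>i\<in>{- int m..int m}. ennreal (2 powr (real_of_int i * s)) *
   indicator {i. ennreal (2 powr (real_of_int i - 1)) < a} i) \<le> ennreal (2 powr s / (1 - 2 powr (- s))) * ennreal_powr a s"
 proof cases
  case 2
  then show ?thesis using q s by (simp add: ennreal_mult_top)
 next
  case 3
  define L where "L = \<lceil>log 2 r\<rceil>"
  define S where "S = {i\<in>{- int m..int m}. 2 powr (real_of_int i - 1) < r}"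
  have "(\<Sum>i\<in>{- int m..int m}. ennreal (2 powr (real_of_int i * s)) * indicator {i. ennreal (2 powr (real_of_int i - 1)) < a} i) =
    (\<Sum>i\<in>S. ennreal (2 powr (real_of_int i * s)))"
   using 3 by (intro sum.mono_neutral_cong_right) (auto simp: S_def ennreal_less_iff)
  also have "\<dots> = ennreal (\<Sum>i\<in>S. 2 powr (real_of_int i * s))" by simp
  also have "\<dots> \<le> ennreal (2 powr (real_of_int L * s) / (1 - 2 powr (- s)))"
  proof (intro ennreal_leI sum_powr_int_le s)
   fix i assume "i \<in> S"
   then have "2 powr (real_of_int i - 1) < r" by (simp add: S_def)
   then have "real_of_int i - 1 < log 2 r" using 3 by (simp add: less_log_iff)
   then show "i \<le> L" unfolding L_def by linarith
  next
   show "finite S" by (rule finite_subset[of _ "{- int m..int m}"]) (auto simp: S_def)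
  qed
  also have "2 powr (real_of_int L * s) \<le> (2 * r) powr s"
  proof -
   have "2 powr real_of_int L \<le> 2 powr (log 2 r + 1)" unfolding L_def by (intro powr_mono) linarith+
   also have "\<dots> = 2 * r" using 3 by (simp add: powr_add)
   finally have "(2 powr real_of_int L) powr s \<le> (2 * r) powr s" using s by (intro powr_mono2) auto
   then show ?thesis by (simp add: powr_powr)
  qed
  finally have "(\<Sum>i\<in>{- int m..int m}. ennreal (2 powr (real_of_int i * s)) * indicator {i. ennreal (2 powr (real_of_int i - 1)) < a} i) \<le>
    ennreal ((2 * r) powr s / (1 - 2 powr (- s)))"
   using q by (simp add: divide_right_mono ennreal_leI order_trans)
  also have "\<dots> = ennreal (2 powr s / (1 - 2 powr (- s))) * ennreal_powr a s"
   using 3 q by (simp add: ennreal_powr_ennreal ennreal_mult[symmetric] powr_mult)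
  finally show ?thesis .
 qed simp
qed

section \<open>The Hardy-Littlewood maximal theorem\<close>

context doubling_measure
begin

text \<open>Whole balls are collected and not only their centres, which makes the level set open and
  gives it the shape required by \<open>covering_estimate\<close>, with dilation factor 1.\<close>

definition max_level :: "('z \<Rightarrow> ennreal) \<Rightarrow> int \<Rightarrow> 'z set" where
 "max_level f i = (\<Union>(x, r)\<in>{(x, r). 0 < r \<and>
   ennreal (dyad i) * emeasure M (ball x r) < (\<integral>\<^sup>+y. f y * indicator (ball x r) y \<partial>M)}. ball x (1 * r))"

lemma max_level_in_M [measurable]: "max_level f i \<in> sets M"
 by (intro open_in_M) (auto simp: max_level_def)

text \<open>The Hardy-Littlewood maximal function, up to a factor depending on \<open>p\<close>.\<close>

definition maximal :: "real \<Rightarrow> ('z \<Rightarrow> ennreal) \<Rightarrow> 'z \<Rightarrow> ennreal" where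
 "maximal p f x = 2 * dyadic_fun p (max_level f) x"

lemma maximal_measurable [measurable]: "maximal p f \<in> borel_measurable M"
 unfolding maximal_def by measurable

lemma average_le_maximal:
 assumes r: "0 < r" and p: "0 < p"
 shows "(\<integral>\<^sup>+y. f y * indicator (ball x r) y \<partial>M) \<le> maximal p f x * emeasure M (ball x r)"
proof -
 let ?I = "\<integral>\<^sup>+y. f y * indicator (ball x r) y \<partial>M"
 have lev: "ennreal (dyad i) \<le> dyadic_fun p (max_level f) x"
  if "ennreal (dyad i) * emeasure M (ball x r) < ?I" for i
  using that r by (intro dyadic_fun_ge p) (auto simp: max_level_def intro!: exI[of _ x] exI[of _ r])
 consider "?I = 0" | "?I = \<infinity>" | c where "?I = ennreal c" "0 < c"
  by (cases ?I) (auto simp: le_less)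
 then show ?thesis
 proof cases
  case 2
  have big: "ennreal (real n) \<le> dyadic_fun p (max_level f) x" for n
  proof -
   have "ennreal (real n) \<le> ennreal (dyad (int n))"
    by (intro ennreal_leI) (simp add: powr_realpow less_imp_le of_nat_less_two_power)
   also have "\<dots> \<le> dyadic_fun p (max_level f) x"
    by (rule lev) (simp add: 2 emeasure_ball ennreal_mult[symmetric] \<mu>_nonneg)
   finally show ?thesis .
  qed
  have "dyadic_fun p (max_level f) x = \<infinity>"
  proof (rule ccontr)
   assume "dyadic_fun p (max_level f) x \<noteq> \<infinity>"
   then obtain d where d: "0 \<le> d" "dyadic_fun p (max_level f) x = ennreal d"
    by (cases "dyadic_fun p (max_level f) x") auto
   obtain n :: nat where "d < real n" using reals_Archimedean2 by blast
   moreover have "real n \<le> d" using big[of n] d by simp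
   ultimately show False by simp
  qed
  then show ?thesis using ball_pos[OF r, of x] by (simp add: maximal_def ennreal_mult_top ennreal_top_mult)
 next
  case 3
  define a where "a = c / \<mu> x r"
  have a: "a > 0" "c = a * \<mu> x r" using 3 \<mu>_pos[OF r, of x] by (auto simp: a_def)
  \<comment> \<open>The largest integer with 2^i < a, strictly, as the levels are defined by a
    strict inequality. The factor 2 in \<open>maximal\<close> makes up for the rounding.\<close>
  define i where "i = \<lceil>log 2 a\<rceil> - 1"
  have i: "dyad i < a" "a \<le> 2 * dyad i"
  proof -
   have "real_of_int i < log 2 a" unfolding i_def by linarith
   then show "dyad i < a" using a by (simp add: less_log_iff)
   have "a = 2 powr log 2 a" using a by simp
   also have "\<dots> \<le> 2 powr (real_of_int i + 1)" unfolding i_def by (intro powr_mono) linarith+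
   finally show "a \<le> 2 * dyad i" by (simp add: powr_add)
  qed
  have "ennreal (dyad i) \<le> dyadic_fun p (max_level f) x"
   using i(1) a \<mu>_pos[OF r, of x]
   by (intro lev) (simp add: 3 emeasure_ball ennreal_mult[symmetric] \<mu>_nonneg ennreal_less_iff)
  then have "2 * ennreal (dyad i) \<le> maximal p f x" unfolding maximal_def by (rule mult_left_mono) simp
  moreover have "ennreal a \<le> 2 * ennreal (dyad i)"
   using i(2) by (simp add: ennreal_mult[symmetric] ennreal_leI flip: ennreal_numeral)
  ultimately have "ennreal a \<le> maximal p f x" by (rule order_trans[rotated])
  then have "ennreal a * emeasure M (ball x r) \<le> maximal p f x * emeasure M (ball x r)" by (rule mult_right_mono) simp
  then show ?thesis using 3 a by (simp add: emeasure_ball ennreal_mult \<mu>_nonneg)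
 qed simp
qed

text \<open>With t = 2^(i-1), the part of f below t contributes at most t to an average above 2 t,
  so the part above t alone has average at least t. This truncation is what makes the weak bounds
  summable over i.\<close>

lemma max_level_weak_bound:
 assumes [measurable]: "f \<in> borel_measurable M"
 shows "emeasure M (max_level f i) \<le> ennreal (cd ^ 3 * 2 powr (1 - real_of_int i)) *
  (\<integral>\<^sup>+y. f y * indicator {i. ennreal (2 powr (real_of_int i - 1)) < f y} i \<partial>M)"
proof -
 define t where "t = 2 powr (real_of_int i - 1)"
 have t: "t > 0" "dyad i = 2 * t" "2 powr (1 - real_of_int i) = 1 / t"
  by (auto simp: t_def powr_diff powr_minus_divide)
 define g where "g y = f y * indicator {i. ennreal (2 powr (real_of_int i - 1)) < f y} i" for y
 have g: "g y = (if ennreal t < f y then f y else 0)" for y by (simp add: g_def t_def)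
 have [measurable]: "g \<in> borel_measurable M" unfolding g by measurable
 define \<nu> where "\<nu> = density M (\<lambda>y. ennreal (1 / t) * g y)"
 define \<B> where "\<B> = {(x, r). 0 < r \<and>
   ennreal (dyad i) * emeasure M (ball x r) < (\<integral>\<^sup>+y. f y * indicator (ball x r) y \<partial>M)}"
 have "emeasure M (\<Union>(x, r)\<in>\<B>. ball x (1 * r)) \<le> ennreal (cd ^ 3) * emeasure \<nu> (\<Union>(x, r)\<in>\<B>. ball x (1 * r))"
 proof (rule covering_estimate)
  fix x r assume "(x, r) \<in> \<B>"
  then have r: "0 < r" and big: "ennreal (dyad i) * emeasure M (ball x r) < (\<integral>\<^sup>+y. f y * indicator (ball x r) y \<partial>M)"
   by (auto simp: \<B>_def)
  have "(\<integral>\<^sup>+y. f y * indicator (ball x r) y \<partial>M) \<le> (\<integral>\<^sup>+y. g y * indicator (ball x r) y + ennreal t * indicator (ball x r) y \<partial>M)"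
   by (intro nn_integral_mono) (auto simp: g split: split_indicator)
  also have "\<dots> = (\<integral>\<^sup>+y. g y * indicator (ball x r) y \<partial>M) + ennreal t * emeasure M (ball x r)"
   by (subst nn_integral_add) (auto simp: nn_integral_cmult_indicator)
  finally have "ennreal (2 * t) * emeasure M (ball x r) \<le> (\<integral>\<^sup>+y. g y * indicator (ball x r) y \<partial>M) + ennreal t * emeasure M (ball x r)"
   using big t by simp
  moreover have "ennreal (2 * t) * emeasure M (ball x r) = ennreal (t * \<mu> x r) + ennreal (t * \<mu> x r)"
   using t(1) by (simp add: emeasure_ball ennreal_mult[symmetric] \<mu>_nonneg flip: ennreal_plus)
  moreover have "ennreal t * emeasure M (ball x r) = ennreal (t * \<mu> x r)"
   using t(1) by (simp add: emeasure_ball ennreal_mult[symmetric] \<mu>_nonneg)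
  ultimately have "ennreal (t * \<mu> x r) + ennreal (t * \<mu> x r) \<le> ennreal (t * \<mu> x r) + (\<integral>\<^sup>+y. g y * indicator (ball x r) y \<partial>M)"
   by (metis add.commute)
  then have "ennreal (t * \<mu> x r) \<le> (\<integral>\<^sup>+y. g y * indicator (ball x r) y \<partial>M)"
   unfolding ennreal_add_left_cancel_le by simp
  then have "ennreal (1 / t) * ennreal (t * \<mu> x r) \<le> ennreal (1 / t) * (\<integral>\<^sup>+y. g y * indicator (ball x r) y \<partial>M)"
   by (rule mult_left_mono) simp
  also have "ennreal (1 / t) * ennreal (t * \<mu> x r) = emeasure M (ball x r)"
   using t(1) by (simp add: emeasure_ball ennreal_mult[symmetric] \<mu>_nonneg)
  also have "ennreal (1 / t) * (\<integral>\<^sup>+y. g y * indicator (ball x r) y \<partial>M) = emeasure \<nu> (ball x (1 * r))"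
   by (simp add: \<nu>_def emeasure_density nn_integral_cmult mult.assoc)
  finally show "0 < r \<and> emeasure M (ball x r) \<le> emeasure \<nu> (ball x (1 * r))" using r by simp
 qed (auto simp: \<nu>_def)
 also have "\<dots> \<le> ennreal (cd ^ 3) * emeasure \<nu> (space \<nu>)"
  by (intro mult_left_mono emeasure_space) simp
 also have "emeasure \<nu> (space \<nu>) = ennreal (1 / t) * (\<integral>\<^sup>+y. g y \<partial>M)"
 proof -
  have "emeasure \<nu> (space M) = (\<integral>\<^sup>+y. ennreal (1 / t) * g y * indicator (space M) y \<partial>M)"
   unfolding \<nu>_def by (rule emeasure_density[OF _ sets.top]) measurable
  then show ?thesis by (simp add: \<nu>_def nn_integral_cmult)
 qed
 also have "ennreal (cd ^ 3) * (ennreal (1 / t) * (\<integral>\<^sup>+y. g y \<partial>M)) = ennreal (cd ^ 3 * (1 / t)) * (\<integral>\<^sup>+y. g y \<partial>M)"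
  using t(1) cd by (subst ennreal_mult) (auto simp: mult.assoc)
 finally show ?thesis
  unfolding max_level_def \<B>_def[symmetric] t(3) by (simp only: g_def)
qed

text \<open>Marcinkiewicz interpolation: weigh the weak bounds by 2^(ip), sum over i and interchange
  with the integral. At a point y only levels with 2^(i-1) < f y contribute, with weights
  2^(i(p-1)), and since p > 1 this geometric sum is at most a multiple of (f y)^(p-1).\<close>

theorem maximal_strong_bound:
 assumes p: "1 < p"
 shows "\<exists>C>0. \<forall>f\<in>borel_measurable M. (pint M p (maximal p f)) \<le> ennreal C * (pint M p f)"
proof -
 define K where "K = 2 powr (p - 1) / (1 - 2 powr (- (p - 1)))"
 have K: "K > 0" using p by (simp add: K_def powr_less_one)
 define C where "C = 2 powr p * (2 * cd ^ 3 * K)"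
 have "(pint M p (maximal p f)) \<le> ennreal C * (pint M p f)"
  if f[measurable]: "f \<in> borel_measurable M" for f
 proof -
  define I where "I i y = (indicator {i. ennreal (2 powr (real_of_int i - 1)) < f y} i :: ennreal)" for i y
  have I: "I i y = (if ennreal (2 powr (real_of_int i - 1)) < f y then 1 else 0 :: ennreal)" for i y by (simp add: I_def)
  have [measurable]: "(\<lambda>y. I i y) \<in> borel_measurable M" for i unfolding I by measurable
  have "(\<integral>\<^sup>+x. ennreal_powr (dyadic_fun p (max_level f) x) p \<partial>M) =
    (\<Sum>n. ennreal (2 powr (real_of_int (int_decode n) * p)) * emeasure M (max_level f (int_decode n)))"
   using p by (intro nn_integral_dyadic_fun) auto
  also have "\<dots> \<le> (\<Sum>n. \<integral>\<^sup>+y. ennreal (2 * cd ^ 3) * (f y * (ennreal (2 powr (real_of_int (int_decode n) * (p - 1))) * I (int_decode n) y)) \<partial>M)"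
  proof (rule suminf_le)
   fix n
   define i where "i = int_decode n"
   have "ennreal (2 powr (real_of_int i * p)) * emeasure M (max_level f i) \<le>
     ennreal (2 powr (real_of_int i * p)) * (ennreal (cd ^ 3 * 2 powr (1 - real_of_int i)) * (\<integral>\<^sup>+y. f y * I i y \<partial>M))"
    unfolding I_def by (intro mult_left_mono max_level_weak_bound f) simp
   also have "\<dots> = ennreal (2 * cd ^ 3 * 2 powr (real_of_int i * (p - 1))) * (\<integral>\<^sup>+y. f y * I i y \<partial>M)"
   proof -
    have "2 powr (real_of_int i * p) * (cd ^ 3 * 2 powr (1 - real_of_int i)) = 2 * cd ^ 3 * 2 powr (real_of_int i * (p - 1))"
     by (simp add: powr_diff right_diff_distrib)
    moreover have "ennreal (2 powr (real_of_int i * p)) * ennreal (cd ^ 3 * 2 powr (1 - real_of_int i)) =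
      ennreal (2 powr (real_of_int i * p) * (cd ^ 3 * 2 powr (1 - real_of_int i)))"
     using cd by (intro ennreal_mult[symmetric]) auto
    ultimately show ?thesis by (simp only: mult.assoc[symmetric])
   qed
   also have "\<dots> = (\<integral>\<^sup>+y. ennreal (2 * cd ^ 3 * 2 powr (real_of_int i * (p - 1))) * (f y * I i y) \<partial>M)"
    by (intro nn_integral_cmult[symmetric]) measurable
   also have "\<dots> = (\<integral>\<^sup>+y. ennreal (2 * cd ^ 3) * (f y * (ennreal (2 powr (real_of_int i * (p - 1))) * I i y)) \<partial>M)"
    using cd by (intro nn_integral_cong) (simp add: ennreal_mult ac_simps)
   finally show "ennreal (2 powr (real_of_int (int_decode n) * p)) * emeasure M (max_level f (int_decode n)) \<le>
     (\<integral>\<^sup>+y. ennreal (2 * cd ^ 3) * (f y * (ennreal (2 powr (real_of_int (int_decode n) * (p - 1))) * I (int_decode n) y)) \<partial>M)"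
    by (simp add: i_def)
  qed auto
  also have "\<dots> = (\<integral>\<^sup>+y. (\<Sum>n. ennreal (2 * cd ^ 3) * (f y * (ennreal (2 powr (real_of_int (int_decode n) * (p - 1))) * I (int_decode n) y))) \<partial>M)"
   by (intro nn_integral_suminf[symmetric]) measurable
  also have "\<dots> \<le> (\<integral>\<^sup>+y. ennreal (2 * cd ^ 3 * K) * ennreal_powr (f y) p \<partial>M)"
  proof (rule nn_integral_mono)
   fix y
   have "(\<Sum>n. ennreal (2 * cd ^ 3) * (f y * (ennreal (2 powr (real_of_int (int_decode n) * (p - 1))) * I (int_decode n) y))) =
     ennreal (2 * cd ^ 3) * (f y * (\<Sum>n. ennreal (2 powr (real_of_int (int_decode n) * (p - 1))) * I (int_decode n) y))"
    by (simp add: ennreal_suminf_cmult)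
   also have "\<dots> \<le> ennreal (2 * cd ^ 3) * (f y * (ennreal K * ennreal_powr (f y) (p - 1)))"
    unfolding I_def K_def using p by (intro mult_left_mono dyadic_layer_sum) auto
   also have "\<dots> = ennreal (2 * cd ^ 3 * K) * (f y * ennreal_powr (f y) (p - 1))"
    using cd K by (simp add: ennreal_mult ac_simps)
   also have "f y * ennreal_powr (f y) (p - 1) = ennreal_powr (f y) p"
   proof (cases "f y")
    case (real r)
    then show ?thesis by (cases "r = 0") (auto simp: ennreal_powr_ennreal ennreal_mult[symmetric] powr_diff)
   qed (simp add: ennreal_top_mult)
   finally show "(\<Sum>n. ennreal (2 * cd ^ 3) * (f y * (ennreal (2 powr (real_of_int (int_decode n) * (p - 1))) * I (int_decode n) y))) \<le>
     ennreal (2 * cd ^ 3 * K) * ennreal_powr (f y) p" .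
  qed
  also have "\<dots> = ennreal (2 * cd ^ 3 * K) * (pint M p f)"
   by (intro nn_integral_cmult) measurable
  finally have "(\<integral>\<^sup>+x. ennreal_powr (dyadic_fun p (max_level f) x) p \<partial>M) \<le> ennreal (2 * cd ^ 3 * K) * (pint M p f)" .
  moreover have "(pint M p (maximal p f)) =
    ennreal (2 powr p) * (\<integral>\<^sup>+x. ennreal_powr (dyadic_fun p (max_level f) x) p \<partial>M)"
  proof -
   have "ennreal_powr 2 p = ennreal (2 powr p)" using ennreal_powr_ennreal[of 2 p] by simp
   then show ?thesis unfolding maximal_def using p by (simp add: ennreal_powr_mult nn_integral_cmult)
  qed
  ultimately have "(pint M p (maximal p f)) \<le> ennreal (2 powr p) * (ennreal (2 * cd ^ 3 * K) * (pint M p f))"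
   by (simp add: mult_left_mono)
  then show ?thesis using cd K by (simp add: C_def ennreal_mult mult.assoc)
 qed
 moreover have "C > 0" using K cd by (simp add: C_def)
 ultimately show ?thesis by blast
qed

end

section \<open>Weak upper gradients yield Hajlasz gradients on PI spaces\<close>

lemma mcshane_extension:
 fixes f :: "'a::metric_space \<Rightarrow> real"
 assumes L: "0 \<le> L" and lip: "\<And>x y. x \<in> S \<Longrightarrow> y \<in> S \<Longrightarrow> \<bar>f x - f y\<bar> \<le> L * dist x y"
 shows "\<exists>h. (\<forall>x\<in>S. h x = f x) \<and> (\<forall>x y. \<bar>h x - h y\<bar> \<le> L * dist x y)"
proof (cases "S = {}")
 case True
 then show ?thesis using L by (intro exI[of _ "\<lambda>_. 0"]) auto
next
 case False
 then obtain s0 where s0: "s0 \<in> S" by blast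
 define h where "h x = (INF y\<in>S. f y + L * dist x y)" for x
 have bdd: "bdd_below ((\<lambda>y. f y + L * dist x y) ` S)" for x
 proof (rule bdd_belowI2)
  fix y assume y: "y \<in> S"
  have "f s0 - f y \<le> L * dist s0 y" using lip[OF s0 y] by linarith
  also have "\<dots> \<le> L * (dist x s0 + dist x y)"
   using L dist_triangle3[of s0 y x] by (intro mult_left_mono) (auto simp: dist_commute)
  finally show "f s0 - L * dist x s0 \<le> f y + L * dist x y" by (simp add: algebra_simps)
 qed
 have le: "h x \<le> h y + L * dist x y" for x y
 proof -
  have "h x - L * dist x y \<le> h y"
   unfolding h_def[of y]
  proof (rule cINF_greatest[OF False])
   fix z assume z: "z \<in> S"
   have "h x \<le> f z + L * dist x z" unfolding h_def using bdd z by (rule cINF_lower)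
   also have "\<dots> \<le> f z + L * (dist x y + dist y z)"
    using L dist_triangle[of x z y] by (intro add_left_mono mult_left_mono) auto
   finally show "h x - L * dist x y \<le> f z + L * dist y z" by (simp add: algebra_simps)
  qed
  then show ?thesis by simp
 qed
 have "h x = f x" if x: "x \<in> S" for x
 proof (rule antisym)
  show "h x \<le> f x" unfolding h_def using cINF_lower[OF bdd x, of x] by simp
  show "f x \<le> h x"
   unfolding h_def
  proof (rule cINF_greatest[OF False])
   show "f x \<le> f y + L * dist x y" if "y \<in> S" for y using lip[OF x that] by linarith
  qed
 qed
 moreover have "\<bar>h x - h y\<bar> \<le> L * dist x y" for x y
  using le[of x y] le[of y x] by (simp add: dist_commute abs_le_iff)
 ultimately show ?thesis by blast
qed

section \<open>Lipschitz truncations along paths\<close>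

context rectifiable_path
begin

text \<open>Increments of \<psi> are dominated by those of the distribution function of G restricted
  to \<open>{a<..b}\<close>, which is continuous because the length measure has no atoms.\<close>

lemma continuous_of_gradient:
 fixes \<psi> :: "real \<Rightarrow> real" and G :: "real \<Rightarrow> ennreal"
 assumes [measurable]: "G \<in> borel_measurable borel"
  and \<psi>: "\<And>s t. a \<le> s \<Longrightarrow> s \<le> t \<Longrightarrow> t \<le> b \<Longrightarrow> ennreal \<bar>\<psi> s - \<psi> t\<bar> \<le> emeasure (density lm G) {s<..t}"
  and fin: "emeasure (density lm G) {a<..b} < \<infinity>"
 shows "continuous_on {a..b} \<psi>"
proof -
 define D where "D = density lm (\<lambda>\<tau>. G \<tau> * indicator {a<..b} \<tau>)"
 have D_sets: "sets D = sets borel" by (simp add: D_def)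
 have D_em: "emeasure D X = emeasure (density lm G) (X \<inter> {a<..b})" if "X \<in> sets borel" for X
  using that unfolding D_def by (simp add: emeasure_density indicator_inter_arith ac_simps)
 have fm: "finite_measure D"
  using D_em[of UNIV] fin by (intro finite_measureI) (simp add: D_def)
 interpret D: finite_borel_measure D
  using fm D_sets by (simp add: finite_borel_measure_def finite_borel_measure_axioms_def)
 have "isCont (cdf D) t" for t
 proof -
  have "{t} \<inter> {a<..b} \<in> null_sets (density lm G)"
  proof (subst null_sets_density_iff)
   have "{t} \<in> null_sets lm" using emeasure_lm_singleton by (auto simp: null_sets_def)
   then have "AE \<tau> in lm. \<tau> \<notin> {t}" by (rule AE_not_in)
   then have "AE \<tau> in lm. \<tau> \<in> {t} \<inter> {a<..b} \<longrightarrow> G \<tau> = 0"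
    by (rule eventually_mono) auto
   then show "{t} \<inter> {a<..b} \<in> sets lm \<and> (AE \<tau> in lm. \<tau> \<in> {t} \<inter> {a<..b} \<longrightarrow> G \<tau> = 0)"
    by simp
  qed simp
  then have "emeasure D {t} = 0" by (simp add: D_em null_sets_def)
  then show ?thesis by (simp add: D.isCont_cdf measure_def)
 qed
 then have cont: "continuous_on UNIV (cdf D)" by (simp add: continuous_on_eq_continuous_at)
 have diff: "\<bar>\<psi> s - \<psi> t\<bar> \<le> \<bar>cdf D s - cdf D t\<bar>" if "s \<in> {a..b}" "t \<in> {a..b}" for s t
 proof -
  have le: "\<bar>\<psi> s - \<psi> t\<bar> \<le> cdf D t - cdf D s" if "a \<le> s" "s \<le> t" "t \<le> b" for s t
  proof -
   have "{s<..t} \<inter> {a<..b} = {s<..t}" using that by auto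
   then have "ennreal \<bar>\<psi> s - \<psi> t\<bar> \<le> emeasure D {s<..t}" using \<psi>[OF that] D_em[of "{s<..t}"] by simp
   also have "\<dots> = ennreal (measure D {s<..t})" by (rule D.emeasure_eq_measure)
   finally have "\<bar>\<psi> s - \<psi> t\<bar> \<le> measure D {s<..t}" by simp
   also have "\<dots> = cdf D t - cdf D s"
    using that by (cases "s = t") (auto simp: D.cdf_diff_eq)
   finally show ?thesis .
  qed
  show ?thesis
   using le[of s t] le[of t s] that by (cases "s \<le> t") (auto simp: abs_minus_commute)
 qed
 show ?thesis
  unfolding continuous_on_iff dist_real_def
 proof (intro ballI allI impI)
  fix t e :: real assume t: "t \<in> {a..b}" and e: "e > 0"
  obtain d where "d > 0" "\<And>s. \<bar>s - t\<bar> < d \<Longrightarrow> \<bar>cdf D s - cdf D t\<bar> < e"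
   using cont e unfolding continuous_on_iff dist_real_def by (meson UNIV_I)
  then show "\<exists>d>0. \<forall>s\<in>{a..b}. \<bar>s - t\<bar> < d \<longrightarrow> \<bar>\<psi> s - \<psi> t\<bar> < e"
   using le_less_trans[OF diff[OF _ t]] by (intro exI[of _ d]) blast
 qed
qed

text \<open>Along the path h has gradient L and f has gradient \<rho>; where they agree either may
  be used, so \<open>glue_along_path\<close> applies. The assumption \<open>N_fin\<close> says that
  the path spends no length in the null set N, on which nothing is known.\<close>

lemma truncated_gradient:
 fixes f h :: "'z \<Rightarrow> real" and \<rho> :: "'z \<Rightarrow> ennreal"
 assumes \<rho>: "\<rho> \<in> borel_measurable borel" and N: "N \<in> sets borel" and U: "open U" and L: "0 \<le> L"
  and h: "\<And>x y. \<bar>h x - h y\<bar> \<le> L * dist x y" and eq: "\<And>x. x \<notin> U \<Longrightarrow> x \<notin> N \<Longrightarrow> h x = f x"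
  and upper: "\<And>s t. a \<le> s \<Longrightarrow> s \<le> t \<Longrightarrow> t \<le> b \<Longrightarrow> ennreal \<bar>f (\<gamma> s) - f (\<gamma> t)\<bar> \<le> curve_integral \<rho> (s, t, \<gamma>)"
  and fin: "curve_integral \<rho> (a, b, \<gamma>) < \<infinity>"
  and N_fin: "curve_integral (\<lambda>x. \<infinity> * indicator N x) (a, b, \<gamma>) < \<infinity>"
 shows "ennreal \<bar>h (\<gamma> a) - h (\<gamma> b)\<bar> \<le>
  curve_integral (\<lambda>x. ennreal L * indicator U x + \<rho> x * indicator (- U) x) (a, b, \<gamma>)"
proof -
 have img: "\<gamma> ` {a..b} \<subseteq> UNIV" by simp
 have bm: "\<sigma> \<in> borel_measurable borel \<Longrightarrow> \<sigma> \<in> borel_on UNIV" for \<sigma> :: "'z \<Rightarrow> ennreal"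
  by (rule measurable_restrict_space1)
 define G where "G \<tau> = \<rho> (\<gamma> \<tau>) * indicator {a..b} \<tau>" for \<tau>
 have G[measurable]: "G \<in> borel_measurable borel"
  unfolding G_def using measurable_along(1)[OF bm[OF \<rho>] img, of a b] by simp
 let ?D = "emeasure (density lm G)"
 have D: "?D {s<..t} = curve_integral \<rho> (s, t, \<gamma>)" if "a \<le> s" "s \<le> t" "t \<le> b" for s t
  unfolding curve_integral_subpath[OF bm[OF \<rho>] img that] using that
  by (subst emeasure_density) (auto simp: G_def intro!: nn_integral_cong split: split_indicator)
 \<comment> \<open>Times at which h = f is given. The closure \<open>K\<close> is still mapped
   outside the open set U, and h = f persists on it because both are continuous along the path.
   Times outside \<open>K\<close> lie in U, except for a set of length 0 that is mapped into
   N.\<close>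
 define T where "T = {t\<in>{a..b}. \<gamma> t \<notin> U \<and> \<gamma> t \<notin> N}"
 define K where "K = closure T"
 have closed_nU: "closed {t\<in>{a..b}. \<gamma> t \<in> - U}"
  using continuous_closed_preimage[OF continuous _ , of "- U"] U
  by (simp add: vimage_def Int_def closed_Compl)
 have K_sub: "K \<subseteq> {t\<in>{a..b}. \<gamma> t \<in> - U}"
  unfolding K_def using closed_nU by (intro closure_minimal) (auto simp: T_def)
 have \<psi>_cont: "continuous_on {a..b} (\<lambda>t. f (\<gamma> t))"
  by (rule continuous_of_gradient[OF G]) (use upper D fin ab in auto)
 have \<phi>_lip: "ennreal \<bar>h (\<gamma> s) - h (\<gamma> t)\<bar> \<le> ennreal L * emeasure lm {s<..t}" if "a \<le> s" "s \<le> t" "t \<le> b" for s t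
 proof -
  have "ennreal \<bar>h (\<gamma> s) - h (\<gamma> t)\<bar> \<le> ennreal L * ennreal (dist (\<gamma> s) (\<gamma> t))"
   using h L by (simp add: ennreal_mult[symmetric] ennreal_leI)
  also have "\<dots> \<le> ennreal L * emeasure lm {s<..t}" by (intro mult_left_mono dist_le_lm that) simp
  finally show ?thesis .
 qed
 have \<phi>_cont: "continuous_on {a..b} (\<lambda>t. h (\<gamma> t))"
 proof -
  have "L-lipschitz_on UNIV h" using h L by (intro lipschitz_onI) (auto simp: dist_real_def)
  then have "continuous_on UNIV h" by (rule lipschitz_on_continuous_on)
  then show ?thesis using continuous_on_compose2[OF _ continuous] by blast
 qed
 have agree: "h (\<gamma> t) = f (\<gamma> t)" if "t \<in> K" for t
 proof -
  have tab: "t \<in> {a..b}" using that K_sub by blast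
  obtain s where s: "\<And>n. s n \<in> T" "s \<longlonglongrightarrow> t" using \<open>t \<in> K\<close> unfolding K_def closure_sequential by blast
  have sab: "s n \<in> {a..b}" "h (\<gamma> (s n)) = f (\<gamma> (s n))" for n using s(1)[of n] eq by (auto simp: T_def)
  have "(\<lambda>n. h (\<gamma> (s n))) \<longlonglongrightarrow> h (\<gamma> t)"
   by (rule continuous_on_tendsto_compose[OF \<phi>_cont s(2) tab]) (use sab in auto)
  moreover have "(\<lambda>n. f (\<gamma> (s n))) \<longlonglongrightarrow> f (\<gamma> t)"
   by (rule continuous_on_tendsto_compose[OF \<psi>_cont s(2) tab]) (use sab in auto)
  ultimately show ?thesis unfolding sab(2) by (rule LIMSEQ_unique)
 qed
 have "ennreal \<bar>h (\<gamma> a) - h (\<gamma> b)\<bar> \<le> ennreal L * emeasure lm ({a<..b} - K) + ?D ({a<..b} \<inter> K)"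
 proof (rule glue_along_path[OF G _ _ agree \<phi>_lip])
  show "closed K" by (simp add: K_def)
  show "K \<subseteq> {a..b}" using K_sub by blast
  show "ennreal \<bar>f (\<gamma> s) - f (\<gamma> t)\<bar> \<le> ?D {s<..t}" if "a \<le> s" "s \<le> t" "t \<le> b" for s t
   using upper[OF that] D[OF that] by simp
  show "?D {a<..b} < \<infinity>" using D[of a b] fin ab by simp
 qed
 also have "emeasure lm ({a<..b} - K) \<le> (\<integral>\<^sup>+\<tau>. indicator U (\<gamma> \<tau>) * indicator {a<..b} \<tau> \<partial>lm)"
 proof -
  have m: "(\<lambda>\<tau>. \<infinity> * indicator N (\<gamma> \<tau>) * indicator {a<..b} \<tau> :: ennreal) \<in> borel_measurable borel"
   using N by (intro measurable_along(2)[OF bm img]) auto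
  have "(\<integral>\<^sup>+\<tau>. \<infinity> * indicator N (\<gamma> \<tau>) * indicator {a<..b} \<tau> \<partial>lm) \<noteq> \<infinity>"
   using N_fin N by (subst (asm) curve_integral_eq[OF bm img]) auto
  then have "AE \<tau> in lm. \<infinity> * indicator N (\<gamma> \<tau>) * indicator {a<..b} \<tau> \<noteq> (\<infinity>::ennreal)"
   using m by (intro nn_integral_noteq_infinite) auto
  then have "AE \<tau> in lm. indicator ({a<..b} - K) \<tau> \<le> (indicator U (\<gamma> \<tau>) * indicator {a<..b} \<tau> :: ennreal)"
  proof eventually_elim
   case (elim \<tau>)
   show ?case
   proof (cases "\<tau> \<in> {a<..b} - K \<and> \<gamma> \<tau> \<notin> U")
    case True
    then have "\<tau> \<notin> T" using closure_subset[of T] unfolding K_def by blast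
    then have "\<gamma> \<tau> \<in> N" using True by (auto simp: T_def)
    then show ?thesis using elim True by simp
   qed (auto split: split_indicator)
  qed
  then have "(\<integral>\<^sup>+\<tau>. indicator ({a<..b} - K) \<tau> \<partial>lm) \<le> (\<integral>\<^sup>+\<tau>. indicator U (\<gamma> \<tau>) * indicator {a<..b} \<tau> \<partial>lm)"
   by (rule nn_integral_mono_AE)
  then show ?thesis by (simp add: K_def)
 qed
 also have "?D ({a<..b} \<inter> K) \<le> (\<integral>\<^sup>+\<tau>. \<rho> (\<gamma> \<tau>) * indicator (- U) (\<gamma> \<tau>) * indicator {a<..b} \<tau> \<partial>lm)"
  using K_sub borel_closed[OF closed_closure[of T]] by (subst emeasure_density) (auto simp: K_def[symmetric] G_def intro!: nn_integral_mono split: split_indicator)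
 also have "ennreal L * (\<integral>\<^sup>+\<tau>. indicator U (\<gamma> \<tau>) * indicator {a<..b} \<tau> \<partial>lm) +
   (\<integral>\<^sup>+\<tau>. \<rho> (\<gamma> \<tau>) * indicator (- U) (\<gamma> \<tau>) * indicator {a<..b} \<tau> \<partial>lm) =
   (\<integral>\<^sup>+\<tau>. ennreal L * (indicator U (\<gamma> \<tau>) * indicator {a<..b} \<tau>) + \<rho> (\<gamma> \<tau>) * indicator (- U) (\<gamma> \<tau>) * indicator {a<..b} \<tau> \<partial>lm)"
 proof -
  have m1[measurable]: "(\<lambda>\<tau>. indicator U (\<gamma> \<tau>) * indicator {a<..b} \<tau> :: ennreal) \<in> borel_measurable borel"
   using U by (intro measurable_along(2)[OF bm img]) auto
  have m2[measurable]: "(\<lambda>\<tau>. \<rho> (\<gamma> \<tau>) * indicator (- U) (\<gamma> \<tau>) * indicator {a<..b} \<tau> :: ennreal) \<in> borel_measurable borel"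
   using U \<rho> by (intro measurable_along(2)[OF bm[of "\<lambda>x. \<rho> x * indicator (- U) x"] img]) auto
  show ?thesis by (subst nn_integral_add) (auto simp: nn_integral_cmult)
 qed
 also have "\<dots> = curve_integral (\<lambda>x. ennreal L * indicator U x + \<rho> x * indicator (- U) x) (a, b, \<gamma>)"
  using U \<rho> by (subst curve_integral_eq[OF bm img]) (auto intro!: nn_integral_cong split: split_indicator)
 finally show ?thesis by (simp add: add_mono mult_left_mono)
qed

end

section \<open>Bad balls and the Lipschitz bound off their union\<close>

context doubling_measure
begin

text \<open>So small that the exceptional parts of two balls, whose measures differ by at most two
  doublings, cannot together fill the smaller one; the remaining parts then have a common
  point.\<close>

definition \<theta> :: real where "\<theta> = 1 / (4 * cd\<^sup>2)"

lemma \<theta>: "0 < \<theta>" "\<theta> \<le> 1 / 4" "\<theta> * cd\<^sup>2 = 1 / 4" "\<theta> * cd \<le> 1 / 4"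
proof -
 have "1 \<le> cd\<^sup>2" "cd \<le> cd\<^sup>2" using cd by (auto intro: one_le_power self_le_power)
 then show pos: "0 < \<theta>" and eq: "\<theta> * cd\<^sup>2 = 1 / 4" using cd by (simp_all add: \<theta>_def)
 have "\<theta> * 1 \<le> \<theta> * cd\<^sup>2" "\<theta> * cd \<le> \<theta> * cd\<^sup>2"
  using pos \<open>1 \<le> cd\<^sup>2\<close> \<open>cd \<le> cd\<^sup>2\<close> by (intro mult_left_mono; simp)+
 then show "\<theta> \<le> 1 / 4" "\<theta> * cd \<le> 1 / 4" using eq by simp_all
qed

text \<open>One index n is enough to make a ball bad, so all \<open>f n\<close> are controlled off
  the same set. Deviation from every constant, rather than from the average, allows the constant to
  be chosen later as the average of a truncated function.\<close>

definition bad :: "('i \<Rightarrow> 'z \<Rightarrow> real) \<Rightarrow> real \<Rightarrow> ('z \<times> real) set" where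
 "bad f l = {(x, r). 0 < r \<and> (\<exists>n. \<forall>c. \<theta> * \<mu> x r < measure M {z \<in> ball x r. l * r < \<bar>f n z - c\<bar>})}"

text \<open>\<kappa> is the dilation in the Poincare inequality, so that the bounds for single bad
  balls can be fed into \<open>covering_estimate\<close>.\<close>

definition bad_set :: "real \<Rightarrow> ('i \<Rightarrow> 'z \<Rightarrow> real) \<Rightarrow> real \<Rightarrow> 'z set" where
 "bad_set \<kappa> f l = (\<Union>(x, r)\<in>bad f l. ball x (\<kappa> * r))"

lemma open_bad_set: "open (bad_set \<kappa> f l)"
 by (auto simp: bad_set_def)

lemma bad_set_in_M [measurable]: "bad_set \<kappa> f l \<in> sets M"
 by (rule open_in_M[OF open_bad_set])

lemma deviation_set_in_M:
 fixes g :: "'z \<Rightarrow> real"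
 assumes "g \<in> borel_measurable M"
 shows "{z \<in> ball x r. s < \<bar>g z - c\<bar>} \<in> sets M"
proof -
 have [measurable]: "g \<in> borel_measurable M" by fact
 have "{z \<in> ball x r. s < \<bar>g z - c\<bar>} = ball x r \<inter> {z \<in> space M. s < \<bar>g z - c\<bar>}" by auto
 also have "\<dots> \<in> sets M" by measurable
 finally show ?thesis .
qed

lemma sub_ball_fmeasurable:
 assumes "A \<in> sets M" "A \<subseteq> ball x r" shows "A \<in> fmeasurable M"
 using assms finite_measure_ball_M[of A x r] by (intro fmeasurableI) (auto simp: Int_absorb2)

lemma deviation_set_fmeasurable:
 fixes g :: "'z \<Rightarrow> real"
 assumes "g \<in> borel_measurable M"
 shows "{z \<in> ball x r. s < \<bar>g z - c\<bar>} \<in> fmeasurable M"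
 by (rule sub_ball_fmeasurable[OF deviation_set_in_M[OF assms]]) blast

lemma bad_antimono:
 assumes f: "\<And>n. f n \<in> borel_measurable M" and l: "l \<le> l'" shows "bad f l' \<subseteq> bad f l"
proof
 fix B assume "B \<in> bad f l'"
 then obtain x r n where B: "B = (x, r)" "0 < r" and dev: "\<And>c. \<theta> * \<mu> x r < measure M {z \<in> ball x r. l' * r < \<bar>f n z - c\<bar>}"
  by (auto simp: bad_def)
 have "measure M {z \<in> ball x r. l' * r < \<bar>f n z - c\<bar>} \<le> measure M {z \<in> ball x r. l * r < \<bar>f n z - c\<bar>}" for c
 proof (rule measure_mono_fmeasurable)
  have "l * r \<le> l' * r" using l B(2) by (intro mult_right_mono) auto
  then show "{z \<in> ball x r. l' * r < \<bar>f n z - c\<bar>} \<subseteq> {z \<in> ball x r. l * r < \<bar>f n z - c\<bar>}" by auto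
  show "{z \<in> ball x r. l * r < \<bar>f n z - c\<bar>} \<in> fmeasurable M"
   by (rule deviation_set_fmeasurable[OF f])
 qed (rule deviation_set_in_M[OF f])
 then have "\<theta> * \<mu> x r < measure M {z \<in> ball x r. l * r < \<bar>f n z - c\<bar>}" for c
  using dev[of c] less_le_trans by blast
 then show "B \<in> bad f l" using B by (auto simp: bad_def)
qed

lemma bad_set_antimono:
 assumes "\<And>n. f n \<in> borel_measurable M" "l \<le> l'" shows "bad_set \<kappa> f l' \<subseteq> bad_set \<kappa> f l"
 unfolding bad_set_def using bad_antimono[of f l l', OF assms] by (intro UN_mono) auto

lemma exists_common_point:
 fixes g :: "'z \<Rightarrow> real"
 assumes g: "g \<in> borel_measurable M" and r: "0 < r" and sub: "ball y r \<subseteq> ball x s"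
  and 1: "measure M {z \<in> ball x s. a < \<bar>g z - c\<bar>} \<le> \<alpha>"
  and 2: "measure M {z \<in> ball y r. b < \<bar>g z - d\<bar>} \<le> \<beta>" and less: "\<alpha> + \<beta> < \<mu> y r"
 shows "\<exists>z\<in>ball y r. \<bar>g z - c\<bar> \<le> a \<and> \<bar>g z - d\<bar> \<le> b"
proof (rule ccontr)
 assume "\<not> ?thesis"
 then have cover: "ball y r \<subseteq> {z \<in> ball x s. a < \<bar>g z - c\<bar>} \<union> {z \<in> ball y r. b < \<bar>g z - d\<bar>}"
  using sub by (force simp: not_le)
 have fm: "{z \<in> ball x s. a < \<bar>g z - c\<bar>} \<in> fmeasurable M" "{z \<in> ball y r. b < \<bar>g z - d\<bar>} \<in> fmeasurable M"
  by (rule deviation_set_fmeasurable[OF g])+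
 have "\<mu> y r \<le> measure M ({z \<in> ball x s. a < \<bar>g z - c\<bar>} \<union> {z \<in> ball y r. b < \<bar>g z - d\<bar>})"
  unfolding \<mu>_def by (rule measure_mono_fmeasurable[OF cover]) (use fm in auto)
 also have "\<dots> \<le> measure M {z \<in> ball x s. a < \<bar>g z - c\<bar>} + measure M {z \<in> ball y r. b < \<bar>g z - d\<bar>}"
  using fm by (intro measure_Un_le) (auto simp: fmeasurable_def)
 finally show False using 1 2 less by linarith
qed

text \<open>About a point w off the bad set, every ball has a constant \<open>c w r\<close> near
  which \<open>f n\<close> stays on most of the ball. The constants for radii s and s/2 differ by at
  most 3/2 l s, which telescopes to 3 l r; approximate continuity identifies the limit as
  \<open>f n w\<close>, with total error 4 l r. For d = dist x y, comparing the constants of x at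
  radius 2 d and of y at radius d gives 8 + 2 + 1 + 4 = 15.\<close>

lemma lipschitz_off_bad_set:
 assumes f: "\<And>n. f n \<in> borel_measurable M" and \<kappa>: "1 \<le> \<kappa>" and l: "0 < l"
  and x: "x \<notin> bad_set \<kappa> f l" "approx_continuous (f n) x" and y: "y \<notin> bad_set \<kappa> f l" "approx_continuous (f n) y"
 shows "\<bar>f n x - f n y\<bar> \<le> 15 * l * dist x y"
proof (cases "x = y")
 case neq: False
 have ex: "\<exists>c. measure M {z \<in> ball w r. l * r < \<bar>f n z - c\<bar>} \<le> \<theta> * \<mu> w r"
  if "w \<notin> bad_set \<kappa> f l" "0 < r" for w r
 proof (rule ccontr)
  assume "\<not> ?thesis"
  then have "(w, r) \<in> bad f l" using \<open>0 < r\<close> by (auto simp: bad_def not_le)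
  moreover have "w \<in> ball w (\<kappa> * r)" using \<kappa> \<open>0 < r\<close> by simp
  ultimately show False using \<open>w \<notin> bad_set \<kappa> f l\<close> by (auto simp: bad_set_def)
 qed
 define c where "c w r = (SOME c. measure M {z \<in> ball w r. l * r < \<bar>f n z - c\<bar>} \<le> \<theta> * \<mu> w r)" for w r
 have c: "measure M {z \<in> ball w r. l * r < \<bar>f n z - c w r\<bar>} \<le> \<theta> * \<mu> w r" if "w \<notin> bad_set \<kappa> f l" "0 < r" for w r
  unfolding c_def by (rule someI_ex[OF ex[OF that]])
 have near: "\<bar>f n w - c w r\<bar> \<le> 4 * l * r" if w: "w \<notin> bad_set \<kappa> f l" "approx_continuous (f n) w" and r: "0 < r" for w r
 proof -
  have half: "\<bar>c w s - c w (s / 2)\<bar> \<le> 3 / 2 * l * s" if s: "0 < s" for s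
  proof -
   have "\<exists>z\<in>ball w (s / 2). \<bar>f n z - c w s\<bar> \<le> l * s \<and> \<bar>f n z - c w (s / 2)\<bar> \<le> l * (s / 2)"
   proof (rule exists_common_point[OF f[of n], where x=w and s=s and \<alpha>="\<theta> * \<mu> w s" and \<beta>="\<theta> * \<mu> w (s / 2)"])
    show "0 < s / 2" using s by simp
    show "ball w (s / 2) \<subseteq> ball w s" by (rule subset_ball) (use s in simp)
    show "measure M {z \<in> ball w s. l * s < \<bar>f n z - c w s\<bar>} \<le> \<theta> * \<mu> w s" by (rule c[OF w(1) s])
    show "measure M {z \<in> ball w (s / 2). l * (s / 2) < \<bar>f n z - c w (s / 2)\<bar>} \<le> \<theta> * \<mu> w (s / 2)"
     by (rule c[OF w(1)]) (use s in simp)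
    have "\<mu> w s \<le> cd * \<mu> w (s / 2)" using \<mu>_double[of "s / 2" w] s by simp
    then have "\<theta> * \<mu> w s \<le> \<theta> * cd * \<mu> w (s / 2)" using \<theta>(1) by (simp add: mult.assoc mult_left_mono)
    also have "\<dots> \<le> 1 / 4 * \<mu> w (s / 2)" using \<theta>(4) by (intro mult_right_mono \<mu>_nonneg)
    finally have "\<theta> * \<mu> w s \<le> 1 / 4 * \<mu> w (s / 2)" .
    moreover have "\<theta> * \<mu> w (s / 2) \<le> 1 / 4 * \<mu> w (s / 2)" using \<theta>(2) by (intro mult_right_mono \<mu>_nonneg)
    ultimately show "\<theta> * \<mu> w s + \<theta> * \<mu> w (s / 2) < \<mu> w (s / 2)" using \<mu>_pos[of "s / 2" w] s by linarith
   qed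
   then obtain z where "\<bar>f n z - c w s\<bar> \<le> l * s" "\<bar>f n z - c w (s / 2)\<bar> \<le> l * (s / 2)" by blast
   then have "\<bar>c w s - c w (s / 2)\<bar> \<le> l * s + l * (s / 2)" by linarith
   then show ?thesis by (simp add: algebra_simps)
  qed
  have iter: "\<bar>c w r - c w (r / 2 ^ i)\<bar> \<le> 3 * l * r * (1 - 1 / 2 ^ i)" for i
  proof (induction i)
   case (Suc i)
   have "\<bar>c w (r / 2 ^ i) - c w (r / 2 ^ Suc i)\<bar> \<le> 3 / 2 * l * (r / 2 ^ i)"
    using half[of "r / 2 ^ i"] r by (simp add: mult.commute)
   then have "\<bar>c w r - c w (r / 2 ^ Suc i)\<bar> \<le> 3 * l * r * (1 - 1 / 2 ^ i) + 3 / 2 * l * (r / 2 ^ i)"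
    using Suc by linarith
   also have "\<dots> = 3 * l * r * (1 - 1 / 2 ^ Suc i)" by (simp add: field_simps)
   finally show ?case .
  qed simp
  have "\<bar>f n w - c w r\<bar> \<le> 4 * l * r + \<delta>" if \<delta>: "\<delta> > 0" for \<delta>
  proof -
   obtain r0 where r0: "r0 > 0" "\<And>s. 0 < s \<and> s < r0 \<Longrightarrow> measure M {z \<in> ball w s. \<delta> < \<bar>f n z - f n w\<bar>} \<le> 1 / 4 * \<mu> w s"
    using w(2)[unfolded approx_continuous_def, rule_format, OF \<delta>, of "1 / 4"] by auto
   obtain i where i: "(1 / 2) ^ i < r0 / r" using real_arch_pow_inv[of "r0 / r" "1 / 2"] r r0(1) by auto
   define s where "s = r / 2 ^ i"
   have s: "0 < s" "s < r0" "s \<le> r" using i r by (auto simp: s_def field_simps power_one_over)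
   have "\<exists>z\<in>ball w s. \<bar>f n z - f n w\<bar> \<le> \<delta> \<and> \<bar>f n z - c w s\<bar> \<le> l * s"
   proof (rule exists_common_point[OF f[of n] s(1) order_refl])
    show "measure M {z \<in> ball w s. \<delta> < \<bar>f n z - f n w\<bar>} \<le> 1 / 4 * \<mu> w s" using r0(2) s by blast
    show "measure M {z \<in> ball w s. l * s < \<bar>f n z - c w s\<bar>} \<le> \<theta> * \<mu> w s" by (rule c[OF w(1) s(1)])
    have "\<theta> * \<mu> w s \<le> 1 / 4 * \<mu> w s" using \<theta>(2) by (intro mult_right_mono \<mu>_nonneg)
    then show "1 / 4 * \<mu> w s + \<theta> * \<mu> w s < \<mu> w s" using \<mu>_pos[OF s(1), of w] by linarith
   qed
   then obtain z where "\<bar>f n z - f n w\<bar> \<le> \<delta>" "\<bar>f n z - c w s\<bar> \<le> l * s" by blast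
   then have "\<bar>f n w - c w s\<bar> \<le> \<delta> + l * s" by linarith
   moreover have "l * s \<le> l * r" using s l by (intro mult_left_mono) auto
   moreover have "\<bar>c w r - c w s\<bar> \<le> 3 * l * r"
   proof -
    have "3 * l * r * (1 - 1 / 2 ^ i) \<le> 3 * l * r * 1" using l r by (intro mult_left_mono) auto
    then show ?thesis using iter[of i] by (simp add: s_def)
   qed
   ultimately show ?thesis by linarith
  qed
  then show ?thesis by (rule field_le_epsilon)
 qed
 define d where "d = dist x y"
 have d: "d > 0" using neq by (simp add: d_def)
 have "\<exists>z\<in>ball y d. \<bar>f n z - c x (2 * d)\<bar> \<le> l * (2 * d) \<and> \<bar>f n z - c y d\<bar> \<le> l * d"
 proof (rule exists_common_point[OF f[of n] d])
  show "measure M {z \<in> ball x (2 * d). l * (2 * d) < \<bar>f n z - c x (2 * d)\<bar>} \<le> \<theta> * \<mu> x (2 * d)"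
   by (rule c[OF x(1)]) (use d in simp)
  show "measure M {z \<in> ball y d. l * d < \<bar>f n z - c y d\<bar>} \<le> \<theta> * \<mu> y d" by (rule c[OF y(1) d])
  show "ball y d \<subseteq> ball x (2 * d)"
  proof
   fix z assume "z \<in> ball y d"
   then show "z \<in> ball x (2 * d)" using dist_triangle[of x z y] by (auto simp: d_def)
  qed
  have "\<mu> x (2 * d) \<le> cd ^ 2 * \<mu> y d" using d by (intro \<mu>_comparable) (auto simp: d_def dist_commute)
  then have "\<theta> * \<mu> x (2 * d) \<le> \<theta> * cd\<^sup>2 * \<mu> y d" using \<theta>(1) by (simp add: mult.assoc mult_left_mono)
  moreover have "\<theta> * \<mu> y d \<le> 1 / 4 * \<mu> y d" using \<theta>(2) by (intro mult_right_mono \<mu>_nonneg)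
  ultimately show "\<theta> * \<mu> x (2 * d) + \<theta> * \<mu> y d < \<mu> y d" using \<mu>_pos[OF d, of y] unfolding \<theta>(3) by linarith
 qed
 then obtain z where "\<bar>f n z - c x (2 * d)\<bar> \<le> l * (2 * d)" "\<bar>f n z - c y d\<bar> \<le> l * d" by blast
 moreover have "\<bar>f n x - c x (2 * d)\<bar> \<le> 4 * l * (2 * d)" "\<bar>f n y - c y d\<bar> \<le> 4 * l * d"
  using near[OF x, of "2 * d"] near[OF y d] d by simp_all
 ultimately have "\<bar>f n x - f n y\<bar> \<le> 4 * l * (2 * d) + l * (2 * d) + l * d + 4 * l * d" by linarith
 then show ?thesis by (simp add: d_def algebra_simps)
qed simp

end

lemma diameter_ball_le:
 fixes x :: "'a::metric_space" assumes "0 < r" shows "diameter (ball x r) \<le> 2 * r"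
proof -
 have "dist y z \<le> 2 * r" if "y \<in> ball x r" "z \<in> ball x r" for y z
  using that dist_triangle3[of y z x] by auto
 then have "(SUP (y, z)\<in>ball x r \<times> ball x r. dist y z) \<le> 2 * r"
  using assms by (intro cSUP_least) (auto intro!: exI[of _ x])
 then show ?thesis using assms by (auto simp: diameter_def)
qed

locale poincare_space = doubling_measure M cd for M :: "'z::{metric_space, second_countable_topology} measure" and cd +
 fixes p Cp \<kappa> :: real
 assumes p: "1 < p" and Cp: "0 < Cp" and \<kappa>: "1 \<le> \<kappa>"
  and poincare: "\<And>x r u \<rho>. 0 < r \<Longrightarrow> integrable (restrict_space M (ball x (\<kappa> * r))) u \<Longrightarrow>
   weak_upper_gradient (restrict_space M (ball x (\<kappa> * r))) p u \<rho> \<Longrightarrow>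
   Lp_integrable (restrict_space M (ball x (\<kappa> * r))) p \<rho> \<Longrightarrow>
   average M (ball x r) (\<lambda>y. \<bar>u y - average M (ball x r) u\<bar>) \<le>
   Cp * diameter (ball x r) *
   (enn2real (\<integral>\<^sup>+y. ennreal_powr (\<rho> y) p \<partial>restrict_space M (ball x (\<kappa> * r))) / measure M (ball x (\<kappa> * r))) powr (1 / p)"
begin

text \<open>By Chebyshev's inequality the mean deviation is at least l r \<eta>, by the Poincare
  inequality it is at most a multiple of r; the radius cancels. The measure of the dilated ball is
  replaced by the smaller \<open>\<mu> x r\<close>, which only enlarges the bound.\<close>

lemma poincare_deviation:
 assumes r: "0 < r" and u[measurable]: "u \<in> borel_measurable M"
  and int: "integrable (restrict_space M (ball x (\<kappa> * r))) u"
  and wug: "weak_upper_gradient (restrict_space M (ball x (\<kappa> * r))) p u \<sigma>"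
  and Lp: "Lp_integrable (restrict_space M (ball x (\<kappa> * r))) p \<sigma>"
  and l: "0 < l" and \<eta>: "0 < \<eta>"
  and dev: "\<eta> * \<mu> x r \<le> measure M {z \<in> ball x r. l * r < \<bar>u z - average M (ball x r) u\<bar>}"
 shows "emeasure M (ball x r) \<le> ennreal ((2 * Cp / (l * \<eta>)) powr p) *
  (\<integral>\<^sup>+y. ennreal_powr (\<sigma> y) p * indicator (ball x (\<kappa> * r)) y \<partial>M)"
proof -
 define B B' where "B = ball x r" and "B' = ball x (\<kappa> * r)"
 have [measurable]: "B \<in> sets M" "B' \<in> sets M" by (auto simp: B_def B'_def)
 have sub: "B \<subseteq> B'" unfolding B_def B'_def using mult_right_mono[of 1 \<kappa> r] r \<kappa> by (intro subset_ball) auto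
 define c where "c = average M B u"
 define I where "I = enn2real (pint (restrict_space M B') p \<sigma>)"
 have I_eq: "ennreal I = (\<integral>\<^sup>+y. ennreal_powr (\<sigma> y) p * indicator B' y \<partial>M)"
 proof -
  have "(pint (restrict_space M B') p \<sigma>) < \<infinity>"
   using Lp by (simp add: Lp_integrable_def B'_def)
  then have "ennreal I = (pint (restrict_space M B') p \<sigma>)" by (simp add: I_def)
  also have "\<dots> = (\<integral>\<^sup>+y. ennreal_powr (\<sigma> y) p * indicator B' y \<partial>M)"
   by (rule nn_integral_restrict_space) simp
  finally show ?thesis .
 qed
 have I0: "0 \<le> I" by (simp add: I_def)
 have "set_integrable M B' u"
  using int by (simp add: set_integrable_def integrable_restrict_space B'_def scaleR_conv_of_real)
 then have "set_integrable M B u" by (rule set_integrable_subset) (use sub in simp_all)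
 moreover have "set_integrable M B (\<lambda>_. c)"
  using ball_finite[of x r] by (simp add: set_integrable_def B_def)
 ultimately have int_dev: "set_integrable M B (\<lambda>y. \<bar>u y - c\<bar>)"
  by (intro set_integrable_abs set_integral_diff)
 have m: "0 < \<mu> x r" by (rule \<mu>_pos[OF r])
 have "l * r * (\<eta> * \<mu> x r) \<le> l * r * measure M {z \<in> B. l * r \<le> \<bar>u z - c\<bar>}"
 proof (intro mult_left_mono order_trans[OF dev])
  show "measure M {z \<in> ball x r. l * r < \<bar>u z - average M (ball x r) u\<bar>} \<le> measure M {z \<in> B. l * r \<le> \<bar>u z - c\<bar>}"
  proof (rule measure_mono_fmeasurable)
   have "{z \<in> B. l * r \<le> \<bar>u z - c\<bar>} = B \<inter> {z \<in> space M. l * r \<le> \<bar>u z - c\<bar>}" by auto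
   also have "\<dots> \<in> sets M" by measurable
   finally show "{z \<in> B. l * r \<le> \<bar>u z - c\<bar>} \<in> fmeasurable M" by (rule sub_ball_fmeasurable[of _ x r]) (auto simp: B_def)
   show "{z \<in> ball x r. l * r < \<bar>u z - average M (ball x r) u\<bar>} \<in> sets M" by (rule deviation_set_in_M[OF u])
  qed (auto simp: B_def c_def)
 qed (use l r in auto)
 also have "\<dots> \<le> (LINT y:B|M. \<bar>u y - c\<bar>)"
  using integral_Markov_inequality'_measure[OF int_dev _ _ mult_pos_pos[OF l r]] l r by (simp add: field_simps)
 also have "\<dots> = \<mu> x r * average M B (\<lambda>y. \<bar>u y - c\<bar>)"
  using m by (simp add: average_def \<mu>_def B_def)
 also have "\<dots> \<le> \<mu> x r * (Cp * (2 * r) * (I / \<mu> x r) powr (1 / p))"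
 proof (intro mult_left_mono)
  have "average M B (\<lambda>y. \<bar>u y - c\<bar>) \<le> Cp * diameter B * (I / measure M B') powr (1 / p)"
   using poincare[OF r int wug Lp] by (simp add: B_def B'_def c_def I_def)
  also have "\<dots> \<le> Cp * (2 * r) * (I / \<mu> x r) powr (1 / p)"
  proof (intro mult_mono powr_mono2 divide_left_mono)
   show "diameter B \<le> 2 * r" unfolding B_def by (rule diameter_ball_le[OF r])
   show "\<mu> x r \<le> measure M B'" using \<mu>_mono[OF sub[unfolded B_def B'_def]] by (simp add: \<mu>_def B'_def)
   then show "0 < measure M B' * \<mu> x r" using m by (simp add: zero_less_mult_iff)
   show "0 \<le> diameter B" unfolding B_def by (rule diameter_ge_0) simp
  qed (use Cp r I0 p m in auto)
  finally show "average M B (\<lambda>y. \<bar>u y - c\<bar>) \<le> Cp * (2 * r) * (I / \<mu> x r) powr (1 / p)" .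
 qed (rule \<mu>_nonneg)
 finally have "l * r * (\<eta> * \<mu> x r) \<le> \<mu> x r * (Cp * (2 * r) * (I / \<mu> x r) powr (1 / p))" .
 then have "(l * \<eta>) * (\<mu> x r * r) \<le> (2 * Cp * (I / \<mu> x r) powr (1 / p)) * (\<mu> x r * r)" by (simp add: ac_simps)
 then have "l * \<eta> \<le> 2 * Cp * (I / \<mu> x r) powr (1 / p)"
  by (rule mult_right_le_imp_le) (use m r in simp)
 then have "l * \<eta> / (2 * Cp) \<le> (I / \<mu> x r) powr (1 / p)" using Cp by (simp add: divide_simps mult.commute)
 then have "(l * \<eta> / (2 * Cp)) powr p \<le> ((I / \<mu> x r) powr (1 / p)) powr p"
  using l \<eta> Cp p by (intro powr_mono2) auto
 also have "\<dots> = I / \<mu> x r" using I0 m p by (simp add: powr_powr)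
 finally have "(l * \<eta> / (2 * Cp)) powr p * \<mu> x r \<le> I" using m by (simp add: field_simps)
 then have "\<mu> x r \<le> I / (l * \<eta> / (2 * Cp)) powr p"
  using l \<eta> Cp by (simp add: field_simps)
 also have "\<dots> = (2 * Cp / (l * \<eta>)) powr p * I"
  using l \<eta> Cp by (simp add: powr_divide)
 finally have "emeasure M (ball x r) \<le> ennreal ((2 * Cp / (l * \<eta>)) powr p * I)"
  unfolding emeasure_ball by (rule ennreal_leI)
 then show ?thesis using I0 I_eq by (simp add: ennreal_mult B'_def)
qed

end

lemma (in rectifiable_path) curve_integral_sum:
 assumes "finite J" "\<And>j. j \<in> J \<Longrightarrow> \<rho> j \<in> borel_on S" "\<gamma> ` {a..b} \<subseteq> S"
 shows "curve_integral (\<lambda>x. \<Sum>j\<in>J. \<rho> j x) (a, b, \<gamma>) = (\<Sum>j\<in>J. curve_integral (\<rho> j) (a, b, \<gamma>))"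
proof -
 have "curve_integral (\<lambda>x. \<Sum>j\<in>J. \<rho> j x) (a, b, \<gamma>) = (\<integral>\<^sup>+\<tau>. (\<Sum>j\<in>J. \<rho> j (\<gamma> \<tau>) * indicator {a<..b} \<tau>) \<partial>lm)"
  using assms by (subst curve_integral_eq[OF _ assms(3)]) (auto simp: sum_distrib_right)
 also have "\<dots> = (\<Sum>j\<in>J. \<integral>\<^sup>+\<tau>. \<rho> j (\<gamma> \<tau>) * indicator {a<..b} \<tau> \<partial>lm)"
  using measurable_along(2)[OF assms(2) assms(3), of _ a b] by (intro nn_integral_sum) auto
 also have "\<dots> = (\<Sum>j\<in>J. curve_integral (\<rho> j) (a, b, \<gamma>))"
  using assms by (intro sum.cong) (auto simp: curve_integral_eq[OF _ assms(3)])
 finally show ?thesis .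
qed

lemma nn_integral_restrict_powr:
 assumes "S \<in> sets M" "space M = UNIV"
 shows "(pint (restrict_space M S) p g) = (\<integral>\<^sup>+x. ennreal_powr (g x) p * indicator S x \<partial>M)"
 using assms by (intro nn_integral_restrict_space) simp

lemma Lp_integrable_restrict:
 assumes "Lp_integrable M p g" "S \<in> sets M" "space M = UNIV"
 shows "Lp_integrable (restrict_space M S) p g"
proof -
 have "(\<integral>\<^sup>+x. ennreal_powr (g x) p * indicator S x \<partial>M) \<le> pint M p g"
  by (intro nn_integral_mono) (auto split: split_indicator)
 then show ?thesis
  using assms unfolding Lp_integrable_def nn_integral_restrict_powr[OF assms(2,3)]
  by (auto intro: measurable_restrict_space1)
qed

text \<open>The exceptional family is described by a globally defined e, as the paths with infinite
  integral of e. This description survives restriction to a subset.\<close>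

lemma weak_upper_gradient_restrictI:
 fixes u :: "'z::metric_space \<Rightarrow> 'v::real_normed_vector"
 assumes S: "S \<in> sets M" "space M = UNIV" and \<sigma>: "\<sigma> \<in> borel_measurable borel"
  and e: "e \<in> borel_measurable borel" "Lp_integrable M p e"
  and upper: "\<And>a b \<gamma>. (a, b, \<gamma>) \<in> paths_in S \<Longrightarrow> curve_integral e (a, b, \<gamma>) < \<infinity> \<Longrightarrow>
   ennreal (norm (u (\<gamma> a) - u (\<gamma> b))) \<le> curve_integral \<sigma> (a, b, \<gamma>)"
 shows "weak_upper_gradient (restrict_space M S) p u \<sigma>"
proof -
 have sp: "space (restrict_space M S) = S" using S by (simp add: space_restrict_space)
 define \<Gamma> where "\<Gamma> = {c \<in> paths_in S. curve_integral e c = \<infinity>}"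
 have "p_negligible (restrict_space M S) p \<Gamma>"
  unfolding p_negligible_def sp
  using e Lp_integrable_restrict[OF e(2) S] by (auto simp: \<Gamma>_def intro: measurable_restrict_space1)
 moreover have "ennreal (norm (u (\<gamma> a) - u (\<gamma> b))) \<le> curve_integral \<sigma> (a, b, \<gamma>)"
  if "(a, b, \<gamma>) \<in> paths_in S - \<Gamma>" for a b \<gamma>
  using that by (intro upper) (auto simp: \<Gamma>_def less_top)
 ultimately show ?thesis
  unfolding weak_upper_gradient_def sp using \<sigma>
  by (intro conjI exI[of _ \<Gamma>]) (auto intro: measurable_restrict_space1)
qed

lemma sum_power2_le: "(\<Sum>j\<in>J. 2 ^ j :: real) \<le> 2 * 2 ^ m" if "J \<subseteq> {..m}"
proof -
 have "(\<Sum>j\<in>J. 2 ^ j :: real) \<le> (\<Sum>j\<le>m. 2 ^ j)" using that by (intro sum_mono2) auto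
 also have "\<dots> \<le> 2 * 2 ^ m" by (induction m) auto
 finally show ?thesis .
qed

text \<open>A sum of distinct powers of 2 is at most twice its largest term, so the p-th power of
  the sum is bounded by the sum of the p-th powers with a constant independent of the number of
  levels. A factor growing with that number would destroy the gain from averaging.\<close>

lemma geometric_layers_powr:
 fixes V :: "nat \<Rightarrow> 'a set"
 assumes J: "finite J" and c: "0 \<le> c" and p: "0 < p"
 shows "ennreal_powr (\<Sum>j\<in>J. ennreal (c * 2 ^ j) * indicator (V j) x) p \<le>
  ennreal ((2 * c) powr p) * (\<Sum>j\<in>J. ennreal (2 powr (real j * p)) * indicator (V j) x)"
proof -
 define J' where "J' = {j\<in>J. x \<in> V j}"
 have eq: "(\<Sum>j\<in>J. ennreal (c * 2 ^ j) * indicator (V j) x) = ennreal (c * (\<Sum>j\<in>J'. 2 ^ j))"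
 proof -
  have "(\<Sum>j\<in>J. ennreal (c * 2 ^ j) * indicator (V j) x) = (\<Sum>j\<in>J'. ennreal (c * 2 ^ j))"
   using J by (intro sum.mono_neutral_cong_right) (auto simp: J'_def)
  also have "\<dots> = ennreal (\<Sum>j\<in>J'. c * 2 ^ j)" using c by (intro sum_ennreal) auto
  finally show ?thesis by (simp add: sum_distrib_left)
 qed
 show ?thesis
 proof (cases "J' = {}")
  case True
  then show ?thesis using eq by simp
 next
  case False
  define m where "m = Max J'"
  have "finite J'" using J by (simp add: J'_def)
  then have m: "m \<in> J'" "J' \<subseteq> {..m}" using Max_in[OF _ False] by (auto simp: m_def)
  have "ennreal_powr (ennreal (c * (\<Sum>j\<in>J'. 2 ^ j))) p \<le> ennreal_powr (ennreal (2 * c * 2 ^ m)) p"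
   using mult_left_mono[OF sum_power2_le[OF m(2)] c] p
   by (intro ennreal_powr_mono ennreal_leI) (simp_all add: ac_simps)
  also have "\<dots> = ennreal ((2 * c) powr p * 2 powr (real m * p))"
   using c by (simp add: ennreal_powr_ennreal powr_mult powr_powr powr_realpow[symmetric])
  also have "\<dots> = ennreal ((2 * c) powr p) * (ennreal (2 powr (real m * p)) * indicator (V m) x)"
   using m by (simp add: ennreal_mult J'_def)
  also have "\<dots> \<le> ennreal ((2 * c) powr p) * (\<Sum>j\<in>J. ennreal (2 powr (real j * p)) * indicator (V j) x)"
   using J m by (intro mult_left_mono member_le_sum) (auto simp: J'_def)
  finally show ?thesis using eq by simp
 qed
qed

lemma (in doubling_measure) borel_measurable_in_M:
 "g \<in> borel_measurable borel \<Longrightarrow> g \<in> borel_measurable M"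
 using borel_in_M by (auto simp: measurable_def)

lemma lipschitz_borel_measurable:
 fixes h :: "'a::metric_space \<Rightarrow> real"
 assumes "0 \<le> L" "\<And>x y. \<bar>h x - h y\<bar> \<le> L * dist x y"
 shows "h \<in> borel_measurable borel"
proof -
 have "L-lipschitz_on UNIV h" using assms by (intro lipschitz_onI) (auto simp: dist_real_def)
 then show ?thesis by (intro borel_measurable_continuous_onI lipschitz_on_continuous_on)
qed

lemma (in doubling_measure) lipschitz_integrable_ball:
 fixes h :: "'z \<Rightarrow> real"
 assumes "0 \<le> L" "\<And>x y. \<bar>h x - h y\<bar> \<le> L * dist x y"
 shows "integrable (restrict_space M (ball x r)) h"
proof -
 have em: "emeasure (restrict_space M (ball x r)) (ball x r) < \<infinity>"
  using ball_finite[of x r] by (subst emeasure_restrict_space) auto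
 interpret R: finite_measure "restrict_space M (ball x r)"
  by (rule finite_measureI) (use em in \<open>auto simp: space_restrict_space\<close>)
 show ?thesis
 proof (rule R.integrable_const_bound[where B="\<bar>h x\<bar> + L * r"])
  have "norm (h y) \<le> \<bar>h x\<bar> + L * r" if "y \<in> ball x r" for y
  proof -
   have "\<bar>h x - h y\<bar> \<le> L * dist x y" by (rule assms)
   also have "\<dots> \<le> L * r" using that assms(1) by (intro mult_left_mono) auto
   finally show ?thesis by simp
  qed
  then show "AE y in restrict_space M (ball x r). norm (h y) \<le> \<bar>h x\<bar> + L * r"
   by (intro AE_I2) (auto simp: space_restrict_space)
  show "h \<in> borel_measurable (restrict_space M (ball x r))"
   by (intro measurable_restrict_space1 borel_measurable_in_M lipschitz_borel_measurable[OF assms])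
 qed
qed

text \<open>\<rho> is a gradient and e an exceptional function for all \<open>f n\<close>
  simultaneously. In the application \<open>f n x\<close> is the norm of
  \<open>u x - d n\<close>.\<close>

locale common_gradient = poincare_space M cd p Cp \<kappa>
 for M :: "'z::{metric_space, second_countable_topology} measure" and cd p Cp \<kappa> +
 fixes f :: "nat \<Rightarrow> 'z \<Rightarrow> real" and \<rho> e :: "'z \<Rightarrow> ennreal"
 assumes f_meas: "\<And>n. f n \<in> borel_measurable M"
  and f_int: "\<And>n x r. integrable (restrict_space M (ball x r)) (f n)"
  and \<rho>_borel: "\<rho> \<in> borel_measurable borel" and e_borel: "e \<in> borel_measurable borel"
  and \<rho>_Lp: "Lp_integrable M p \<rho>" and e_Lp: "Lp_integrable M p e"
  and upper: "\<And>n a b \<gamma>. (a, b, \<gamma>) \<in> paths_in UNIV \<Longrightarrow> curve_integral e (a, b, \<gamma>) < \<infinity> \<Longrightarrow>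
   ennreal \<bar>f n (\<gamma> a) - f n (\<gamma> b)\<bar> \<le> curve_integral \<rho> (a, b, \<gamma>)"
begin

abbreviation "U \<equiv> bad_set \<kappa> f"

text \<open>The Poincare inequality for \<open>f n\<close> itself. It leads to the weak-type bound
  only.\<close>

lemma bad_ball_weak:
 assumes xr: "(x, r) \<in> bad f l" and l: "0 < l"
 shows "emeasure M (ball x r) \<le> ennreal ((2 * Cp / (l * \<theta>)) powr p) *
  (\<integral>\<^sup>+y. ennreal_powr (\<rho> y) p * indicator (ball x (\<kappa> * r)) y \<partial>M)"
proof -
 obtain n where r: "0 < r" and dev: "\<And>c. \<theta> * \<mu> x r < measure M {z \<in> ball x r. l * r < \<bar>f n z - c\<bar>}"
  using xr by (auto simp: bad_def)
 show ?thesis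
 proof (rule poincare_deviation[OF r f_meas[of n] f_int _ _ l \<theta>(1)])
  show "weak_upper_gradient (restrict_space M (ball x (\<kappa> * r))) p (f n) \<rho>"
   by (rule weak_upper_gradient_restrictI[OF _ _ \<rho>_borel e_borel e_Lp])
    (use upper in \<open>auto simp: paths_in_def\<close>)
  show "Lp_integrable (restrict_space M (ball x (\<kappa> * r))) p \<rho>"
   by (rule Lp_integrable_restrict[OF \<rho>_Lp]) auto
 qed (use dev[of "average M (ball x r) (f n)"] in simp)
qed

text \<open>Covers both cases of \<open>bad_ball_estimate\<close>: \<open>2 / \<theta>\<close> when
  a higher bad set fills a fixed fraction of the ball, the other summand when the Poincare
  inequality is used. 30 is 2 * 15, from \<open>geometric_layers_powr\<close> and
  \<open>lipschitz_off_bad_set\<close>.\<close>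

definition C1 :: real where "C1 = 2 / \<theta> + (4 * Cp / \<theta>) powr p * 2 powr p * 30 powr p"

lemma C1_ge: "2 / \<theta> \<le> C1" "(4 * Cp / \<theta>) powr p * 2 powr p * 30 powr p \<le> C1" "(4 * Cp / \<theta>) powr p * 2 powr p \<le> C1" "0 < C1"
proof -
 have "(1::real) \<le> 30 powr p" using p by (intro ge_one_powr_ge_zero) auto
 then have "(4 * Cp / \<theta>) powr p * 2 powr p * 1 \<le> (4 * Cp / \<theta>) powr p * 2 powr p * 30 powr p"
  by (intro mult_left_mono) auto
 moreover have "0 < 2 / \<theta>" "0 \<le> (4 * Cp / \<theta>) powr p * 2 powr p * 30 powr p" using \<theta>(1) by simp_all
 ultimately show "2 / \<theta> \<le> C1" "(4 * Cp / \<theta>) powr p * 2 powr p * 30 powr p \<le> C1"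
  "(4 * Cp / \<theta>) powr p * 2 powr p \<le> C1" "0 < C1"
  unfolding C1_def by linarith+
qed

text \<open>The Lipschitz truncations of \<open>f n\<close> at the levels \<open>2\<^sup>j l\<close>, \<open>k \<le> j < 2k\<close>, are averaged: this divides the
 contribution of each level to the gradient by \<open>k\<close>, which is a gain because \<open>p > 1\<close>.\<close>

lemma bad_ball_estimate:
 assumes xr: "(x, r) \<in> bad f l" and l: "0 < l" and k: "1 \<le> k"
 shows "emeasure M (ball x r) \<le>
  ennreal (C1 * real k powr - p) * (\<Sum>j\<in>{k..<2*k}. ennreal (2 powr (real j * p)) * emeasure M (U (2 ^ j * l) \<inter> ball x (\<kappa> * r))) +
  ennreal (C1 * l powr - p) * (\<integral>\<^sup>+y. ennreal_powr (\<rho> y) p * indicator (ball x (\<kappa> * r) - U (2 ^ (2 * k - 1) * l)) y \<partial>M)"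
proof -
 obtain n where r: "0 < r" and dev: "\<And>c. \<theta> * \<mu> x r < measure M {z \<in> ball x r. l * r < \<bar>f n z - c\<bar>}"
  using xr by (auto simp: bad_def)
 define B B' where "B = ball x r" and "B' = ball x (\<kappa> * r)"
 have [measurable]: "B \<in> sets M" "B' \<in> sets M" by (auto simp: B_def B'_def)
 have BB': "B \<subseteq> B'" unfolding B_def B'_def using mult_right_mono[of 1 \<kappa> r] r \<kappa> by (intro subset_ball) auto
 define V where "V j = U (2 ^ j * l)" for j :: nat
 have V_open: "open (V j)" for j by (simp add: V_def open_bad_set)
 have [measurable]: "V j \<in> sets M" for j by (simp add: V_def)
 have V_borel[measurable]: "V j \<in> sets borel" for j using V_open by simp
 have V_anti: "V j \<subseteq> V i" if "i \<le> j" for i j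
  unfolding V_def using that l by (intro bad_set_antimono f_meas mult_right_mono power_increasing) auto
 define L where "L j = 15 * (2 ^ j * l)" for j :: nat
 have L0: "0 \<le> L j" for j using l by (simp add: L_def)
 define J where "J = {k..<2*k}"
 have J: "finite J" "card J = k" "J \<noteq> {}" using k by (auto simp: J_def)
 obtain N0 where N0: "N0 \<in> null_sets M" "{z\<in>space M. \<not> approx_continuous (f n) z} \<subseteq> N0"
  using AE_approx_continuous[OF f_meas[of n]] by (auto elim!: AE_E simp: null_sets_def)
 \<comment> \<open>Contains all points without approximate continuity. It has to be Borel because
   its indicator is integrated along paths.\<close>
 obtain N where N: "N \<in> sets borel" "N0 \<subseteq> N" "emeasure M N = emeasure M N0"
  using borel_cover[of N0] N0(1) by (auto simp: null_sets_def)
 have N_null: "N \<in> null_sets M" using N N0(1) borel_in_M by (auto simp: null_sets_def)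
 have [measurable]: "N \<in> sets M" using N_null by auto
 have ac: "approx_continuous (f n) z" if "z \<notin> N" for z using that N(2) N0(2) by auto
 have "\<exists>h. (\<forall>y\<in>- V j - N. h y = f n y) \<and> (\<forall>y z. \<bar>h y - h z\<bar> \<le> L j * dist y z)" for j
 proof (rule mcshane_extension[OF L0])
  fix y z assume "y \<in> - V j - N" "z \<in> - V j - N"
  then have "\<bar>f n y - f n z\<bar> \<le> 15 * (2 ^ j * l) * dist y z"
   using l by (intro lipschitz_off_bad_set[OF f_meas \<kappa>] ac) (auto simp: V_def)
  then show "\<bar>f n y - f n z\<bar> \<le> L j * dist y z" by (simp add: L_def)
 qed
 then have "\<forall>j. \<exists>h. (\<forall>y\<in>- V j - N. h y = f n y) \<and> (\<forall>y z. \<bar>h y - h z\<bar> \<le> L j * dist y z)" by blast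
 from choice[OF this] obtain H where H: "\<forall>j. (\<forall>y\<in>- V j - N. H j y = f n y) \<and> (\<forall>y z. \<bar>H j y - H j z\<bar> \<le> L j * dist y z)" ..
 have H_eq: "H j y = f n y" if "y \<notin> V j" "y \<notin> N" for j y using H that by blast
 have H_lip: "\<bar>H j y - H j z\<bar> \<le> L j * dist y z" for j y z using H by blast
 \<comment> \<open>The average of the truncations \<open>H j\<close>, each equal to
   \<open>f n\<close> off \<open>V j\<close> and N. As the \<open>V j\<close> decrease, h equals
   \<open>f n\<close> off \<open>V k\<close> and N.\<close>
 define h where "h y = (\<Sum>j\<in>J. H j y) / real k" for y
 define Lh where "Lh = (\<Sum>j\<in>J. L j) / real k"
 have Lh0: "0 \<le> Lh" unfolding Lh_def by (intro divide_nonneg_nonneg sum_nonneg L0) simp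
 have h_diff: "\<bar>h y - h z\<bar> \<le> (\<Sum>j\<in>J. \<bar>H j y - H j z\<bar>) / real k" for y z
 proof -
  have "h y - h z = (\<Sum>j\<in>J. H j y - H j z) / real k" by (simp add: h_def sum_subtractf diff_divide_distrib)
  then show ?thesis by (simp add: divide_right_mono)
 qed
 have h_lip: "\<bar>h y - h z\<bar> \<le> Lh * dist y z" for y z
 proof -
  have "(\<Sum>j\<in>J. \<bar>H j y - H j z\<bar>) \<le> (\<Sum>j\<in>J. L j * dist y z)" by (intro sum_mono H_lip)
  then have "(\<Sum>j\<in>J. \<bar>H j y - H j z\<bar>) / real k \<le> (\<Sum>j\<in>J. L j) * dist y z / real k"
   by (simp add: sum_distrib_right divide_right_mono)
  then show ?thesis using h_diff[of y z] by (simp add: Lh_def)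
 qed
 have h_eq: "h y = f n y" if "y \<notin> V k" "y \<notin> N" for y
 proof -
  have "H j y = f n y" if "j \<in> J" for j using H_eq[of y j] V_anti[of k j] that \<open>y \<notin> V k\<close> \<open>y \<notin> N\<close> by (auto simp: J_def)
  then show ?thesis using J k by (simp add: h_def)
 qed
 have h_meas: "h \<in> borel_measurable M" by (intro borel_measurable_in_M lipschitz_borel_measurable[OF Lh0 h_lip])
 define S where "S y = (\<Sum>j\<in>J. ennreal (15 * l / real k * 2 ^ j) * indicator (V j) y)" for y
 define W where "W = V (2 * k - 1)"
 have [measurable]: "W \<in> sets M" "W \<in> sets borel" by (auto simp: W_def)
 \<comment> \<open>Each level contributes 1/k of its Lipschitz constant on \<open>V j\<close>. The
   shares of \<rho> add up to at most \<rho>, and since W is the smallest of the \<open>V j\<close>,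
   all of them live off W.\<close>
 define \<sigma> where "\<sigma> y = S y + \<rho> y * indicator (- W) y" for y
 have S_borel: "S \<in> borel_measurable borel" unfolding S_def by measurable
 have \<sigma>_borel: "\<sigma> \<in> borel_measurable borel" unfolding \<sigma>_def using \<rho>_borel S_borel by measurable
 have [measurable]: "S \<in> borel_measurable M" "\<rho> \<in> borel_measurable M" "\<sigma> \<in> borel_measurable M"
  using borel_measurable_in_M S_borel \<rho>_borel \<sigma>_borel by auto
 \<comment> \<open>A finite integral of \<open>e0\<close> makes \<rho> integrable along the path,
   makes the gradient inequality for \<open>f n\<close> valid on all subpaths, and forbids positive
   length in N.\<close>
 define e0 where "e0 y = \<rho> y + (e y + \<infinity> * indicator N y)" for y
 have e0_borel: "e0 \<in> borel_measurable borel" unfolding e0_def using \<rho>_borel e_borel N(1) by measurable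
 have e0_Lp: "Lp_integrable M p e0"
 proof -
  have "AE y in M. (\<infinity> * indicator N y :: ennreal) = 0"
   using AE_not_in[OF N_null] by eventually_elim simp
  then have "(\<integral>\<^sup>+y. ennreal_powr (\<infinity> * indicator N y) p \<partial>M) = (\<integral>\<^sup>+y. ennreal_powr 0 p \<partial>M)"
   by (intro nn_integral_cong_AE) auto
  then have "Lp_integrable M p (\<lambda>y. \<infinity> * indicator N y)"
   by (simp add: Lp_integrable_def)
  then show ?thesis unfolding e0_def using p by (intro Lp_integrable_add \<rho>_Lp e_Lp) auto
 qed
 have h_wug: "weak_upper_gradient (restrict_space M B') p h \<sigma>"
 proof (rule weak_upper_gradient_restrictI[OF _ _ \<sigma>_borel e0_borel e0_Lp])
  fix a b \<gamma> assume path: "(a, b, \<gamma>) \<in> paths_in B'" and fin: "curve_integral e0 (a, b, \<gamma>) < \<infinity>"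
  interpret rectifiable_path a b \<gamma> by (rule curve_integral_finite_imp_rectifiable[OF path fin])
  have img: "\<gamma> ` {a..b} \<subseteq> UNIV" by simp
  have bm: "\<tau> \<in> borel_measurable borel \<Longrightarrow> \<tau> \<in> borel_on UNIV" for \<tau> :: "'z \<Rightarrow> ennreal"
   by (rule measurable_restrict_space1)
  have fin_le: "curve_integral \<tau> (a, b, \<gamma>) < \<infinity>" if "\<And>y. \<tau> y \<le> e0 y" for \<tau>
   using curve_integral_mono[of \<gamma> a b \<tau> e0] that fin by (meson le_less_trans)
  have fin_\<rho>: "curve_integral \<rho> (a, b, \<gamma>) < \<infinity>" and fin_e: "curve_integral e (a, b, \<gamma>) < \<infinity>"
   and fin_N: "curve_integral (\<lambda>y. \<infinity> * indicator N y) (a, b, \<gamma>) < \<infinity>"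
   by (rule fin_le; simp add: e0_def add_increasing add_increasing2)+
  define \<sigma>' where "\<sigma>' j y = ennreal (L j) * indicator (V j) y + \<rho> y * indicator (- V j) y" for j y
  have \<sigma>'_borel: "\<sigma>' j \<in> borel_measurable borel" for j unfolding \<sigma>'_def using \<rho>_borel by measurable
  have H_upper: "ennreal \<bar>H j (\<gamma> a) - H j (\<gamma> b)\<bar> \<le> curve_integral (\<sigma>' j) (a, b, \<gamma>)" for j
   unfolding \<sigma>'_def
  proof (rule truncated_gradient[OF \<rho>_borel N(1) V_open L0 H_lip H_eq _ fin_\<rho> fin_N])
   fix s t assume st: "a \<le> s" "s \<le> t" "t \<le> b"
   have "curve_integral e (s, t, \<gamma>) < \<infinity>"
    using curve_integral_subpath_le[OF bm[OF e_borel] img st] fin_e by (rule le_less_trans)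
   moreover have "(s, t, \<gamma>) \<in> paths_in UNIV"
    using st continuous by (auto simp: paths_in_def intro: continuous_on_subset)
   ultimately show "ennreal \<bar>f n (\<gamma> s) - f n (\<gamma> t)\<bar> \<le> curve_integral \<rho> (s, t, \<gamma>)" by (intro upper)
  qed
  have "ennreal (norm (h (\<gamma> a) - h (\<gamma> b))) \<le> ennreal ((\<Sum>j\<in>J. \<bar>H j (\<gamma> a) - H j (\<gamma> b)\<bar>) / real k)"
   using h_diff by (intro ennreal_leI) simp
  also have "\<dots> = ennreal (\<Sum>j\<in>J. 1 / real k * \<bar>H j (\<gamma> a) - H j (\<gamma> b)\<bar>)"
   by (simp add: sum_divide_distrib)
  also have "\<dots> = (\<Sum>j\<in>J. ennreal (1 / real k) * ennreal \<bar>H j (\<gamma> a) - H j (\<gamma> b)\<bar>)"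
   by (simp add: sum_ennreal[symmetric] ennreal_mult[symmetric] del: sum_ennreal)
  also have "\<dots> \<le> (\<Sum>j\<in>J. ennreal (1 / real k) * curve_integral (\<sigma>' j) (a, b, \<gamma>))"
   by (intro sum_mono mult_left_mono H_upper) simp
  also have "\<dots> = (\<Sum>j\<in>J. curve_integral (\<lambda>y. ennreal (1 / real k) * \<sigma>' j y) (a, b, \<gamma>))"
   by (intro sum.cong refl curve_integral_cmult[OF bm[OF \<sigma>'_borel] img, symmetric])
  also have "\<dots> = curve_integral (\<lambda>y. \<Sum>j\<in>J. ennreal (1 / real k) * \<sigma>' j y) (a, b, \<gamma>)"
   using \<sigma>'_borel J(1) by (intro curve_integral_sum[symmetric, of J _ UNIV] img bm) auto
  also have "\<dots> \<le> curve_integral \<sigma> (a, b, \<gamma>)"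
  proof (rule curve_integral_mono)
   fix y
   have "ennreal (1 / real k) * \<sigma>' j y \<le> ennreal (15 * l / real k * 2 ^ j) * indicator (V j) y + ennreal (1 / real k) * (\<rho> y * indicator (- W) y)"
    if "j \<in> J" for j
   proof -
    have "W \<subseteq> V j" unfolding W_def using that by (intro V_anti) (auto simp: J_def)
    then have "\<rho> y * indicator (- V j) y \<le> \<rho> y * indicator (- W) y" by (auto split: split_indicator)
    moreover have "ennreal (1 / real k) * ennreal (L j) = ennreal (15 * l / real k * 2 ^ j)"
     using l by (simp add: L_def ennreal_mult[symmetric] field_simps)
    moreover have "ennreal (1 / real k) * \<sigma>' j y = ennreal (1 / real k) * ennreal (L j) * indicator (V j) y + ennreal (1 / real k) * (\<rho> y * indicator (- V j) y)"
     by (simp only: \<sigma>'_def distrib_left mult.assoc)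
    ultimately show ?thesis
     by (simp only: add_left_mono mult_left_mono zero_le)
   qed
   then have "(\<Sum>j\<in>J. ennreal (1 / real k) * \<sigma>' j y) \<le> (\<Sum>j\<in>J. ennreal (15 * l / real k * 2 ^ j) * indicator (V j) y + ennreal (1 / real k) * (\<rho> y * indicator (- W) y))"
    by (rule sum_mono)
   also have "\<dots> = S y + of_nat k * (ennreal (1 / real k) * (\<rho> y * indicator (- W) y))"
    using J by (simp add: sum.distrib S_def)
   also have "of_nat k * (ennreal (1 / real k) * (\<rho> y * indicator (- W) y)) = \<rho> y * indicator (- W) y"
    using k by (simp add: mult.assoc[symmetric] ennreal_of_nat_eq_real_of_nat ennreal_mult[symmetric])
   finally show "(\<Sum>j\<in>J. ennreal (1 / real k) * \<sigma>' j y) \<le> \<sigma> y" by (simp add: \<sigma>_def)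
  qed
  finally show "ennreal (norm (h (\<gamma> a) - h (\<gamma> b))) \<le> curve_integral \<sigma> (a, b, \<gamma>)" .
 qed auto
 define Z where "Z = (\<Sum>j\<in>J. ennreal (2 powr (real j * p)) * emeasure M (V j \<inter> B'))"
 define R where "R = (\<integral>\<^sup>+y. ennreal_powr (\<rho> y) p * indicator (B' - W) y \<partial>M)"
 have Z_fin: "Z < \<infinity>"
  using finite_measure_ball_M[of "V _" x "\<kappa> * r"] J(1) by (auto simp: Z_def B'_def ennreal_mult_less_top)
 have R_fin: "R < \<infinity>"
 proof -
  have "R \<le> pint M p \<rho>"
   unfolding R_def by (intro nn_integral_mono) (auto split: split_indicator)
  then show ?thesis using \<rho>_Lp by (auto simp: Lp_integrable_def intro: le_less_trans)
 qed
 have \<sigma>_int: "(\<integral>\<^sup>+y. ennreal_powr (\<sigma> y) p * indicator B' y \<partial>M) \<le>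
   ennreal (2 powr p) * (ennreal ((30 * l / real k) powr p) * Z + R)"
 proof -
  have "(\<integral>\<^sup>+y. ennreal_powr (\<sigma> y) p * indicator B' y \<partial>M) \<le>
    (\<integral>\<^sup>+y. ennreal (2 powr p) * (ennreal ((30 * l / real k) powr p) * (\<Sum>j\<in>J. ennreal (2 powr (real j * p)) * indicator (V j \<inter> B') y)
     + ennreal_powr (\<rho> y) p * indicator (B' - W) y) \<partial>M)"
  proof (rule nn_integral_mono)
   fix y
   have "ennreal_powr (\<sigma> y) p \<le> ennreal (2 powr p) * (ennreal_powr (S y) p + ennreal_powr (\<rho> y * indicator (- W) y) p)"
    unfolding \<sigma>_def using p by (intro ennreal_powr_add) simp
   also have "ennreal_powr (S y) p \<le> ennreal ((2 * (15 * l / real k)) powr p) * (\<Sum>j\<in>J. ennreal (2 powr (real j * p)) * indicator (V j) y)"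
    unfolding S_def using J l p by (intro geometric_layers_powr) auto
   also have "ennreal_powr (\<rho> y * indicator (- W) y) p = ennreal_powr (\<rho> y) p * indicator (- W) y"
    by (auto split: split_indicator)
   finally have "ennreal_powr (\<sigma> y) p \<le> ennreal (2 powr p) * (ennreal ((30 * l / real k) powr p) * (\<Sum>j\<in>J. ennreal (2 powr (real j * p)) * indicator (V j) y) + ennreal_powr (\<rho> y) p * indicator (- W) y)"
    by (simp add: mult_left_mono add_right_mono)
   then show "ennreal_powr (\<sigma> y) p * indicator B' y \<le>
     ennreal (2 powr p) * (ennreal ((30 * l / real k) powr p) * (\<Sum>j\<in>J. ennreal (2 powr (real j * p)) * indicator (V j \<inter> B') y)
     + ennreal_powr (\<rho> y) p * indicator (B' - W) y)"
    by (auto split: split_indicator simp: indicator_inter_arith Diff_eq)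
  qed
  also have "\<dots> = ennreal (2 powr p) * (ennreal ((30 * l / real k) powr p) * Z + R)"
   by (simp add: nn_integral_cmult nn_integral_add nn_integral_sum nn_integral_cmult_indicator Z_def R_def)
  finally show ?thesis .
 qed
 have "emeasure M (ball x r) \<le> ennreal (C1 * real k powr - p) * Z + ennreal (C1 * l powr - p) * R"
 \<comment> \<open>\<open>f n\<close> deviates on more than the fraction \<theta> of the ball.
   Either h deviates on half of that, and the Poincare inequality for h applies, or h differs from
   \<open>f n\<close> on half of it. Then \<open>V k\<close> fills at least the fraction \<theta> /
   2 of the ball, and the term j = k alone suffices, because 2^(kp) \<ge> k^p.\<close>
 proof (cases "\<theta> / 2 * \<mu> x r \<le> measure M {z \<in> ball x r. l * r < \<bar>h z - average M (ball x r) h\<bar>}")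
  case True
  have "emeasure M (ball x r) \<le> ennreal ((2 * Cp / (l * (\<theta> / 2))) powr p) *
    (\<integral>\<^sup>+y. ennreal_powr (\<sigma> y) p * indicator (ball x (\<kappa> * r)) y \<partial>M)"
  proof (rule poincare_deviation[OF r h_meas lipschitz_integrable_ball[OF Lh0 h_lip] h_wug[unfolded B'_def] _ l _ True])
   have "(\<integral>\<^sup>+y. ennreal_powr (\<sigma> y) p * indicator B' y \<partial>M) < \<infinity>"
    using Z_fin R_fin by (intro le_less_trans[OF \<sigma>_int]) (simp add: ennreal_mult_less_top)
   then show "Lp_integrable (restrict_space M (ball x (\<kappa> * r))) p \<sigma>"
    unfolding Lp_integrable_def B'_def[symmetric]
    by (subst nn_integral_restrict_powr) (auto intro: measurable_restrict_space1)
  qed (use \<theta>(1) in simp)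
  also have "\<dots> \<le> ennreal ((2 * Cp / (l * (\<theta> / 2))) powr p) * (ennreal (2 powr p) * (ennreal ((30 * l / real k) powr p) * Z + R))"
   using \<sigma>_int by (intro mult_left_mono) (simp_all add: B'_def)
  also have "\<dots> = ennreal ((4 * Cp / \<theta>) powr p * 2 powr p * 30 powr p * real k powr - p) * Z + ennreal ((4 * Cp / \<theta>) powr p * 2 powr p * l powr - p) * R"
  proof -
   have a: "(2 * Cp / (l * (\<theta> / 2))) powr p = (4 * Cp / \<theta>) powr p * l powr - p"
    using l Cp \<theta>(1) by (simp add: powr_mult powr_divide powr_minus_divide)
   have b: "(30 * l / real k) powr p = 30 powr p * l powr p * real k powr - p"
    using l k by (simp add: powr_mult powr_divide powr_minus_divide)
   have c: "l powr - p * l powr p = 1" using l by (simp add: powr_minus)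
   have d: "(4 * Cp / \<theta>) powr p * l powr - p * (2 powr p * (30 powr p * l powr p * real k powr - p)) =
     (4 * Cp / \<theta>) powr p * 2 powr p * 30 powr p * real k powr - p * (l powr - p * l powr p)" by (simp only: ac_simps)
   have "ennreal ((2 * Cp / (l * (\<theta> / 2))) powr p) * (ennreal (2 powr p) * (ennreal ((30 * l / real k) powr p) * Z + R)) =
     ennreal ((4 * Cp / \<theta>) powr p * l powr - p * (2 powr p * (30 powr p * l powr p * real k powr - p))) * Z +
     ennreal ((4 * Cp / \<theta>) powr p * l powr - p * 2 powr p) * R"
    unfolding a b by (simp add: distrib_left ennreal_mult mult.assoc)
   then show ?thesis unfolding d c by (simp add: ac_simps)
  qed
  also have "\<dots> \<le> ennreal (C1 * real k powr - p) * Z + ennreal (C1 * l powr - p) * R"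
   using C1_ge by (intro add_mono mult_right_mono ennreal_leI) auto
  finally show ?thesis .
 next
  case False
  define c where "c = average M (ball x r) h"
  have fm: "V k \<inter> B \<in> fmeasurable M" by (rule sub_ball_fmeasurable[of _ x r]) (auto simp: B_def)
  have "measure M {z \<in> ball x r. l * r < \<bar>f n z - c\<bar>} \<le> measure M ({z \<in> ball x r. l * r < \<bar>h z - c\<bar>} \<union> (V k \<inter> B) \<union> (N \<inter> B))"
  proof (rule measure_mono_fmeasurable)
   show "{z \<in> ball x r. l * r < \<bar>f n z - c\<bar>} \<subseteq> {z \<in> ball x r. l * r < \<bar>h z - c\<bar>} \<union> (V k \<inter> B) \<union> (N \<inter> B)"
    using h_eq by (auto simp: B_def)
   show "{z \<in> ball x r. l * r < \<bar>f n z - c\<bar>} \<in> sets M" by (rule deviation_set_in_M[OF f_meas])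
   have "N \<inter> B \<in> fmeasurable M" by (rule sub_ball_fmeasurable[of _ x r]) (auto simp: B_def)
   then show "{z \<in> ball x r. l * r < \<bar>h z - c\<bar>} \<union> (V k \<inter> B) \<union> (N \<inter> B) \<in> fmeasurable M"
    using fm deviation_set_fmeasurable[OF h_meas] by (intro fmeasurable.Un)
  qed
  also have "\<dots> = measure M ({z \<in> ball x r. l * r < \<bar>h z - c\<bar>} \<union> (V k \<inter> B))"
  proof (rule measure_Un_null_set)
   show "N \<inter> B \<in> null_sets M" using N_null by (auto intro: null_set_Int1 null_set_Int2)
   show "{z \<in> ball x r. l * r < \<bar>h z - c\<bar>} \<union> (V k \<inter> B) \<in> sets M"
    by (intro sets.Un deviation_set_in_M[OF h_meas] sets.Int) auto
  qed
  also have "\<dots> \<le> measure M {z \<in> ball x r. l * r < \<bar>h z - c\<bar>} + measure M (V k \<inter> B)"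
   using fm deviation_set_fmeasurable[OF h_meas] by (intro measure_Un_le) auto
  finally have "\<theta> * \<mu> x r < \<theta> / 2 * \<mu> x r + measure M (V k \<inter> B)"
   using dev[of c] False by (simp add: c_def)
  then have "\<mu> x r \<le> 2 / \<theta> * measure M (V k \<inter> B)" using \<theta>(1) by (simp add: field_simps)
  also have "\<dots> \<le> C1 * measure M (V k \<inter> B)" using C1_ge by (intro mult_right_mono) auto
  finally have "emeasure M (ball x r) \<le> ennreal C1 * emeasure M (V k \<inter> B)"
   using C1_ge(4) fm by (simp add: emeasure_ball emeasure_eq_ennreal_measure[of M "V k \<inter> B"] fmeasurable_def less_top[symmetric] ennreal_mult[symmetric] ennreal_leI)
  also have "\<dots> \<le> ennreal (C1 * real k powr - p * 2 powr (real k * p)) * emeasure M (V k \<inter> B')"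
  proof (intro mult_mono ennreal_leI emeasure_mono)
   have "real k powr p \<le> (2 ^ k) powr p"
    using p k by (intro powr_mono2) (auto simp: of_nat_less_two_power less_imp_le)
   also have "\<dots> = 2 powr (real k * p)" by (simp add: powr_powr powr_realpow[symmetric])
   finally have "1 \<le> real k powr - p * 2 powr (real k * p)"
    using k by (simp add: powr_minus_divide)
   then have "C1 * 1 \<le> C1 * (real k powr - p * 2 powr (real k * p))" using C1_ge(4) by (intro mult_left_mono) auto
   then show "C1 \<le> C1 * real k powr - p * 2 powr (real k * p)" by (simp add: mult.assoc)
  qed (use BB' in auto)
  also have "\<dots> = ennreal (C1 * real k powr - p) * (ennreal (2 powr (real k * p)) * emeasure M (V k \<inter> B'))"
   using C1_ge(4) by (simp add: ennreal_mult mult.assoc)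
  also have "\<dots> \<le> ennreal (C1 * real k powr - p) * Z"
   unfolding Z_def using J k by (intro mult_left_mono member_le_sum) (auto simp: J_def)
  finally show ?thesis by (simp add: add_increasing2)
 qed
 then show ?thesis by (simp add: Z_def R_def V_def W_def J_def B'_def)
qed

section \<open>The recursion for the measures of the bad sets\<close>

lemma exists_covering_power: "\<exists>n. 5 * \<kappa> \<le> 2 ^ n"
 using real_arch_pow[of 2 "5 * \<kappa>"] by (auto intro: less_imp_le)

definition n0 :: nat where "n0 = (SOME n. 5 * \<kappa> \<le> 2 ^ n)"

lemma n0: "5 * \<kappa> \<le> 2 ^ n0"
 unfolding n0_def by (rule someI_ex[OF exists_covering_power])

definition E\<rho> :: real where "E\<rho> = enn2real (pint M p \<rho>)"

lemma E\<rho>: "(pint M p \<rho>) = ennreal E\<rho>" "0 \<le> E\<rho>"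
 using \<rho>_Lp by (auto simp: E\<rho>_def Lp_integrable_def)

lemma \<rho>_meas [measurable]: "\<rho> \<in> borel_measurable M"
 by (rule borel_measurable_in_M[OF \<rho>_borel])

definition D\<rho> :: "'z measure" where "D\<rho> = density M (\<lambda>y. ennreal_powr (\<rho> y) p)"

lemma D\<rho>: "sets D\<rho> = sets M" "A \<in> sets M \<Longrightarrow> emeasure D\<rho> A = (\<integral>\<^sup>+y. ennreal_powr (\<rho> y) p * indicator A y \<partial>M)"
 by (auto simp: D\<rho>_def emeasure_density)

lemma finite_measure_D\<rho>: "finite_measure D\<rho>"
proof
 have "emeasure D\<rho> (space D\<rho>) = ennreal E\<rho>"
  using D\<rho>(2)[OF sets.top] E\<rho>(1) by (simp add: D\<rho>_def)
 then show "emeasure D\<rho> (space D\<rho>) \<noteq> \<infinity>" by simp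
qed

text \<open>Covering estimate with a multiple of the measure of density \<rho>^p. It is not summable
  over dyadic levels, but it makes all measures finite and bounds the boundary terms when the
  recursion is summed.\<close>

lemma emeasure_U_weak:
 assumes l: "0 < l"
 shows "emeasure M (U l) \<le> ennreal (cd ^ n0 * (2 * Cp / \<theta>) powr p * l powr - p * E\<rho>)"
proof -
 define \<nu> where "\<nu> = scale_measure (ennreal ((2 * Cp / (l * \<theta>)) powr p)) D\<rho>"
 have "emeasure M (\<Union>(x, r)\<in>bad f l. ball x (\<kappa> * r)) \<le> ennreal (cd ^ n0) * emeasure \<nu> (\<Union>(x, r)\<in>bad f l. ball x (\<kappa> * r))"
 proof (rule covering_estimate[OF _ \<kappa> n0])
  fix x r assume xr: "(x, r) \<in> bad f l"
  then show "0 < r \<and> emeasure M (ball x r) \<le> emeasure \<nu> (ball x (\<kappa> * r))"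
   using bad_ball_weak[OF xr l] by (simp add: \<nu>_def D\<rho>) (simp add: bad_def)
 qed (simp add: \<nu>_def D\<rho>)
 also have "\<dots> \<le> ennreal (cd ^ n0) * emeasure \<nu> (space \<nu>)" by (intro mult_left_mono emeasure_space) simp
 also have "emeasure \<nu> (space \<nu>) = ennreal ((2 * Cp / (l * \<theta>)) powr p) * ennreal E\<rho>"
  using D\<rho>(2)[OF sets.top] E\<rho>(1) by (simp add: \<nu>_def space_scale_measure D\<rho>_def)
 also have "(2 * Cp / (l * \<theta>)) powr p = (2 * Cp / \<theta>) powr p * l powr - p"
  using l Cp \<theta>(1) by (simp add: powr_mult powr_divide powr_minus_divide)
 also have "ennreal (cd ^ n0) * (ennreal ((2 * Cp / \<theta>) powr p * l powr - p) * ennreal E\<rho>) = ennreal (cd ^ n0 * (2 * Cp / \<theta>) powr p * l powr - p * E\<rho>)"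
  using cd E\<rho>(2) by (simp add: ennreal_mult[symmetric] mult.assoc)
 finally show ?thesis by (simp add: bad_set_def)
qed

text \<open>The density g reproduces the right-hand side of \<open>bad_ball_estimate\<close>. Since
  the covering estimate keeps the mass on \<open>U l\<close>, the gradient is counted only on
  \<open>U l\<close> minus a higher bad set, and over dyadic l such differences telescope.\<close>

lemma emeasure_U_recursion:
 assumes l: "0 < l" and k: "1 \<le> k"
 shows "emeasure M (U l) \<le> ennreal (cd ^ n0) *
  (ennreal (C1 * real k powr - p) * (\<Sum>j\<in>{k..<2*k}. ennreal (2 powr (real j * p)) * emeasure M (U (2 ^ j * l))) +
   ennreal (C1 * l powr - p) * emeasure D\<rho> (U l - U (2 ^ (2 * k - 1) * l)))"
proof -
 define g where "g y = ennreal (C1 * real k powr - p) * (\<Sum>j\<in>{k..<2*k}. ennreal (2 powr (real j * p)) * indicator (U (2 ^ j * l)) y) +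
   ennreal (C1 * l powr - p) * (ennreal_powr (\<rho> y) p * indicator (- U (2 ^ (2 * k - 1) * l)) y)" for y
 have [measurable]: "U c \<in> sets M" for c by (rule bad_set_in_M)
 have [measurable]: "g \<in> borel_measurable M" unfolding g_def by measurable
 have \<nu>: "emeasure (density M g) A = ennreal (C1 * real k powr - p) * (\<Sum>j\<in>{k..<2*k}. ennreal (2 powr (real j * p)) * emeasure M (U (2 ^ j * l) \<inter> A)) +
   ennreal (C1 * l powr - p) * (\<integral>\<^sup>+y. ennreal_powr (\<rho> y) p * indicator (A - U (2 ^ (2 * k - 1) * l)) y \<partial>M)"
  if A[measurable]: "A \<in> sets M" for A
 proof -
  have "emeasure (density M g) A = (\<integral>\<^sup>+y. ennreal (C1 * real k powr - p) * (\<Sum>j\<in>{k..<2*k}. ennreal (2 powr (real j * p)) * indicator (U (2 ^ j * l) \<inter> A) y) +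
   ennreal (C1 * l powr - p) * (ennreal_powr (\<rho> y) p * indicator (A - U (2 ^ (2 * k - 1) * l)) y) \<partial>M)"
  proof (subst emeasure_density)
   show "(\<integral>\<^sup>+y. g y * indicator A y \<partial>M) = (\<integral>\<^sup>+y. ennreal (C1 * real k powr - p) * (\<Sum>j\<in>{k..<2*k}. ennreal (2 powr (real j * p)) * indicator (U (2 ^ j * l) \<inter> A) y) +
   ennreal (C1 * l powr - p) * (ennreal_powr (\<rho> y) p * indicator (A - U (2 ^ (2 * k - 1) * l)) y) \<partial>M)"
    by (intro nn_integral_cong) (simp add: g_def indicator_def)
  qed simp_all
  also have "\<dots> = ennreal (C1 * real k powr - p) * (\<Sum>j\<in>{k..<2*k}. ennreal (2 powr (real j * p)) * emeasure M (U (2 ^ j * l) \<inter> A)) +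
   ennreal (C1 * l powr - p) * (\<integral>\<^sup>+y. ennreal_powr (\<rho> y) p * indicator (A - U (2 ^ (2 * k - 1) * l)) y \<partial>M)"
  proof (subst nn_integral_add)
   show "(\<integral>\<^sup>+y. ennreal (C1 * real k powr - p) * (\<Sum>j\<in>{k..<2*k}. ennreal (2 powr (real j * p)) * indicator (U (2 ^ j * l) \<inter> A) y) \<partial>M) +
     (\<integral>\<^sup>+y. ennreal (C1 * l powr - p) * (ennreal_powr (\<rho> y) p * indicator (A - U (2 ^ (2 * k - 1) * l)) y) \<partial>M) =
     ennreal (C1 * real k powr - p) * (\<Sum>j\<in>{k..<2*k}. ennreal (2 powr (real j * p)) * emeasure M (U (2 ^ j * l) \<inter> A)) +
     ennreal (C1 * l powr - p) * (\<integral>\<^sup>+y. ennreal_powr (\<rho> y) p * indicator (A - U (2 ^ (2 * k - 1) * l)) y \<partial>M)"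
    by (subst nn_integral_cmult, measurable, subst nn_integral_cmult, measurable, subst nn_integral_sum, measurable)
     (simp only: nn_integral_cmult_indicator[OF sets.Int[OF bad_set_in_M A]])
  qed measurable
  finally show ?thesis .
 qed
 have "emeasure M (\<Union>(x, r)\<in>bad f l. ball x (\<kappa> * r)) \<le> ennreal (cd ^ n0) * emeasure (density M g) (\<Union>(x, r)\<in>bad f l. ball x (\<kappa> * r))"
 proof (rule covering_estimate[OF _ \<kappa> n0])
  fix x r assume xr: "(x, r) \<in> bad f l"
  then have "0 < r" by (simp add: bad_def)
  then show "0 < r \<and> emeasure M (ball x r) \<le> emeasure (density M g) (ball x (\<kappa> * r))"
   using bad_ball_estimate[OF xr l k] by (simp only: \<nu>[OF ball_in_M] simp_thms)
 qed simp
 also have "\<dots> = ennreal (cd ^ n0) * emeasure (density M g) (U l)" by (simp add: bad_set_def)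
 also have "\<dots> \<le> ennreal (cd ^ n0) *
  (ennreal (C1 * real k powr - p) * (\<Sum>j\<in>{k..<2*k}. ennreal (2 powr (real j * p)) * emeasure M (U (2 ^ j * l))) +
   ennreal (C1 * l powr - p) * emeasure D\<rho> (U l - U (2 ^ (2 * k - 1) * l)))"
  unfolding \<nu>[OF bad_set_in_M] D\<rho>(2)[OF sets.Diff[OF bad_set_in_M bad_set_in_M]]
  by (intro mult_left_mono add_mono order_refl sum_mono emeasure_mono bad_set_in_M) auto
 finally show ?thesis by (simp add: bad_set_def)
qed

lemma sum_int_telescope:
 fixes g :: "int \<Rightarrow> real"
 shows "(\<Sum>i\<in>{- int m..int m}. g i - g (i + 1)) = g (- int m) - g (int m + 1)"
proof (induction m)
 case (Suc m)
 have "{- int (Suc m)..int (Suc m)} = insert (- int (Suc m)) (insert (int (Suc m)) {- int m..int m})" by auto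
 then show ?case using Suc by (simp add: algebra_simps)
qed simp

text \<open>The recursion is summed over a finite window of levels. A shifted sum differs from the
  original by boundary terms, which the weak bound controls, and the gradient terms telescope to a
  multiple of \<open>E\<rho>\<close>. The sum over the window is finite, so half of it can be
  absorbed; the bound does not depend on m.\<close>

lemma dyadic_sum_bounded:
 "\<exists>K\<ge>0. \<forall>m. (\<Sum>i\<in>{- int m..int m}. 2 powr (real_of_int i * p) * measure M (U (dyad i))) \<le> K"
proof -
 define w where "w i = 2 powr (real_of_int i * p) * measure M (U (dyad i))" for i :: int
 define a where "a i = measure D\<rho> (U (dyad i))" for i :: int
 interpret D: finite_measure D\<rho> by (rule finite_measure_D\<rho>)
 have fin: "emeasure M (U (dyad i)) < \<infinity>" for i :: int
  using emeasure_U_weak[of "dyad i"] by (auto intro: le_less_trans)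
 have em: "emeasure M (U (dyad i)) = ennreal (measure M (U (dyad i)))" for i :: int
  using fin[of i] by (intro emeasure_eq_ennreal_measure) (simp add: less_top)
 define W0 where "W0 = cd ^ n0 * (2 * Cp / \<theta>) powr p * E\<rho>"
 have W0: "0 \<le> W0" using cd E\<rho>(2) by (simp add: W0_def)
 have w0: "0 \<le> w i" for i by (simp add: w_def)
 have w_le: "w i \<le> W0" for i
 proof -
  have "ennreal (measure M (U (dyad i))) \<le> ennreal (W0 * (dyad i) powr - p)"
   using emeasure_U_weak[of "dyad i"] by (simp add: em W0_def ac_simps)
  then have "measure M (U (dyad i)) \<le> W0 * (dyad i) powr - p"
   using W0 by (simp add: ennreal_le_iff)
  then have "w i \<le> 2 powr (real_of_int i * p) * (W0 * (dyad i) powr - p)"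
   unfolding w_def by (rule mult_left_mono) simp
  also have "\<dots> = W0" by (simp add: powr_powr powr_minus)
  finally show ?thesis .
 qed
 have a0: "0 \<le> a i" "a i \<le> E\<rho>" for i
 proof -
  have "emeasure D\<rho> (U (dyad i)) \<le> ennreal E\<rho>"
   unfolding D\<rho>(2)[OF bad_set_in_M] E\<rho>(1)[symmetric] by (intro nn_integral_mono) (auto split: split_indicator)
  then show "a i \<le> E\<rho>" using E\<rho>(2) by (simp add: a_def D.emeasure_eq_measure)
 qed (simp add: a_def)
 define C2 where "C2 = cd ^ n0 * C1"
 have C2: "C2 > 0" using cd C1_ge(4) by (simp add: C2_def)
 have rec: "w i \<le> C2 * real k powr - p * (\<Sum>j\<in>{k..<2*k}. w (i + int j)) + C2 * (a i - a (i + int (2 * k - 1)))"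
  if k: "1 \<le> k" for i k
 proof -
  define l where "l = dyad i"
  have l: "l > 0" by (simp add: l_def)
  have shift: "2 ^ j * l = dyad (i + int j)" for j
   by (simp add: l_def powr_add powr_realpow mult.commute)
  have "emeasure D\<rho> (U l - U (2 ^ (2 * k - 1) * l)) = ennreal (a i - a (i + int (2 * k - 1)))"
  proof -
   have "l \<le> 2 ^ (2 * k - 1) * l" using l by simp
   then have "U (2 ^ (2 * k - 1) * l) \<subseteq> U l" by (intro bad_set_antimono f_meas)
   then have "measure D\<rho> (U l - U (2 ^ (2 * k - 1) * l)) = measure D\<rho> (U l) - measure D\<rho> (U (2 ^ (2 * k - 1) * l))"
    by (intro D.finite_measure_Diff) (auto simp: D\<rho>)
   then have "emeasure D\<rho> (U l - U (2 ^ (2 * k - 1) * l)) = ennreal (measure D\<rho> (U l) - measure D\<rho> (U (2 ^ (2 * k - 1) * l)))"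
    by (simp only: D.emeasure_eq_measure)
   then show ?thesis by (simp only: shift[of "2 * k - 1"]) (simp only: a_def l_def)
  qed
  moreover have "emeasure M (U (2 ^ j * l)) = ennreal (measure M (U (dyad (i + int j))))" for j
   unfolding shift by (rule em)
  ultimately have "ennreal (measure M (U l)) \<le> ennreal (cd ^ n0) *
   (ennreal (C1 * real k powr - p) * (\<Sum>j\<in>{k..<2*k}. ennreal (2 powr (real j * p)) * ennreal (measure M (U (dyad (i + int j))))) +
    ennreal (C1 * l powr - p) * ennreal (a i - a (i + int (2 * k - 1))))"
   using emeasure_U_recursion[OF l k] em[of i] by (simp only: l_def)
  moreover have a_diff: "0 \<le> a i - a (i + int (2 * k - 1))"
  proof -
   have "dyad i \<le> dyad (i + int (2 * k - 1))" by (intro powr_mono) auto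
   then have "U (dyad (i + int (2 * k - 1))) \<subseteq> U (dyad i)" by (intro bad_set_antimono f_meas)
   then show ?thesis unfolding a_def by (simp add: D.finite_measure_mono D\<rho>)
  qed
  moreover have "(\<Sum>j\<in>{k..<2*k}. ennreal (2 powr (real j * p)) * ennreal (measure M (U (dyad (i + int j))))) =
    ennreal (\<Sum>j\<in>{k..<2*k}. 2 powr (real j * p) * measure M (U (dyad (i + int j))))"
   by (simp add: ennreal_mult[symmetric])
  ultimately have "ennreal (measure M (U l)) \<le> ennreal (cd ^ n0 *
   (C1 * real k powr - p * (\<Sum>j\<in>{k..<2*k}. 2 powr (real j * p) * measure M (U (dyad (i + int j)))) +
    C1 * l powr - p * (a i - a (i + int (2 * k - 1)))))"
   using cd C1_ge(4) by (simp add: ennreal_mult[symmetric] sum_nonneg ennreal_plus[symmetric] del: ennreal_plus)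
  then have "measure M (U l) \<le> cd ^ n0 *
   (C1 * real k powr - p * (\<Sum>j\<in>{k..<2*k}. 2 powr (real j * p) * measure M (U (dyad (i + int j)))) +
    C1 * l powr - p * (a i - a (i + int (2 * k - 1))))" (is "_ \<le> ?R")
   using cd C1_ge(4) a_diff by (subst (asm) ennreal_le_iff) (auto intro!: mult_nonneg_nonneg add_nonneg_nonneg sum_nonneg)
  then have "w i \<le> 2 powr (real_of_int i * p) * ?R"
   unfolding w_def l_def by (rule mult_left_mono) simp
  also have "\<dots> = C2 * real k powr - p * (2 powr (real_of_int i * p) * (\<Sum>j\<in>{k..<2*k}. 2 powr (real j * p) * measure M (U (dyad (i + int j))))) +
    C2 * ((2 powr (real_of_int i * p) * l powr - p) * (a i - a (i + int (2 * k - 1))))"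
   by (simp add: C2_def algebra_simps)
  also have "2 powr (real_of_int i * p) * l powr - p = 1" by (simp add: l_def powr_powr powr_minus)
  also have "2 powr (real_of_int i * p) * (\<Sum>j\<in>{k..<2*k}. 2 powr (real j * p) * measure M (U (dyad (i + int j)))) = (\<Sum>j\<in>{k..<2*k}. w (i + int j))"
   unfolding sum_distrib_left w_def by (intro sum.cong refl) (simp add: powr_add[symmetric] mult.assoc[symmetric] distrib_right)
  finally show ?thesis by simp
 qed
 \<comment> \<open>Here p > 1 enters: k levels with the factor k^(-p) each amount to k^(1-p), which
   is as small as desired.\<close>
 obtain k :: nat where k: "1 \<le> k" "C2 * real k powr (1 - p) \<le> 1 / 2"
 proof -
  obtain k :: nat where k: "max 1 ((2 * C2) powr (1 / (p - 1))) < real k" using reals_Archimedean2 by blast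
  have "2 * C2 = ((2 * C2) powr (1 / (p - 1))) powr (p - 1)" using C2 p by (simp add: powr_powr)
  also have "\<dots> \<le> real k powr (p - 1)" using k p by (intro powr_mono2) auto
  finally have "2 * C2 \<le> real k powr (p - 1)" .
  then have "2 * C2 * real k powr (1 - p) \<le> real k powr (p - 1) * real k powr (1 - p)" by (rule mult_right_mono) simp
  also have "\<dots> = 1" using k by (simp add: powr_add[symmetric])
  finally show ?thesis using k by (intro that[of k]) auto
 qed
 \<comment> \<open>Obtained by solving Sm \<le> (Sm + 2 k W0) / 2 + 2 k C2 E\<rho> for Sm.\<close>
 define K where "K = 2 * real k * W0 + 4 * real k * C2 * E\<rho>"
 have "(\<Sum>i\<in>{- int m..int m}. w i) \<le> K" for m
 proof -
  define Sm where "Sm = (\<Sum>i\<in>{- int m..int m}. w i)"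
  have shift_w: "(\<Sum>i\<in>{- int m..int m}. w (i + int j)) \<le> Sm + real j * W0" for j
  proof (induction j)
   case (Suc j)
   have "(\<Sum>i\<in>{- int m..int m}. w (i + int (Suc j))) = (\<Sum>i\<in>{- int m..int m}. w (i + int j)) - (\<Sum>i\<in>{- int m..int m}. w (i + int j) - w (i + 1 + int j))"
    by (simp add: sum_subtractf ac_simps)
   also have "(\<Sum>i\<in>{- int m..int m}. w (i + int j) - w (i + 1 + int j)) = w (- int m + int j) - w (int m + 1 + int j)"
    by (rule sum_int_telescope[of "\<lambda>i. w (i + int j)"])
   finally show ?case using Suc w0[of "- int m + int j"] w_le[of "int m + 1 + int j"] by (simp add: algebra_simps)
  qed (simp add: Sm_def)
  have shift_a: "(\<Sum>i\<in>{- int m..int m}. a i - a (i + int q)) \<le> real q * E\<rho>" for q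
  proof (induction q)
   case (Suc q)
   have "(\<Sum>i\<in>{- int m..int m}. a i - a (i + int (Suc q))) = (\<Sum>i\<in>{- int m..int m}. a i - a (i + int q)) + (\<Sum>i\<in>{- int m..int m}. a (i + int q) - a (i + 1 + int q))"
    by (simp add: sum_subtractf ac_simps)
   also have "(\<Sum>i\<in>{- int m..int m}. a (i + int q) - a (i + 1 + int q)) = a (- int m + int q) - a (int m + 1 + int q)"
    by (rule sum_int_telescope[of "\<lambda>i. a (i + int q)"])
   finally show ?case using Suc a0(1)[of "int m + 1 + int q"] a0(2)[of "- int m + int q"] by (simp add: algebra_simps)
  qed simp
  have "Sm \<le> (\<Sum>i\<in>{- int m..int m}. C2 * real k powr - p * (\<Sum>j\<in>{k..<2*k}. w (i + int j)) + C2 * (a i - a (i + int (2 * k - 1))))"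
   unfolding Sm_def by (intro sum_mono rec k)
  also have "\<dots> = C2 * real k powr - p * (\<Sum>j\<in>{k..<2*k}. \<Sum>i\<in>{- int m..int m}. w (i + int j)) + C2 * (\<Sum>i\<in>{- int m..int m}. a i - a (i + int (2 * k - 1)))"
   by (subst sum.swap) (simp add: sum.distrib sum_distrib_left)
  also have "\<dots> \<le> C2 * real k powr - p * (real k * (Sm + 2 * real k * W0)) + C2 * (2 * real k * E\<rho>)"
  proof (intro add_mono mult_left_mono)
   have "(\<Sum>j\<in>{k..<2*k}. \<Sum>i\<in>{- int m..int m}. w (i + int j)) \<le> (\<Sum>j\<in>{k..<2*k}. Sm + 2 * real k * W0)"
   proof (rule sum_mono)
    fix j assume "j \<in> {k..<2*k}"
    then have "real j * W0 \<le> 2 * real k * W0" using W0 by (intro mult_right_mono) auto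
    then show "(\<Sum>i\<in>{- int m..int m}. w (i + int j)) \<le> Sm + 2 * real k * W0" using shift_w[of j] by linarith
   qed
   then show "(\<Sum>j\<in>{k..<2*k}. \<Sum>i\<in>{- int m..int m}. w (i + int j)) \<le> real k * (Sm + 2 * real k * W0)" by simp
   have "real (2 * k - 1) * E\<rho> \<le> 2 * real k * E\<rho>" using E\<rho>(2) by (intro mult_right_mono) auto
   then show "(\<Sum>i\<in>{- int m..int m}. a i - a (i + int (2 * k - 1))) \<le> 2 * real k * E\<rho>" using shift_a[of "2 * k - 1"] by linarith
  qed (use C2 in auto)
  also have "C2 * real k powr - p * (real k * (Sm + 2 * real k * W0)) = C2 * real k powr (1 - p) * (Sm + 2 * real k * W0)"
   using k(1) by (simp add: powr_diff powr_minus_divide)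
  also have "\<dots> \<le> 1 / 2 * (Sm + 2 * real k * W0)"
  proof (intro mult_right_mono k(2))
   show "0 \<le> Sm + 2 * real k * W0" unfolding Sm_def using W0 w0 by (intro add_nonneg_nonneg sum_nonneg) auto
  qed
  finally show ?thesis by (simp add: Sm_def[symmetric] K_def algebra_simps)
 qed
 moreover have "0 \<le> K" using W0 C2 E\<rho>(2) by (simp add: K_def)
 ultimately show ?thesis unfolding w_def by blast
qed

text \<open>On the bad set of level 2^i the function G is at least 2^i. So if G x + G y \<le> s <
  2^i, both points are off that set and \<open>lipschitz_off_bad_set\<close> gives the constant 15 *
  2^i; choosing 2^i \<le> 2 s, up to \<epsilon>, turns it into 30 s.\<close>

theorem exists_common_hajlasz_gradient:
 "\<exists>G A. Lp_integrable M p G \<and> A \<in> null_sets M \<and>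
  (\<forall>n. \<forall>x\<in>- A. \<forall>y\<in>- A. ennreal \<bar>f n x - f n y\<bar> \<le> ennreal (dist x y) * (G x + G y))"
proof -
 define G where "G = dyadic_fun p (\<lambda>i. U (dyad i))"
 obtain K where K: "0 \<le> K" "\<And>m. (\<Sum>i\<in>{- int m..int m}. 2 powr (real_of_int i * p) * measure M (U (dyad i))) \<le> K"
  using dyadic_sum_bounded by blast
 have G_meas[measurable]: "G \<in> borel_measurable M" unfolding G_def by measurable
 have "(pint M p G) = (\<Sum>n. ennreal (2 powr (real_of_int (int_decode n) * p)) * emeasure M (U (dyad (int_decode n))))"
  unfolding G_def using p by (intro nn_integral_dyadic_fun) auto
 also have "\<dots> \<le> ennreal K"
 proof (rule suminf_int_le[where w="\<lambda>i. ennreal (2 powr (real_of_int i * p)) * emeasure M (U (dyad i))"])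
  fix m
  have "emeasure M (U (dyad i)) = ennreal (measure M (U (dyad i)))" for i
  proof -
   have "emeasure M (U (dyad i)) < \<infinity>"
    using emeasure_U_weak[of "dyad i"] by (auto intro: le_less_trans)
   then show ?thesis by (intro emeasure_eq_ennreal_measure) (simp add: less_top)
  qed
  then have "(\<Sum>i\<in>{- int m..int m}. ennreal (2 powr (real_of_int i * p)) * emeasure M (U (dyad i))) =
    ennreal (\<Sum>i\<in>{- int m..int m}. 2 powr (real_of_int i * p) * measure M (U (dyad i)))"
   by (simp add: ennreal_mult[symmetric])
  then show "(\<Sum>i\<in>{- int m..int m}. ennreal (2 powr (real_of_int i * p)) * emeasure M (U (dyad i))) \<le> ennreal K"
   using K(2)[of m] by (simp add: ennreal_leI)
 qed
 finally have G_Lp: "Lp_integrable M p G" by (auto simp: Lp_integrable_def intro: le_less_trans)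
 have "AE x in M. \<forall>n. approx_continuous (f n) x"
  unfolding AE_all_countable by (intro allI AE_approx_continuous f_meas)
 then obtain A where A: "A \<in> null_sets M" "{x\<in>space M. \<not> (\<forall>n. approx_continuous (f n) x)} \<subseteq> A"
  by (auto elim!: AE_E simp: null_sets_def)
 have "ennreal \<bar>f n x - f n y\<bar> \<le> ennreal (dist x y) * (30 * G x + 30 * G y)" if x: "x \<in> - A" and y: "y \<in> - A" for n x y
 proof (cases "x = y \<or> G x + G y = \<infinity>")
  case True
  then show ?thesis
  proof
   assume "G x + G y = \<infinity>"
   then have "30 * G x + 30 * G y = \<infinity>" by (auto simp: ennreal_mult_top)
   then show ?thesis by (cases "x = y") (auto simp: ennreal_mult_top)
  qed simp
 next
  case False
  define s where "s = enn2real (G x + G y)"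
  have s: "G x + G y = ennreal s" "0 \<le> s" using False by (auto simp: s_def less_top)
  \<comment> \<open>The \<epsilon> takes care of s = 0, which lies between no two powers of
    2.\<close>
  have eps: "\<bar>f n x - f n y\<bar> \<le> 30 * (s + \<epsilon>) * dist x y" if \<epsilon>: "\<epsilon> > 0" for \<epsilon>
  proof -
   define i where "i = \<lfloor>log 2 (s + \<epsilon>)\<rfloor> + 1"
   have pos: "0 < s + \<epsilon>" using s(2) \<epsilon> by simp
   have low: "s < dyad i"
   proof -
    have "log 2 (s + \<epsilon>) < real_of_int i" unfolding i_def by linarith
    then have "s + \<epsilon> < dyad i" using pos by (simp add: log_less_iff)
    then show ?thesis using \<epsilon> by linarith
   qed
   have up: "dyad i \<le> 2 * (s + \<epsilon>)"
   proof -
    have "dyad i \<le> 2 powr (log 2 (s + \<epsilon>) + 1)" unfolding i_def by (intro powr_mono) linarith+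
    also have "\<dots> = 2 * (s + \<epsilon>)" using pos by (simp add: powr_add)
    finally show ?thesis .
   qed
   have notin: "w \<notin> U (dyad i)" if "G w \<le> ennreal s" for w
   proof
    assume "w \<in> U (dyad i)"
    then have "ennreal (dyad i) \<le> G w" unfolding G_def using p by (intro dyadic_fun_ge) auto
    then have "ennreal (dyad i) \<le> ennreal s" using that by (rule order_trans)
    then show False using low s(2) by simp
   qed
   have "G x \<le> ennreal s" "G y \<le> ennreal s" unfolding s(1)[symmetric] by simp_all
   then have "\<bar>f n x - f n y\<bar> \<le> 15 * dyad i * dist x y"
    using A(2) x y by (intro lipschitz_off_bad_set[OF f_meas \<kappa>] notin) auto
   also have "\<dots> \<le> 15 * (2 * (s + \<epsilon>)) * dist x y" using up by (intro mult_right_mono mult_left_mono) auto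
   finally show ?thesis by simp
  qed
  have "\<bar>f n x - f n y\<bar> \<le> 30 * s * dist x y + \<delta>" if \<delta>: "\<delta> > 0" for \<delta>
  proof -
   have "0 < dist x y" using False by simp
   then show ?thesis using eps[of "\<delta> / (30 * dist x y)"] \<delta> by (simp add: distrib_right distrib_left)
  qed
  then have "\<bar>f n x - f n y\<bar> \<le> 30 * s * dist x y" by (rule field_le_epsilon)
  then have "ennreal \<bar>f n x - f n y\<bar> \<le> ennreal (dist x y) * (30 * ennreal s)"
   using s(2) by (simp add: ennreal_mult[symmetric] ennreal_leI ac_simps flip: ennreal_numeral)
  then show ?thesis by (simp add: s(1)[symmetric] distrib_left)
 qed
 moreover have "Lp_integrable M p (\<lambda>x. 30 * G x)" using p by (intro Lp_integrable_cmult[OF G_Lp]) auto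
 ultimately show ?thesis using A(1) by (intro exI[of _ "\<lambda>x. 30 * G x"] exI[of _ A]) blast
qed

end

lemma measurable_norm_diff:
 fixes u :: "'a \<Rightarrow> 'v::real_normed_vector"
 assumes "u \<in> borel_measurable M" shows "(\<lambda>x. norm (u x - d)) \<in> borel_measurable M"
 by (rule measurable_compose[OF assms]) (intro borel_measurable_continuous_onI continuous_intros)

lemma (in doubling_measure) norm_integrable_ball:
 fixes u :: "'z \<Rightarrow> 'v::real_normed_vector"
 assumes u[measurable]: "u \<in> borel_measurable M" and p: "1 \<le> p"
  and Lp: "Lp_integrable M p (enorm u)"
 shows "integrable (restrict_space M (ball x r)) (\<lambda>y. norm (u y - d))"
proof (rule integrableI_bounded)
 show "(\<lambda>y. norm (u y - d)) \<in> borel_measurable (restrict_space M (ball x r))"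
  by (intro measurable_restrict_space1 measurable_norm_diff u)
 have [measurable]: "(\<lambda>y. norm (u y)) \<in> borel_measurable M" "(\<lambda>y. norm (u y - d)) \<in> borel_measurable M"
  using measurable_norm_diff[OF u, of 0] measurable_norm_diff[OF u, of d] by simp_all
 have "(\<integral>\<^sup>+y. ennreal (norm (norm (u y - d))) \<partial>restrict_space M (ball x r)) = (\<integral>\<^sup>+y. ennreal (norm (u y - d)) * indicator (ball x r) y \<partial>M)"
  by (subst nn_integral_restrict_space) auto
 also have "\<dots> \<le> (\<integral>\<^sup>+y. ennreal (1 + norm d) * indicator (ball x r) y + ennreal_powr (ennreal (norm (u y))) p \<partial>M)"
 proof (rule nn_integral_mono)
  fix y
  have "norm (u y) \<le> 1 + norm (u y) powr p"
  proof (cases "norm (u y) \<le> 1")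
   case False
   then have "norm (u y) powr 1 \<le> norm (u y) powr p" using p by (intro powr_mono) auto
   then show ?thesis by simp
  qed (simp add: add_increasing2)
  then have "norm (u y - d) \<le> (1 + norm d) + norm (u y) powr p"
   using norm_triangle_ineq4[of "u y" d] by linarith
  then have "ennreal (norm (u y - d)) \<le> ennreal (1 + norm d) + ennreal_powr (ennreal (norm (u y))) p"
   by (simp add: ennreal_powr_ennreal ennreal_plus[symmetric] ennreal_leI del: ennreal_plus)
  then show "ennreal (norm (u y - d)) * indicator (ball x r) y \<le> ennreal (1 + norm d) * indicator (ball x r) y + ennreal_powr (ennreal (norm (u y))) p"
   by (auto split: split_indicator)
 qed
 also have "\<dots> = ennreal (1 + norm d) * emeasure M (ball x r) + (\<integral>\<^sup>+y. ennreal_powr (ennreal (norm (u y))) p \<partial>M)"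
  by (subst nn_integral_add) (auto simp: nn_integral_cmult_indicator)
 also have "\<dots> < \<infinity>"
  using Lp ball_finite[of x r] by (auto simp: Lp_integrable_def ennreal_mult_less_top)
 finally show "(\<integral>\<^sup>+y. ennreal (norm (norm (u y - d))) \<partial>restrict_space M (ball x r)) < \<infinity>" .
qed

text \<open>Distances in the target are recovered from the functions
  \<open>norm (u x - d n)\<close>: with \<open>d n\<close> close to \<open>u x\<close>, the
  difference of the values at x and y is close to \<open>norm (u x - u y)\<close>. As all these
  functions share one gradient, u has it as well.\<close>

theorem (in poincare_space) weak_upper_gradient_imp_hajlasz:
 fixes u :: "'z \<Rightarrow> 'v::real_normed_vector"
 assumes u: "ess_separable_measurable M u" and u_Lp: "Lp_integrable M p (enorm u)"
  and wug: "weak_upper_gradient M p u \<rho>" and \<rho>: "Lp_integrable M p \<rho>"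
 shows "\<exists>G. hajlasz_upper_gradient M u G \<and> Lp_integrable M p G"
proof -
 have u_meas[measurable]: "u \<in> borel_measurable M" by (rule ess_separable_measurable_measurable[OF u])
 obtain A C where A: "A \<in> null_sets M" and C: "countable C" "u ` (space M - A) \<subseteq> closure C"
  using ess_separable_measurableE[OF u] .
 \<comment> \<open>Inserting 0 keeps the set nonempty, so that it is the range of its
   enumeration.\<close>
 define d where "d = from_nat_into (insert 0 C)"
 have d: "range d = insert 0 C" using C(1) by (simp add: d_def range_from_nat_into)
 obtain \<Gamma> where \<rho>_borel: "\<rho> \<in> borel_on UNIV" and \<Gamma>: "p_negligible M p \<Gamma>"
  and upper': "\<forall>(a, b, \<gamma>) \<in> paths_in UNIV - \<Gamma>. ennreal (norm (u (\<gamma> a) - u (\<gamma> b))) \<le> curve_integral \<rho> (a, b, \<gamma>)"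
  using wug unfolding weak_upper_gradient_def space_M by blast
 obtain e where e: "e \<in> borel_on UNIV" "Lp_integrable M p e" "\<forall>c\<in>\<Gamma>. curve_integral e c = \<infinity>"
  using \<Gamma> unfolding p_negligible_def space_M by blast
 interpret common_gradient M cd p Cp \<kappa> "\<lambda>n x. norm (u x - d n)" \<rho> e
 proof
  show "(\<lambda>x. norm (u x - d n)) \<in> borel_measurable M" for n by (rule measurable_norm_diff[OF u_meas])
  show "integrable (restrict_space M (ball x r)) (\<lambda>x. norm (u x - d n))" for n x r
   using p by (intro norm_integrable_ball[OF u_meas _ u_Lp]) auto
  show "\<rho> \<in> borel_measurable borel" "e \<in> borel_measurable borel"
   using \<rho>_borel e(1) by (simp_all add: measurable_def sets_restrict_space space_restrict_space)
  fix n a b and \<gamma> :: "real \<Rightarrow> 'z"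
  assume "(a, b, \<gamma>) \<in> paths_in UNIV" "curve_integral e (a, b, \<gamma>) < \<infinity>"
  then have "(a, b, \<gamma>) \<in> paths_in UNIV - \<Gamma>" using e(3) by auto
  from bspec[OF upper' this] have "ennreal (norm (u (\<gamma> a) - u (\<gamma> b))) \<le> curve_integral \<rho> (a, b, \<gamma>)" by simp
  moreover have "\<bar>norm (u (\<gamma> a) - d n) - norm (u (\<gamma> b) - d n)\<bar> \<le> norm (u (\<gamma> a) - u (\<gamma> b))"
   using norm_triangle_ineq3[of "u (\<gamma> a) - d n" "u (\<gamma> b) - d n"] by simp
  ultimately show "ennreal \<bar>norm (u (\<gamma> a) - d n) - norm (u (\<gamma> b) - d n)\<bar> \<le> curve_integral \<rho> (a, b, \<gamma>)"
   by (blast intro: order_trans ennreal_leI)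
 qed (use \<rho> e in auto)
 obtain G A' where G: "Lp_integrable M p G" and A': "A' \<in> null_sets M"
  and haj: "\<forall>n. \<forall>x\<in>- A'. \<forall>y\<in>- A'. ennreal \<bar>norm (u x - d n) - norm (u y - d n)\<bar> \<le> ennreal (dist x y) * (G x + G y)"
  using exists_common_hajlasz_gradient by blast
 have "ennreal (norm (u x - u y)) \<le> ennreal (dist x y) * (G x + G y)"
  if x: "x \<in> space M - (A \<union> A')" and y: "y \<in> space M - (A \<union> A')" for x y
 proof (rule ennreal_le_epsilon)
  fix \<epsilon> :: real assume \<epsilon>: "0 < \<epsilon>"
  have "u x \<in> closure (insert 0 C)" using C(2) x closure_mono[of C "insert 0 C"] by auto
  then obtain n where n: "dist (d n) (u x) < \<epsilon> / 2" using \<epsilon> d unfolding closure_approachable by (metis half_gt_zero rangeE)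
  have "norm (u x - u y) \<le> norm (u x - d n) + norm (u y - d n)"
   using norm_triangle_ineq4[of "u x - d n" "u y - d n"] by simp
  also have "\<dots> \<le> \<bar>norm (u x - d n) - norm (u y - d n)\<bar> + 2 * norm (u x - d n)" by linarith
  also have "\<dots> \<le> \<bar>norm (u x - d n) - norm (u y - d n)\<bar> + \<epsilon>" using n by (simp add: dist_norm norm_minus_commute)
  finally have "ennreal (norm (u x - u y)) \<le> ennreal \<bar>norm (u x - d n) - norm (u y - d n)\<bar> + ennreal \<epsilon>"
   using \<epsilon> by (simp add: ennreal_plus[symmetric] ennreal_leI del: ennreal_plus)
  also have "\<dots> \<le> ennreal (dist x y) * (G x + G y) + ennreal \<epsilon>"
   using haj x y by (intro add_right_mono) auto
  finally show "ennreal (norm (u x - u y)) \<le> ennreal (dist x y) * (G x + G y) + ennreal \<epsilon>" .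
 qed
 moreover have "A \<union> A' \<in> null_sets M" using A A' by (rule null_sets.Un)
 ultimately have "hajlasz_upper_gradient M u G"
  unfolding hajlasz_upper_gradient_def using G
  by (intro conjI bexI[of _ "A \<union> A'"] ballI) (simp_all add: Lp_integrable_def)
 then show ?thesis using G by blast
qed

text \<open>Each superlevel set at a rational q is covered by a Borel set up to a null set, and f'
  is the supremum of the q over these covers. The sets \<open>K n\<close> of finite measure turn
  equality of measures in \<open>cover\<close> into a null difference.\<close>

lemma complete_borel_majorant:
 fixes f :: "'z::topological_space \<Rightarrow> ennreal"
 assumes sp: "space M = UNIV" and borel: "sets borel \<subseteq> sets M"
  and K: "\<And>n::nat. K n \<in> sets M" "\<And>n. emeasure M (K n) < \<infinity>" "(\<Union>n. K n) = UNIV"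
  and cover: "\<And>A. A \<in> sets M \<Longrightarrow> \<exists>B\<in>sets borel. A \<subseteq> B \<and> emeasure M B = emeasure M A"
  and f[measurable]: "f \<in> borel_measurable M"
 shows "\<exists>f'\<in>borel_measurable borel. (\<forall>x. f x \<le> f' x) \<and> (AE x in M. f' x = f x)"
proof -
 have cover': "\<exists>B\<in>sets borel. A \<subseteq> B \<and> B - A \<in> null_sets M" if A: "A \<in> sets M" for A
 proof -
  have "\<forall>n. \<exists>B. B \<in> sets borel \<and> A \<inter> K n \<subseteq> B \<and> emeasure M B = emeasure M (A \<inter> K n)"
   using cover[OF sets.Int[OF A K(1)]] by blast
  from choice[OF this] obtain B where B: "\<forall>n. B n \<in> sets borel \<and> A \<inter> K n \<subseteq> B n \<and> emeasure M (B n) = emeasure M (A \<inter> K n)" ..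
  have B_M: "B n \<in> sets M" for n using B borel by blast
  have null: "B n - A \<inter> K n \<in> null_sets M" for n
  proof -
   have "emeasure M (A \<inter> K n) \<noteq> \<infinity>"
    using emeasure_mono[of "A \<inter> K n" "K n" M] K(1,2)[of n] by (auto simp: top_unique)
   then have "emeasure M (B n - A \<inter> K n) = emeasure M (B n) - emeasure M (A \<inter> K n)"
    using B A K(1) B_M by (intro emeasure_Diff) auto
   then show ?thesis using B B_M A K(1) \<open>emeasure M (A \<inter> K n) \<noteq> \<infinity>\<close> by (intro null_setsI) auto
  qed
  show ?thesis
  proof (intro bexI conjI)
   show "A \<subseteq> (\<Union>n. B n)"
   proof
    fix x assume "x \<in> A"
    moreover obtain n where "x \<in> K n" using K(3) by blast
    ultimately have "x \<in> B n" using spec[OF B, of n] by blast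
    then show "x \<in> (\<Union>n. B n)" by blast
   qed
   have "(\<Union>n. B n - A \<inter> K n) \<in> null_sets M" using null by (intro null_sets_UN) auto
   then show "(\<Union>n. B n) - A \<in> null_sets M"
   proof (rule null_sets_subset)
    show "(\<Union>n. B n) - A \<in> sets M" using B_M A by (intro sets.Diff sets.countable_UN) auto
   qed blast
   show "(\<Union>n. B n) \<in> sets borel" using spec[OF B] by (intro sets.countable_UN) blast
  qed
 qed
 have "\<forall>q::rat. \<exists>B. B \<in> sets borel \<and> {x. ennreal (real_of_rat q) < f x} \<subseteq> B \<and> B - {x. ennreal (real_of_rat q) < f x} \<in> null_sets M"
 proof
  fix q :: rat
  have "{x\<in>space M. ennreal (real_of_rat q) < f x} \<in> sets M" by measurable
  then show "\<exists>B. B \<in> sets borel \<and> {x. ennreal (real_of_rat q) < f x} \<subseteq> B \<and> B - {x. ennreal (real_of_rat q) < f x} \<in> null_sets M"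
   using cover'[of "{x. ennreal (real_of_rat q) < f x}"] unfolding sp by simp blast
 qed
 from choice[OF this] obtain B where B: "\<forall>q. B q \<in> sets borel \<and> {x. ennreal (real_of_rat q) < f x} \<subseteq> B q \<and> B q - {x. ennreal (real_of_rat q) < f x} \<in> null_sets M" ..
 have [measurable]: "B q \<in> sets borel" for q using B by blast
 \<comment> \<open>Negative q contribute 0, because \<open>ennreal\<close> truncates them.\<close>
 define f' where "f' x = (SUP q. ennreal (real_of_rat q) * indicator (B q) x)" for x
 have "f' \<in> borel_measurable borel" unfolding f'_def by measurable
 moreover have le: "f x \<le> f' x" for x
 proof (rule ccontr)
  assume "\<not> f x \<le> f' x"
  then have lt: "f' x < f x" by simp
  then obtain y :: ennreal where y: "f' x < y" "y < f x" using dense by blast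
  then obtain a where a: "f' x = ennreal a" "0 \<le> a" by (cases "f' x") auto
  obtain b where b: "y = ennreal b" "0 \<le> b" using y by (cases y) auto
  have "a < b" using y a b by (simp add: ennreal_less_iff)
  then obtain q where q: "a < real_of_rat q" "real_of_rat q < b" using of_rat_dense by blast
  have "ennreal (real_of_rat q) < f x" using y(2) b q a(2) by (meson ennreal_leI less_imp_le le_less_trans)
  then have "x \<in> B q" using B by blast
  then have "ennreal (real_of_rat q) \<le> f' x" unfolding f'_def by (intro SUP_upper2[of q]) auto
  then show False using a q by (simp add: ennreal_le_iff)
 qed
 moreover have "AE x in M. f' x = f x"
 proof -
  have "AE x in M. \<forall>q. x \<notin> B q - {x. ennreal (real_of_rat q) < f x}"
   unfolding AE_all_countable using B by (intro allI AE_not_in) blast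
  then show ?thesis
  proof eventually_elim
   case (elim x)
   have "f' x \<le> f x" unfolding f'_def
    using elim by (intro SUP_least) (auto split: split_indicator)
   then show ?case using le[of x] by (rule antisym)
  qed
 qed
 ultimately show ?thesis by blast
qed

lemma complete_measure_restrict_space:
 assumes "complete_measure M" "S \<in> sets M"
 shows "complete_measure (restrict_space M S)"
proof
 interpret complete_measure M by fact
 fix A B assume "B \<subseteq> A" "A \<in> null_sets (restrict_space M S)"
 moreover have "null_sets (restrict_space M S) = {N \<in> null_sets M. N \<subseteq> S}"
  using assms(2) by (intro set_eqI) (auto simp: null_sets_restrict_space)
 ultimately show "B \<in> sets (restrict_space M S)"
  using assms(2) complete[of B A] by (auto simp: sets_restrict_space_iff)
qed

lemma (in doubling_measure) borel_compatible_restrict_space: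
 assumes S: "S \<in> sets M" shows "borel_compatible_measure (restrict_space M S)"
proof -
 have sp: "space (restrict_space M S) = S" using S by (simp add: space_restrict_space)
 show ?thesis
 proof (intro borel_compatible_measure.intro borel_compatible_measure_axioms.intro)
  show "complete_measure (restrict_space M S)"
   by (intro complete_measure_restrict_space S) unfold_locales
  show "sets (restrict_space borel (space (restrict_space M S))) \<subseteq> sets (restrict_space M S)"
   unfolding sp using borel_sets_M by (auto simp: sets_restrict_space)
  fix f :: "'z \<Rightarrow> ennreal" assume f: "f \<in> borel_measurable (restrict_space M S)"
  have "(\<lambda>x. f x * indicator S x) \<in> borel_measurable M"
   using f S by (simp add: borel_measurable_restrict_space_iff_ennreal)
  moreover have "(\<Union>n. ball undefined (real n)) = (UNIV :: 'z set)"
   using reals_Archimedean2 by (auto intro!: UNIV_eq_I)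
  ultimately have "\<exists>f'\<in>borel_measurable borel. (\<forall>x. f x * indicator S x \<le> f' x) \<and> (AE x in M. f' x = f x * indicator S x)"
   by (intro complete_borel_majorant[where K="\<lambda>n. ball undefined (real n)"] space_M borel_sets_M ball_in_M ball_finite borel_cover)
  then obtain f' where f': "f' \<in> borel_measurable borel" "\<forall>x. f x * indicator S x \<le> f' x" "AE x in M. f' x = f x * indicator S x" by blast
  show "\<exists>f'\<in>borel_measurable (restrict_space borel (space (restrict_space M S))).
    (\<forall>x\<in>space (restrict_space M S). f x \<le> f' x) \<and> (AE x in restrict_space M S. f' x = f x)"
   unfolding sp
  proof (intro bexI conjI)
   show "f' \<in> borel_on S" using f'(1) by (rule measurable_restrict_space1)
   show "\<forall>x\<in>S. f x \<le> f' x" using f'(2) by (auto dest!: spec split: split_indicator_asm)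
   show "AE x in restrict_space M S. f' x = f x"
    using f'(3) S by (subst AE_restrict_space_iff) (auto elim!: eventually_mono)
  qed
 qed
qed

lemma (in doubling_measure) borel_compatible: "borel_compatible_measure M"
proof -
 have "restrict_space M UNIV = M"
  by (rule measure_eqI) (auto simp: sets_restrict_space intro!: emeasure_restrict_space[THEN trans] sets.top[of M, simplified])
 then show ?thesis using borel_compatible_restrict_space[OF sets.top] by simp
qed

section \<open>Extension of Hajlasz functions\<close>

text \<open>Dense in the sense of the measure-density condition, not topologically. Nonemptiness
  makes \<open>infdist\<close> the genuine distance to \<Omega>.\<close>

locale dense_set = doubling_measure M cd
 for M :: "'z::{metric_space, second_countable_topology} measure" and cd +
 fixes \<Omega> :: "'z set" and c\<Omega> :: real
 assumes \<Omega>_in_M [measurable]: "\<Omega> \<in> sets M" and \<Omega>_nonempty: "\<Omega> \<noteq> {}" and c\<Omega>: "0 < c\<Omega>"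
  and density: "x \<in> \<Omega> \<Longrightarrow> 0 < r \<Longrightarrow> r \<le> 1 \<Longrightarrow> ennreal c\<Omega> * emeasure M (ball x r) \<le> emeasure M (ball x r \<inter> \<Omega>)"
begin

section \<open>Distance to the set, Whitney balls and the partition of unity\<close>

abbreviation R :: "'z \<Rightarrow> real" where "R x \<equiv> infdist x \<Omega>"

lemma R_lip: "\<bar>R x - R y\<bar> \<le> dist x y"
 by (rule infdist_triangle_abs)

lemma exists_near: "R x < s \<Longrightarrow> \<exists>w\<in>\<Omega>. dist x w < s"
 using \<Omega>_nonempty by (auto simp: infdist_def dest!: cInf_lessD[rotated])

lemma emeasure_eq_measure_ball: "A \<in> sets M \<Longrightarrow> emeasure M (ball x r \<inter> A) = ennreal (measure M (ball x r \<inter> A))"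
 using finite_measure_ball_M[of A x r] by (intro emeasure_eq_ennreal_measure) (simp add: Int_commute less_top)

lemma density_measure:
 assumes "x \<in> \<Omega>" "0 < r" "r \<le> 1" shows "c\<Omega> * \<mu> x r \<le> measure M (ball x r \<inter> \<Omega>)"
proof -
 have "ennreal (c\<Omega> * \<mu> x r) \<le> ennreal (measure M (ball x r \<inter> \<Omega>))"
  using density[OF assms] c\<Omega> \<mu>_nonneg[of x r]
  by (simp add: emeasure_ball emeasure_eq_measure_ball[OF \<Omega>_in_M] ennreal_mult)
 then show ?thesis by (simp add: ennreal_le_iff)
qed

text \<open>Almost every point of the complement is a density point of the complement. A point x at
  distance 0 has points of \<Omega> arbitrarily near, and the density condition there puts a fixed
  fraction of \<Omega> into all small balls about x. Hence the closure adds only a null set to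
  \<Omega>.\<close>

lemma AE_infdist_pos: "AE x in M. x \<notin> \<Omega> \<longrightarrow> 0 < R x"
proof -
 \<comment> \<open>Half the fraction of \<open>ball x r\<close> that must belong to \<Omega>;
   \<open>cd ^ 2\<close> compares this ball with a ball of half the radius about a nearby point of
   \<Omega>.\<close>
 define \<delta> where "\<delta> = c\<Omega> / (2 * cd ^ 2)"
 have \<delta>: "0 < \<delta>" using c\<Omega> cd by (simp add: \<delta>_def)
 have "- \<Omega> \<in> sets M" using sets.compl_sets[OF \<Omega>_in_M] by (simp add: Compl_eq_Diff_UNIV)
 from density_point[OF this \<delta>] show ?thesis
 proof eventually_elim
  case (elim x)
  show ?case
  proof (intro impI, rule ccontr)
   assume x: "x \<notin> \<Omega>" and "\<not> 0 < R x"
   then have R0: "R x = 0" using infdist_nonneg[of x \<Omega>] by simp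
   obtain r0 where r0: "0 < r0" "\<And>r. 0 < r \<Longrightarrow> r < r0 \<Longrightarrow> measure M (ball x r - - \<Omega>) \<le> \<delta> * \<mu> x r"
    using elim x by auto
   define r where "r = min (r0 / 2) 1"
   have r: "0 < r" "r < r0" "r \<le> 1" using r0(1) by (auto simp: r_def)
   have "R x < r / 2" using R0 r by simp
   then obtain w where w: "w \<in> \<Omega>" "dist x w < r / 2"
    using exists_near by blast
   have sub: "ball w (r / 2) \<subseteq> ball x r"
   proof
    fix z assume "z \<in> ball w (r / 2)"
    then have "dist w z < r / 2" by simp
    then show "z \<in> ball x r" using dist_triangle[of x z w] w(2) by simp
   qed
   have "\<mu> x r \<le> cd ^ 2 * \<mu> w (r / 2)" using w(2) r by (intro \<mu>_comparable) (auto simp: dist_commute)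
   then have "c\<Omega> * \<mu> x r \<le> cd ^ 2 * (c\<Omega> * \<mu> w (r / 2))" using c\<Omega> by simp
   also have "c\<Omega> * \<mu> w (r / 2) \<le> measure M (ball w (r / 2) \<inter> \<Omega>)" using r w by (intro density_measure) auto
   also have "\<dots> \<le> measure M (ball x r - - \<Omega>)"
    using sub by (intro measure_mono_fmeasurable sub_ball_fmeasurable[of _ x r]) (auto simp: Diff_Compl)
   also have "\<dots> \<le> \<delta> * \<mu> x r" using r0(2) r by simp
   finally have "c\<Omega> * \<mu> x r \<le> cd ^ 2 * (\<delta> * \<mu> x r)" using cd by simp
   also have "\<dots> = c\<Omega> * \<mu> x r / 2" using cd by (simp add: \<delta>_def)
   finally show False using c\<Omega> \<mu>_pos[OF r(1), of x] by simp
  qed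
 qed
qed

text \<open>The radius R x / 40 makes the 5-fold balls of radius R x / 8 cover, well inside the
  supports of radius R x / 4 of the later partition functions. Only R x < 1 is considered, since the
  density condition concerns radii up to 1; the extension is cut off at distance 1.\<close>

definition whitney :: "('z \<times> real) set" where
 "whitney = (SOME G. G \<subseteq> {(x, R x / 40) | x. 0 < R x \<and> R x < 1} \<and>
   (\<forall>B\<in>G. \<forall>B'\<in>G. B \<noteq> B' \<longrightarrow> ball (fst B) (snd B) \<inter> ball (fst B') (snd B') = {}) \<and>
   (\<forall>B\<in>{(x, R x / 40) | x. 0 < R x \<and> R x < 1}. \<exists>B'\<in>G. ball (fst B) (snd B) \<subseteq> ball (fst B') (5 * snd B')))"

lemma whitney:
 "whitney \<subseteq> {(x, R x / 40) | x. 0 < R x \<and> R x < 1}"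
 "\<forall>B\<in>whitney. \<forall>B'\<in>whitney. B \<noteq> B' \<longrightarrow> ball (fst B) (snd B) \<inter> ball (fst B') (snd B') = {}"
 "\<forall>B\<in>{(x, R x / 40) | x. 0 < R x \<and> R x < 1}. \<exists>B'\<in>whitney. ball (fst B) (snd B) \<subseteq> ball (fst B') (5 * snd B')"
proof -
 have "\<forall>B\<in>{(x, R x / 40) | x. 0 < R x \<and> R x < 1}. 0 < snd B \<and> snd B \<le> 1" by auto
 from someI_ex[OF vitali_covering_metric[OF this], folded whitney_def]
 show "whitney \<subseteq> {(x, R x / 40) | x. 0 < R x \<and> R x < 1}"
  "\<forall>B\<in>whitney. \<forall>B'\<in>whitney. B \<noteq> B' \<longrightarrow> ball (fst B) (snd B) \<inter> ball (fst B') (snd B') = {}"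
  "\<forall>B\<in>{(x, R x / 40) | x. 0 < R x \<and> R x < 1}. \<exists>B'\<in>whitney. ball (fst B) (snd B) \<subseteq> ball (fst B') (5 * snd B')"
  by blast+
qed

definition centers :: "'z set" where "centers = fst ` whitney"

lemma centers_R: "x \<in> centers \<Longrightarrow> 0 < R x \<and> R x < 1"
 using whitney(1) by (auto simp: centers_def)

lemma centers_disjoint:
 assumes "x \<in> centers" "y \<in> centers" "x \<noteq> y"
 shows "ball x (R x / 40) \<inter> ball y (R y / 40) = {}"
proof -
 have "(x, R x / 40) \<in> whitney" "(y, R y / 40) \<in> whitney" using assms whitney(1) by (auto simp: centers_def)
 with whitney(2) assms(3) show ?thesis by fastforce
qed

lemma centers_cover:
 assumes "0 < R x" "R x < 1" shows "\<exists>c\<in>centers. dist x c < R c / 8"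
proof -
 have "(x, R x / 40) \<in> {(x, R x / 40) | x. 0 < R x \<and> R x < 1}" using assms by blast
 from bspec[OF whitney(3) this] obtain B where B: "B \<in> whitney" "ball x (R x / 40) \<subseteq> ball (fst B) (5 * snd B)" by auto
 obtain c where c: "B = (c, R c / 40)" using B(1) whitney(1) by blast
 have "x \<in> ball x (R x / 40)" using assms by simp
 then have "x \<in> ball (fst B) (5 * snd B)" using B(2) by blast
 then have "x \<in> ball c (R c / 8)" by (simp add: c)
 moreover have "c \<in> centers" using B(1) by (force simp: centers_def c)
 ultimately show ?thesis by (auto simp: dist_commute)
qed

lemma countable_centers: "countable centers"
proof -
 define F where "F = (\<lambda>c. ball c (R c / 40)) ` centers"
 have "countable F"
  using centers_disjoint by (intro countable_disjoint_open_subsets) (fastforce simp: F_def disjoint_def)+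
 moreover have "inj_on (\<lambda>c. ball c (R c / 40)) centers"
 proof (rule inj_onI, rule ccontr)
  fix x y assume xy: "x \<in> centers" "y \<in> centers" "ball x (R x / 40) = ball y (R y / 40)" "x \<noteq> y"
  then have "ball x (R x / 40) = {}" using centers_disjoint[of x y] by auto
  then show False using centers_R[OF xy(1)] by simp
 qed
 ultimately show ?thesis unfolding F_def by (auto dest: countable_image_inj_on)
qed

text \<open>Centres are indexed by natural numbers, so that sums over them can be written as series
  over all n, the terms outside \<open>I\<close> being 0.\<close>

definition I :: "nat set" where "I = to_nat_on centers ` centers"
definition X :: "nat \<Rightarrow> 'z" where "X n = from_nat_into centers n"

lemma X_center: "n \<in> I \<Longrightarrow> X n \<in> centers"
 using countable_centers by (auto simp: I_def X_def)

lemma X_R: "n \<in> I \<Longrightarrow> 0 < R (X n)" "n \<in> I \<Longrightarrow> R (X n) < 1"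
 using X_center centers_R by blast+

lemma X_inj: "n \<in> I \<Longrightarrow> m \<in> I \<Longrightarrow> X n = X m \<Longrightarrow> n = m"
 using countable_centers by (auto simp: I_def X_def)

lemma X_surj: "c \<in> centers \<Longrightarrow> \<exists>n\<in>I. X n = c"
 using countable_centers by (auto simp: I_def X_def)

text \<open>At least 1/2 within distance R (X n) / 8 of the centre, where
  \<open>centers_cover\<close> places every point for some n, and 0 from distance R (X n) / 4
  on.\<close>

definition a :: "nat \<Rightarrow> 'z \<Rightarrow> real" where
 "a n x = (if n \<in> I then max 0 (1 - 4 * dist x (X n) / R (X n)) else 0)"

definition F :: "'z \<Rightarrow> nat set" where "F x = {n\<in>I. dist x (X n) < R (X n) / 4}"

lemma a_nonneg: "0 \<le> a n x"
 by (simp add: a_def)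

lemma a_pos_iff: "a n x \<noteq> 0 \<longleftrightarrow> n \<in> F x"
 using X_R[of n] by (auto simp: a_def F_def field_simps max_def)

lemma F_R:
 assumes "n \<in> F x"
 shows "n \<in> I" "dist x (X n) < R (X n) / 4" "3 / 4 * R (X n) \<le> R x" "R x \<le> 5 / 4 * R (X n)"
 using assms R_lip[of x "X n"] by (auto simp: F_def)

text \<open>The disjoint balls of radius R (X n) / 40 with n in \<open>F x\<close> lie in the ball
  of radius 2 R x about x, and each has at least the fraction cd^(-7) of its measure: R x \<le> 5/4
  R (X n), and 1/4 + 2 * 5/4 \<le> 2^7 / 40.\<close>

lemma card_F:
 assumes "0 < R x" shows "finite (F x) \<and> real (card (F x)) \<le> cd ^ 7"
proof -
 have bound: "real (card J) \<le> cd ^ 7" if J: "finite J" "J \<subseteq> F x" for J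
 proof -
  let ?B = "\<lambda>n. ball (X n) (R (X n) / 40)"
  have n: "n \<in> I" "dist x (X n) < R (X n) / 4" "3 / 4 * R (X n) \<le> R x" "R x \<le> 5 / 4 * R (X n)" if "n \<in> J" for n
   using F_R[of n x] that J by auto
  have "real (card J) * (\<mu> x (2 * R x) / cd ^ 7) = (\<Sum>n\<in>J. \<mu> x (2 * R x) / cd ^ 7)" by simp
  also have "\<dots> \<le> (\<Sum>n\<in>J. measure M (?B n))"
  proof (rule sum_mono)
   fix j assume j: "j \<in> J"
   have "\<mu> x (2 * R x) \<le> cd ^ 7 * \<mu> (X j) (R (X j) / 40)"
    using n[OF j] X_R[of j] by (intro \<mu>_comparable) (auto simp: dist_commute)
   then show "\<mu> x (2 * R x) / cd ^ 7 \<le> measure M (?B j)"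
    using cd by (simp add: \<mu>_def field_simps)
  qed
  also have "\<dots> = measure M (\<Union>n\<in>J. ?B n)"
  proof (rule measure_finite_Union[symmetric])
   show "disjoint_family_on ?B J"
    unfolding disjoint_family_on_def using centers_disjoint X_center X_inj n(1) by metis
   show "emeasure M (?B j) \<noteq> \<infinity>" for j using ball_finite[of "X j" "R (X j) / 40"] by simp
  qed (use J in auto)
  also have "\<dots> \<le> \<mu> x (2 * R x)"
   unfolding \<mu>_def
  proof (intro measure_mono_fmeasurable)
   show "(\<Union>n\<in>J. ?B n) \<subseteq> ball x (2 * R x)"
   proof clarify
    fix j z assume j: "j \<in> J" and "z \<in> ?B j"
    then have "dist (X j) z < R (X j) / 40" by simp
    then show "z \<in> ball x (2 * R x)" using n[OF j] dist_triangle[of x z "X j"] by simp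
   qed
   show "(\<Union>n\<in>J. ?B n) \<in> sets M" using J by (intro sets.finite_UN) auto
  qed (auto intro: sub_ball_fmeasurable)
  finally have "real (card J) * (\<mu> x (2 * R x) / cd ^ 7) \<le> 1 * \<mu> x (2 * R x)" by simp
  then show ?thesis using \<mu>_pos[of "2 * R x" x] assms cd by (simp add: field_simps)
 qed
 have "finite (F x)"
 proof (rule ccontr)
  assume "infinite (F x)"
  obtain m :: nat where m: "cd ^ 7 < real m" using reals_Archimedean2 by blast
  obtain J where "finite J" "J \<subseteq> F x" "card J = m" using infinite_arbitrarily_large[OF \<open>infinite (F x)\<close>] by blast
  then show False using bound[of J] m by simp
 qed
 then show ?thesis using bound by blast
qed

definition S :: "'z \<Rightarrow> real" where "S x = (\<Sum>n. a n x)"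
definition \<phi> :: "nat \<Rightarrow> 'z \<Rightarrow> real" where "\<phi> n x = a n x / S x"

lemma S_eq: "finite J \<Longrightarrow> F x \<subseteq> J \<Longrightarrow> S x = (\<Sum>n\<in>J. a n x)"
 unfolding S_def using a_pos_iff by (intro suminf_finite) auto

lemma \<phi>_zero: "n \<notin> F x \<Longrightarrow> \<phi> n x = 0"
 using a_pos_iff by (auto simp: \<phi>_def)

lemma S_ge:
 assumes "0 < R x" "R x < 1" shows "1 / 2 \<le> S x" "F x \<noteq> {}"
proof -
 obtain n where n: "n \<in> I" "dist x (X n) < R (X n) / 8" using centers_cover[OF assms] X_surj by blast
 then have nF: "n \<in> F x" using X_R[of n] by (auto simp: F_def)
 have "1 / 2 \<le> a n x" using n X_R[of n] by (simp add: a_def field_simps max_def)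
 also have "\<dots> \<le> (\<Sum>n\<in>F x. a n x)" using nF card_F[OF assms(1)] a_nonneg by (intro member_le_sum) auto
 also have "\<dots> = S x" using card_F[OF assms(1)] by (intro S_eq[symmetric]) auto
 finally show "1 / 2 \<le> S x" .
 show "F x \<noteq> {}" using nF by blast
qed

lemma \<phi>_nonneg: "0 \<le> \<phi> n x"
proof (cases "\<exists>J. finite J \<and> F x \<subseteq> J")
 case True
 then obtain J where "finite J" "F x \<subseteq> J" by blast
 then show ?thesis using a_nonneg by (auto simp: \<phi>_def S_eq intro!: divide_nonneg_nonneg sum_nonneg)
next
 case False
 then have "infinite (F x)" by blast
 then have "R x = 0" using card_F[of x] infdist_nonneg[of x \<Omega>] by (cases "0 < R x") auto
 then have "F x = {}" using F_R(3)[of _ x] X_R(1) by (force simp: F_def)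
 with \<open>infinite (F x)\<close> show ?thesis by simp
qed

lemma sum_\<phi>:
 assumes "0 < R x" "R x < 1" "finite J" "F x \<subseteq> J" shows "(\<Sum>n\<in>J. \<phi> n x) = 1"
 using S_ge(1)[OF assms(1,2)] S_eq[OF assms(3,4)] by (simp add: \<phi>_def sum_divide_distrib[symmetric])

lemma a_measurable [measurable]: "a n \<in> borel_measurable borel"
proof -
 have "continuous_on UNIV (\<lambda>x. max 0 (1 - 4 * dist x (X n) / R (X n)))" if "n \<in> I"
  using X_R(1)[OF that] by (intro continuous_intros) auto
 then show ?thesis by (cases "n \<in> I") (auto simp: a_def[abs_def] borel_measurable_continuous_onI)
qed

lemma \<phi>_measurable [measurable]: "\<phi> n \<in> borel_measurable borel"
 unfolding \<phi>_def[abs_def] S_def[abs_def] by measurable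

text \<open>For an index active at x or y one has R (X n) \<ge> 7/10 \<rho>, so \<open>a n\<close>
  changes by at most 6 dist x y / \<rho>. Division by S \<ge> 1/2 gives 12 from the numerator and 24
  cd^7 from the change of S, which has at most 2 cd^7 active terms; together at most 36
  cd^7.\<close>

lemma \<phi>_diff:
 assumes x: "0 < R x" "R x < 1" and y: "0 < R y" "R y < 1"
  and \<rho>: "R x \<le> \<rho>" "R y \<le> \<rho>" "dist x y \<le> \<rho> / 8" "\<rho> = R x \<or> \<rho> = R y"
 shows "\<bar>\<phi> n x - \<phi> n y\<bar> \<le> 36 * cd ^ 7 * dist x y / \<rho>"
proof -
 define J where "J = F x \<union> F y"
 have J: "finite J" "F x \<subseteq> J" "F y \<subseteq> J" "real (card J) \<le> 2 * cd ^ 7"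
  using card_F[OF x(1)] card_F[OF y(1)] card_Un_le[of "F x" "F y"] by (auto simp: J_def)
 have \<rho>0: "0 < \<rho>" using x \<rho> by linarith
 have a_diff: "\<bar>a n x - a n y\<bar> \<le> 6 * dist x y / \<rho>" for n
 proof (cases "n \<in> J")
  case True
  have lower: "7 / 8 * \<rho> \<le> R x" "7 / 8 * \<rho> \<le> R y"
   using \<rho> R_lip[of x y] by linarith+
  have nI: "n \<in> I" using True by (auto simp: J_def F_def)
  have "7 / 10 * \<rho> \<le> R (X n)" using True lower F_R(4)[of n x] F_R(4)[of n y] by (auto simp: J_def)
  then have inv: "4 / R (X n) \<le> 6 / \<rho>" using \<rho>0 by (simp add: field_simps)
  have "\<bar>a n x - a n y\<bar> \<le> \<bar>4 * dist x (X n) / R (X n) - 4 * dist y (X n) / R (X n)\<bar>"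
   using nI by (auto simp: a_def max_def)
  also have "\<dots> = 4 / R (X n) * \<bar>dist x (X n) - dist y (X n)\<bar>"
  proof -
   have "4 * dist x (X n) / R (X n) - 4 * dist y (X n) / R (X n) = 4 / R (X n) * (dist x (X n) - dist y (X n))"
    by (simp add: diff_divide_distrib right_diff_distrib)
   then show ?thesis using X_R(1)[OF nI] by (simp only: abs_mult) simp
  qed
  also have "\<dots> \<le> 6 / \<rho> * dist x y"
   using inv abs_dist_diff_le[of x "X n" y] \<rho>0 by (intro mult_mono) (auto simp: dist_commute)
  finally show ?thesis by simp
 next
  case False
  then have "a n x = 0" "a n y = 0" using a_pos_iff by (auto simp: J_def)
  then show ?thesis using \<rho>0 by simp
 qed
 have Sx: "1 / 2 \<le> S x" and Sy: "1 / 2 \<le> S y" using S_ge x y by auto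
 define \<epsilon> where "\<epsilon> = dist x y / \<rho>"
 have \<epsilon>: "0 \<le> \<epsilon>" using \<rho>0 by (simp add: \<epsilon>_def)
 have S_diff: "\<bar>S x - S y\<bar> \<le> 12 * cd ^ 7 * \<epsilon>"
 proof -
  have "\<bar>S x - S y\<bar> = \<bar>\<Sum>n\<in>J. a n x - a n y\<bar>" using J by (simp add: S_eq[OF J(1)] sum_subtractf)
  also have "\<dots> \<le> (\<Sum>n\<in>J. 6 * \<epsilon>)"
   using a_diff by (intro order_trans[OF sum_abs] sum_mono) (simp add: \<epsilon>_def)
  also have "\<dots> \<le> (2 * cd ^ 7) * (6 * \<epsilon>)" unfolding sum_constant using J(4) \<epsilon> by (intro mult_right_mono) auto
  finally show ?thesis by simp
 qed
 have \<phi>_y: "\<phi> n y \<le> 1"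
 proof -
  have "a n y \<le> S y"
  proof (cases "n \<in> J")
   case True
   then show ?thesis unfolding S_eq[OF J(1,3)] using J(1) a_nonneg by (intro member_le_sum) auto
  next
   case False
   then have "a n y = 0" using a_pos_iff by (auto simp: J_def)
   then show ?thesis using Sy by simp
  qed
  then show ?thesis using Sy by (simp add: \<phi>_def)
 qed
 have cd7: "1 \<le> cd ^ 7" using cd by simp
 have "\<phi> n x - \<phi> n y = (a n x - a n y) / S x + \<phi> n y * ((S y - S x) / S x)"
  using Sx Sy by (simp add: \<phi>_def field_simps)
 then have "\<bar>\<phi> n x - \<phi> n y\<bar> \<le> \<bar>a n x - a n y\<bar> / S x + \<phi> n y * (\<bar>S y - S x\<bar> / S x)"
  using Sx \<phi>_nonneg[of n y] abs_triangle_ineq[of "(a n x - a n y) / S x" "\<phi> n y * ((S y - S x) / S x)"] by (simp add: abs_mult)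
 also have "\<dots> \<le> (6 * \<epsilon>) / (1 / 2) + 1 * ((12 * cd ^ 7 * \<epsilon>) / (1 / 2))"
 proof (intro add_mono mult_mono frac_le \<phi>_y \<phi>_nonneg Sx)
  show "\<bar>a n x - a n y\<bar> \<le> 6 * \<epsilon>" using a_diff[of n] by (simp add: \<epsilon>_def)
  show "\<bar>S y - S x\<bar> \<le> 12 * cd ^ 7 * \<epsilon>" using S_diff by (simp add: abs_minus_commute)
 qed (use \<epsilon> Sx cd in auto)
 also have "\<dots> \<le> 36 * cd ^ 7 * \<epsilon>" using mult_right_mono[OF cd7 \<epsilon>] by (simp add: mult.commute)
 finally show ?thesis by (simp add: \<epsilon>_def)
qed

end

lemma ess_separable_measurable_If:
 fixes u v :: "'z \<Rightarrow> 'v::real_normed_vector"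
 assumes S: "S \<in> sets M" and u: "ess_separable_measurable (restrict_space M S) u" and v: "ess_separable_measurable M v"
 shows "ess_separable_measurable M (\<lambda>x. if x \<in> S then u x else v x)"
proof -
 have sp: "space (restrict_space M S) = S" using sets.sets_into_space[OF S] by (auto simp: space_restrict_space)
 obtain A C where A: "A \<in> null_sets (restrict_space M S)" and C: "countable C" "u ` (S - A) \<subseteq> closure C"
  using ess_separable_measurableE[OF u] unfolding sp by blast
 obtain B D where B: "B \<in> null_sets M" and D: "countable D" "v ` (space M - B) \<subseteq> closure D"
  using ess_separable_measurableE[OF v] .
 have A': "A \<in> null_sets M" using A S by (simp add: null_sets_restrict_space)
 show ?thesis
 proof (rule ess_separable_measurableI)
  show "(\<lambda>x. if x \<in> S then u x else v x) \<in> borel_measurable M"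
   using ess_separable_measurable_measurable[OF u] ess_separable_measurable_measurable[OF v] S sets.sets_into_space[OF S]
   by (subst measurable_If_restrict_space_iff) (auto simp: Int_absorb1 intro: measurable_restrict_space1)
  show "A \<union> B \<in> null_sets M" using A' B by (rule null_sets.Un)
  show "countable (C \<union> D)" using C D by simp
  show "(\<lambda>x. if x \<in> S then u x else v x) ` (space M - (A \<union> B)) \<subseteq> closure (C \<union> D)"
   using C(2) D(2) closure_mono[of C "C \<union> D"] closure_mono[of D "C \<union> D"] by (auto simp: image_subset_iff)
 qed
qed

lemma ess_separable_measurable_scaleR_const:
 fixes c :: "'v::real_normed_vector"
 assumes k: "k \<in> borel_measurable M" shows "ess_separable_measurable M (\<lambda>x. k x *\<^sub>R c)"
proof (rule ess_separable_measurableI)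
 show "(\<lambda>x. k x *\<^sub>R c) \<in> borel_measurable M"
  by (rule measurable_compose[OF k]) (intro borel_measurable_continuous_onI continuous_intros)
 show "countable ((\<lambda>q. q *\<^sub>R c) ` \<rat>)" by (intro countable_image countable_rat)
 have "(\<lambda>q. q *\<^sub>R c) ` closure \<rat> \<subseteq> closure ((\<lambda>q. q *\<^sub>R c) ` \<rat>)"
  by (intro image_closure_subset continuous_intros closed_closure closure_subset)
 then show "(\<lambda>x. k x *\<^sub>R c) ` (space M - {}) \<subseteq> closure ((\<lambda>q. q *\<^sub>R c) ` \<rat>)"
  unfolding Rats_closure_real by blast
qed simp

section \<open>The extended function and its Hajlasz gradient\<close>

locale extension_data = dense_set M cd \<Omega> c\<Omega>
 for M :: "'z::{metric_space, second_countable_topology} measure" and cd \<Omega> c\<Omega> +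
 fixes p :: real and u :: "'z \<Rightarrow> 'v::real_normed_vector" and g :: "'z \<Rightarrow> ennreal" and N :: "'z set"
 assumes p: "1 < p"
  and u: "ess_separable_measurable (restrict_space M \<Omega>) u" and g: "g \<in> borel_measurable (restrict_space M \<Omega>)"
  and N: "N \<in> null_sets M"
  and haj: "x \<in> \<Omega> - N \<Longrightarrow> y \<in> \<Omega> - N \<Longrightarrow> ennreal (norm (u x - u y)) \<le> ennreal (dist x y) * (g x + g y)"
begin

definition h :: "'z \<Rightarrow> ennreal" where "h x = (ennreal (norm (u x)) + g x) * indicator \<Omega> x"

lemma h_measurable [measurable]: "h \<in> borel_measurable M"
proof -
 have "(\<lambda>x. ennreal (norm (u x)) + g x) \<in> borel_measurable (restrict_space M \<Omega>)"
  using measurable_ennreal_norm[OF u] g by (rule borel_measurable_add)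
 then show ?thesis unfolding h_def[abs_def] by (simp add: borel_measurable_restrict_space_iff_ennreal)
qed

definition K1 :: real where "K1 = cd ^ 4 / c\<Omega> + 1"

lemma K1: "1 \<le> K1"
 using cd c\<Omega> by (simp add: K1_def)

text \<open>One point must serve all x in the support of the n-th partition function, so it is
  chosen by averaging h over the part A of \<Omega> in \<open>ball (X n) (2 * r)\<close>,
  independently of x. For every such x, A lies in \<open>ball x (4 * r)\<close>, and the density
  condition at a nearby point of \<Omega> makes A a fixed fraction of that ball. So the average over
  A is at most a multiple of the maximal function at x.\<close>

lemma exists_good_point:
 assumes n: "n \<in> I"
 shows "\<exists>y. y \<in> \<Omega> - N \<and> dist (X n) y < 2 * R (X n) \<and> (\<forall>x. n \<in> F x \<longrightarrow> h y \<le> ennreal K1 * maximal p h x)"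
proof -
 define r where "r = R (X n)"
 have r: "0 < r" "r < 1" using X_R[OF n] by (auto simp: r_def)
 have "R (X n) < 3 / 2 * r" using r by (simp add: r_def)
 then obtain w where w: "w \<in> \<Omega>" "dist (X n) w < 3 / 2 * r" using exists_near by blast
 define A where "A = ball (X n) (2 * r) \<inter> \<Omega>"
 have A[measurable]: "A \<in> sets M" by (simp add: A_def)
 define \<delta> where "\<delta> = measure M A"
 have A_eq: "emeasure M A = ennreal \<delta>" unfolding A_def \<delta>_def by (rule emeasure_eq_measure_ball[OF \<Omega>_in_M])
 have sub: "ball w (r / 2) \<inter> \<Omega> \<subseteq> A"
 proof
  fix z assume z: "z \<in> ball w (r / 2) \<inter> \<Omega>"
  then have "dist w z < r / 2" by simp
  then show "z \<in> A" using z dist_triangle[of "X n" z w] w(2) by (simp add: A_def)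
 qed
 have low: "c\<Omega> * \<mu> w (r / 2) \<le> \<delta>"
 proof -
  have "c\<Omega> * \<mu> w (r / 2) \<le> measure M (ball w (r / 2) \<inter> \<Omega>)" using r w by (intro density_measure) auto
  also have "\<dots> \<le> \<delta>" unfolding \<delta>_def
   using sub by (intro measure_mono_fmeasurable sub_ball_fmeasurable[of _ "X n" "2 * r"]) (auto simp: A_def)
  finally show ?thesis .
 qed
 have \<delta>: "0 < \<delta>" using low \<mu>_pos[of "r / 2" w] c\<Omega> r by (auto intro: less_le_trans[OF _ low])
 have "AE y in M. y \<in> A \<longrightarrow> y \<notin> N" using AE_not_in[OF N] by eventually_elim simp
 from exists_le_average[OF h_measurable A A_eq \<delta> this]
 obtain y where y: "y \<in> A" "y \<notin> N" "ennreal \<delta> * h y \<le> emeasure (density M h) A" by blast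
 have "h y \<le> ennreal K1 * maximal p h x" if x: "n \<in> F x" for x
 proof -
  have Fx: "dist x (X n) < r / 4" using F_R[OF x] by (simp add: r_def)
  have \<mu>_le: "\<mu> x (4 * r) \<le> cd ^ 4 / c\<Omega> * \<delta>"
  proof -
   have "dist w x \<le> dist w (X n) + dist (X n) x" by (rule dist_triangle)
   then have "\<mu> x (4 * r) \<le> cd ^ 4 * \<mu> w (r / 2)"
    using w(2) Fx r by (intro \<mu>_comparable) (auto simp: dist_commute)
   also have "\<dots> = cd ^ 4 / c\<Omega> * (c\<Omega> * \<mu> w (r / 2))" using c\<Omega> by simp
   also have "\<dots> \<le> cd ^ 4 / c\<Omega> * \<delta>" using low cd c\<Omega> by (intro mult_left_mono) auto
   finally show ?thesis .
  qed
  have "ennreal \<delta> * h y \<le> (\<integral>\<^sup>+z. h z * indicator A z \<partial>M)" using y(3) by (simp add: emeasure_density)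
  also have "\<dots> \<le> (\<integral>\<^sup>+z. h z * indicator (ball x (4 * r)) z \<partial>M)"
  proof (rule nn_integral_mono)
   fix z
   have "z \<in> ball x (4 * r)" if "z \<in> A"
   proof -
    have "dist (X n) z < 2 * r" using that by (simp add: A_def)
    then show ?thesis using dist_triangle[of x z "X n"] Fx r by simp
   qed
   then show "h z * indicator A z \<le> h z * indicator (ball x (4 * r)) z" by (auto split: split_indicator)
  qed
  also have "\<dots> \<le> maximal p h x * emeasure M (ball x (4 * r))" using r p by (intro average_le_maximal) auto
  also have "\<dots> \<le> maximal p h x * ennreal (K1 * \<delta>)"
   using \<mu>_le \<delta> by (intro mult_left_mono) (auto simp: emeasure_ball K1_def distrib_right intro!: ennreal_leI)
  also have "\<dots> = ennreal \<delta> * (ennreal K1 * maximal p h x)"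
   using K1 \<delta> by (simp add: ennreal_mult ac_simps)
  finally show ?thesis using \<delta> by (subst (asm) ennreal_mult_le_mult_iff) auto
 qed
 then show ?thesis using y by (intro exI[of _ y]) (auto simp: A_def r_def)
qed

definition Y :: "nat \<Rightarrow> 'z" where
 "Y n = (SOME y. y \<in> \<Omega> - N \<and> dist (X n) y < 2 * R (X n) \<and> (\<forall>x. n \<in> F x \<longrightarrow> h y \<le> ennreal K1 * maximal p h x))"

lemma Y:
 assumes "n \<in> I"
 shows "Y n \<in> \<Omega> - N" "dist (X n) (Y n) < 2 * R (X n)" "\<And>x. n \<in> F x \<Longrightarrow> h (Y n) \<le> ennreal K1 * maximal p h x"
 using someI_ex[OF exists_good_point[OF assms], folded Y_def] by blast+

lemma h_bound:
 assumes n: "n \<in> F x" and s: "maximal p h x \<le> ennreal s" "0 \<le> s"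
 shows "Y n \<in> \<Omega> - N" "h (Y n) \<le> ennreal (K1 * s)" "dist x (Y n) \<le> 3 * R x"
proof -
 show "Y n \<in> \<Omega> - N" using Y(1) F_R(1)[OF n] by blast
 have "h (Y n) \<le> ennreal K1 * maximal p h x" using Y(3) F_R(1)[OF n] n by blast
 also have "\<dots> \<le> ennreal K1 * ennreal s" using s by (intro mult_left_mono) auto
 finally show "h (Y n) \<le> ennreal (K1 * s)" using K1 s by (simp add: ennreal_mult)
 show "dist x (Y n) \<le> 3 * R x"
  using Y(2)[OF F_R(1)[OF n]] F_R(2,3)[OF n] dist_triangle[of x "Y n" "X n"] by linarith
qed

lemma norm_le_h: "y \<in> \<Omega> \<Longrightarrow> h y \<le> ennreal t \<Longrightarrow> 0 \<le> t \<Longrightarrow> norm (u y) \<le> t"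
proof -
 assume y: "y \<in> \<Omega>" "h y \<le> ennreal t" "0 \<le> t"
 have "ennreal (norm (u y)) \<le> h y" using y(1) by (simp add: h_def)
 then show ?thesis using y by (metis ennreal_le_iff order_trans)
qed

lemma norm_diff_le_h:
 assumes y: "y \<in> \<Omega> - N" "h y \<le> ennreal t" and z: "z \<in> \<Omega> - N" "h z \<le> ennreal t" and t: "0 \<le> t" and d: "dist y z \<le> d"
 shows "norm (u y - u z) \<le> 2 * t * d"
proof -
 have "g y \<le> ennreal t" "g z \<le> ennreal t"
  using y z by (auto simp: h_def intro: order_trans[rotated])
 then have "ennreal (norm (u y - u z)) \<le> ennreal d * (ennreal t + ennreal t)"
  using haj[OF y(1) z(1)] d by (meson add_mono mult_mono ennreal_leI order_trans zero_le)
 also have "\<dots> = ennreal (2 * t * d)"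
  using t order_trans[OF zero_le_dist d] by (simp add: ennreal_mult[symmetric] ennreal_plus[symmetric] ac_simps del: ennreal_plus)
 finally show ?thesis using t order_trans[OF zero_le_dist d] by (simp add: ennreal_le_iff)
qed

definition E :: "'z \<Rightarrow> 'v" where "E x = (\<Sum>n\<in>F x. \<phi> n x *\<^sub>R u (Y n))"

lemma E_eq: "finite J \<Longrightarrow> F x \<subseteq> J \<Longrightarrow> E x = (\<Sum>n\<in>J. \<phi> n x *\<^sub>R u (Y n))"
 unfolding E_def using \<phi>_zero by (intro sum.mono_neutral_left) auto

text \<open>Where 0 < R x < 1 the value \<open>E x\<close> is a convex combination of the active
  coefficients \<open>u (Y n)\<close>.\<close>

lemma E_convex:
 assumes x: "0 < R x" "R x < 1" and B: "\<And>n. n \<in> F x \<Longrightarrow> norm (u (Y n) - c) \<le> B"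
 shows "norm (E x - c) \<le> B"
proof -
 have fin: "finite (F x)" using card_F[OF x(1)] by blast
 have one: "(\<Sum>n\<in>F x. \<phi> n x) = 1" by (rule sum_\<phi>[OF x fin order_refl])
 have "E x - c = (\<Sum>n\<in>F x. \<phi> n x *\<^sub>R u (Y n)) - (\<Sum>n\<in>F x. \<phi> n x) *\<^sub>R c" by (simp add: E_def one)
 also have "\<dots> = (\<Sum>n\<in>F x. \<phi> n x *\<^sub>R (u (Y n) - c))"
  by (simp add: scaleR_sum_left sum_subtractf scaleR_diff_right)
 finally have "norm (E x - c) = norm (\<Sum>n\<in>F x. \<phi> n x *\<^sub>R (u (Y n) - c))" by simp
 also have "\<dots> \<le> (\<Sum>n\<in>F x. norm (\<phi> n x *\<^sub>R (u (Y n) - c)))" by (rule norm_sum)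
 also have "\<dots> \<le> (\<Sum>n\<in>F x. \<phi> n x * B)"
  using \<phi>_nonneg B by (intro sum_mono) (simp add: mult_left_mono)
 also have "\<dots> = B" by (simp add: sum_distrib_right[symmetric] one)
 finally show ?thesis .
qed

lemma E_bound:
 assumes "0 < R x" "R x < 1" "maximal p h x \<le> ennreal s" "0 \<le> s"
 shows "norm (E x) \<le> K1 * s"
proof -
 have "norm (E x - 0) \<le> K1 * s"
 proof (rule E_convex[OF assms(1,2)])
  fix n assume n: "n \<in> F x"
  show "norm (u (Y n) - 0) \<le> K1 * s"
   using norm_le_h[OF _ h_bound(2)[OF n assms(3,4)]] h_bound(1)[OF n assms(3,4)] K1 assms(4) by simp
 qed
 then show ?thesis by simp
qed

lemma E_diff_far:
 assumes x: "0 < R x" "R x < 1" "maximal p h x \<le> ennreal s" and y: "0 < R y" "R y < 1" "maximal p h y \<le> ennreal s"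
  and s: "0 \<le> s" and d: "3 * R x + 3 * R y + dist x y \<le> d"
 shows "norm (E x - E y) \<le> 2 * (K1 * s) * d"
proof -
 have "norm (E y - E x) \<le> 2 * (K1 * s) * d"
 proof (rule E_convex[OF y(1,2)])
  fix m assume m: "m \<in> F y"
  have "norm (E x - u (Y m)) \<le> 2 * (K1 * s) * d"
  proof (rule E_convex[OF x(1,2)])
   fix n assume n: "n \<in> F x"
   have "dist (Y n) (Y m) \<le> dist x (Y n) + dist x y + dist y (Y m)"
    using dist_triangle[of "Y n" "Y m" x] dist_triangle[of x "Y m" y] by (simp add: dist_commute)
   also have "\<dots> \<le> d" using h_bound(3)[OF n x(3) s] h_bound(3)[OF m y(3) s] d by linarith
   finally show "norm (u (Y n) - u (Y m)) \<le> 2 * (K1 * s) * d"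
    using h_bound(1,2)[OF n x(3) s] h_bound(1,2)[OF m y(3) s] K1 s by (intro norm_diff_le_h) auto
  qed
  then show "norm (u (Y m) - E x) \<le> 2 * (K1 * s) * d" by (simp add: norm_minus_commute)
 qed
 then show ?thesis by (simp add: norm_minus_commute)
qed

text \<open>1008 = 2 * 36 * 14: at most 2 cd^7 active indices, 36 cd^7 from
  \<open>\<phi>_diff\<close>, and 14 K1 s \<rho> for the difference of two coefficients.\<close>

definition KE :: real where "KE = 1008 * (cd ^ 7 * cd ^ 7) * K1"

text \<open>If dist x y > \<rho>/8, the coefficients are compared directly, with 6 \<rho> + dist x y
  \<le> 49 dist x y. For nearer points the differences of the partition functions sum to 0, so a
  fixed coefficient \<open>u (Y m)\<close> can be subtracted from all others; the points
  \<open>Y n\<close> involved are within 7 \<rho> of \<open>Y m\<close>.\<close>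

lemma E_diff:
 assumes x: "0 < R x" "R x < 1" "maximal p h x \<le> ennreal s" and y: "0 < R y" "R y < 1" "maximal p h y \<le> ennreal s"
  and s: "0 \<le> s"
 shows "norm (E x - E y) \<le> KE * s * dist x y"
proof -
 define \<rho> where "\<rho> = max (R x) (R y)"
 have \<rho>: "R x \<le> \<rho>" "R y \<le> \<rho>" "\<rho> = R x \<or> \<rho> = R y" "0 < \<rho>" using x y by (auto simp: \<rho>_def)
 have cd7: "1 \<le> cd ^ 7" using cd by simp
 have K1s: "0 \<le> K1 * s" using K1 s by simp
 have KE_ge: "1008 * (K1 * s) \<le> KE * s"
 proof -
  have "1 * 1 \<le> cd ^ 7 * cd ^ 7" using cd by (intro mult_mono cd7) auto
  then have "1 \<le> cd ^ 7 * cd ^ 7" by (simp only: mult_1)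
  then have "1008 * (K1 * s) * 1 \<le> 1008 * (K1 * s) * (cd ^ 7 * cd ^ 7)" using K1s by (intro mult_left_mono) auto
  then show ?thesis by (simp add: KE_def ac_simps)
 qed
 show ?thesis
 proof (cases "dist x y \<le> \<rho> / 8")
  case False
  then have "norm (E x - E y) \<le> 2 * (K1 * s) * (49 * dist x y)"
   using \<rho> by (intro E_diff_far[OF x y s]) linarith
  also have "\<dots> \<le> KE * s * dist x y"
  proof -
   have "98 * (K1 * s) * dist x y \<le> KE * s * dist x y" using KE_ge K1s by (intro mult_right_mono) auto
   then show ?thesis by simp
  qed
  finally show ?thesis .
 next
  case near: True
  define J where "J = F x \<union> F y"
  have J: "finite J" "F x \<subseteq> J" "F y \<subseteq> J" "real (card J) \<le> 2 * cd ^ 7"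
   using card_F[OF x(1)] card_F[OF y(1)] card_Un_le[of "F x" "F y"] by (auto simp: J_def)
  obtain m where m: "m \<in> F x" using S_ge(2)[OF x(1,2)] by blast
  have close: "norm (u (Y n) - u (Y m)) \<le> 2 * (K1 * s) * (7 * \<rho>)" if n: "n \<in> J" for n
  proof -
   have m_le: "dist x (Y m) \<le> 3 * \<rho>" using h_bound(3)[OF m x(3) s] \<rho> by linarith
   have "Y n \<in> \<Omega> - N \<and> h (Y n) \<le> ennreal (K1 * s) \<and> dist x (Y n) \<le> 4 * \<rho>"
   proof (cases "n \<in> F x")
    case True
    then show ?thesis using h_bound[OF True x(3) s] \<rho> by auto
   next
    case False
    then have n': "n \<in> F y" using n by (simp add: J_def)
    show ?thesis using h_bound[OF n' y(3) s] \<rho> near dist_triangle[of x "Y n" y] by auto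
   qed
   then show ?thesis
    using h_bound(1,2)[OF m x(3) s] m_le K1s dist_triangle[of "Y n" "Y m" x] by (intro norm_diff_le_h) (auto simp: dist_commute)
  qed
  have diff0: "(\<Sum>n\<in>J. \<phi> n x - \<phi> n y) = 0"
   using sum_\<phi>[OF x(1,2) J(1,2)] sum_\<phi>[OF y(1,2) J(1,3)] by (simp add: sum_subtractf)
  have "E x - E y = (\<Sum>n\<in>J. (\<phi> n x - \<phi> n y) *\<^sub>R u (Y n)) - (\<Sum>n\<in>J. \<phi> n x - \<phi> n y) *\<^sub>R u (Y m)"
   using diff0 J by (simp add: E_eq[OF J(1)] sum_subtractf scaleR_diff_left)
  also have "\<dots> = (\<Sum>n\<in>J. (\<phi> n x - \<phi> n y) *\<^sub>R (u (Y n) - u (Y m)))"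
   unfolding scaleR_sum_left by (simp only: sum_subtractf[symmetric] scaleR_diff_right)
  finally have "norm (E x - E y) \<le> (\<Sum>n\<in>J. norm ((\<phi> n x - \<phi> n y) *\<^sub>R (u (Y n) - u (Y m))))"
   by (simp only: norm_sum)
  also have "\<dots> \<le> (\<Sum>n\<in>J. (36 * cd ^ 7 * dist x y / \<rho>) * (2 * (K1 * s) * (7 * \<rho>)))"
   unfolding norm_scaleR using \<rho> near close \<phi>_diff[OF x(1,2) y(1,2)] cd
   by (intro sum_mono mult_mono) auto
  also have "\<dots> = real (card J) * (504 * cd ^ 7 * (K1 * s) * dist x y)"
   using \<rho>(4) by simp
  also have "\<dots> \<le> (2 * cd ^ 7) * (504 * cd ^ 7 * (K1 * s) * dist x y)"
   using J(4) cd K1s by (intro mult_right_mono) auto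
  also have "\<dots> = KE * s * dist x y" by (simp add: KE_def)
  finally show ?thesis .
 qed
qed

text \<open>The linear cut-off kills the extension at distance 1, beyond which there are no Whitney
  balls. Points off \<Omega> at distance 0 from it form a null set, so their values are
  arbitrary.\<close>

definition w :: "'z \<Rightarrow> 'v" where "w x = (if x \<in> \<Omega> then u x else max 0 (1 - R x) *\<^sub>R E x)"

definition good :: "'z set" where "good = {x. (x \<in> \<Omega> \<and> x \<notin> N) \<or> (x \<notin> \<Omega> \<and> 0 < R x)}"

lemma AE_good: "AE x in M. x \<in> good"
 using AE_infdist_pos AE_not_in[OF N] by eventually_elim (auto simp: good_def)

definition KK :: real where "KK = KE + 9 * K1"

text \<open>9 = 2 * 4 + 1: coefficients at y come from points within 4 dist x y of x, and the
  cut-off costs R y \<le> dist x y times the norm of E y. If R y \<ge> 1, then w y = 0 and dist x y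
  \<ge> 1, so the bound for u x alone suffices.\<close>

lemma w_diff_mixed:
 assumes x: "x \<in> \<Omega>" "x \<notin> N" "h x \<le> ennreal s" and y: "y \<notin> \<Omega>" "0 < R y" "maximal p h y \<le> ennreal s" and s: "0 \<le> s"
 shows "norm (w x - w y) \<le> 9 * (K1 * s) * dist x y"
proof -
 have K1s: "s \<le> K1 * s" using mult_right_mono[OF K1 s] by simp
 have Ry: "R y \<le> dist x y" using infdist_le[OF x(1), of y] by (simp add: dist_commute)
 have wx: "w x = u x" using x by (simp add: w_def)
 show ?thesis
 proof (cases "R y < 1")
  case False
  then have wy: "w y = 0" using y by (simp add: w_def)
  have "norm (u x) \<le> s" by (rule norm_le_h[OF x(1,3) s])
  also have "\<dots> \<le> 9 * (K1 * s) * 1" using K1s s by simp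
  also have "\<dots> \<le> 9 * (K1 * s) * dist x y" using False Ry K1s s by (intro mult_left_mono) auto
  finally show ?thesis by (simp add: wx wy)
 next
  case True
  have "norm (E y - u x) \<le> 2 * (K1 * s) * (4 * dist x y)"
  proof (rule E_convex[OF y(2) True])
   fix n assume n: "n \<in> F y"
   show "norm (u (Y n) - u x) \<le> 2 * (K1 * s) * (4 * dist x y)"
   proof (rule norm_diff_le_h)
    show "h x \<le> ennreal (K1 * s)" using x(3) K1s by (meson ennreal_leI order_trans)
    show "dist (Y n) x \<le> 4 * dist x y"
     using h_bound(3)[OF n y(3) s] Ry dist_triangle[of "Y n" x y] by (simp add: dist_commute)
   qed (use x h_bound[OF n y(3) s] K1s s in auto)
  qed
  moreover have "norm (R y *\<^sub>R E y) \<le> dist x y * (K1 * s)"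
   using E_bound[OF y(2) True y(3) s] Ry y(2) by (simp add: mult_mono)
  moreover have "w x - w y = - (E y - u x) + R y *\<^sub>R E y"
   unfolding wx using y(1) True by (simp add: w_def scaleR_diff_left)
  ultimately have "norm (w x - w y) \<le> 2 * (K1 * s) * (4 * dist x y) + dist x y * (K1 * s)"
   using norm_triangle_ineq[of "- (E y - u x)" "R y *\<^sub>R E y"] by (simp only: norm_minus_cancel)
  then show ?thesis by (simp add: algebra_simps)
 qed
qed

lemma w_zero_diff:
 assumes x: "x \<notin> \<Omega>" "0 < R x" "maximal p h x \<le> ennreal s" and y: "y \<notin> \<Omega>" "1 \<le> R y" and s: "0 \<le> s"
 shows "norm (w x - w y) \<le> K1 * s * dist x y"
proof (cases "R x < 1")
 case True
 have "1 - R x \<le> dist x y" using R_lip[of x y] y by linarith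
 then have "(1 - R x) * norm (E x) \<le> dist x y * (K1 * s)"
  using E_bound[OF x(2) True x(3) s] True by (intro mult_mono) auto
 then show ?thesis using x(1) y True by (simp add: w_def mult.commute)
next
 case False
 then show ?thesis using x y K1 s by (simp add: w_def)
qed

lemma w_diff:
 assumes x: "x \<in> good" "h x \<le> ennreal s" "maximal p h x \<le> ennreal s"
  and y: "y \<in> good" "h y \<le> ennreal s" "maximal p h y \<le> ennreal s" and s: "0 \<le> s"
 shows "norm (w x - w y) \<le> KK * s * dist x y"
proof -
 have K1s: "s \<le> K1 * s" "0 \<le> K1 * s" using mult_right_mono[OF K1 s] s by simp_all
 have KE0: "0 \<le> KE" using cd K1 by (simp add: KE_def)
 have 1: "t * dist x y \<le> KK * s * dist x y" if "t \<le> 9 * (K1 * s) + KE * s" for t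
  using that by (intro mult_right_mono) (auto simp: KK_def algebra_simps)
 have KEs: "0 \<le> KE * s" using KE0 s by simp
 consider "x \<in> \<Omega>" "y \<in> \<Omega>" | "x \<in> \<Omega>" "y \<notin> \<Omega>" | "x \<notin> \<Omega>" "y \<in> \<Omega>" | "x \<notin> \<Omega>" "y \<notin> \<Omega>" by blast
 then show ?thesis
 proof cases
  case 1
  then have "norm (w x - w y) \<le> 2 * s * dist x y"
   using x y s by (simp add: w_def) (intro norm_diff_le_h, auto simp: good_def)
  then show ?thesis using K1s KEs \<open>\<And>t. t \<le> _ \<Longrightarrow> _\<close>[of "2 * s"] by linarith
 next
  case 2
  then have "norm (w x - w y) \<le> 9 * (K1 * s) * dist x y"
   using x y s by (intro w_diff_mixed) (auto simp: good_def)
  then show ?thesis using K1s KEs \<open>\<And>t. t \<le> _ \<Longrightarrow> _\<close>[of "9 * (K1 * s)"] by linarith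
 next
  case 3
  then have "norm (w y - w x) \<le> 9 * (K1 * s) * dist y x"
   using x y s by (intro w_diff_mixed) (auto simp: good_def)
  then show ?thesis using K1s KEs \<open>\<And>t. t \<le> _ \<Longrightarrow> _\<close>[of "9 * (K1 * s)"] by (simp add: norm_minus_commute dist_commute)
 next
  case 4
  then have R: "0 < R x" "0 < R y" using x y by (auto simp: good_def)
  show ?thesis
  proof (cases "R x < 1 \<and> R y < 1")
   case True
   \<comment> \<open>Product rule: one term carries the difference of E, the other that of the
     cut-off, which is 1-Lipschitz.\<close>
   have "w x - w y = (1 - R x) *\<^sub>R (E x - E y) + (R y - R x) *\<^sub>R E y"
    using 4 True by (simp add: w_def algebra_simps)
   then have "norm (w x - w y) \<le> \<bar>1 - R x\<bar> * norm (E x - E y) + \<bar>R y - R x\<bar> * norm (E y)"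
    using norm_triangle_ineq[of "(1 - R x) *\<^sub>R (E x - E y)" "(R y - R x) *\<^sub>R E y"] by simp
   also have "\<dots> \<le> 1 * (KE * s * dist x y) + dist x y * (K1 * s)"
    using True R R_lip[of y x] E_diff[of x s y] E_bound[of y s] x y s KEs
    by (intro add_mono mult_mono) (auto simp: dist_commute)
   also have "\<dots> = (KE * s + K1 * s) * dist x y" by (simp add: algebra_simps)
   finally show ?thesis using K1s KEs \<open>\<And>t. t \<le> _ \<Longrightarrow> _\<close>[of "KE * s + K1 * s"] by linarith
  next
   case False
   then have "norm (w x - w y) \<le> K1 * s * dist x y"
    using w_zero_diff[OF 4(1) R(1) x(3) 4(2) _ s] w_zero_diff[OF 4(2) R(2) y(3) 4(1) _ s]
    by (auto simp: norm_minus_commute dist_commute not_less)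
   then show ?thesis using K1s KEs \<open>\<And>t. t \<le> _ \<Longrightarrow> _\<close>[of "K1 * s"] by linarith
  qed
 qed
qed

lemma w_ess_separable: "ess_separable_measurable M w"
proof -
 interpret borel_compatible_measure M by (rule borel_compatible)
 have "ess_separable_measurable M (\<lambda>x. max 0 (1 - R x) *\<^sub>R E x)"
 proof (rule ess_separable_measurable_lim)
  have "(\<lambda>x. R x) \<in> borel_measurable borel" by (intro borel_measurable_continuous_onI continuous_intros)
  then have "(\<lambda>x. max 0 (1 - R x) * \<phi> n x) \<in> borel_measurable borel" for n by measurable
  then show "ess_separable_measurable M (\<lambda>x. \<Sum>n<k. (max 0 (1 - R x) * \<phi> n x) *\<^sub>R u (Y n))" for k
   by (intro ess_separable_measurable_sum ess_separable_measurable_scaleR_const borel_measurable_in_M) auto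
  have "(\<lambda>k. \<Sum>n<k. (max 0 (1 - R x) * \<phi> n x) *\<^sub>R u (Y n)) \<longlonglongrightarrow> max 0 (1 - R x) *\<^sub>R E x" for x
  proof (rule tendsto_eventually)
   have "finite (F x)"
   proof (cases "0 < R x")
    case False
    then have "F x = {}" using F_R(3)[of _ x] X_R(1) by (force simp: F_def)
    then show ?thesis by simp
   qed (use card_F in blast)
   then obtain k0 where k0: "F x \<subseteq> {..<k0}" using finite_nat_iff_bounded by blast
   show "\<forall>\<^sub>F k in sequentially. (\<Sum>n<k. (max 0 (1 - R x) * \<phi> n x) *\<^sub>R u (Y n)) = max 0 (1 - R x) *\<^sub>R E x"
    using eventually_ge_at_top[of k0]
   proof eventually_elim
    case (elim k)
    then have "F x \<subseteq> {..<k}" using k0 by auto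
    then show ?case by (simp add: E_eq[of "{..<k}" x] scaleR_sum_right)
   qed
  qed
  then show "AE x in M. (\<lambda>k. \<Sum>n<k. (max 0 (1 - R x) * \<phi> n x) *\<^sub>R u (Y n)) \<longlonglongrightarrow> max 0 (1 - R x) *\<^sub>R E x" by simp
 qed
 from ess_separable_measurable_If[OF \<Omega>_in_M u this] show ?thesis by (simp add: w_def[abs_def])
qed

definition G :: "'z \<Rightarrow> ennreal" where "G x = ennreal KK * (h x + maximal p h x)"

lemma KK: "K1 \<le> KK" "1 \<le> KK" "0 \<le> KK"
 using K1 cd by (auto simp: KK_def KE_def add_increasing)

lemma norm_w_le_G: "x \<in> good \<Longrightarrow> ennreal (norm (w x)) \<le> G x"
proof (cases "h x + maximal p h x = \<infinity>")
 case True
 then show ?thesis unfolding G_def True using KK by (simp add: ennreal_mult_top)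
next
 case False
 assume x: "x \<in> good"
 define s where "s = enn2real (h x + maximal p h x)"
 have s: "h x + maximal p h x = ennreal s" "0 \<le> s" using False by (auto simp: s_def less_top)
 have hs: "h x \<le> ennreal s" "maximal p h x \<le> ennreal s" unfolding s(1)[symmetric] by simp_all
 have K1s: "s \<le> KK * s" "K1 * s \<le> KK * s" using mult_right_mono[OF KK(2) s(2)] mult_right_mono[OF KK(1) s(2)] by simp_all
 have "norm (w x) \<le> KK * s"
 proof (cases "x \<in> \<Omega>")
  case True
  then show ?thesis using norm_le_h[OF True hs(1) s(2)] K1s by (simp add: w_def)
 next
  case False
  then have R: "0 < R x" using x by (simp add: good_def)
  show ?thesis
  proof (cases "R x < 1")
   case True
   have "(1 - R x) * norm (E x) \<le> 1 * (K1 * s)"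
    using E_bound[OF R True hs(2) s(2)] R True by (intro mult_mono) auto
   then show ?thesis using False True K1s by (simp add: w_def)
  qed (use False K1s s in \<open>simp add: w_def\<close>)
 qed
 then show ?thesis using KK s by (simp add: G_def ennreal_mult[symmetric] ennreal_leI)
qed

lemma hajlasz_w: "hajlasz_upper_gradient M w G"
proof -
 obtain A where A: "A \<in> null_sets M" "{x\<in>space M. \<not> x \<in> good} \<subseteq> A"
  using AE_good by (auto elim!: AE_E simp: null_sets_def)
 have G_meas: "G \<in> borel_measurable M" unfolding G_def[abs_def] by measurable
 have "ennreal (norm (w x - w y)) \<le> ennreal (dist x y) * (G x + G y)"
  if "x \<in> space M - A" "y \<in> space M - A" for x y
 proof (cases "x = y \<or> h x + maximal p h x + (h y + maximal p h y) = \<infinity>")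
  case True
  then show ?thesis
  proof
   assume "h x + maximal p h x + (h y + maximal p h y) = \<infinity>"
   then have "h x + maximal p h x = \<infinity> \<or> h y + maximal p h y = \<infinity>" by (simp add: ennreal_add_eq_top)
   then have "G x + G y = \<infinity>" using KK by (auto simp: G_def ennreal_mult_top)
   then show ?thesis by (cases "x = y") (auto simp: ennreal_mult_top)
  qed simp
 next
  case False
  define s where "s = enn2real (h x + maximal p h x + (h y + maximal p h y))"
  have s: "h x + maximal p h x + (h y + maximal p h y) = ennreal s" "0 \<le> s" using False by (auto simp: s_def less_top)
  have xs: "h x \<le> ennreal s" "maximal p h x \<le> ennreal s" "h y \<le> ennreal s" "maximal p h y \<le> ennreal s"
   unfolding s(1)[symmetric] by (simp_all add: add_increasing add_increasing2)
  have "x \<in> good" "y \<in> good" using that A(2) by auto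
  then have "norm (w x - w y) \<le> KK * s * dist x y" using xs s(2) by (intro w_diff)
  then have "ennreal (norm (w x - w y)) \<le> ennreal (dist x y) * (ennreal KK * ennreal s)"
   using KK s(2) by (simp add: ennreal_mult[symmetric] ennreal_leI ac_simps)
  then show ?thesis by (simp add: G_def s(1)[symmetric] distrib_left)
 qed
 then show ?thesis unfolding hajlasz_upper_gradient_def using A(1) G_meas by (intro conjI bexI[of _ A] ballI) auto
qed

end

text \<open>All estimates are homogeneous in t, so the constant depends only on p, on the doubling
  and density constants and on the maximal theorem.\<close>

theorem (in dense_set) hajlasz_extension:
 assumes p: "1 < p"
 shows "\<exists>C>0. \<forall>(u :: 'z \<Rightarrow> 'v::real_normed_vector) g t. 0 < t \<longrightarrow> ess_separable_measurable (restrict_space M \<Omega>) u \<longrightarrow>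
  Lp_bound (restrict_space M \<Omega>) p t (enorm u) \<longrightarrow>
  hajlasz_upper_gradient (restrict_space M \<Omega>) u g \<longrightarrow> Lp_bound (restrict_space M \<Omega>) p t g \<longrightarrow>
  (\<exists>w G. (\<forall>x\<in>\<Omega>. w x = u x) \<and> ess_separable_measurable M w \<and> Lp_bound M p (C * t) (enorm w) \<and>
   hajlasz_upper_gradient M w G \<and> Lp_bound M p (C * t) G)"
proof -
 obtain Cm where Cm: "0 < Cm" and max_bound: "\<forall>f\<in>borel_measurable M. (pint M p (maximal p f)) \<le> ennreal Cm * (pint M p f)"
  using maximal_strong_bound[OF p] by blast
 \<comment> \<open>The inner \<open>2 powr p * 2\<close> bounds h as a sum of norm u and g,
   \<open>1 + Cm\<close> accounts for h and its maximal function, and the outer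
   \<open>2 powr p\<close> for adding these two.\<close>
 define D where "D = 2 powr p * ((1 + Cm) * (2 powr p * 2))"
 have D: "0 < D" using Cm by (simp add: D_def add_pos_pos)
 \<comment> \<open>This is \<open>KK\<close> written out: the constant has to be fixed before u, g
   and the null set that the locale depends on.\<close>
 define K where "K = 1008 * (cd ^ 7 * cd ^ 7) * (cd ^ 4 / c\<Omega> + 1) + 9 * (cd ^ 4 / c\<Omega> + 1)"
 have c: "0 < cd ^ 4 / c\<Omega> + 1" using cd c\<Omega> by (intro add_pos_pos divide_pos_pos) auto
 have K: "0 < K" unfolding K_def by (intro add_pos_pos mult_pos_pos c) (use cd in auto)
 show ?thesis
 proof (intro exI[of _ "K * D powr (1 / p)"] conjI allI impI)
  show "0 < K * D powr (1 / p)" using K D by simp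
  fix u :: "'z \<Rightarrow> 'v" and g t
  assume t: "0 < t" and u: "ess_separable_measurable (restrict_space M \<Omega>) u"
   and u_Lp: "Lp_bound (restrict_space M \<Omega>) p t (enorm u)"
   and haj: "hajlasz_upper_gradient (restrict_space M \<Omega>) u g" and g_Lp: "Lp_bound (restrict_space M \<Omega>) p t g"
  have sp: "space (restrict_space M \<Omega>) = \<Omega>" by (simp add: space_restrict_space)
  obtain N where N: "N \<in> null_sets (restrict_space M \<Omega>)"
   and haj': "\<forall>x\<in>\<Omega> - N. \<forall>y\<in>\<Omega> - N. ennreal (norm (u x - u y)) \<le> ennreal (dist x y) * (g x + g y)"
   using haj unfolding hajlasz_upper_gradient_def sp by blast
  have N': "N \<in> null_sets M" using N by (simp add: null_sets_restrict_space)
  interpret extension_data M cd \<Omega> c\<Omega> p u g N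
  proof
   show "g \<in> borel_measurable (restrict_space M \<Omega>)" using g_Lp by (rule Lp_bound_measurable)
  qed (use p u N' haj' in auto)
  have KK_eq: "KK = K" by (simp add: KK_def KE_def K1_def K_def)
  have h_int: "(pint M p h) \<le> ennreal (2 powr p * 2 * t powr p)"
  proof -
   have [measurable]: "(enorm u) \<in> borel_measurable (restrict_space M \<Omega>)" "g \<in> borel_measurable (restrict_space M \<Omega>)"
    using Lp_bound_measurable[OF u_Lp] Lp_bound_measurable[OF g_Lp] by auto
   have "(pint M p h) = (\<integral>\<^sup>+x. ennreal_powr (ennreal (norm (u x)) + g x) p \<partial>restrict_space M \<Omega>)"
    by (subst nn_integral_restrict_space) (auto simp: h_def intro!: nn_integral_cong split: split_indicator)
   also have "\<dots> \<le> (\<integral>\<^sup>+x. ennreal (2 powr p) * (ennreal_powr (ennreal (norm (u x))) p + ennreal_powr (g x) p) \<partial>restrict_space M \<Omega>)"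
    using p by (intro nn_integral_mono ennreal_powr_add) auto
   also have "\<dots> = ennreal (2 powr p) * ((\<integral>\<^sup>+x. ennreal_powr (ennreal (norm (u x))) p \<partial>restrict_space M \<Omega>) + (pint (restrict_space M \<Omega>) p g))"
    by (simp add: nn_integral_cmult nn_integral_add)
   also have "\<dots> \<le> ennreal (2 powr p) * (ennreal (t powr p) + ennreal (t powr p))"
    using u_Lp g_Lp unfolding Lp_bound_def by (intro mult_left_mono add_mono) auto
   also have "\<dots> = ennreal (2 powr p * 2 * t powr p)"
    by (simp add: ennreal_plus[symmetric] ennreal_mult[symmetric] del: ennreal_plus)
   finally show ?thesis .
  qed
  have "Lp_bound M p (D powr (1 / p) * t) (\<lambda>x. h x + maximal p h x)"
   unfolding Lp_bound_def
  proof
   show "(\<lambda>x. h x + maximal p h x) \<in> borel_measurable M" by measurable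
   have "(\<integral>\<^sup>+x. ennreal_powr (h x + maximal p h x) p \<partial>M) \<le> (\<integral>\<^sup>+x. ennreal (2 powr p) * (ennreal_powr (h x) p + ennreal_powr (maximal p h x) p) \<partial>M)"
    using p by (intro nn_integral_mono ennreal_powr_add) auto
   also have "\<dots> = ennreal (2 powr p) * ((pint M p h) + (pint M p (maximal p h)))"
    by (simp add: nn_integral_cmult nn_integral_add)
   also have "\<dots> \<le> ennreal (2 powr p) * (ennreal (2 powr p * 2 * t powr p) + ennreal Cm * ennreal (2 powr p * 2 * t powr p))"
    using h_int by (intro mult_left_mono add_mono order_trans[OF bspec[OF max_bound h_measurable]]) auto
   also have "\<dots> = ennreal (D * t powr p)"
    using Cm by (simp add: D_def ennreal_plus[symmetric] ennreal_mult[symmetric] algebra_simps del: ennreal_plus)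
   also have "D * t powr p = (D powr (1 / p) * t) powr p"
    using p t D by (simp add: powr_mult powr_powr)
   finally show "(\<integral>\<^sup>+x. ennreal_powr (h x + maximal p h x) p \<partial>M) \<le> ennreal ((D powr (1 / p) * t) powr p)" .
  qed
  then have "Lp_bound M p (K * (D powr (1 / p) * t)) (\<lambda>x. ennreal K * (h x + maximal p h x))"
   using p K D t by (intro Lp_bound_cmult) auto
  then have G_Lp: "Lp_bound M p (K * D powr (1 / p) * t) G"
   by (simp add: G_def[abs_def] KK_eq mult.assoc)
  show "\<exists>w G. (\<forall>x\<in>\<Omega>. w x = u x) \<and> ess_separable_measurable M w \<and> Lp_bound M p (K * D powr (1 / p) * t) (enorm w) \<and>
   hajlasz_upper_gradient M w G \<and> Lp_bound M p (K * D powr (1 / p) * t) G"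
  proof (intro exI[of _ w] exI[of _ G] conjI ballI)
   show "w x = u x" if "x \<in> \<Omega>" for x using that by (simp add: w_def)
   have "AE x in M. ennreal (norm (w x)) \<le> G x" using AE_good by eventually_elim (rule norm_w_le_G)
   then show "Lp_bound M p (K * D powr (1 / p) * t) (enorm w)"
    using K D t p by (intro Lp_bound_mono[OF G_Lp] measurable_ennreal_norm w_ess_separable) auto
  qed (use w_ess_separable hajlasz_w G_Lp in auto)
 qed
qed

section \<open>Extension sets\<close>

text \<open>Completeness holds because a set of outer measure 0 satisfies Caratheodory's criterion;
  replacing the doubling constant by \<open>max 1 c\<close> gives the normalization.\<close>

lemma doubling_measure_caratheodory:
 fixes \<mu> :: "'z::{metric_space, second_countable_topology} set \<Rightarrow> ennreal"
 assumes mm: "metric_measure_space \<mu>" and dbl: "Defs.doubling \<mu>"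
 shows "\<exists>cd. doubling_measure (caratheodory_measure \<mu>) cd"
proof -
 have oms: "outer_measure_space (Pow UNIV) \<mu>" and borel: "sets borel \<subseteq> lambda_system UNIV (Pow UNIV) \<mu>"
  and reg: "\<forall>A. \<exists>B\<in>sets borel. A \<subseteq> B \<and> \<mu> B = \<mu> A"
  and balls: "\<forall>x. \<forall>r>0. 0 < \<mu> (ball x r) \<and> \<mu> (ball x r) < \<infinity>"
  using mm by (auto simp: metric_measure_space_def borel_regular_outer_measure_def)
 note sp = space_caratheodory_measure[OF oms] and st = sets_caratheodory_measure[OF oms]
  and em = emeasure_caratheodory_measure[OF oms]
 obtain c where c: "0 < c" "\<And>x r. 0 < r \<Longrightarrow> \<mu> (ball x (2 * r)) \<le> ennreal c * \<mu> (ball x r)"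
  using dbl by (auto simp: Defs.doubling_def)
 have ball: "ball x r \<in> lambda_system UNIV (Pow UNIV) \<mu>" for x r using borel by auto
 have pos: "positive (Pow UNIV) \<mu>" and inc: "increasing (Pow UNIV) \<mu>" and cs: "countably_subadditive (Pow UNIV) \<mu>"
  using oms by (auto simp: outer_measure_space_def)
 interpret P: sigma_algebra UNIV "Pow UNIV :: 'z set set" by (rule sigma_algebra_Pow)
 have sub: "subadditive (Pow UNIV) \<mu>" by (rule P.countably_subadditive_subadditive[OF pos cs])
 have mono: "\<mu> A \<le> \<mu> B" if "A \<subseteq> B" for A B using inc that by (auto simp: increasing_def)
 have complete: "B \<in> lambda_system UNIV (Pow UNIV) \<mu>" if "\<mu> B = 0" for B
 proof -
  have "\<mu> (X \<inter> B) + \<mu> (X - B) = \<mu> X" for X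
  proof (rule antisym)
   have "\<mu> (X \<inter> B) \<le> 0" using mono[of "X \<inter> B" B] that by simp
   then show "\<mu> (X \<inter> B) + \<mu> (X - B) \<le> \<mu> X" using mono[of "X - B" X] by simp
   have "\<mu> ((X \<inter> B) \<union> (X - B)) \<le> \<mu> (X \<inter> B) + \<mu> (X - B)" by (rule subadditiveD[OF sub]) auto
   then show "\<mu> X \<le> \<mu> (X \<inter> B) + \<mu> (X - B)" by (simp add: Int_Diff_Un)
  qed
  then show ?thesis unfolding P.lambda_system_eq by simp
 qed
 have "doubling_measure (caratheodory_measure \<mu>) (max 1 c)"
 proof
  show "space (caratheodory_measure \<mu>) = UNIV" by (rule sp)
  show "sets borel \<subseteq> sets (caratheodory_measure \<mu>)" using borel by (simp add: st)
  show "B \<in> sets (caratheodory_measure \<mu>)" if "B \<subseteq> A" "A \<in> null_sets (caratheodory_measure \<mu>)" for A B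
  proof -
   have "A \<in> lambda_system UNIV (Pow UNIV) \<mu>" "emeasure (caratheodory_measure \<mu>) A = 0"
    using that(2) st by (auto simp: null_sets_def)
   then have "\<mu> A = 0" using em by simp
   then have "\<mu> B = 0" using mono[OF that(1)] by simp
   then show ?thesis using complete st by simp
  qed
  fix x :: 'z and r :: real
  show "0 < emeasure (caratheodory_measure \<mu>) (ball x r)" if "0 < r"
   unfolding em[OF ball] using balls that by blast
  show "emeasure (caratheodory_measure \<mu>) (ball x r) < \<infinity>"
  proof (cases "0 < r")
   case True
   then show ?thesis unfolding em[OF ball] using balls by blast
  next
   case False
   then have "ball x r = {}" by simp
   then show ?thesis by (simp only: emeasure_empty) simp
  qed
  show "emeasure (caratheodory_measure \<mu>) (ball x (2 * r)) \<le> ennreal (max 1 c) * emeasure (caratheodory_measure \<mu>) (ball x r)" if "0 < r"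
   unfolding em[OF ball] by (rule order_trans[OF c(2)[OF that]]) (intro mult_right_mono ennreal_leI, auto)
  fix A assume A: "A \<in> sets (caratheodory_measure \<mu>)"
  obtain B where B: "B \<in> sets borel" "A \<subseteq> B" "\<mu> B = \<mu> A" using reg by blast
  have "emeasure (caratheodory_measure \<mu>) B = emeasure (caratheodory_measure \<mu>) A"
   using B(3) em[OF subsetD[OF borel B(1)]] em[OF A[unfolded st]] by simp
  then show "\<exists>B\<in>sets borel. A \<subseteq> B \<and> emeasure (caratheodory_measure \<mu>) B = emeasure (caratheodory_measure \<mu>) A"
   using B by blast
 qed simp
 then show ?thesis by blast
qed

lemma poincare_space_caratheodory:
 fixes \<mu> :: "'z::{metric_space, second_countable_topology} set \<Rightarrow> ennreal"
 assumes p: "1 < p" and PI: "PI_space p \<mu>"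
 shows "\<exists>cd Cp \<kappa>. poincare_space (caratheodory_measure \<mu>) cd p Cp \<kappa>"
proof -
 have mm: "metric_measure_space \<mu>" and dbl: "Defs.doubling \<mu>" and poin: "weak_poincare p (caratheodory_measure \<mu>)"
  using PI by (auto simp: PI_space_def)
 obtain cd where cd: "doubling_measure (caratheodory_measure \<mu>) cd"
  using doubling_measure_caratheodory[OF mm dbl] by blast
 obtain Cp \<kappa> where C: "0 < Cp" "1 \<le> \<kappa>" and P: "\<forall>x. \<forall>r>0. \<forall>u :: 'z \<Rightarrow> real. \<forall>\<rho>.
    let B = ball x r; B' = ball x (\<kappa> * r); N' = restrict_space (caratheodory_measure \<mu>) B' in
    integrable N' u \<longrightarrow> weak_upper_gradient N' p u \<rho> \<longrightarrow> Lp_integrable N' p \<rho> \<longrightarrow>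
    average (caratheodory_measure \<mu>) B (\<lambda>y. \<bar>u y - average (caratheodory_measure \<mu>) B u\<bar>) \<le>
     Cp * diameter B *
     (enn2real (pint N' p \<rho>) / measure (caratheodory_measure \<mu>) B') powr (1 / p)"
  using poin unfolding weak_poincare_def by blast
 have "poincare_space (caratheodory_measure \<mu>) cd p Cp \<kappa>"
  by (intro poincare_space.intro poincare_space_axioms.intro cd p C) (use P in \<open>simp add: Let_def\<close>)
 then show ?thesis by blast
qed

section \<open>Equivalence classes and Sobolev norms\<close>

definition ae_class :: "'z measure \<Rightarrow> ('z \<Rightarrow> 'v::real_normed_vector) \<Rightarrow> ('z \<Rightarrow> 'v) set" where
 "ae_class N u = {v. ess_separable_measurable N v \<and> (AE x in N. u x = v x)}"

lemma ae_rel_image: "ess_separable_measurable N u \<Longrightarrow> ae_rel N `` {u} = ae_class N u"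
 by (auto simp: ae_rel_def ae_class_def)

lemma Lp_spaceE:
 assumes "U \<in> Lp_space N p"
 obtains u where "ess_separable_measurable N u" "Lp_integrable N p (enorm u)" "U = ae_class N u"
 using assms unfolding Lp_space_def by (auto elim!: quotientE simp: ae_rel_image)

lemma ae_class_in_Lp_space:
 assumes "ess_separable_measurable N u" "Lp_integrable N p (enorm u)"
 shows "ae_class N u \<in> Lp_space N p"
 unfolding Lp_space_def ae_rel_image[OF assms(1), symmetric] using assms by (intro quotientI) simp

lemma ae_class_self: "ess_separable_measurable N u \<Longrightarrow> u \<in> ae_class N u"
 by (simp add: ae_class_def)

lemma Lp_space_rep:
 assumes U: "U \<in> Lp_space N p" and u: "u \<in> U"
 shows "ess_separable_measurable N u" "Lp_integrable N p (enorm u)" "U = ae_class N u"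
  "Lp_class_norm N p U = Lp_norm N p (enorm u)"
proof -
 obtain u0 where u0: "ess_separable_measurable N u0" "Lp_integrable N p (enorm u0)" "U = ae_class N u0"
  using Lp_spaceE[OF U] .
 have eq: "AE x in N. u0 x = u x" and u_sep: "ess_separable_measurable N u" using u by (auto simp: u0 ae_class_def)
 show "ess_separable_measurable N u" by (rule u_sep)
 have "AE x in N. ennreal (norm (u x)) = ennreal (norm (u0 x))" using eq by eventually_elim simp
 from Lp_integrable_cong_AE(1)[OF u0(2) measurable_ennreal_norm[OF u_sep] this]
 show "Lp_integrable N p (enorm u)" .
 show "U = ae_class N u"
  using eq unfolding u0 ae_class_def by (auto elim: eventually_elim2)
 have "(\<lambda>v. Lp_norm N p (enorm v)) ` U = {Lp_norm N p (enorm u)}"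
 proof -
  have "Lp_norm N p (enorm v) = Lp_norm N p (enorm u)" if "v \<in> U" for v
  proof -
   have "AE x in N. u0 x = v x" using that by (auto simp: u0 ae_class_def)
   with eq have "AE x in N. ennreal_powr (ennreal (norm (v x))) p = ennreal_powr (ennreal (norm (u x))) p"
    by eventually_elim simp
   then show ?thesis unfolding Lp_norm_def by (subst nn_integral_cong_AE) auto
  qed
  then have "(\<lambda>v. Lp_norm N p (enorm v)) ` U = (\<lambda>v. Lp_norm N p (enorm u)) ` U"
   by (rule image_cong[OF refl])
  also have "\<dots> = {Lp_norm N p (enorm u)}" using u by auto
  finally show ?thesis .
 qed
 then show "Lp_class_norm N p U = Lp_norm N p (enorm u)"
  by (simp add: Lp_class_norm_def)
qed

lemma Lp_norm_nonneg: "0 \<le> Lp_norm N p f"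
 by (simp add: Lp_norm_def)

lemma Lp_bound_imp_Lp_norm_le:
 assumes "Lp_bound N p t f" "0 < p" "0 \<le> t" shows "Lp_norm N p f \<le> t"
proof -
 have "enn2real (pint N p f) \<le> enn2real (ennreal (t powr p))"
  using assms(1) unfolding Lp_bound_def by (intro enn2real_mono) auto
 then have "enn2real (pint N p f) powr (1 / p) \<le> (t powr p) powr (1 / p)"
  using assms(2) by (intro powr_mono2) auto
 also have "\<dots> = t" using assms by (simp add: powr_powr)
 finally show ?thesis by (simp add: Lp_norm_def)
qed

lemma Lp_norm_le_imp_Lp_bound:
 assumes "Lp_integrable N p f" "0 < p" "Lp_norm N p f \<le> t" shows "Lp_bound N p t f"
proof -
 define I where "I = enn2real (pint N p f)"
 have I: "(pint N p f) = ennreal I" "0 \<le> I"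
  using assms(1) by (auto simp: I_def Lp_integrable_def)
 have "I = (I powr (1 / p)) powr p" using I assms(2) by (simp add: powr_powr)
 also have "\<dots> \<le> t powr p" using assms by (intro powr_mono2) (auto simp: Lp_norm_def I_def)
 finally show ?thesis using assms(1) I by (simp add: Lp_bound_def Lp_integrable_def ennreal_leI)
qed

text \<open>The infimum in the norm need not be attained, so a gradient with a given bound exists
  only for t strictly above the norm.\<close>

lemma W1p_norm_facts:
 assumes U: "U \<in> W1p N p" and p: "0 < p"
 shows W1p_norm_nonneg: "0 \<le> W1p_norm N p U"
  and Lp_class_norm_le_W1p_norm: "Lp_class_norm N p U \<le> W1p_norm N p U"
  and W1p_norm_less_imp_sobolev_bound: "\<And>t u. W1p_norm N p U < t \<Longrightarrow> u \<in> U \<Longrightarrow> sobolev_bound N p t u"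
proof -
 define S where "S = {Lp_norm N p \<rho> | \<rho> u. u \<in> U \<and> weak_upper_gradient N p u \<rho> \<and> Lp_integrable N p \<rho>}"
 have U_Lp: "U \<in> Lp_space N p" and S_ne: "S \<noteq> {}" using U by (auto simp: W1p_def S_def)
 have norm_eq: "W1p_norm N p U = Lp_class_norm N p U + Inf S" by (simp add: W1p_norm_def S_def)
 have Inf: "0 \<le> Inf S" using S_ne by (intro cInf_greatest) (auto simp: S_def Lp_norm_nonneg)
 obtain u0 where "u0 \<in> U" using U by (auto simp: W1p_def)
 then have cl: "0 \<le> Lp_class_norm N p U" using Lp_space_rep(4)[OF U_Lp] by (simp add: Lp_norm_nonneg)
 show "0 \<le> W1p_norm N p U" "Lp_class_norm N p U \<le> W1p_norm N p U" using norm_eq Inf cl by auto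
 fix t u assume t: "W1p_norm N p U < t" and u: "u \<in> U"
 have "Inf S < t" using t norm_eq cl by simp
 from cInf_lessD[OF S_ne this] obtain \<rho> v where v: "v \<in> U" "weak_upper_gradient N p v \<rho>" "Lp_integrable N p \<rho>" "Lp_norm N p \<rho> < t"
  by (auto simp: S_def)
 have "AE x in N. v x = u x"
  using v(1) unfolding Lp_space_rep(3)[OF U_Lp u] ae_class_def by (auto elim: eventually_mono)
 moreover have "Lp_bound N p t (enorm u)"
  using t norm_eq Inf Lp_space_rep[OF U_Lp u] p by (intro Lp_norm_le_imp_Lp_bound) auto
 moreover have "Lp_bound N p t \<rho>" using v p by (intro Lp_norm_le_imp_Lp_bound) auto
 moreover have "0 \<le> t" using t norm_eq Inf cl by simp
 ultimately show "sobolev_bound N p t u"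
  unfolding sobolev_bound_def using v(2) Lp_space_rep(1)[OF U_Lp u] by blast
qed

text \<open>Converse passage from bounds to the norm. The factor 2 arises because the norm adds the
  two quantities that t bounds separately.\<close>

lemma ae_class_W1p:
 assumes u: "ess_separable_measurable N u" "Lp_bound N p t (enorm u)"
  and \<rho>: "weak_upper_gradient N p u \<rho>" "Lp_bound N p t \<rho>" and p: "0 < p" and t: "0 \<le> t"
 shows "ae_class N u \<in> W1p N p" "W1p_norm N p (ae_class N u) \<le> 2 * t"
proof -
 define S where "S = {Lp_norm N p \<rho> | \<rho> v. v \<in> ae_class N u \<and> weak_upper_gradient N p v \<rho> \<and> Lp_integrable N p \<rho>}"
 have Lp: "ae_class N u \<in> Lp_space N p" using u Lp_bound_imp_Lp_integrable by (intro ae_class_in_Lp_space)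
 show W: "ae_class N u \<in> W1p N p"
  unfolding W1p_def using Lp ae_class_self[OF u(1)] \<rho>(1) Lp_bound_imp_Lp_integrable[OF \<rho>(2)] by blast
 have "Inf S \<le> Lp_norm N p \<rho>"
 proof (rule cInf_lower)
  show "Lp_norm N p \<rho> \<in> S" unfolding S_def using ae_class_self[OF u(1)] \<rho>(1) Lp_bound_imp_Lp_integrable[OF \<rho>(2)] by blast
  show "bdd_below S" by (rule bdd_belowI[of _ 0]) (auto simp: S_def Lp_norm_nonneg)
 qed
 also have "\<dots> \<le> t" using \<rho>(2) p t by (rule Lp_bound_imp_Lp_norm_le)
 finally have "Inf S \<le> t" .
 moreover have "Lp_class_norm N p (ae_class N u) \<le> t"
  unfolding Lp_space_rep(4)[OF Lp ae_class_self[OF u(1)]] using u(2) p t by (rule Lp_bound_imp_Lp_norm_le)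
 ultimately show "W1p_norm N p (ae_class N u) \<le> 2 * t" by (simp add: W1p_norm_def S_def)
qed

lemma hajlasz_upper_gradient_cong_AE:
 assumes haj: "hajlasz_upper_gradient N u g" and eq: "AE x in N. v x = u x"
 shows "hajlasz_upper_gradient N v g"
proof -
 obtain A where g: "g \<in> borel_measurable N" and A: "A \<in> null_sets N"
  and le: "\<forall>x\<in>space N - A. \<forall>y\<in>space N - A. ennreal (norm (u x - u y)) \<le> ennreal (dist x y) * (g x + g y)"
  using haj unfolding hajlasz_upper_gradient_def by blast
 obtain B where B: "B \<in> null_sets N" "{x\<in>space N. v x \<noteq> u x} \<subseteq> B"
  using eq by (auto elim!: AE_E simp: null_sets_def)
 have "ennreal (norm (v x - v y)) \<le> ennreal (dist x y) * (g x + g y)"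
  if "x \<in> space N - (A \<union> B)" "y \<in> space N - (A \<union> B)" for x y
 proof -
  have "v x = u x" "v y = u y" using that B(2) by auto
  then show ?thesis using le that by simp
 qed
 moreover have "A \<union> B \<in> null_sets N" using A B(1) by (rule null_sets.Un)
 ultimately show ?thesis
  unfolding hajlasz_upper_gradient_def using g by (intro conjI bexI[of _ "A \<union> B"] ballI) auto
qed

lemma hajlasz_upper_gradient_restrict:
 assumes haj: "hajlasz_upper_gradient M u g" and S: "S \<in> sets M"
 shows "hajlasz_upper_gradient (restrict_space M S) u g"
proof -
 obtain A where g: "g \<in> borel_measurable M" and A: "A \<in> null_sets M"
  and le: "\<forall>x\<in>space M - A. \<forall>y\<in>space M - A. ennreal (norm (u x - u y)) \<le> ennreal (dist x y) * (g x + g y)"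
  using haj unfolding hajlasz_upper_gradient_def by blast
 have "A \<inter> S \<in> null_sets (restrict_space M S)" using A S by (simp add: null_sets_restrict_space null_set_Int2)
 moreover have "space (restrict_space M S) - A \<inter> S \<subseteq> space M - A" by (auto simp: space_restrict_space)
 ultimately show ?thesis
  unfolding hajlasz_upper_gradient_def using le g
  by (intro conjI bexI[of _ "A \<inter> S"] ballI) (auto intro: measurable_restrict_space1)
qed

lemma (in borel_compatible_measure) M1p_subset_W1p:
 assumes p: "0 < p" shows "(M1p N p :: ('z \<Rightarrow> 'v::banach) set set) \<subseteq> W1p N p"
proof
 fix U :: "('z \<Rightarrow> 'v) set" assume "U \<in> M1p N p"
 then obtain u g where U: "U \<in> Lp_space N p" and u: "u \<in> U" "hajlasz_upper_gradient N u g" "Lp_integrable N p g"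
  by (auto simp: M1p_def)
 obtain v \<rho> where v: "AE x in N. v x = u x" "ess_separable_measurable N v" "weak_upper_gradient N p v \<rho>" "Lp_integrable N p \<rho>"
  using hajlasz_imp_weak_upper_gradient[OF p Lp_space_rep(1)[OF U u(1)] u(2,3)] by blast
 have "v \<in> U"
  unfolding Lp_space_rep(3)[OF U u(1)] ae_class_def using v(1,2) by (auto elim: eventually_mono)
 then show "U \<in> W1p N p" using U v(3,4) unfolding W1p_def by blast
qed

lemma (in poincare_space) extension_set_imp_W1p_subset_M1p:
 assumes \<Omega>: "\<Omega> \<in> sets M" and ext: "W1p_extension_set TYPE('v::banach) p M \<Omega>"
 shows "(W1p (restrict_space M \<Omega>) p :: ('z \<Rightarrow> 'v) set set) \<subseteq> M1p (restrict_space M \<Omega>) p"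
proof
 let ?N = "restrict_space M \<Omega>"
 fix U :: "('z \<Rightarrow> 'v) set" assume U: "U \<in> W1p ?N p"
 obtain C and E :: "('z \<Rightarrow> 'v) set \<Rightarrow> ('z \<Rightarrow> 'v) set" where
  "\<forall>U \<in> W1p ?N p. E U \<in> W1p M p \<and> (\<forall>f\<in>E U. \<forall>u\<in>U. AE x in ?N. f x = u x) \<and> W1p_norm M p (E U) \<le> C * W1p_norm ?N p U"
  using ext unfolding W1p_extension_set_def by blast
 from bspec[OF this U] have EU: "E U \<in> W1p M p" and eq: "\<forall>f\<in>E U. \<forall>u\<in>U. AE x in ?N. f x = u x" by blast+
 obtain f \<rho> where f: "E U \<in> Lp_space M p" "f \<in> E U" "weak_upper_gradient M p f \<rho>" "Lp_integrable M p \<rho>"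
  using EU by (auto simp: W1p_def)
 obtain G where G: "hajlasz_upper_gradient M f G" "Lp_integrable M p G"
  using weak_upper_gradient_imp_hajlasz[OF Lp_space_rep(1,2)[OF f(1,2)] f(3,4)] by blast
 obtain u where u: "U \<in> Lp_space ?N p" "u \<in> U" using U by (auto simp: W1p_def)
 have "AE x in ?N. f x = u x" using eq f(2) u(2) by blast
 then have "AE x in ?N. u x = f x" by eventually_elim simp
 then have "hajlasz_upper_gradient ?N u G"
  by (rule hajlasz_upper_gradient_cong_AE[OF hajlasz_upper_gradient_restrict[OF G(1) \<Omega>]])
 moreover have "Lp_integrable ?N p G" by (rule Lp_integrable_restrict[OF G(2) \<Omega> space_M])
 ultimately show "U \<in> M1p ?N p" using u unfolding M1p_def by blast
qed

lemma zero_class: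
 fixes N :: "'z::metric_space measure"
 assumes p: "0 < p"
 shows "ae_class N (\<lambda>_. 0 :: 'v::real_normed_vector) \<in> W1p N p" "W1p_norm N p (ae_class N (\<lambda>_. 0 :: 'v)) = 0"
proof -
 have sep: "ess_separable_measurable N (\<lambda>_. 0 :: 'v)"
  by (rule ess_separable_measurableI[of _ _ "{}" "{0}"]) auto
 have Lp: "Lp_bound N p 0 (\<lambda>_. ennreal (norm (0 :: 'v)))" "Lp_bound N p 0 (\<lambda>_. 0)" by (auto simp: Lp_bound_def)
 have "p_negligible N p {}"
  unfolding p_negligible_def by (auto intro!: exI[of _ "\<lambda>_. 0"] simp: Lp_integrable_def)
 then have wug: "weak_upper_gradient N p (\<lambda>_. 0 :: 'v) (\<lambda>_. 0)"
  unfolding weak_upper_gradient_def by (auto intro!: exI[of _ "{}"])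
 note W = ae_class_W1p[OF sep Lp(1) wug Lp(2) p order_refl]
 show "ae_class N (\<lambda>_. 0 :: 'v) \<in> W1p N p" by (rule W(1))
 show "W1p_norm N p (ae_class N (\<lambda>_. 0 :: 'v)) = 0" using W(2) W1p_norm_nonneg[OF W(1) p] by simp
qed

lemma W1p_norm_0_imp_AE_0:
 assumes U: "U \<in> W1p N p" "u \<in> U" and p: "0 < p" and zero: "W1p_norm N p U = 0"
 shows "AE x in N. u x = 0"
proof -
 have Lp: "U \<in> Lp_space N p" using U by (simp add: W1p_def)
 have "Lp_norm N p (enorm u) \<le> 0"
  using Lp_class_norm_le_W1p_norm[OF U(1) p] Lp_space_rep(4)[OF Lp U(2)] zero by simp
 then have "Lp_bound N p 0 (enorm u)"
  by (rule Lp_norm_le_imp_Lp_bound[OF Lp_space_rep(2)[OF Lp U(2)] p])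
 then have "(\<integral>\<^sup>+x. ennreal_powr (ennreal (norm (u x))) p \<partial>N) = 0" by (simp add: Lp_bound_def)
 moreover have [measurable]: "(enorm u) \<in> borel_measurable N"
  by (rule measurable_ennreal_norm[OF Lp_space_rep(1)[OF Lp U(2)]])
 ultimately have "AE x in N. ennreal_powr (ennreal (norm (u x))) p = 0" by (simp add: nn_integral_0_iff_AE)
 then show ?thesis by eventually_elim simp
qed

text \<open>Chain of bounds: Sobolev to Hajlasz on \<Omega> by Zabreiko's lemma, extension by the
  Whitney construction, and back to a weak upper gradient on the whole space. The parameter t above
  the norm replaces the norm for lack of an optimal gradient.\<close>

lemma (in dense_set) bounded_extension:
 assumes p: "1 < p"
  and WM: "(W1p (restrict_space M \<Omega>) p :: ('z \<Rightarrow> 'v::banach) set set) \<subseteq> M1p (restrict_space M \<Omega>) p"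
 shows "\<exists>C>0. \<forall>t>0. \<forall>U :: ('z \<Rightarrow> 'v) set. U \<in> W1p (restrict_space M \<Omega>) p \<longrightarrow> W1p_norm (restrict_space M \<Omega>) p U < t \<longrightarrow>
  (\<exists>V\<in>W1p M p. (\<forall>f\<in>V. \<forall>u\<in>U. AE x in restrict_space M \<Omega>. f x = u x) \<and> W1p_norm M p V \<le> C * t)"
proof -
 let ?N = "restrict_space M \<Omega>"
 interpret Z: borel_compatible_measure M by (rule borel_compatible)
 interpret N: borel_compatible_measure ?N by (rule borel_compatible_restrict_space[OF \<Omega>_in_M])
 \<comment> \<open>The inclusion of the spaces gives some Hajlasz bound for each single function,
   without uniformity; this is the finiteness hypothesis of Zabreiko's lemma.\<close>
 have finite: "\<exists>s>0. hajlasz_bound ?N p s u" if "0 < t" and sob: "sobolev_bound ?N p t u" for t and u :: "'z \<Rightarrow> 'v"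
 proof -
  obtain v \<rho> where u: "ess_separable_measurable ?N u" "Lp_bound ?N p t (enorm u)"
   and v: "AE x in ?N. v x = u x" "weak_upper_gradient ?N p v \<rho>" "Lp_bound ?N p t \<rho>"
   using sob by (auto simp: sobolev_bound_def)
  have "v \<in> ae_class ?N u"
   using N.ess_separable_measurable_AE_eq[OF u(1) v(1)] v(1) by (auto simp: ae_class_def elim: eventually_mono)
  moreover have Lp: "ae_class ?N u \<in> Lp_space ?N p"
   by (rule ae_class_in_Lp_space[OF u(1) Lp_bound_imp_Lp_integrable[OF u(2)]])
  ultimately have "ae_class ?N u \<in> W1p ?N p"
   unfolding W1p_def using v(2) Lp_bound_imp_Lp_integrable[OF v(3)] by blast
  with WM have "ae_class ?N u \<in> M1p ?N p" by blast
  then obtain u' g where u': "u' \<in> ae_class ?N u" "hajlasz_upper_gradient ?N u' g" "Lp_integrable ?N p g"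
   unfolding M1p_def by blast
  have "hajlasz_upper_gradient ?N u g"
   using u'(1) by (intro hajlasz_upper_gradient_cong_AE[OF u'(2)]) (simp add: ae_class_def)
  moreover obtain s where "0 < s" "Lp_bound ?N p s g" using Lp_integrable_imp_Lp_bound[OF u'(3)] p by auto
  ultimately show ?thesis using u(1) unfolding hajlasz_bound_def by (intro exI[of _ s]) auto
 qed
 have "\<exists>C>0. \<forall>t>0. \<forall>u :: 'z \<Rightarrow> 'v. sobolev_bound ?N p t u \<longrightarrow> hajlasz_bound ?N p (C * t) u"
  by (rule N.sobolev_bound_imp_hajlasz_bound[OF _ finite]) (use p in auto)
 then obtain C1 where C1: "0 < C1" and haj: "\<forall>t>0. \<forall>u :: 'z \<Rightarrow> 'v. sobolev_bound ?N p t u \<longrightarrow> hajlasz_bound ?N p (C1 * t) u"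
  by blast
 obtain C2 where C2: "0 < C2" and ext: "\<forall>(u :: 'z \<Rightarrow> 'v) g t. 0 < t \<longrightarrow> ess_separable_measurable ?N u \<longrightarrow>
  Lp_bound ?N p t (enorm u) \<longrightarrow> hajlasz_upper_gradient ?N u g \<longrightarrow> Lp_bound ?N p t g \<longrightarrow>
  (\<exists>w G. (\<forall>x\<in>\<Omega>. w x = u x) \<and> ess_separable_measurable M w \<and> Lp_bound M p (C2 * t) (enorm w) \<and>
   hajlasz_upper_gradient M w G \<and> Lp_bound M p (C2 * t) G)"
  using hajlasz_extension[OF p] by blast
 \<comment> \<open>8 = 2 * 4: the factor 4 from Hajlasz gradient to weak upper gradient, the factor
   2 from \<open>ae_class_W1p\<close>.\<close>
 define C where "C = 8 * (C2 * max 1 C1)"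
 have "\<exists>V\<in>W1p M p. (\<forall>f\<in>V. \<forall>u\<in>U. AE x in ?N. f x = u x) \<and> W1p_norm M p V \<le> C * t"
  if t: "0 < t" and U: "U \<in> W1p ?N p" and less: "W1p_norm ?N p U < t" for t and U :: "('z \<Rightarrow> 'v) set"
 proof -
  have U_Lp: "U \<in> Lp_space ?N p" and "\<exists>u. u \<in> U" using U by (auto simp: W1p_def)
  then obtain u where u: "u \<in> U" by blast
  have sob: "sobolev_bound ?N p t u" using W1p_norm_less_imp_sobolev_bound[OF U _ less u] p by simp
  then obtain g where g: "hajlasz_upper_gradient ?N u g" "Lp_bound ?N p (C1 * t) g"
   using haj t unfolding hajlasz_bound_def by blast
  define s where "s = max 1 C1 * t"
  have s: "0 < s" "t \<le> s" "C1 * t \<le> s" using t C1 by (auto simp: s_def mult_right_mono)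
  have u_Lp': "Lp_bound ?N p t (enorm u)" using sob by (simp add: sobolev_bound_def)
  have u_Lp: "Lp_bound ?N p s (enorm u)"
   by (rule Lp_bound_mono[OF u_Lp' _ s(2) _ Lp_bound_measurable[OF u_Lp']]) (use t p in auto)
  have g_Lp: "Lp_bound ?N p s g"
   by (rule Lp_bound_mono[OF g(2) _ s(3) _ Lp_bound_measurable[OF g(2)]]) (use t C1 p in auto)
  note w_ex = spec[OF spec[OF spec[OF ext, of u], of g], of s]
  note w_ex = mp[OF mp[OF mp[OF mp[OF mp[OF w_ex s(1)] Lp_space_rep(1)[OF U_Lp u]] u_Lp] g(1)] g_Lp]
  obtain w G where w: "\<forall>x\<in>\<Omega>. w x = u x" "ess_separable_measurable M w" "Lp_bound M p (C2 * s) (enorm w)"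
   "hajlasz_upper_gradient M w G" "Lp_bound M p (C2 * s) G"
   using w_ex by (elim exE conjE)
  have C2s: "0 \<le> C2 * s" using C2 s by simp
  obtain v \<rho> where v: "AE x in M. v x = w x" "ess_separable_measurable M v" "weak_upper_gradient M p v \<rho>"
   "Lp_integrable M p \<rho>" "(pint M p \<rho>) = (\<integral>\<^sup>+x. ennreal_powr (4 * G x) p \<partial>M)"
   using Z.hajlasz_imp_weak_upper_gradient[OF _ w(2,4) Lp_bound_imp_Lp_integrable[OF w(5)]] p by auto
  have "Lp_bound M p (4 * (C2 * s)) (\<lambda>x. ennreal 4 * G x)" using p C2s by (intro Lp_bound_cmult[OF w(5)]) auto
  then have \<rho>: "Lp_bound M p (4 * (C2 * s)) \<rho>" using v(4,5) by (simp add: Lp_bound_def Lp_integrable_def)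
  have v_Lp: "Lp_bound M p (4 * (C2 * s)) (enorm v)"
  proof (rule Lp_bound_mono[OF w(3) C2s])
   show "AE x in M. ennreal (norm (v x)) \<le> ennreal (norm (w x))" using v(1) by eventually_elim simp
  qed (use C2s p v(2) measurable_ennreal_norm in auto)
  have V: "ae_class M v \<in> W1p M p" "W1p_norm M p (ae_class M v) \<le> 2 * (4 * (C2 * s))"
   using ae_class_W1p[OF v(2) v_Lp v(3) \<rho>] p C2s by auto
  have "AE x in ?N. f x = u' x" if "f \<in> ae_class M v" "u' \<in> U" for f u'
  proof -
   have "AE x in M. v x = f x" using that by (simp add: ae_class_def)
   with v(1) have "AE x in M. x \<in> \<Omega> \<longrightarrow> f x = u x" by eventually_elim (use w(1) in auto)
   then have 1: "AE x in ?N. f x = u x" by (subst AE_restrict_space_iff) (simp_all add: Int_absorb2)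
   have "AE x in ?N. u x = u' x" using that(2) unfolding Lp_space_rep(3)[OF U_Lp u] by (simp add: ae_class_def)
   with 1 show ?thesis by eventually_elim simp
  qed
  then show ?thesis using V by (intro bexI[of _ "ae_class M v"]) (auto simp: C_def s_def ac_simps)
 qed
 moreover have "0 < C" using C2 by (simp add: C_def)
 ultimately show ?thesis by blast
qed

lemma (in dense_set) W1p_subset_M1p_imp_extension_set:
 assumes p: "1 < p"
  and WM: "(W1p (restrict_space M \<Omega>) p :: ('z \<Rightarrow> 'v::banach) set set) \<subseteq> M1p (restrict_space M \<Omega>) p"
 shows "W1p_extension_set TYPE('v) p M \<Omega>"
proof -
 let ?N = "restrict_space M \<Omega>"
 have p0: "0 < p" using p by simp
 obtain C where C: "0 < C" and ext: "\<forall>t>0. \<forall>U :: ('z \<Rightarrow> 'v) set. U \<in> W1p ?N p \<longrightarrow> W1p_norm ?N p U < t \<longrightarrow>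
  (\<exists>V\<in>W1p M p. (\<forall>f\<in>V. \<forall>u\<in>U. AE x in ?N. f x = u x) \<and> W1p_norm M p V \<le> C * t)"
  using bounded_extension[OF p WM] by blast
 have "\<exists>V. U \<in> W1p ?N p \<longrightarrow> V \<in> W1p M p \<and> (\<forall>f\<in>V. \<forall>u\<in>U. AE x in ?N. f x = u x) \<and> W1p_norm M p V \<le> C * 2 * W1p_norm ?N p U"
  for U :: "('z \<Rightarrow> 'v) set"
 proof (cases "U \<in> W1p ?N p")
  case True
  show ?thesis
  \<comment> \<open>\<open>bounded_extension\<close> is applied with t twice the norm, which exceeds
    the norm only if it is positive. A class of norm 0 vanishes a.e. and is extended by 0.\<close>
  proof (cases "W1p_norm ?N p U = 0")
   case zero: True
   have "AE x in ?N. f x = u x" if f: "f \<in> ae_class M (\<lambda>_. 0)" and u: "u \<in> U" for f u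
   proof -
    have "AE x in M. 0 = f x" using f by (simp add: ae_class_def)
    then have "AE x in ?N. f x = 0" by (subst AE_restrict_space_iff) (auto elim: eventually_mono)
    with W1p_norm_0_imp_AE_0[OF True u p0 zero] show ?thesis by eventually_elim simp
   qed
   then show ?thesis using zero_class[OF p0, of M, where 'v='v] zero by (intro exI[of _ "ae_class M (\<lambda>_. 0)"]) auto
  next
   case False
   then have "0 < 2 * W1p_norm ?N p U" "W1p_norm ?N p U < 2 * W1p_norm ?N p U"
    using W1p_norm_nonneg[OF True p0] by auto
   then obtain V where "V \<in> W1p M p" "\<forall>f\<in>V. \<forall>u\<in>U. AE x in ?N. f x = u x" "W1p_norm M p V \<le> C * (2 * W1p_norm ?N p U)"
    using ext True by blast
   then show ?thesis by (intro exI[of _ V]) (simp add: mult.assoc)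
  qed
 qed simp
 then have "\<forall>U :: ('z \<Rightarrow> 'v) set. \<exists>V. U \<in> W1p ?N p \<longrightarrow> V \<in> W1p M p \<and> (\<forall>f\<in>V. \<forall>u\<in>U. AE x in ?N. f x = u x) \<and> W1p_norm M p V \<le> C * 2 * W1p_norm ?N p U"
  by blast
 from choice[OF this] obtain E :: "('z \<Rightarrow> 'v) set \<Rightarrow> ('z \<Rightarrow> 'v) set" where
  E: "\<forall>U. U \<in> W1p ?N p \<longrightarrow> E U \<in> W1p M p \<and> (\<forall>f\<in>E U. \<forall>u\<in>U. AE x in ?N. f x = u x) \<and> W1p_norm M p (E U) \<le> C * 2 * W1p_norm ?N p U" ..
 show ?thesis
  unfolding W1p_extension_set_def
 proof (intro exI conjI ballI)
  show "0 < C * 2" using C by simp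
  fix U :: "('z \<Rightarrow> 'v) set" assume U: "U \<in> W1p ?N p"
  note EU = mp[OF spec[OF E] U]
  show "E U \<in> W1p M p" "W1p_norm M p (E U) \<le> C * 2 * W1p_norm ?N p U" using EU by blast+
  fix f u assume "f \<in> E U" "u \<in> U"
  then show "AE x in ?N. f x = u x" using EU by blast
 qed
qed

lemma W1p_extension_set_empty:
 fixes M :: "'z::metric_space measure"
 assumes p: "0 < p" shows "W1p_extension_set TYPE('v::real_normed_vector) p M {}"
 unfolding W1p_extension_set_def
proof (intro exI[of _ 1] exI[of _ "\<lambda>_. ae_class M (\<lambda>_. 0)"] conjI ballI)
 fix U :: "('z \<Rightarrow> 'v) set" assume U: "U \<in> W1p (restrict_space M {}) p"
 show "ae_class M (\<lambda>_. 0 :: 'v) \<in> W1p M p" by (rule zero_class(1)[OF p])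
 show "W1p_norm M p (ae_class M (\<lambda>_. 0 :: 'v)) \<le> 1 * W1p_norm (restrict_space M {}) p U"
  using zero_class(2)[OF p, of M, where 'v='v] W1p_norm_nonneg[OF U p] by simp
 show "AE x in restrict_space M {}. f x = u x" for f u :: "'z \<Rightarrow> 'v"
  by (rule AE_I2) (simp add: space_restrict_space)
qed simp

theorem corollary1p5:
 fixes p :: real
  and \<mu> :: "'z::{metric_space, second_countable_topology} set \<Rightarrow> ennreal"
  and \<Omega> :: "'z set"
 assumes "1 < p"
  and "PI_space p \<mu>"
  and "\<Omega> \<in> sets (caratheodory_measure \<mu>)"
  and "measure_density \<mu> \<Omega>"
 shows "W1p_extension_set TYPE('v::banach) p (caratheodory_measure \<mu>) \<Omega> \<longleftrightarrow>
  (W1p (restrict_space (caratheodory_measure \<mu>) \<Omega>) p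
    :: ('z \<Rightarrow> 'v) set set) =
   M1p (restrict_space (caratheodory_measure \<mu>) \<Omega>) p"
proof -
 let ?M = "caratheodory_measure \<mu>"
 obtain cd Cp \<kappa> where "poincare_space ?M cd p Cp \<kappa>" using poincare_space_caratheodory[OF assms(1,2)] by blast
 then interpret poincare_space ?M cd p Cp \<kappa> .
 interpret N: borel_compatible_measure "restrict_space ?M \<Omega>" by (rule borel_compatible_restrict_space[OF assms(3)])
 have p0: "0 < p" using assms(1) by simp
 have "W1p_extension_set TYPE('v) p ?M \<Omega>"
  if WM: "(W1p (restrict_space ?M \<Omega>) p :: ('z \<Rightarrow> 'v) set set) = M1p (restrict_space ?M \<Omega>) p"
 \<comment> \<open>The Whitney construction measures distances to a point set, and
   \<open>infdist\<close> to the empty set is 0 by convention; the empty set is treated by the zero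
   extension.\<close>
 proof (cases "\<Omega> = {}")
  case True
  then show ?thesis using W1p_extension_set_empty[OF p0] by simp
 next
  case False
  obtain c where c: "0 < c" "\<forall>x\<in>\<Omega>. \<forall>r\<in>{0<..1}. ennreal c * \<mu> (ball x r) \<le> \<mu> (ball x r \<inter> \<Omega>)"
   using assms(4) by (auto simp: measure_density_def)
  have oms: "outer_measure_space (Pow UNIV) \<mu>"
   using assms(2) by (simp add: PI_space_def metric_measure_space_def borel_regular_outer_measure_def)
  have em: "emeasure ?M A = \<mu> A" if "A \<in> sets ?M" for A
   using that by (simp add: emeasure_caratheodory_measure[OF oms] sets_caratheodory_measure[OF oms])
  interpret dense_set ?M cd \<Omega> c
  proof
   show "ennreal c * emeasure ?M (ball x r) \<le> emeasure ?M (ball x r \<inter> \<Omega>)" if "x \<in> \<Omega>" "0 < r" "r \<le> 1" for x r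
    using c(2) that assms(3) by (simp add: em[OF ball_in_M] em[OF sets.Int[OF ball_in_M assms(3)]])
  qed (use assms(3) False c(1) in auto)
  show ?thesis by (rule W1p_subset_M1p_imp_extension_set[OF assms(1)]) (simp add: WM)
 qed
 then show ?thesis
  using extension_set_imp_W1p_subset_M1p[OF assms(3), where 'v='v] N.M1p_subset_W1p[OF p0, where 'v='v] by blast
qed

end
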